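(* Let $\{(X(t),\varphi(t))\}$ be a Markov-modulated fluid flow with irreducible phase generator $Q$ on the finite set $\mathcal S$, rate vector $\boldsymbol c$ and stationary drift $\mu=\boldsymbol\alpha^{T}\boldsymbol c$, and let $a,b\ge 0$. The distribution of the phase at the first escape from $(-a,b)$ is given as follows. (i) If $\varphi(0)\in\mathcal S_0$, $$\begin{bmatrix}B_{0+}^{(a,b)} & A_{0-}^{(a,b)}\end{bmatrix}=(-Q_{00})^{-1}\begin{bmatrix}Q_{0+}&Q_{0-}\end{bmatrix}\begin{bmatrix}B_{++}^{(a,b)} & A_{+-}^{(a,b)}\\ B_{-+}^{(a,b)} & A_{--}^{(a,b)}\end{bmatrix}.$$ (ii) If $\mu\ne 0$ and $\varphi(0)$ is in $\mathcal S_+$ or $\mathcal S_-$, $$\begin{bmatrix}B_{++}^{(a,b)} & A_{+-}^{(a,b)}\\ B_{-+}^{(a,b)} & A_{--}^{(a,b)}\end{bmatrix}=\mathcal U\,(I+\mathcal P)^{-1}.$$ (iii) If $\mu=0$ and $\varphi(0)$ is in $\mathcal S_+$ or $\mathcal S_-$, $$\begin{bmatrix}B_{++}^{(a,b)} & A_{+-}^{(a,b)}\\ B_{-+}^{(a,b)} & A_{--}^{(a,b)}\end{bmatrix}=\mathcal U\,(I+\mathcal P)^{\#}+\boldsymbol w\,\boldsymbol\eta^{T},$$ where $\boldsymbol\eta$ is the left eigenvector of $I+\mathcal P$ for the eigenvalue $0$ and $$\boldsymbol w=(\boldsymbol\eta^{T}\boldsymbol\beta)^{-1}\left(\begin{bmatrix}\boldsymbol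 h_+\\ \boldsymbol h_-\end{bmatrix}-\mathcal U\,(I+\mathcal P)^{\#}\boldsymbol\beta\right).$$ Here $$\mathcal P=\begin{bmatrix}0&\Psi e^{U(a+b)}\\ \widehat\Psi e^{\widehat U(a+b)}&0\end{bmatrix},\qquad \mathcal U=\begin{bmatrix}e^{\widehat U b}&\Psi e^{Ua}\\ \widehat\Psi e^{\widehat U b}&e^{Ua}\end{bmatrix},\qquad \boldsymbol\beta=\begin{bmatrix} b\,\boldsymbol 1_+ +\boldsymbol h_+\\ -a\,\boldsymbol 1_- +\boldsymbol h_-\end{bmatrix},$$ with $\boldsymbol h=-Q^{\#}\boldsymbol c$, and $^{\#}$ denotes the group inverse.
   Context: Fluid flow: $\{\varphi(t):t\ge 0\}$ is a continuous-time irreducible Markov chain (the phase) on a finite set $\mathcal S$ with generator $Q$; $\boldsymbol c=[c_i:i\in\mathcal S]$ is a vector of arbitrary real constants, and $X(t)=X(0)+\int_0^t c_{\varphi(s)}\,ds$ (the level). Let $\mathcal S_+=\{i:c_i>0\}$, $\mathcal S_-=\{i:c_i<0\}$, $\mathcal S_0=\{i:c_i=0\}$, with $\mathcal S_+$ and $\mathcal S_-$ nonempty (if $\mathcal S_0$ is empty, blocks indexed by it are omitted). For a vector $\boldsymbol v$ indexed by $\mathcal S$, $\boldsymbol v_+,\boldsymbol v_-$ denote its subvectors indexed by $\mathcal S_+,\mathcal S_-$; matrix sub-blocks are denoted similarly ($Q_{0+}$ has rows in $\mathcal S_0$, columns in $\mathcal S_+$, etc.). $\boldsymbol 1$ is a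 vector of ones. $\boldsymbol\alpha$ is the stationary probability vector of $Q$: $\boldsymbol\alpha^{T}Q=\boldsymbol 0$, $\boldsymbol\alpha^{T}\boldsymbol 1=1$. Group inverse: for a square matrix $M$ with simple eigenvalue $0$ and right and left eigenvectors $\boldsymbol v,\boldsymbol u$ for that eigenvalue normalised by $\boldsymbol u^{T}\boldsymbol v=1$, $M^{\#}$ is the unique matrix with $M^{\#}M=I-\boldsymbol v\boldsymbol u^{T}$ and $M^{\#}\boldsymbol v=\boldsymbol 0$. For $x\ge 0$ let $\tau_x^-=\inf\{t:X(t)<X(0)-x\}$ and $\tau_x^+=\inf\{t:X(t)>X(0)+x\}$; let $\Theta=\inf\{t>0:X(t)=X(0)\}$. First passage matrices: $\Psi_{ij}=P[\Theta<\infty,\varphi(\Theta)=j\mid\varphi(0)=i]$ for $i\in\mathcal S_+$, $j\in\mathcal S_-$; $\widehat\Psi_{ij}=P[\Theta<\infty,\varphi(\Theta)=j\mid\varphi(0)=i]$ for $i\in\mathcal S_-$, $j\in\mathcal S_+$. $U$ is the matrix indexed by $\mathcal S_-$ such that $(e^{Ux})_{ij}=P[\tau_x^-<\infty,\varphi(\tau_x^-)=j\mid\varphi(0)=i]$ for all $x\ge 0$, $i,j\in\mathcal S_-$; $\widehat U$ is the matrix indexed by $\mathcal S_+$ such that $(e^{\widehat Ux})_{ij}=P[\tau_x^+<\infty,\varphi(\tau_x^+)=j\mid\varphi(0)=i]$ for all $x\ge 0$, $i,j\in\mathcal S_+$. Escape probability matrices: $A^{(a,b)}_{ij}=P[\tau_a^-<\tau_b^+,\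 \varphi(\tau_a^-)=j\mid X(0)=0,\varphi(0)=i]$ for $i\in\mathcal S$, $j\in\mathcal S_-$, and $B^{(a,b)}_{ij}=P[\tau_b^+<\tau_a^-,\ \varphi(\tau_b^+)=j\mid X(0)=0,\varphi(0)=i]$ for $i\in\mathcal S$, $j\in\mathcal S_+$. $A^{(a,b)}$ is partitioned into row blocks $A_{+-}^{(a,b)},A_{--}^{(a,b)},A_{0-}^{(a,b)}$ and $B^{(a,b)}$ into $B_{++}^{(a,b)},B_{-+}^{(a,b)},B_{0+}^{(a,b)}$, according to the initial phase being in $\mathcal S_+,\mathcal S_-,\mathcal S_0$. *)

theory Defs
  imports "HOL-Probability.Probability" "HOL-Computational_Algebra.Polynomial"
begin

section \<open>Matrices\<close>

text \<open>The row index is the outer one: \<open>M :: real^'n^'m\<close> has rows in \<open>'m\<close> and columns in \<open>'n\<close>.\<close>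

definition matrix_exp :: "real^'n^'n \<Rightarrow> real^'n^'n" where
  "matrix_exp M = (\<Sum>k. (1 / fact k) *\<^sub>R (((**) M ^^ k) (mat 1)))"

definition char_polynomial :: "real^'n^'n \<Rightarrow> real poly" where
  "char_polynomial M = det (\<chi> i j. (if i = j then [:0, 1:] else 0) - [:M $ i $ j:])"

definition simple_eigenvalue :: "real^'n^'n \<Rightarrow> real \<Rightarrow> bool" where
  "simple_eigenvalue M l \<longleftrightarrow> order l (char_polynomial M) = 1"

definition outer_product :: "real^'m \<Rightarrow> real^'n \<Rightarrow> real^'n^'m" where
  "outer_product v u = (\<chi> i j. v $ i * u $ j)"

text \<open>If \<open>0\<close> is a simple eigenvalue of \<open>M\<close>, then \<open>v\<close> and \<open>u\<close> are unique up to a factor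
  \<open>v \<mapsto> r v\<close>, \<open>u \<mapsto> u / r\<close>; as this leaves \<open>v u\<^sup>T\<close> and the line spanned by \<open>v\<close> unchanged, the description
  determines exactly one matrix. Otherwise the value is unspecified.\<close>

definition group_inverse :: "real^'n^'n \<Rightarrow> real^'n^'n" where
  "group_inverse M = (THE G. \<exists>v u. M *v v = 0 \<and> u v* M = 0 \<and> u \<bullet> v = 1 \<and>
     G ** M = mat 1 - outer_product v u \<and> G *v v = 0)"

text \<open>Sub-blocks are selected by enumerations of their index sets by finite types.\<close>

definition submat :: "('r::finite \<Rightarrow> 's) \<Rightarrow> ('k::finite \<Rightarrow> 's) \<Rightarrow> real^'s^'s \<Rightarrow> real^'k^'r" where
  "submat e f M = (\<chi> i j. M $ e i $ f j)"

definition subvec :: "('r::finite \<Rightarrow> 's) \<Rightarrow> real^'s \<Rightarrow> real^'r" where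
  "subvec e v = (\<chi> i. v $ e i)"

definition block_vec :: "real^'p \<Rightarrow> real^'m \<Rightarrow> real^('p + 'm)" where
  "block_vec x y = (\<chi> i. case i of Inl p \<Rightarrow> x $ p | Inr m \<Rightarrow> y $ m)"

text \<open>The row of blocks \<open>[K L]\<close>, and the block matrix with rows \<open>[K L]\<close> and \<open>[M N]\<close>.\<close>

definition block_row :: "real^'p^'r \<Rightarrow> real^'m^'r \<Rightarrow> real^('p + 'm)^'r" where
  "block_row K L = (\<chi> i. block_vec (K $ i) (L $ i))"

definition block_mat ::
  "real^'p^'r \<Rightarrow> real^'m^'r \<Rightarrow> real^'p^'t \<Rightarrow> real^'m^'t \<Rightarrow> real^('p + 'm)^('r + 't)" where
  "block_mat K L M N =
     (\<chi> i. case i of Inl r \<Rightarrow> block_vec (K $ r) (L $ r) | Inr t \<Rightarrow> block_vec (M $ t) (N $ t))"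


section \<open>The phase process\<close>

definition generator :: "real^'s^'s \<Rightarrow> bool" where
  "generator Q \<longleftrightarrow> (\<forall>i j. i \<noteq> j \<longrightarrow> 0 \<le> Q $ i $ j) \<and> (\<forall>i. (\<Sum>j\<in>UNIV. Q $ i $ j) = 0)"

definition irreducible_generator :: "real^'s^'s \<Rightarrow> bool" where
  "irreducible_generator Q \<longleftrightarrow>
     generator Q \<and> (\<forall>i j. (i, j) \<in> {(k, l). k \<noteq> l \<and> 0 < Q $ k $ l}\<^sup>*)"

definition stationary_vector :: "real^'s^'s \<Rightarrow> real^'s \<Rightarrow> bool" where
  "stationary_vector Q \<alpha> \<longleftrightarrow> (\<forall>i. 0 \<le> \<alpha> $ i) \<and> \<alpha> v* Q = 0 \<and> \<alpha> \<bullet> 1 = 1"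

text \<open>Right-continuous step functions on \<open>[0,\<infinity>)\<close> with finitely many jumps in every bounded interval:
  in a finite discrete state space these are the right-continuous functions with left limits.\<close>

definition step_path :: "(real \<Rightarrow> 's) \<Rightarrow> bool" where
  "step_path f \<longleftrightarrow> (\<forall>t\<ge>0. eventually (\<lambda>s. f s = f t) (at_right t)) \<and>
     (\<forall>t>0. \<exists>k. eventually (\<lambda>s. f s = k) (at_left t))"

text \<open>Under the law \<open>N\<close>, the process \<open>\<phi>\<close> is a Markov chain with generator \<open>Q\<close> started in phase \<open>i\<close>. The last
  clause is the Markov property with transition matrices \<open>exp (Q t)\<close>, with the conditional
  probabilities multiplied out.\<close>

definition markov_chain_from ::
  "real^'s^'s \<Rightarrow> 'w measure \<Rightarrow> (real \<Rightarrow> 'w \<Rightarrow> 's) \<Rightarrow> 's \<Rightarrow> bool" where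
  "markov_chain_from Q N \<phi> i \<longleftrightarrow>
     prob_space N \<and>
     (\<forall>t\<ge>0. \<phi> t \<in> measurable N (count_space UNIV)) \<and>
     (\<forall>\<omega>\<in>space N. step_path (\<lambda>t. \<phi> t \<omega>)) \<and>
     (AE \<omega> in N. \<phi> 0 \<omega> = i) \<and>
     (\<forall>n (t :: nat \<Rightarrow> real) (k :: nat \<Rightarrow> 's). 0 \<le> t 0 \<longrightarrow> (\<forall>m\<le>n. t m \<le> t (Suc m)) \<longrightarrow>
        \<P>(\<omega> in N. \<forall>m\<le>Suc n. \<phi> (t m) \<omega> = k m) =
        \<P>(\<omega> in N. \<forall>m\<le>n. \<phi> (t m) \<omega> = k m) *
          matrix_exp ((t (Suc n) - t n) *\<^sub>R Q) $ k n $ k (Suc n))"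


section \<open>The level process and first passage\<close>

definition level :: "real^'s \<Rightarrow> real \<Rightarrow> (real \<Rightarrow> 's) \<Rightarrow> real \<Rightarrow> real" where
  "level c x0 f t = x0 + integral {0..t} (\<lambda>s. c $ f s)"

text \<open>Passage times of a level path \<open>X\<close>; the value is \<open>\<infinity>\<close> if the passage does not occur.\<close>

definition tau_minus :: "(real \<Rightarrow> real) \<Rightarrow> real \<Rightarrow> ereal" where
  "tau_minus X x = Inf (ereal ` {t. 0 \<le> t \<and> X t < X 0 - x})"

definition tau_plus :: "(real \<Rightarrow> real) \<Rightarrow> real \<Rightarrow> ereal" where
  "tau_plus X x = Inf (ereal ` {t. 0 \<le> t \<and> X t > X 0 + x})"

definition return_time :: "(real \<Rightarrow> real) \<Rightarrow> ereal" where
  "return_time X = Inf (ereal ` {t. 0 < t \<and> X t = X 0})"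

text \<open>In what follows \<open>P i\<close> is the law of the process given that the initial phase is \<open>i\<close>, and \<open>x0\<close> is
  the initial level. The matrices are defined for all pairs of phases; the first passage and
  escape matrices of interest are sub-blocks.\<close>

definition return_matrix ::
  "real^'s \<Rightarrow> ('s \<Rightarrow> 'w measure) \<Rightarrow> (real \<Rightarrow> 'w \<Rightarrow> 's) \<Rightarrow> real \<Rightarrow> real^'s^'s" where
  "return_matrix c P \<phi> x0 = (\<chi> i j. \<P>(\<omega> in P i.
     let T = return_time (level c x0 (\<lambda>t. \<phi> t \<omega>)) in T < \<infinity> \<and> \<phi> (real_of_ereal T) \<omega> = j))"

definition down_matrix ::
  "real^'s \<Rightarrow> ('s \<Rightarrow> 'w measure) \<Rightarrow> (real \<Rightarrow> 'w \<Rightarrow> 's) \<Rightarrow> real \<Rightarrow> real \<Rightarrow> real^'s^'s" where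
  "down_matrix c P \<phi> x0 x = (\<chi> i j. \<P>(\<omega> in P i.
     let T = tau_minus (level c x0 (\<lambda>t. \<phi> t \<omega>)) x in T < \<infinity> \<and> \<phi> (real_of_ereal T) \<omega> = j))"

definition up_matrix ::
  "real^'s \<Rightarrow> ('s \<Rightarrow> 'w measure) \<Rightarrow> (real \<Rightarrow> 'w \<Rightarrow> 's) \<Rightarrow> real \<Rightarrow> real \<Rightarrow> real^'s^'s" where
  "up_matrix c P \<phi> x0 x = (\<chi> i j. \<P>(\<omega> in P i.
     let T = tau_plus (level c x0 (\<lambda>t. \<phi> t \<omega>)) x in T < \<infinity> \<and> \<phi> (real_of_ereal T) \<omega> = j))"

definition escape_down ::
  "real^'s \<Rightarrow> ('s \<Rightarrow> 'w measure) \<Rightarrow> (real \<Rightarrow> 'w \<Rightarrow> 's) \<Rightarrow> real \<Rightarrow> real \<Rightarrow> real^'s^'s" where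
  "escape_down c P \<phi> a b = (\<chi> i j. \<P>(\<omega> in P i.
     let X = level c 0 (\<lambda>t. \<phi> t \<omega>) in
       tau_minus X a < tau_plus X b \<and> \<phi> (real_of_ereal (tau_minus X a)) \<omega> = j))"

definition escape_up ::
  "real^'s \<Rightarrow> ('s \<Rightarrow> 'w measure) \<Rightarrow> (real \<Rightarrow> 'w \<Rightarrow> 's) \<Rightarrow> real \<Rightarrow> real \<Rightarrow> real^'s^'s" where
  "escape_up c P \<phi> a b = (\<chi> i j. \<P>(\<omega> in P i.
     let X = level c 0 (\<lambda>t. \<phi> t \<omega>) in
       tau_plus X b < tau_minus X a \<and> \<phi> (real_of_ereal (tau_plus X b)) \<omega> = j))"


section \<open>The matrices of the escape formula\<close>

text \<open>\<open>\<Psi>'\<close> and \<open>U'\<close> stand for the hatted matrices.\<close>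

definition calP :: "real^'m^'p \<Rightarrow> real^'p^'m \<Rightarrow> real^'m^'m \<Rightarrow> real^'p^'p \<Rightarrow> real \<Rightarrow> real \<Rightarrow>
    real^('p + 'm)^('p + 'm)" where
  "calP \<Psi> \<Psi>' U U' a b = block_mat
     0                                         (\<Psi> ** matrix_exp ((a + b) *\<^sub>R U))
     (\<Psi>' ** matrix_exp ((a + b) *\<^sub>R U'))      0"

definition calU :: "real^'m^'p \<Rightarrow> real^'p^'m \<Rightarrow> real^'m^'m \<Rightarrow> real^'p^'p \<Rightarrow> real \<Rightarrow> real \<Rightarrow>
    real^('p + 'm)^('p + 'm)" where
  "calU \<Psi> \<Psi>' U U' a b = block_mat
     (matrix_exp (b *\<^sub>R U'))                   (\<Psi> ** matrix_exp (a *\<^sub>R U))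
     (\<Psi>' ** matrix_exp (b *\<^sub>R U'))            (matrix_exp (a *\<^sub>R U))"

end

theory Submission
  imports Defs
begin

text \<open>Everything is derived from the law of the phase process on the space of step paths, where the
  strong Markov property holds at passage times. A path that passes the level \<open>b\<close> either escapes from
  \<open>(-a, b)\<close> at \<open>b\<close>, or first escapes at \<open>-a\<close> and then climbs by \<open>a + b\<close>; with the mirror image this says
  \<open>E (I + P) = U\<close>. If \<open>\<mu> \<noteq> 0\<close>, one of the two blocks of \<open>P\<close> has all row sums below \<open>1\<close>, because an exponential
  functional of the level decreases geometrically in mean, and \<open>I + P\<close> is invertible. If \<open>\<mu> = 0\<close>, the flow is
  recurrent, the blocks of \<open>P\<close> are positive and stochastic, so that \<open>I + P\<close> has a one-dimensional kernel,
  and the missing information \<open>E \<beta> = h\<close> is optional stopping for the martingale \<open>X(t) + h(\<phi>(t))\<close>.\<close>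

section \<open>The path space\<close>

text \<open>Upward passage is downward passage for the rates \<open>- c\<close>, so passage and
  escape are treated once, through \<open>down\<close> and \<open>escape\<close>. The exponentials
  of \<open>U\<close> and \<open>U'\<close> enter only as the passage probabilities that the
  hypotheses equate them with. A passage below \<open>x\<close> begins with a passage below
  \<open>0\<close>, so products such as \<open>\<Psi> ** matrix_exp (x *\<^sub>R U)\<close> are
  passage probabilities too, and every nonzero block of the two matrices consists of values of
  \<open>down\<close>. One obstacle is \<Psi>, defined by the first return to the initial level
  rather than by the passage strictly below it. The two differ on paths whose phase changes at the
  very instant of return; these end a sojourn at a time fixed by their past, which has probability
  0. Another is the divisor \<eta> \<bullet> \<beta> in (iii). It is nonzero because \<eta> has one
  strict sign on the up phases and, once the down phases are eliminated, \<beta> becomes strictly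
  positive there, being a limit of rescaled escape probabilities. The laws are moved to path space
  because shifting and stopping act there.\<close>

definition path_space :: "(real \<Rightarrow> 's::finite) measure" where
  "path_space = sigma {f. step_path f} {{f. step_path f \<and> f t = k} |t k. 0 \<le> t}"

lemma space_path_space [simp]: "space path_space = {f. step_path f}"
  unfolding path_space_def by (rule space_measure_of) auto

lemma sets_path_space:
  "sets path_space = sigma_sets {f. step_path f} {{f. step_path f \<and> f t = k} |t k. 0 \<le> t}"
  unfolding path_space_def by (rule sets_measure_of) auto

lemma measurable_coordinate:
  assumes "0 \<le> t"
  shows "(\<lambda>f. f t) \<in> path_space \<rightarrow>\<^sub>M count_space (UNIV :: 's::finite set)"
proof -
  have "(\<lambda>f. f t) -` {k} \<inter> space path_space \<in> sets (path_space :: (real \<Rightarrow> 's) measure)" for k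
    unfolding sets_path_space using assms
    by (intro sigma_sets.Basic) (auto intro!: exI[of _ t] exI[of _ k])
  then show ?thesis
    by (subst measurable_count_space_eq2) (auto simp del: space_path_space)
qed

text \<open>Clipping the time at 0 removes the side condition on \<open>t\<close>, so that the
  measurability prover can apply the rule; paths are unconstrained at negative times.\<close>

lemma measurable_coordinate_max [measurable]:
  "(\<lambda>f. f (max 0 t)) \<in> path_space \<rightarrow>\<^sub>M count_space (UNIV :: 's::finite set)"
  by (rule measurable_coordinate) simp

lemma measurable_path_spaceI:
  fixes g :: "'a \<Rightarrow> real \<Rightarrow> 's::finite"
  assumes "\<And>x. x \<in> space M \<Longrightarrow> step_path (g x)"
    and m: "\<And>t. 0 \<le> t \<Longrightarrow> (\<lambda>x. g x t) \<in> M \<rightarrow>\<^sub>M count_space UNIV"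
  shows "g \<in> M \<rightarrow>\<^sub>M path_space"
  unfolding path_space_def
proof (rule measurable_measure_of)
  show "g \<in> space M \<rightarrow> {f. step_path f}" using assms(1) by auto
  fix A :: "(real \<Rightarrow> 's) set" assume "A \<in> {{f. step_path f \<and> f t = k} |t k. 0 \<le> t}"
  then obtain t k where A: "A = {f. step_path f \<and> f t = k}" and t: "0 \<le> t" by auto
  have "g -` A \<inter> space M = (\<lambda>x. g x t) -` {k} \<inter> space M"
    unfolding A using assms(1) by auto
  also have "\<dots> \<in> sets M" using m[OF t] by (rule measurable_sets) auto
  finally show "g -` A \<inter> space M \<in> sets M" .
qed auto

section \<open>Shifted and stopped paths\<close>

definition shift :: "real \<Rightarrow> (real \<Rightarrow> 's) \<Rightarrow> real \<Rightarrow> 's" where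
  "shift t f = (\<lambda>s. f (t + s))"

text \<open>The inner \<open>max 0 s\<close> discards the values at negative times, which no event
  sees. Two paths that agree on \<open>[0, t]\<close> therefore have literally the same stopped
  path.\<close>

definition stop :: "real \<Rightarrow> (real \<Rightarrow> 's) \<Rightarrow> real \<Rightarrow> 's" where
  "stop t f = (\<lambda>s. f (min (max 0 s) t))"

lemma shift_apply: "shift t f s = f (t + s)"
  by (simp add: shift_def)

lemma step_pathE:
  assumes "step_path f" "0 \<le> t"
  obtains e k where "0 < e" "f t = k" "\<forall>s. t \<le> s \<and> s < t + e \<longrightarrow> f s = k"
proof -
  have "eventually (\<lambda>s. f s = f t) (at_right t)" using assms by (simp add: step_path_def)
  then obtain b where "b > t" "\<forall>y>t. y < b \<longrightarrow> f y = f t"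
    unfolding eventually_at_right_field by blast
  then show ?thesis by (intro that[of "b - t" "f t"]) (auto simp: le_less)
qed

lemma step_path_leftD: "step_path f \<Longrightarrow> 0 < t \<Longrightarrow> \<exists>e k. 0 < e \<and> e \<le> t \<and> (\<forall>s. t - e \<le> s \<and> s < t \<longrightarrow> f s = k)"
proof -
  assume "step_path f" "0 < t"
  then obtain k where "eventually (\<lambda>s. f s = k) (at_left t)" by (auto simp: step_path_def)
  then obtain b where b: "b < t" "\<forall>y>b. y < t \<longrightarrow> f y = k"
    unfolding eventually_at_left_field by auto
  define e where "e = min t ((t - b)/2)"
  have e: "0 < e" "e \<le> t" "e \<le> (t - b) / 2"
    using b(1) \<open>0 < t\<close> unfolding e_def by (simp_all del: le_divide_eq_numeral1)
  then have "f s = k" if "t - e \<le> s" "s < t" for s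
  proof -
    have "b < s" using e(3) b(1) that(1) by argo
    then show ?thesis using b(2) that(2) by simp
  qed
  then show ?thesis using e by blast
qed

lemma step_path_shift:
  assumes f: "step_path f" and t: "0 \<le> t"
  shows "step_path (shift t f)"
  unfolding step_path_def
proof (intro conjI allI impI)
  fix s :: real assume "0 \<le> s"
  then have "0 \<le> t + s" using t by simp
  then obtain e k where "0 < e" "f (t + s) = k" "\<forall>u. t + s \<le> u \<and> u < t + s + e \<longrightarrow> f u = k"
    by (rule step_pathE[OF f])
  then show "eventually (\<lambda>u. shift t f u = shift t f s) (at_right s)"
    unfolding eventually_at_right_field shift_def by (intro exI[of _ "s + e"]) auto
next
  fix s :: real assume s: "0 < s"
  then have "0 < t + s" using t by simp
  then obtain e k where "e > 0" "\<forall>u. t + s - e \<le> u \<and> u < t + s \<longrightarrow> f u = k"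
    using step_path_leftD[OF f] by blast
  then show "\<exists>k. eventually (\<lambda>u. shift t f u = k) (at_left s)"
    unfolding eventually_at_left_field shift_def
    by (intro exI[of _ k] exI[of _ "s - e"]) auto
qed

lemma step_path_stop:
  assumes f: "step_path f" and t: "0 \<le> t"
  shows "step_path (stop t f)"
  unfolding step_path_def
proof (intro conjI allI impI)
  fix s :: real assume s: "0 \<le> s"
  obtain e k where e: "0 < e" "f s = k" "\<forall>u. s \<le> u \<and> u < s + e \<longrightarrow> f u = k"
    by (rule step_pathE[OF f s])
  show "eventually (\<lambda>u. stop t f u = stop t f s) (at_right s)"
  proof (cases "s < t")
    case True
    then show ?thesis using e unfolding eventually_at_right_field stop_def
      by (intro exI[of _ "min t (s + e)"]) (use s in auto)
  next
    case False
    then show ?thesis unfolding eventually_at_right_field stop_def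
      by (intro exI[of _ "s + 1"]) (use s in \<open>auto simp: min_def max_def\<close>)
  qed
next
  fix s :: real assume s: "0 < s"
  then obtain e k where e: "e > 0" "e \<le> s" "\<forall>u. s - e \<le> u \<and> u < s \<longrightarrow> f u = k"
    using step_path_leftD[OF f s] by blast
  show "\<exists>k. eventually (\<lambda>u. stop t f u = k) (at_left s)"
  proof (cases "s \<le> t")
    case True
    then show ?thesis using e unfolding eventually_at_left_field stop_def
      by (intro exI[of _ k] exI[of _ "s - e"]) auto
  next
    case False
    then show ?thesis unfolding eventually_at_left_field stop_def
      by (intro exI[of _ "f t"] exI[of _ "t"]) (use t in \<open>auto simp: min_def max_def\<close>)
  qed
qed

text \<open>The argument is the first point of the dyadic grid strictly to the right of
  \<open>t\<close>, at distance at most \<open>1/2^n\<close>. A step path is constant on some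
  \<open>[t, t + e)\<close>, so the values do not merely converge but are eventually equal.\<close>

lemma path_grid_eventually:
  assumes f: "step_path f" and t: "0 \<le> t"
  shows "eventually (\<lambda>n. f ((of_int \<lfloor>t * 2^n\<rfloor> + 1) / 2^n) = f t) sequentially"
proof -
  obtain e k where e: "0 < e" "f t = k" "\<forall>u. t \<le> u \<and> u < t + e \<longrightarrow> f u = k"
    by (rule step_pathE[OF f t])
  have "(\<lambda>n. (1/2::real)^n) \<longlonglongrightarrow> 0" by (rule LIMSEQ_realpow_zero) auto
  then have "eventually (\<lambda>n. (1/2::real)^n < e) sequentially"
    using e(1) by (rule order_tendstoD)
  then show ?thesis
  proof eventually_elim
    case (elim n)
    have "t * 2^n < of_int \<lfloor>t * 2^n\<rfloor> + 1" "of_int \<lfloor>t * 2^n\<rfloor> \<le> t * 2^n" by linarith+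
    then have "t < (of_int \<lfloor>t * 2^n\<rfloor> + 1)/2^n" "(of_int \<lfloor>t * 2^n\<rfloor> + 1)/2^n \<le> t + 1/2^n"
      by (auto simp: field_simps)
    then show ?case using e(2,3) elim by (auto simp: power_one_over)
  qed
qed

text \<open>Evaluation at the dyadic point to the right of \<open>t\<close> involves only countably
  many times and is measurable in both variables; evaluation at \<open>t\<close> is its
  limit.\<close>

lemma measurable_path_eval:
  "(\<lambda>(t, f). f (max 0 t)) \<in> borel \<Otimes>\<^sub>M path_space \<rightarrow>\<^sub>M count_space (UNIV :: 's::finite set)"
proof (rule measurable_count_space_eq2[THEN iffD2])
  let ?M = "borel \<Otimes>\<^sub>M (path_space :: (real \<Rightarrow> 's) measure)"
  have "(\<lambda>(t, f). f (max 0 t)) -` {k} \<inter> space ?M \<in> sets ?M" for k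
  proof -
    define g :: "nat \<Rightarrow> real \<times> (real \<Rightarrow> 's) \<Rightarrow> 's" where
      "g n = (\<lambda>x. snd x (max 0 ((of_int \<lfloor>max 0 (fst x) * 2^n\<rfloor> + 1) / 2^n)))" for n
    have g: "g n \<in> ?M \<rightarrow>\<^sub>M count_space UNIV" for n
      unfolding g_def
      by (rule measurable_compose_countable[where f="\<lambda>i x. snd x (max 0 ((of_int i + 1) / 2^n))"]) measurable
    have [measurable]: "(\<lambda>x. of_bool (g n x = k) :: real) \<in> borel_measurable ?M" for n
      by (rule measurable_compose[OF g]) simp
    have "(\<lambda>x. of_bool (snd x (max 0 (fst x)) = k) :: real) \<in> borel_measurable ?M"
    proof (rule borel_measurable_LIMSEQ_real)
      fix x :: "real \<times> (real \<Rightarrow> 's)" assume "x \<in> space ?M"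
      then have step: "step_path (snd x)" by (auto simp: space_pair_measure)
      have "eventually (\<lambda>n. g n x = snd x (max 0 (fst x))) sequentially"
        using path_grid_eventually[OF step max.cobounded1]
        by eventually_elim (simp add: g_def)
      then have "eventually (\<lambda>n. of_bool (snd x (max 0 (fst x)) = k) = (of_bool (g n x = k) :: real)) sequentially"
        by eventually_elim simp
      then show "(\<lambda>n. of_bool (g n x = k) :: real) \<longlonglongrightarrow> of_bool (snd x (max 0 (fst x)) = k)"
        by (rule Lim_transform_eventually[OF tendsto_const])
    qed measurable
    then have "{x\<in>space ?M. of_bool (snd x (max 0 (fst x)) = k) = (1::real)} \<in> sets ?M"
      by measurable
    also have "{x\<in>space ?M. of_bool (snd x (max 0 (fst x)) = k) = (1::real)} =
      (\<lambda>(t, f). f (max 0 t)) -` {k} \<inter> space ?M" by auto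
    finally show ?thesis .
  qed
  then show "(\<lambda>(t, f). f (max 0 t)) \<in> space ?M \<rightarrow> (UNIV::'s set) \<and>
    (\<forall>k\<in>UNIV. (\<lambda>(t, f). f (max 0 t)) -` {k} \<inter> space ?M \<in> sets ?M)"
    by auto
qed auto

lemma measurable_path_eval_at:
  assumes [measurable]: "T \<in> borel_measurable M" and [measurable]: "g \<in> M \<rightarrow>\<^sub>M path_space"
  shows "(\<lambda>x. g x (max 0 (T x))) \<in> M \<rightarrow>\<^sub>M count_space (UNIV :: 's::finite set)"
proof -
  have "(\<lambda>x. (T x, g x)) \<in> M \<rightarrow>\<^sub>M borel \<Otimes>\<^sub>M path_space" by measurable
  from measurable_compose[OF this measurable_path_eval] show ?thesis by simp
qed

lemma measurable_eval_nonneg: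
  assumes "T \<in> borel_measurable M" and "g \<in> M \<rightarrow>\<^sub>M path_space" and "\<And>x. x \<in> space M \<Longrightarrow> 0 \<le> T x"
  shows "(\<lambda>x. g x (T x)) \<in> M \<rightarrow>\<^sub>M count_space (UNIV :: 's::finite set)"
  using measurable_path_eval_at[OF assms(1,2)]
  by (rule measurable_cong[THEN iffD1, rotated]) (use assms(3) in \<open>auto simp: max_def\<close>)

lemma measurable_shift_at:
  assumes [measurable]: "T \<in> borel_measurable M" and g: "g \<in> M \<rightarrow>\<^sub>M path_space"
    and T: "\<And>x. x \<in> space M \<Longrightarrow> 0 \<le> T x"
  shows "(\<lambda>x. shift (T x) (g x)) \<in> M \<rightarrow>\<^sub>M (path_space :: (real \<Rightarrow> 's::finite) measure)"
proof (rule measurable_path_spaceI)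
  fix x assume "x \<in> space M"
  then show "step_path (shift (T x) (g x))"
    using measurable_space[OF g] T by (auto intro!: step_path_shift)
next
  fix t :: real assume "0 \<le> t"
  then show "(\<lambda>x. shift (T x) (g x) t) \<in> M \<rightarrow>\<^sub>M count_space UNIV"
    unfolding shift_def using T by (intro measurable_eval_nonneg[OF _ g] borel_measurable_add assms(1)) auto
qed

lemma measurable_shift [measurable]:
  "0 \<le> t \<Longrightarrow> shift t \<in> path_space \<rightarrow>\<^sub>M (path_space :: (real \<Rightarrow> 's::finite) measure)"
  using measurable_shift_at[of "\<lambda>_. t" path_space "\<lambda>f. f"] by simp

lemma measurable_stop:
  "0 \<le> t \<Longrightarrow> stop t \<in> path_space \<rightarrow>\<^sub>M (path_space :: (real \<Rightarrow> 's::finite) measure)"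
  by (rule measurable_path_spaceI) (simp add: step_path_stop, simp add: stop_def measurable_coordinate)


section \<open>The level of a path\<close>

definition lev :: "real^'s \<Rightarrow> (real \<Rightarrow> 's) \<Rightarrow> real \<Rightarrow> real" where
  "lev c f t = integral {0..t} (\<lambda>s. c $ f s)"

lemma level_eq: "level c x0 f t = x0 + lev c f t"
  by (simp add: level_def lev_def)

lemma lev_0 [simp]: "lev c f 0 = 0"
  by (simp add: lev_def)

lemma lev_minus: "lev (- c) f t = - lev c f t"
  by (simp add: lev_def)

context
  fixes c :: "real^'s::finite" and f :: "real \<Rightarrow> 's"
  assumes f: "step_path f"
begin

lemma borel_measurable_rate: "(\<lambda>s. c $ f (max 0 s)) \<in> borel_measurable borel"
proof (rule measurable_compose[where g="\<lambda>k. c $ k" and N="count_space UNIV"])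
  show "(\<lambda>s. f (max 0 s)) \<in> borel \<rightarrow>\<^sub>M count_space UNIV"
    using measurable_path_eval_at[of "\<lambda>s. s" borel "\<lambda>_. f"] f by simp
qed simp

lemma set_integrable_rate: "set_integrable lborel {u..t} (\<lambda>s. c $ f (max 0 s))"
proof -
  have "integrable (restrict_space lborel {u..t}) (\<lambda>s. c $ f (max 0 s))"
  proof (rule finite_measure.integrable_const_bound[where B="norm c"])
    show "finite_measure (restrict_space lborel {u..t})"
      by (rule finite_measureI) (simp add: emeasure_restrict_space space_restrict_space emeasure_lborel_Icc_eq)
    show "(\<lambda>s. c $ f (max 0 s)) \<in> borel_measurable (restrict_space lborel {u..t})"
      using borel_measurable_rate by (intro measurable_restrict_space1) auto
  qed (auto simp: component_le_norm_cart)
  then show ?thesis by (simp add: integrable_restrict_space set_integrable_def)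
qed

lemma integrable_on_rate: "0 \<le> u \<Longrightarrow> (\<lambda>s. c $ f s) integrable_on {u..t}"
  using set_borel_integral_eq_integral(1)[OF set_integrable_rate[of u t]]
  by (rule integrable_eq) auto

text \<open>In this form the level is a Lebesgue integral with the path as parameter, which makes it
  measurable as a function of the path.\<close>

lemma lev_eq_lebesgue: "lev c f t = (\<integral>s. indicator {0..t} s *\<^sub>R (c $ f (max 0 s)) \<partial>lborel)"
  using set_borel_integral_eq_integral(2)[OF set_integrable_rate[of 0 t]]
  unfolding lev_def set_lebesgue_integral_def
  by (auto intro!: Henstock_Kurzweil_Integration.integral_cong)

lemma lev_diff: "0 \<le> s \<Longrightarrow> s \<le> t \<Longrightarrow> lev c f t = lev c f s + integral {s..t} (\<lambda>u. c $ f u)"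
  unfolding lev_def
  using Henstock_Kurzweil_Integration.integral_combine[of 0 s t "\<lambda>u. c $ f u"] integrable_on_rate[of 0 t] by simp

lemma lev_lipschitz: "0 \<le> s \<Longrightarrow> 0 \<le> t \<Longrightarrow> \<bar>lev c f t - lev c f s\<bar> \<le> norm c * \<bar>t - s\<bar>"
proof (induction s t rule: linorder_wlog)
  case (le s t)
  have "norm (integral {s..t} (\<lambda>u. c $ f u)) \<le> integral {s..t} (\<lambda>u. norm c)"
    using le by (intro integral_norm_bound_integral integrable_on_rate) (auto simp: component_le_norm_cart)
  then show ?case using lev_diff[of s t] le by (simp add: mult.commute)
qed (simp add: abs_minus_commute)

lemma lev_shift:
  assumes "0 \<le> t" "0 \<le> s"
  shows "lev c f (t + s) = lev c f t + lev c (shift t f) s"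
proof -
  have "((\<lambda>u. c $ f u) has_integral (integral {t..t+s} (\<lambda>u. c $ f u))) (cbox t (t+s))"
    using assms integrable_on_rate[of t] by (auto simp: integrable_integral)
  from has_integral_affinity'[OF this, of 1 t]
  have "((\<lambda>u. c $ f (u + t)) has_integral (integral {t..t+s} (\<lambda>u. c $ f u))) {0..s}" by simp
  then have "lev c (shift t f) s = integral {t..t+s} (\<lambda>u. c $ f u)"
    unfolding lev_def shift_def by (simp add: integral_unique add.commute)
  then show ?thesis using lev_diff[of t "t + s"] assms by simp
qed

lemma lev_const:
  assumes "0 \<le> t" and "\<And>s. 0 \<le> s \<Longrightarrow> s < t \<Longrightarrow> f s = k"
  shows "lev c f t = c $ k * t"
proof -
  have "integral {0..t} (\<lambda>s. c $ f s) = integral {0..t} (\<lambda>s. c $ k)"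
    using assms by (intro integral_spike[of "{t}"]) auto
  then show ?thesis using assms unfolding lev_def by simp
qed

lemma continuous_on_lev: "continuous_on {0..} (lev c f)"
proof (rule continuous_onI)
  fix x e :: real assume x: "x \<in> {0..}" and e: "0 < e"
  show "\<exists>d>0. \<forall>x'\<in>{0..}. dist x' x < d \<longrightarrow> dist (lev c f x') (lev c f x) \<le> e"
  proof (intro exI[of _ "e / (norm c + 1)"] conjI ballI impI)
    show "0 < e / (norm c + 1)" using e by (simp add: add_nonneg_pos)
    fix x' assume x': "x' \<in> {0..}" "dist x' x < e / (norm c + 1)"
    have "\<bar>lev c f x' - lev c f x\<bar> \<le> norm c * \<bar>x' - x\<bar>" using x x' by (intro lev_lipschitz) auto
    also have "\<dots> \<le> (norm c + 1) * \<bar>x' - x\<bar>" by (intro mult_right_mono) auto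
    also have "\<dots> \<le> e" using x'(2)
      by (simp add: dist_real_def pos_less_divide_eq add_nonneg_pos mult.commute del: distrib_left_numeral)
    finally show "dist (lev c f x') (lev c f x) \<le> e" by (simp add: dist_real_def)
  qed
qed

end

lemma lev_add_const:
  assumes f: "step_path f" and "0 \<le> t" "0 \<le> s" and "\<And>u. t \<le> u \<Longrightarrow> u < t + s \<Longrightarrow> f u = k"
  shows "lev c f (t + s) = lev c f t + c $ k * s"
  using lev_shift[OF f, of t s] lev_const[OF step_path_shift[OF f], of t s k c] assms
  by (simp add: shift_def)

lemma lev_bound: "step_path f \<Longrightarrow> 0 \<le> t \<Longrightarrow> \<bar>lev c f t\<bar> \<le> norm c * t"
  using lev_lipschitz[of f 0 t c] by simp

lemma borel_measurable_lev [measurable]: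
  "(\<lambda>f. lev c f t) \<in> borel_measurable (path_space :: (real \<Rightarrow> 's::finite) measure)"
proof -
  have "(\<lambda>x. fst x (max 0 (snd x))) \<in> (path_space :: (real \<Rightarrow> 's) measure) \<Otimes>\<^sub>M lborel \<rightarrow>\<^sub>M count_space UNIV"
    by (rule measurable_path_eval_at) auto
  then have [measurable]: "(\<lambda>x. c $ (fst x (max 0 (snd x)))) \<in> borel_measurable ((path_space :: (real \<Rightarrow> 's) measure) \<Otimes>\<^sub>M lborel)"
    by (rule measurable_compose[where g="\<lambda>k. c $ k"]) simp
  have "(\<lambda>f. \<integral>s. indicator {0..t} s *\<^sub>R (c $ f (max 0 s)) \<partial>lborel) \<in> borel_measurable (path_space :: (real \<Rightarrow> 's) measure)"
    by (rule lborel.borel_measurable_lebesgue_integral) (simp add: case_prod_unfold)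
  then show ?thesis
    by (rule measurable_cong[THEN iffD1, rotated]) (simp add: lev_eq_lebesgue)
qed

lemma lev_agree:
  assumes "\<And>s. 0 \<le> s \<Longrightarrow> s \<le> t \<Longrightarrow> f s = g s"
  shows "lev c f t = lev c g t"
  unfolding lev_def using assms by (auto intro!: Henstock_Kurzweil_Integration.integral_cong)


section \<open>First passage times of a path\<close>

text \<open>Strict passage, as in \<open>tau_minus\<close>: it forces the phase at the passage time
  to have negative rate (\<open>at_down_time\<close>). Hitting \<open>- x\<close> would not, since
  the phase may change at the moment of contact.\<close>

definition down_time :: "real^'s \<Rightarrow> real \<Rightarrow> (real \<Rightarrow> 's) \<Rightarrow> ereal" where
  "down_time c x f = Inf (ereal ` {t. 0 \<le> t \<and> lev c f t < - x})"

lemma tau_minus_level: "tau_minus (level c x0 f) x = down_time c x f"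
proof -
  have "{t. 0 \<le> t \<and> level c x0 f t < level c x0 f 0 - x} = {t. 0 \<le> t \<and> lev c f t < - x}"
    by (auto simp: level_eq)
  then show ?thesis by (simp add: tau_minus_def down_time_def)
qed

lemma tau_plus_level: "tau_plus (level c x0 f) x = down_time (- c) x f"
proof -
  have "{t. 0 \<le> t \<and> level c x0 f t > level c x0 f 0 + x} = {t. 0 \<le> t \<and> lev (- c) f t < - x}"
    by (auto simp: level_eq lev_minus)
  then show ?thesis by (simp add: tau_plus_def down_time_def)
qed

lemma down_time_less_iff: "down_time c x f < ereal u \<longleftrightarrow> (\<exists>t\<ge>0. t < u \<and> lev c f t < - x)"
  unfolding down_time_def Inf_less_iff by auto

lemma down_time_nonneg [simp]: "0 \<le> down_time c x f"
  unfolding down_time_def by (intro Inf_greatest) auto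

lemma down_time_finite_iff: "down_time c x f < \<infinity> \<longleftrightarrow> (\<exists>t\<ge>0. lev c f t < - x)"
  unfolding down_time_def Inf_less_iff by auto

lemma down_time_finiteE:
  assumes "down_time c x f < \<infinity>"
  obtains T where "0 \<le> T" "down_time c x f = ereal T"
proof (cases "down_time c x f")
  case (real r)
  then show ?thesis using that[of r] down_time_nonneg[of c x f] by simp
qed (use assms down_time_nonneg[of c x f] in auto)

lemma real_of_down_time_nonneg [simp]: "0 \<le> real_of_ereal (down_time c x f)"
  by (simp add: real_of_ereal_pos)

text \<open>Before the passage time the bound is the definition of the infimum; at the passage time
  itself it follows from the continuity of the level.\<close>

lemma level_before_down_time:
  assumes "ereal t \<le> down_time c x f" "0 \<le> t" "0 \<le> x" and f: "step_path f"
  shows "- x \<le> lev c f t"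
proof (cases "t = 0")
  case False
  have "isCont (lev c f) t"
    using continuous_on_lev[OF f, of c] False assms(2) by (simp add: continuous_on_interior)
  then have "(lev c f \<longlongrightarrow> lev c f t) (at_left t)"
    by (simp add: isCont_def filterlim_at_split)
  moreover have "eventually (\<lambda>s. - x \<le> lev c f s) (at_left t)"
  proof -
    have "- x \<le> lev c f s" if "0 < s" "s < t" for s
    proof (rule ccontr)
      assume "\<not> - x \<le> lev c f s"
      then have "down_time c x f < ereal t" using that by (auto simp: down_time_less_iff intro!: exI[of _ s])
      then show False using assms(1) by simp
    qed
    then show ?thesis unfolding eventually_at_left_field using False assms(2) by (intro exI[of _ 0]) auto
  qed
  ultimately show ?thesis by (rule tendsto_lowerbound) simp
qed (use assms in simp)

text \<open>The level is at least \<open>- x\<close> at \<open>T\<close>, is below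
  \<open>- x\<close> at times arbitrarily soon after \<open>T\<close>, and is affine with slope
  \<open>c $ f T\<close> on a short interval from \<open>T\<close> on. This leaves only the value
  \<open>- x\<close> and a negative slope.\<close>

lemma at_down_time:
  assumes T: "down_time c x f = ereal T" and x: "0 \<le> x" and f: "step_path f"
  shows "lev c f T = - x" "c $ f T < 0"
proof -
  have T0: "0 \<le> T" using down_time_nonneg[of c x f] T by simp
  have ge: "- x \<le> lev c f T" using level_before_down_time[of T c x f] assms T0 by simp
  obtain e k where e: "0 < e" "f T = k" "\<forall>s. T \<le> s \<and> s < T + e \<longrightarrow> f s = k"
    by (rule step_pathE[OF f T0])
  have lev: "lev c f (T + s) = lev c f T + c $ f T * s" if "0 \<le> s" "s < e" for s
    by (rule lev_add_const[OF f]) (use that e T0 in auto)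
  have passed: "\<exists>s. 0 \<le> s \<and> s < d \<and> lev c f (T + s) < - x" if "0 < d" for d
  proof -
    have "down_time c x f < ereal (T + d)" using T that by simp
    then obtain t where t: "0 \<le> t" "t < T + d" "lev c f t < - x" by (auto simp: down_time_less_iff)
    have "T \<le> t"
    proof (rule ccontr)
      assume "\<not> T \<le> t"
      then have "down_time c x f < ereal T" using t by (auto simp: down_time_less_iff)
      then show False using T by simp
    qed
    then show ?thesis using t by (intro exI[of _ "t - T"]) auto
  qed
  show neg: "c $ f T < 0"
  proof (rule ccontr)
    assume "\<not> c $ f T < 0"
    then have "- x \<le> lev c f (T + s)" if "0 \<le> s" "s < e" for s
      using lev[OF that] ge that by (simp add: add_increasing2)
    then show False using passed[OF e(1)] by force
  qed
  show "lev c f T = - x"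
  proof (rule ccontr)
    assume "lev c f T \<noteq> - x"
    then have gt: "0 < lev c f T + x" using ge by simp
    \<comment> \<open>The second term is the time that a level falling at rate
      \<open>c $ f T\<close> needs from its value at \<open>T\<close> down to \<open>- x\<close>;
      until then nothing can be passed.\<close>
    define d where "d = min e ((lev c f T + x) / - (c $ f T))"
    have "0 < d" using e(1) gt neg unfolding d_def by (simp only: min_less_iff_conj divide_pos_pos neg_0_less_iff_less)
    from passed[OF this] obtain s where s: "0 \<le> s" "s < d" "lev c f (T + s) < - x" by auto
    then have "lev c f T + c $ f T * s < - x" using lev[of s] by (simp add: d_def)
    moreover have "s * - (c $ f T) < lev c f T + x" using s(2) neg unfolding d_def
      by (subst pos_less_divide_eq[symmetric]) auto
    ultimately show False by (simp add: mult.commute)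
  qed
qed

text \<open>Converse of \<open>at_down_time\<close>: a negative rate at \<open>T\<close> persists
  for a short while, so the level \<open>- x\<close> is left downwards at once.\<close>

lemma down_time_eqI:
  assumes T: "0 \<le> T" and f: "step_path f" and b: "\<And>t. 0 \<le> t \<Longrightarrow> t \<le> T \<Longrightarrow> - x \<le> lev c f t"
    and "lev c f T = - x" "c $ f T < 0"
  shows "down_time c x f = ereal T"
proof (rule antisym)
  show "ereal T \<le> down_time c x f"
  proof (rule ccontr)
    assume "\<not> ereal T \<le> down_time c x f"
    then have "down_time c x f < ereal T" by simp
    then obtain t where "0 \<le> t" "t < T" "lev c f t < - x" by (auto simp: down_time_less_iff)
    then show False using b[of t] by simp
  qed
  obtain e k where e: "0 < e" "f T = k" "\<forall>s. T \<le> s \<and> s < T + e \<longrightarrow> f s = k"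
    by (rule step_pathE[OF f T])
  show "down_time c x f \<le> ereal T"
  proof (rule dense_ge)
    fix y assume y: "ereal T < y"
    obtain d where d: "0 < d" "ereal (T + d) \<le> y"
    proof (cases y)
      case (real r)
      then show ?thesis using y that[of "r - T"] by simp
    next
      case PInf
      then show ?thesis using that[of 1] by simp
    qed (use y in simp)
    define s where "s = min d e / 2"
    have s: "0 < s" "s < d" "s < e" using d e by (auto simp: s_def min_def)
    have "lev c f (T + s) = lev c f T + c $ f T * s"
      by (rule lev_add_const[OF f]) (use s e T in auto)
    then have "lev c f (T + s) < - x" using assms s by (simp add: mult_neg_pos)
    then have "down_time c x f < ereal (T + d)" using s T by (auto simp: down_time_less_iff intro!: exI[of _ "T + s"])
    then show "down_time c x f \<le> y" using d by simp
  qed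
qed

text \<open>Nothing is passed up to \<open>T\<close>, so the set of times below \<open>- z\<close>
  is the translate by \<open>T\<close> of the corresponding set for the shifted path. An empty set
  gives infinity on both sides.\<close>

lemma down_time_shift:
  assumes f: "step_path f" and T: "0 \<le> T" and b: "\<And>t. 0 \<le> t \<Longrightarrow> t \<le> T \<Longrightarrow> - z \<le> lev c f t"
  shows "down_time c z f = ereal T + down_time c (z + lev c f T) (shift T f)"
proof -
  have "{t. 0 \<le> t \<and> lev c f t < - z} = (\<lambda>s. T + s) ` {s. 0 \<le> s \<and> lev c (shift T f) s < - (z + lev c f T)}"
  proof (intro set_eqI iffI)
    fix t assume t: "t \<in> {t. 0 \<le> t \<and> lev c f t < - z}"
    then have "T < t" using b[of t] by force
    then show "t \<in> (\<lambda>s. T + s) ` {s. 0 \<le> s \<and> lev c (shift T f) s < - (z + lev c f T)}"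
      using lev_shift[OF f T, of "t - T" c] t by (intro image_eqI[of _ _ "t - T"]) auto
  next
    fix t assume "t \<in> (\<lambda>s. T + s) ` {s. 0 \<le> s \<and> lev c (shift T f) s < - (z + lev c f T)}"
    then show "t \<in> {t. 0 \<le> t \<and> lev c f t < - z}" using lev_shift[OF f T, of _ c] T by auto
  qed
  then have eq: "ereal ` {t. 0 \<le> t \<and> lev c f t < - z} =
    (\<lambda>s. ereal T + ereal s) ` {s. 0 \<le> s \<and> lev c (shift T f) s < - (z + lev c f T)}" (is "_ = _ ` ?S")
    by (simp add: image_image)
  show ?thesis
  proof (cases "?S = {}")
    case True
    then show ?thesis by (simp only: down_time_def eq True image_empty Inf_empty top_ereal_def) simp
  next
    case False
    then have "(INF s\<in>?S. ereal T + ereal s) = ereal T + (INF s\<in>?S. ereal s)"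
      by (intro INF_ereal_add_right) auto
    then show ?thesis by (simp only: down_time_def eq)
  qed
qed

text \<open>The level is Lipschitz, so a strict passage at a real time is also seen at a rational
  time shortly afterwards, and countably many times suffice.\<close>

lemma measurable_down_time [measurable]:
  "down_time c x \<in> borel_measurable (path_space :: (real \<Rightarrow> 's::finite) measure)"
proof (rule borel_measurableI_less)
  have finite: "{f\<in>space path_space. down_time c x f < ereal u} \<in> sets path_space" for u
  proof -
    have "{f\<in>space path_space. down_time c x f < ereal u} =
      {f\<in>space path_space. \<exists>q\<in>{q\<in>\<rat>. 0 \<le> q \<and> q < u}. lev c f q < - x}" (is "?A = ?B")
    proof (intro set_eqI iffI)
      fix f assume "f \<in> ?A"
      then obtain t where f: "step_path f" and t: "0 \<le> t" "t < u" "lev c f t < - x"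
        by (auto simp: down_time_less_iff)
      \<comment> \<open>Within this time the level cannot climb back over the margin
        \<open>- x - lev c f t\<close>; the summand 1 keeps the divisor positive when
        \<open>c = 0\<close>.\<close>
      define d where "d = min (u - t) ((- x - lev c f t) / (norm c + 1))"
      have "0 < d" using t by (simp add: d_def add_nonneg_pos)
      then obtain q where q: "q \<in> \<rat>" "t < q" "q < t + d" using Rats_dense_in_real[of t "t + d"] by auto
      have "lev c f q - lev c f t \<le> norm c * (q - t)" using lev_lipschitz[OF f, of t q c] q t by simp
      also have "\<dots> \<le> (norm c + 1) * (q - t)" using q by (intro mult_right_mono) auto
      also have "\<dots> < - x - lev c f t"
      proof -
        have "q - t < (- x - lev c f t) / (norm c + 1)" using q by (simp add: d_def)
        then show ?thesis by (simp add: pos_less_divide_eq add_nonneg_pos mult.commute)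
      qed
      finally show "f \<in> ?B" using f q t by (auto simp: d_def intro!: bexI[of _ q])
    next
      fix f assume "f \<in> ?B"
      then show "f \<in> ?A" by (auto simp: down_time_less_iff)
    qed
    also have "?B \<in> sets path_space"
    proof (rule sets.sets_Collect_countable_Ex')
      show "countable {q\<in>\<rat>. 0 \<le> q \<and> q < u}"
        by (rule countable_subset[OF _ countable_rat]) auto
    qed measurable
    finally show ?thesis .
  qed
  fix y :: ereal
  show "{f\<in>space path_space. down_time c x f < y} \<in> sets (path_space :: (real \<Rightarrow> 's) measure)"
  proof (cases y)
    case PInf
    have "{f\<in>space path_space. down_time c x f < y} = (\<Union>n::nat. {f\<in>space path_space. down_time c x f < ereal n})"
      unfolding PInf by (auto simp: less_PInf_Ex_of_nat)
    then show ?thesis using finite by auto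
  next
    case MInf
    then show ?thesis by (simp add: not_less)
  next
    case (real u)
    then show ?thesis using finite[of u] by simp
  qed
qed

lemma measurable_at_down_time [measurable]:
  "(\<lambda>f. f (real_of_ereal (down_time c x f))) \<in> path_space \<rightarrow>\<^sub>M count_space (UNIV :: 's::finite set)"
  by (rule measurable_eval_nonneg) auto


section \<open>The Markov property\<close>

text \<open>Uniqueness of finite measures on an intersection-stable generator, for two restricted
  image measures that are proportional. The total masses are compared separately because
  \<open>G\<close> need not contain \<Omega>. The Markov property uses it once for the past and once
  for the future.\<close>

lemma measure_eq_on_generated:
  assumes M: "finite_measure M" and N: "finite_measure N"
    and f: "f \<in> M \<rightarrow>\<^sub>M sigma \<Omega> G" and g: "g \<in> N \<rightarrow>\<^sub>M sigma \<Omega> G"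
    and G: "Int_stable G" "G \<subseteq> Pow \<Omega>" and E: "E \<in> sets M" and F: "F \<in> sets N"
    and eq: "\<And>A. A \<in> G \<Longrightarrow> measure M {x\<in>E. f x \<in> A} = r * measure N {x\<in>F. g x \<in> A}"
    and total: "measure M E = r * measure N F"
    and A: "A \<in> sigma_sets \<Omega> G"
  shows "measure M {x\<in>E. f x \<in> A} = r * measure N {x\<in>F. g x \<in> A}"
proof -
  interpret M: finite_measure M by fact
  interpret N: finite_measure N by fact
  have sets: "sets (sigma \<Omega> G) = sigma_sets \<Omega> G" "space (sigma \<Omega> G) = \<Omega>" using G(2) by auto
  have fE: "{x\<in>E. f x \<in> A} = E \<inter> (f -` A \<inter> space M)" and gF: "{x\<in>F. g x \<in> A} = F \<inter> (g -` A \<inter> space N)" for A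
    using sets.sets_into_space[OF E] sets.sets_into_space[OF F] by auto
  have fA: "{x\<in>E. f x \<in> A} \<in> sets M" and gA: "{x\<in>F. g x \<in> A} \<in> sets N" if "A \<in> sigma_sets \<Omega> G" for A
    unfolding fE gF using that E F measurable_sets[OF f, of A] measurable_sets[OF g, of A] sets by auto
  show ?thesis using G A
  proof (induction rule: sigma_sets_induct_disjoint)
    case (basic A)
    then show ?case by (rule eq)
  next
    case empty
    then show ?case by simp
  next
    case (compl A)
    have "{x\<in>E. f x \<in> \<Omega> - A} = E - {x\<in>E. f x \<in> A}" "{x\<in>F. g x \<in> \<Omega> - A} = F - {x\<in>F. g x \<in> A}"
      using measurable_space[OF f] measurable_space[OF g] sets.sets_into_space[OF E] sets.sets_into_space[OF F] sets(2)
      by auto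
    then show ?case
      using compl(2) total fA[OF compl(1)] gA[OF compl(1)] E F
      by (simp add: M.finite_measure_Diff N.finite_measure_Diff algebra_simps)
  next
    case (union A)
    have "(\<lambda>n. measure M {x\<in>E. f x \<in> A n}) sums measure M (\<Union>n. {x\<in>E. f x \<in> A n})"
      using union fA by (intro M.finite_measure_UNION) (auto simp: disjoint_family_on_def)
    moreover have "(\<lambda>n. r * measure N {x\<in>F. g x \<in> A n}) sums (r * measure N (\<Union>n. {x\<in>F. g x \<in> A n}))"
      using union gA by (intro sums_mult N.finite_measure_UNION) (auto simp: disjoint_family_on_def)
    moreover have "(\<Union>n. {x\<in>E. f x \<in> A n}) = {x\<in>E. f x \<in> (\<Union>n. A n)}"
      "(\<Union>n. {x\<in>F. g x \<in> A n}) = {x\<in>F. g x \<in> (\<Union>n. A n)}" by auto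
    ultimately show ?case using union(3) by (simp add: sums_iff)
  qed
qed

lemma (in finite_measure) measure_tendsto:
  assumes [measurable]: "\<And>n. E n \<in> sets M" "F \<in> sets M"
    and "\<And>x. x \<in> space M \<Longrightarrow> eventually (\<lambda>n. x \<in> E n \<longleftrightarrow> x \<in> F) sequentially"
  shows "(\<lambda>n. measure M (E n)) \<longlonglongrightarrow> measure M F"
proof -
  have "(\<lambda>n. \<integral>x. indicator (E n) x \<partial>M) \<longlonglongrightarrow> (\<integral>x. indicator F x \<partial>M :: real)"
  proof (rule integral_dominated_convergence[where w="\<lambda>_. 1"])
    show "AE x in M. (\<lambda>n. indicator (E n) x :: real) \<longlonglongrightarrow> indicator F x"
    proof (rule AE_I2)
      fix x assume "x \<in> space M"
      from assms(3)[OF this] have "eventually (\<lambda>n. indicator F x = (indicator (E n) x :: real)) sequentially"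
        by eventually_elim (simp add: indicator_def)
      then show "(\<lambda>n. indicator (E n) x :: real) \<longlonglongrightarrow> indicator F x"
        by (rule Lim_transform_eventually[OF tendsto_const])
    qed
  qed (auto simp: indicator_def)
  then show ?thesis by simp
qed

section \<open>Cylinder sets and events determined up to a time\<close>

definition cyl :: "real set \<Rightarrow> (real \<Rightarrow> 's) \<Rightarrow> (real \<Rightarrow> 's) set" where
  "cyl J x = {f. step_path f \<and> (\<forall>u\<in>J. f u = x u)}"

lemma cyl_sets:
  fixes x :: "real \<Rightarrow> 's::finite"
  assumes "finite J" "J \<subseteq> {0..}"
  shows "cyl J x \<in> sets path_space"
proof -
  have coord: "{f\<in>space path_space. f u = x u} \<in> sets path_space" if "u \<in> J" for u
  proof -
    have "0 \<le> u" using that assms by auto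
    from measurable_sets[OF measurable_coordinate[OF this], of "{x u}"] show ?thesis
      by (simp add: vimage_def Int_def conj_commute)
  qed
  have "cyl J x = {f\<in>space path_space. \<forall>u\<in>J. f u = x u}" by (simp add: cyl_def)
  also have "\<dots> \<in> sets path_space"
    using coord assms(1) by (rule sets.sets_Collect_finite_All)
  finally show ?thesis .
qed

lemma cyl_Int_disjoint: "u \<in> J \<Longrightarrow> u \<in> J' \<Longrightarrow> x u \<noteq> x' u \<Longrightarrow> cyl J x \<inter> cyl J' x' = {}"
  unfolding cyl_def by fastforce

lemma cyl_Int:
  assumes "\<forall>u\<in>J \<inter> J'. x u = x' u"
  shows "cyl J x \<inter> cyl J' x' = cyl (J \<union> J') (\<lambda>u. if u \<in> J then x u else x' u)"
proof -
  have "(\<forall>u\<in>J \<union> J'. f u = (if u \<in> J then x u else x' u)) \<longleftrightarrow> (\<forall>u\<in>J. f u = x u) \<and> (\<forall>u\<in>J'. f u = x' u)" for f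
    using assms by (metis IntI UnE UnI1 UnI2)
  then show ?thesis unfolding cyl_def by blast
qed

definition agree :: "real \<Rightarrow> (real \<Rightarrow> 's) \<Rightarrow> (real \<Rightarrow> 's) \<Rightarrow> bool" where
  "agree t f g \<longleftrightarrow> step_path f \<and> step_path g \<and> (\<forall>s. 0 \<le> s \<and> s \<le> t \<longrightarrow> f s = g s)"

text \<open>The natural filtration in the form of Galmarino's test: together with measurability this
  says that \<open>A\<close> belongs to the sigma-algebra of the coordinates up to \<open>t\<close>
  (\<open>determined_sigma_sets\<close>). It is far easier to check than membership in a generated
  sigma-algebra.\<close>

definition determined :: "real \<Rightarrow> (real \<Rightarrow> 's) set \<Rightarrow> bool" where
  "determined t A \<longleftrightarrow> (\<forall>f g. agree t f g \<longrightarrow> (f \<in> A \<longleftrightarrow> g \<in> A))"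

lemma agree_mono: "agree v f g \<Longrightarrow> u \<le> v \<Longrightarrow> agree u f g"
  by (simp add: agree_def)

lemma determined_mono: "determined u A \<Longrightarrow> u \<le> v \<Longrightarrow> determined v A"
  using agree_mono[of v _ _ u] unfolding determined_def by blast

lemma determined_Diff: "determined u A \<Longrightarrow> determined u B \<Longrightarrow> determined u (A - B)"
  unfolding determined_def by blast

lemma determined_empty: "determined u {}"
  by (simp add: determined_def)

text \<open>The empty set is added for stability under intersection: two cylinders that prescribe
  different phases at a common time are disjoint.\<close>

definition cylinders :: "real set \<Rightarrow> (real \<Rightarrow> 's) set set" where
  "cylinders I = insert {} {cyl J x |J x. finite J \<and> J \<subseteq> I}"

lemma cylindersI: "finite J \<Longrightarrow> J \<subseteq> I \<Longrightarrow> cyl J x \<in> cylinders I"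
  by (auto simp: cylinders_def)

lemma cylindersE:
  assumes "A \<in> cylinders I" obtains "A = {}" | J x where "finite J" "J \<subseteq> I" "A = cyl J x"
  using assms by (auto simp: cylinders_def)

lemma Int_stable_cylinders: "Int_stable (cylinders I)"
proof (rule Int_stableI)
  fix A B :: "(real \<Rightarrow> 'a) set" assume "A \<in> cylinders I" "B \<in> cylinders I"
  then show "A \<inter> B \<in> cylinders I"
  proof (elim cylindersE)
    fix J x J' x' assume *: "finite J" "J \<subseteq> I" "A = cyl J x" "finite J'" "J' \<subseteq> I" "B = cyl J' x'"
    show ?thesis
    proof (cases "\<forall>u\<in>J \<inter> J'. x u = x' u")
      case True
      show ?thesis unfolding *(3,6) cyl_Int[OF True] using * by (intro cylindersI) auto
    next
      case False
      then have "A \<inter> B = {}" unfolding *(3,6) using cyl_Int_disjoint by blast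
      then show ?thesis by (simp add: cylinders_def)
    qed
  qed (auto simp: cylinders_def)
qed

lemma cylinders_subset: "cylinders I \<subseteq> Pow {f. step_path f}"
  by (auto simp: cylinders_def cyl_def)

lemma sets_sigma_cylinders: "sets (sigma {f. step_path f} (cylinders I)) = sigma_sets {f. step_path f} (cylinders I)"
  using cylinders_subset by (rule sets_measure_of)

lemma space_sigma_cylinders [simp]: "space (sigma {f. step_path f} (cylinders I)) = {f. step_path f}"
  using cylinders_subset by (rule space_measure_of)

lemma sets_cylinders:
  assumes "I \<subseteq> {0..}"
  shows "sigma_sets {f. step_path f} (cylinders I) \<subseteq> sets (path_space :: (real \<Rightarrow> 's::finite) measure)"
proof -
  have "cylinders I \<subseteq> sets (path_space :: (real \<Rightarrow> 's) measure)"
    using assms by (auto elim!: cylindersE intro: cyl_sets order_trans)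
  from sets.sigma_sets_subset[OF this] show ?thesis by simp
qed

lemma sets_path_space_cylinders:
  "sets (path_space :: (real \<Rightarrow> 's::finite) measure) = sigma_sets {f. step_path f} (cylinders {0..})"
proof (rule antisym)
  show "sets (path_space :: (real \<Rightarrow> 's) measure) \<subseteq> sigma_sets {f. step_path f} (cylinders {0..})"
    unfolding sets_path_space
  proof (rule sigma_sets_mono', rule subsetI)
    fix A :: "(real \<Rightarrow> 's) set" assume "A \<in> {{f. step_path f \<and> f t = k} |t k. 0 \<le> t}"
    then obtain t k where "A = {f. step_path f \<and> f t = k}" "0 \<le> t" by auto
    then have "A = cyl {t} (\<lambda>_. k)" by (auto simp: cyl_def)
    then show "A \<in> cylinders {0..}" using \<open>0 \<le> t\<close> by (auto intro: cylindersI)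
  qed
qed (rule sets_cylinders, simp)

text \<open>A determined event is its own preimage under \<open>stop t\<close>, and
  \<open>stop t\<close> is measurable from the coordinates up to \<open>t\<close> alone.\<close>

lemma determined_sigma_sets:
  fixes A :: "(real \<Rightarrow> 's::finite) set"
  assumes t: "0 \<le> t" and A: "A \<in> sets path_space" and d: "determined t A"
  shows "A \<in> sigma_sets {f. step_path f} (cylinders {0..t})"
proof -
  let ?F = "sigma {f. step_path f} (cylinders {0..t}) :: (real \<Rightarrow> 's) measure"
  have "stop t \<in> ?F \<rightarrow>\<^sub>M path_space"
  proof (rule measurable_path_spaceI)
    fix s :: real assume s: "0 \<le> s"
    have "(\<lambda>f. stop t f s) -` {k} \<inter> space ?F \<in> sets ?F" for k
    proof -
      have "(\<lambda>f. stop t f s) -` {k} \<inter> space ?F = cyl {min s t} (\<lambda>_. k)" using s by (auto simp: cyl_def stop_def)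
      also have "\<dots> \<in> sets ?F"
        unfolding sets_sigma_cylinders using s t by (intro sigma_sets.Basic cylindersI) auto
      finally show ?thesis .
    qed
    then show "(\<lambda>f. stop t f s) \<in> ?F \<rightarrow>\<^sub>M count_space UNIV"
      by (subst measurable_count_space_eq2) auto
  qed (use t in \<open>simp add: step_path_stop\<close>)
  from measurable_sets[OF this A] have "stop t -` A \<inter> {f. step_path f} \<in> sigma_sets {f. step_path f} (cylinders {0..t})"
    by (simp add: sets_sigma_cylinders)
  moreover have "stop t -` A \<inter> {f. step_path f} = A"
  proof -
    have "stop t f \<in> A \<longleftrightarrow> f \<in> A" if "step_path f" for f
    proof -
      have "agree t (stop t f) f" using that t by (simp add: agree_def stop_def step_path_stop[unfolded stop_def])
      then show ?thesis using d unfolding determined_def by blast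
    qed
    moreover have "A \<subseteq> {f. step_path f}" using sets.sets_into_space[OF A] by simp
    ultimately show ?thesis by auto
  qed
  ultimately show ?thesis by simp
qed

section \<open>The chain on path space and its Markov property\<close>

locale phase_chain =
  fixes Q :: "real^'s^'s" and L :: "'s \<Rightarrow> (real \<Rightarrow> 's) measure"
  assumes irreducible: "irreducible_generator Q"
    and sets_L [measurable_cong]: "\<And>i. sets (L i) = sets path_space"
    and markov_L: "\<And>i. markov_chain_from Q (L i) (\<lambda>t f. f t) i"
begin

lemma space_L [simp]: "space (L i) = {f. step_path f}"
  using sets_eq_imp_space_eq[OF sets_L] by simp

sublocale L: prob_space "L i" for i
  using markov_L by (simp add: markov_chain_from_def)

lemma step_paths_sets [simp]: "{f. step_path f} \<in> sets (L i)"
  using sets.top[of "L i"] by simp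

lemma prob_step_paths [simp]: "measure (L i) {f. step_path f} = 1"
  using L.prob_space[of i] by simp

definition trans :: "real \<Rightarrow> 's \<Rightarrow> 's \<Rightarrow> real" where
  "trans t i j = matrix_exp (t *\<^sub>R Q) $ i $ j"

lemma measurable_L: "f \<in> path_space \<rightarrow>\<^sub>M N \<Longrightarrow> f \<in> L i \<rightarrow>\<^sub>M N"
  using measurable_cong_sets[OF sets_L refl] by blast

lemma AE_start: "AE f in L i. f 0 = i"
  using markov_L by (simp add: markov_chain_from_def)

lemma finite_dimensional:
  assumes "0 \<le> t 0" "\<And>m. m \<le> n \<Longrightarrow> t m \<le> t (Suc m)"
  shows "measure (L i) {f. step_path f \<and> (\<forall>m\<le>Suc n. f (t m) = k m)} =
    measure (L i) {f. step_path f \<and> (\<forall>m\<le>n. f (t m) = k m)} * trans (t (Suc n) - t n) (k n) (k (Suc n))"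
  using markov_L[of i] assms unfolding markov_chain_from_def trans_def by simp

text \<open>The Markov clause of the definition speaks of monotone sequences of times; listing
  \<open>J\<close> in increasing order and appending \<open>s\<close> turns it into a statement on
  finite sets of times.\<close>

lemma cyl_insert:
  assumes J: "finite J" "J \<noteq> {}" "J \<subseteq> {0..}" and s: "\<And>u. u \<in> J \<Longrightarrow> u \<le> s"
  shows "measure (L i) (cyl (insert s J) x) = measure (L i) (cyl J x) * trans (s - Max J) (x (Max J)) (x s)"
proof -
  define xs where "xs = sorted_list_of_set J"
  have xs: "set xs = J" "sorted xs" "xs \<noteq> []" using J by (auto simp: xs_def)
  define n where "n = length xs - 1"
  have len: "length xs = Suc n" using xs(3) by (simp add: n_def)
  define t where "t m = (if m \<le> n then xs ! m else s)" for m
  have tJ: "t m \<in> J" if "m \<le> n" for m using that len xs(1) by (auto simp: t_def)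
  have surj: "\<exists>m\<le>n. u = t m" if "u \<in> J" for u
    using that xs(1) len by (auto simp: t_def in_set_conv_nth less_Suc_eq_le)
  have t0: "0 \<le> t 0" using tJ[of 0] J by auto
  have mono: "t m \<le> t (Suc m)" if "m \<le> n" for m
    using that len sorted_nth_mono[OF xs(2), of m "Suc m"] s[OF tJ[OF that]] by (auto simp: t_def)
  have "t m \<le> t n" if "m \<le> n" for m using that len sorted_nth_mono[OF xs(2), of m n] by (simp add: t_def)
  then have max: "Max J = t n" using J tJ[of n] surj by (intro Max_eqI) auto
  have 1: "{f. step_path f \<and> (\<forall>m\<le>n. f (t m) = x (t m))} = cyl J x"
    unfolding cyl_def using tJ surj by (intro Collect_cong conj_cong refl) metis
  have ts: "t (Suc n) = s" by (simp add: t_def)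
  have 2: "{f. step_path f \<and> (\<forall>m\<le>Suc n. f (t m) = x (t m))} = cyl (insert s J) x"
  proof -
    have "(\<forall>m\<le>Suc n. f (t m) = x (t m)) \<longleftrightarrow> f s = x s \<and> (\<forall>m\<le>n. f (t m) = x (t m))" for f
      using ts by (auto simp: le_Suc_eq)
    then show ?thesis using 1 unfolding cyl_def by (auto simp: set_eq_iff)
  qed
  show ?thesis using finite_dimensional[of t n i "\<lambda>m. x (t m)", OF t0 mono] unfolding 1 2 max ts by simp
qed

lemma measure_cyl_start: "measure (L i) (cyl {0} y) = of_bool (i = y 0)"
proof -
  have "cyl {0} y \<in> sets (L i)" unfolding sets_L by (rule cyl_sets) auto
  have "AE f in L i. f \<in> cyl {0} y \<longleftrightarrow> i = y 0" using AE_start[of i] AE_space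
    by eventually_elim (auto simp: cyl_def)
  then have "measure (L i) (cyl {0} y) = measure (L i) {f\<in>space (L i). i = y 0}"
    using \<open>cyl {0} y \<in> sets (L i)\<close> by (intro L.finite_measure_eq_AE sets.sets_Collect_const) auto
  then show ?thesis using L.prob_space[of i] by (cases "i = y 0") simp_all
qed

lemma measure_coordinate:
  assumes "0 \<le> s"
  shows "measure (L i) {f. step_path f \<and> f s = l} = trans s i l"
proof -
  define t where "t m = (if m = 0 then 0 else s)" for m :: nat
  define k where "k m = (if m = 0 then i else l)" for m :: nat
  have "measure (L i) {f. step_path f \<and> (\<forall>m\<le>Suc 0. f (t m) = k m)} =
    measure (L i) {f. step_path f \<and> (\<forall>m\<le>0. f (t m) = k m)} * trans (t (Suc 0) - t 0) (k 0) (k (Suc 0))"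
    using assms by (intro finite_dimensional) (auto simp: t_def)
  moreover have "measure (L i) {f. step_path f \<and> (\<forall>m\<le>0. f (t m) = k m)} = 1"
    using measure_cyl_start[of i "\<lambda>_. i"] by (simp add: t_def k_def cyl_def)
  moreover have "measure (L i) {f. step_path f \<and> (\<forall>m\<le>Suc 0. f (t m) = k m)} = measure (L i) {f. step_path f \<and> f s = l}"
  proof (rule L.finite_measure_eq_AE)
    show "AE f in L i. (f \<in> {f. step_path f \<and> (\<forall>m\<le>Suc 0. f (t m) = k m)}) = (f \<in> {f. step_path f \<and> f s = l})"
      using AE_start[of i] by eventually_elim (auto simp: t_def k_def le_Suc_eq)
    have "{f. step_path f \<and> (\<forall>m\<le>Suc 0. f (t m) = k m)} = cyl {0} (\<lambda>_. i) \<inter> cyl {s} (\<lambda>_. l)"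
      by (auto simp: cyl_def t_def k_def le_Suc_eq)
    then show "{f. step_path f \<and> (\<forall>m\<le>Suc 0. f (t m) = k m)} \<in> sets (L i)"
      using assms by (simp add: sets_L cyl_sets sets.Int)
    have "{f. step_path f \<and> f s = l} = cyl {s} (\<lambda>_. l)" by (auto simp: cyl_def)
    then show "{f. step_path f \<and> f s = l} \<in> sets (L i)" using assms by (simp add: sets_L cyl_sets)
  qed
  ultimately show ?thesis by (simp add: t_def k_def)
qed

text \<open>The event is one cylinder with times \<open>J\<close> and \<open>t + J'\<close>.
  Removing the times of the future from the largest one downwards splits off the same transition
  probabilities under \<open>L i\<close> as under \<open>L (x t)\<close>.\<close>

lemma markov_cylinders:
  assumes J: "finite J" "J \<subseteq> {0..t}" "t \<in> J" and J': "finite J'" "J' \<subseteq> {0..}"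
  shows "measure (L i) {f\<in>cyl J x. shift t f \<in> cyl J' y} = measure (L i) (cyl J x) * measure (L (x t)) (cyl J' y)"
  using J'
proof (induction J' rule: finite_linorder_max_induct)
  case empty
  have "{f\<in>cyl J x. shift t f \<in> cyl {} y} = cyl J x"
    using J by (auto simp: cyl_def intro!: step_path_shift)
  moreover have "cyl {} y = space (L (x t))" by (simp add: cyl_def)
  ultimately show ?case using L.prob_space by simp
next
  case (insert s J')
  have t0: "0 \<le> t" using J by auto
  have s0: "0 \<le> s" using insert by auto
  show ?case
  \<comment> \<open>The instant \<open>t\<close> belongs to the past and, if \<open>0\<close> is
    among the times of \<open>J'\<close>, also to the future. If the two prescribe different phases
    there, both sides vanish.\<close>
  proof (cases "(0 \<in> insert s J') \<and> x t \<noteq> y 0")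
    case True
    have e1: "{f\<in>cyl J x. shift t f \<in> cyl (insert s J') y} = {}"
      using True J by (force simp: cyl_def shift_def)
    have e2: "measure (L (x t)) (cyl (insert s J') y) \<le> measure (L (x t)) (cyl {0} y)"
    proof (rule L.finite_measure_mono)
      show "cyl (insert s J') y \<subseteq> cyl {0} y" using True by (auto simp: cyl_def)
    qed (simp add: sets_L cyl_sets)
    have "measure (L (x t)) (cyl (insert s J') y) = 0"
      using e2 True measure_cyl_start[of "x t" y] by (simp add: measure_le_0_iff)
    then show ?thesis unfolding e1 by simp
  next
    case False
    \<comment> \<open>The concatenated pattern: \<open>x\<close> up to and including
      \<open>t\<close>, then \<open>y\<close> shifted by \<open>t\<close>.\<close>
    define z where "z u = (if u \<le> t then x u else y (u - t))" for u
    have z: "{f\<in>cyl J x. shift t f \<in> cyl K y} = cyl (J \<union> (+) t ` K) z" if "K \<subseteq> insert s J'" for K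
    proof -
      have zJ: "z u = x u" if "u \<in> J" for u using that J by (auto simp: z_def)
      have zK: "z (t + u) = y u" if "u \<in> K" for u
      proof -
        have "0 \<le> u" using that \<open>K \<subseteq> _\<close> insert by auto
        moreover have "u = 0 \<Longrightarrow> x t = y 0" using that \<open>K \<subseteq> _\<close> False by auto
        ultimately show ?thesis by (auto simp: z_def)
      qed
      show ?thesis by (auto simp: cyl_def zJ zK shift_apply step_path_shift[OF _ t0])
    qed
    have zt: "z t = x t" by (simp add: z_def)
    have cJ: "cyl J z = cyl J x" using J by (auto simp: cyl_def z_def)
    show ?thesis
    proof (cases "J' = {}")
      case True
      show ?thesis
      proof (cases "s = 0")
        case s: True
        then have "{f\<in>cyl J x. shift t f \<in> cyl (insert s J') y} = cyl J x"
          using z[of "insert s J'"] True cJ J by (simp add: insert_absorb)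
        then show ?thesis using s True False measure_cyl_start[of "x t" y] by simp
      next
        case s: False
        have "Max J = t" using J by (intro Max_eqI) auto
        moreover have "measure (L i) (cyl (insert (t + s) J) z) = measure (L i) (cyl J z) * trans (t + s - Max J) (z (Max J)) (z (t + s))"
          using J s0 by (intro cyl_insert) auto
        moreover have "{f\<in>cyl J x. shift t f \<in> cyl (insert s J') y} = cyl (insert (t + s) J) z"
          using z[of "insert s J'"] True by simp
        moreover have "cyl {s} y = {f. step_path f \<and> f s = y s}" by (auto simp: cyl_def)
        moreover have "z (t + s) = y s" using s s0 by (simp add: z_def)
        ultimately show ?thesis using True zt cJ measure_coordinate[OF s0] by simp
      qed
    next
      case J'0: False
      then have s: "0 < s" using insert by (metis all_not_in_conv atLeast_iff insert_subset order_le_less_trans subset_iff)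
      have max: "Max (J \<union> (+) t ` J') = t + Max J'"
      proof (rule Max_eqI)
        have "0 \<le> Max J'" using J'0 insert by (auto simp: Max_ge_iff)
        then show "y \<le> t + Max J'" if "y \<in> J \<union> (+) t ` J'" for y
          using that J insert by (auto intro: add_increasing2)
      qed (use J insert J'0 in auto)
      have 1: "measure (L i) (cyl (insert (t + s) (J \<union> (+) t ` J')) z) =
        measure (L i) (cyl (J \<union> (+) t ` J') z) * trans (t + s - Max (J \<union> (+) t ` J')) (z (Max (J \<union> (+) t ` J'))) (z (t + s))"
      proof (rule cyl_insert)
        show "u \<le> t + s" if "u \<in> J \<union> (+) t ` J'" for u using that J insert s by force
      qed (use J insert t0 in auto)
      have 2: "J \<union> (+) t ` (insert s J') = insert (t + s) (J \<union> (+) t ` J')" by auto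
      have 3: "z (t + Max J') = y (Max J')"
      proof -
        have "Max J' \<in> insert s J'" using J'0 insert by simp
        moreover have "0 \<le> Max J'" using J'0 insert by (auto simp: Max_ge_iff)
        ultimately show ?thesis using False by (auto simp: z_def)
      qed
      have 4: "z (t + s) = y s" using s by (simp add: z_def)
      have 5: "measure (L (x t)) (cyl (insert s J') y) = measure (L (x t)) (cyl J' y) * trans (s - Max J') (y (Max J')) (y s)"
        using insert J'0 by (intro cyl_insert) (auto simp: less_imp_le)
      have 6: "measure (L i) (cyl (J \<union> (+) t ` J') z) = measure (L i) (cyl J x) * measure (L (x t)) (cyl J' y)"
        using insert.IH insert.prems z[OF subset_insertI] by (simp only: insert_subset)
      have 7: "t + s - (t + Max J') = s - Max J'" by simp
      show ?thesis
        unfolding z[OF order_refl] 2 1 max 3 4 5 6 7 by (rule mult.assoc)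
    qed
  qed
qed

text \<open>From cylinders to general events in two rounds: with a cylinder as future, the past is
  extended to all events determined up to \<open>t\<close>; with the past then fixed, the future is
  extended to all measurable events.\<close>

theorem markov:
  assumes t: "0 \<le> t" and A: "A \<in> sets path_space" "determined t A" and B: "B \<in> sets path_space"
  shows "measure (L i) {f\<in>A. f t = k \<and> shift t f \<in> B} = measure (L i) {f\<in>A. f t = k} * measure (L k) B"
proof -
  let ?S = "{f. step_path f} :: (real \<Rightarrow> 's) set"
  have At: "{f\<in>A. f t = k} \<in> sets (L i)" if "A \<in> sets path_space" for A k
  proof -
    have "{f\<in>A. f t = k} = A \<inter> cyl {t} (\<lambda>_. k)" using sets.sets_into_space[OF that] by (auto simp: cyl_def)
    then show ?thesis using that t by (auto simp: sets_L intro!: sets.Int cyl_sets)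
  qed
  have shift_sets: "{f\<in>A. shift t f \<in> B} \<in> sets path_space" if "A \<in> sets path_space" "B \<in> sets path_space" for A B
  proof -
    have "{f\<in>A. shift t f \<in> B} = A \<inter> (shift t -` B \<inter> space path_space)" using sets.sets_into_space[OF that(1)] by auto
    then show ?thesis using measurable_sets[OF measurable_shift[OF t] that(2)] that(1) by (metis sets.Int)
  qed
  have cylinder: "measure (L i) {f\<in>A. f t = k \<and> shift t f \<in> cyl J' y} = measure (L i) {f\<in>A. f t = k} * measure (L k) (cyl J' y)"
    if J': "finite J'" "J' \<subseteq> {0..}" for J' y
  proof -
    let ?E = "{f\<in>cyl {t} (\<lambda>_. k). shift t f \<in> cyl J' y}" and ?F = "cyl {t} (\<lambda>_. k)"
    have id: "(\<lambda>f. f) \<in> L i \<rightarrow>\<^sub>M sigma ?S (cylinders {0..t})"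
    proof (rule measurable_sigma_sets[OF sets_sigma_cylinders cylinders_subset])
      fix C :: "(real \<Rightarrow> 's) set" assume "C \<in> cylinders {0..t}"
      then have "C \<in> sets path_space" using sets_cylinders[of "{0..t}"] by (auto intro: sigma_sets.Basic)
      moreover have "(\<lambda>f. f) -` C \<inter> space (L i) = C" using sets.sets_into_space[OF calculation] by auto
      ultimately show "(\<lambda>f. f) -` C \<inter> space (L i) \<in> sets (L i)" by (simp only: sets_L)
    qed simp
    have "measure (L i) {f\<in>?E. f \<in> A} = measure (L k) (cyl J' y) * measure (L i) {f\<in>?F. f \<in> A}"
    proof (rule measure_eq_on_generated[OF _ _ id id Int_stable_cylinders cylinders_subset])
      show "finite_measure (L i)" "finite_measure (L i)" by (rule L.finite_measure_axioms)+
      show "?E \<in> sets (L i)" "?F \<in> sets (L i)"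
        using t J' by (auto simp: sets_L intro!: shift_sets cyl_sets)
      show "A \<in> sigma_sets ?S (cylinders {0..t})" by (rule determined_sigma_sets[OF t A])
      have basic: "measure (L i) {f\<in>?E. f \<in> cyl J x} = measure (L k) (cyl J' y) * measure (L i) {f\<in>?F. f \<in> cyl J x}"
        if J: "finite J" "J \<subseteq> {0..t}" for J x
      proof (cases "t \<in> J \<and> x t \<noteq> k")
        case True
        then have "cyl {t} (\<lambda>_. k) \<inter> cyl J x = {}" by (intro cyl_Int_disjoint[of t]) auto
        then have "{f\<in>?E. f \<in> cyl J x} = {}" "{f\<in>?F. f \<in> cyl J x} = {}" by blast+
        then show ?thesis by (simp only: measure_empty mult_zero_right)
      next
        case False
        define x' where "x' = x(t := k)"
        have c: "cyl {t} (\<lambda>_. k) \<inter> cyl J x = cyl (insert t J) x'"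
        proof -
          have "(f t = k \<and> (\<forall>u\<in>J. f u = x u)) \<longleftrightarrow> (\<forall>u\<in>insert t J. f u = x' u)" for f
            unfolding x'_def using False by (metis fun_upd_apply insert_iff)
          then show ?thesis unfolding cyl_def by blast
        qed
        have "{f\<in>?E. f \<in> cyl J x} = {f\<in>cyl (insert t J) x'. shift t f \<in> cyl J' y}"
          "{f\<in>?F. f \<in> cyl J x} = cyl (insert t J) x'"
          using c by blast+
        then show ?thesis
          using markov_cylinders[of "insert t J" t J' i x' y] J J' t by (simp add: x'_def)
      qed
      show "measure (L i) {f\<in>?E. f \<in> C} = measure (L k) (cyl J' y) * measure (L i) {f\<in>?F. f \<in> C}"
        if "C \<in> cylinders {0..t}" for C
        using that basic by (auto elim!: cylindersE)
      have "{f\<in>?E. f \<in> cyl {} x} = ?E" "{f\<in>?F. f \<in> cyl {} x} = ?F" for x by (auto simp: cyl_def)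
      with basic[of "{}"] show "measure (L i) ?E = measure (L k) (cyl J' y) * measure (L i) ?F" by simp
    qed
    moreover have "{f\<in>?E. f \<in> A} = {f\<in>A. f t = k \<and> shift t f \<in> cyl J' y}" "{f\<in>?F. f \<in> A} = {f\<in>A. f t = k}"
      using sets.sets_into_space[OF A(1)] by (auto simp: cyl_def)
    ultimately show ?thesis by simp
  qed
  have "measure (L i) {f\<in>{f\<in>A. f t = k}. shift t f \<in> B} =
    measure (L i) {f\<in>A. f t = k} * measure (L k) {f\<in>space (L k). f \<in> B}"
  proof (rule measure_eq_on_generated[OF _ _ _ _ Int_stable_cylinders[where I="{0..}"] cylinders_subset])
    have sets: "sets (sigma ?S (cylinders {0..})) = sets path_space"
      by (simp add: sets_sigma_cylinders sets_path_space_cylinders)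
    show "shift t \<in> L i \<rightarrow>\<^sub>M sigma ?S (cylinders {0..})" "(\<lambda>f. f) \<in> L k \<rightarrow>\<^sub>M sigma ?S (cylinders {0..})"
      using measurable_shift[OF t] by (simp_all add: measurable_cong_sets[OF sets_L sets])
    show "B \<in> sigma_sets ?S (cylinders {0..})" using B by (simp add: sets_path_space_cylinders)
    show "measure (L i) {f\<in>{f\<in>A. f t = k}. shift t f \<in> C} =
      measure (L i) {f\<in>A. f t = k} * measure (L k) {f\<in>space (L k). f \<in> C}" if "C \<in> cylinders {0..}" for C
      using that
    proof (cases rule: cylindersE)
      case (2 J x)
      then have "{f\<in>space (L k). f \<in> C} = C" by (auto simp: cyl_def)
      then show ?thesis using cylinder[of J x] 2 by (simp add: conj_assoc)
    qed simp
  qed (use L.prob_space At[OF A(1)] in \<open>auto intro: L.finite_measure_axioms\<close>)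
  moreover have "{f\<in>space (L k). f \<in> B} = B" using sets.sets_into_space[OF B] by auto
  ultimately show ?thesis by (simp add: conj_assoc)
qed

text \<open>The random time is approximated from the right by its dyadic upper roundings, to which the
  Markov property at fixed times applies; right continuity of the paths gives the limit for
  cylinder sets.\<close>

theorem strong_markov:
  assumes T [measurable]: "T \<in> borel_measurable path_space" and T0: "\<And>f. 0 \<le> T f"
    and A [measurable]: "A \<in> sets path_space"
    and det: "\<And>u. 0 < u \<Longrightarrow> determined u {f\<in>A. T f < ereal u}"
    and B: "B \<in> sets path_space"
  shows "measure (L i) {f\<in>A. T f < \<infinity> \<and> f (real_of_ereal (T f)) = k \<and> shift (real_of_ereal (T f)) f \<in> B} =
    measure (L i) {f\<in>A. T f < \<infinity> \<and> f (real_of_ereal (T f)) = k} * measure (L k) B"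
proof -
  let ?S = "{f. step_path f} :: (real \<Rightarrow> 's) set"
  define R where "R f = real_of_ereal (T f)" for f
  have R0: "0 \<le> R f" for f using T0[of f] by (simp add: R_def real_of_ereal_pos)
  have R [measurable]: "R \<in> borel_measurable path_space" unfolding R_def by measurable
  define A' where "A' = {f\<in>A. T f < \<infinity>}"
  have A'S: "A' \<subseteq> ?S" using sets.sets_into_space[OF A] by (auto simp: A'_def)
  have A'_eq: "A' = A \<inter> {f\<in>space path_space. T f < \<infinity>}" using sets.sets_into_space[OF A] by (auto simp: A'_def)
  have A' [measurable]: "A' \<in> sets path_space" unfolding A'_eq by measurable
  define Tn :: "nat \<Rightarrow> (real \<Rightarrow> 's) \<Rightarrow> real" where "Tn n f = (of_int \<lfloor>R f * 2^n\<rfloor> + 1) / 2^n" for n f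
  have Tn0: "0 \<le> Tn n f" for n f using R0[of f] by (simp add: Tn_def)
  have Tn [measurable]: "Tn n \<in> borel_measurable path_space" for n unfolding Tn_def by measurable
  have eval: "{f\<in>A'. f (X f) = k \<and> shift (X f) f \<in> C} \<in> sets path_space" "{f\<in>A'. f (X f) = k} \<in> sets path_space"
    if X: "X \<in> borel_measurable path_space" "\<And>f. 0 \<le> X f" and C: "C \<in> sets path_space" for X C k
  proof -
    have [measurable]: "(\<lambda>f. f (X f)) \<in> path_space \<rightarrow>\<^sub>M count_space UNIV"
      "(\<lambda>f. shift (X f) f) \<in> path_space \<rightarrow>\<^sub>M path_space"
      using X by (auto intro!: measurable_eval_nonneg measurable_shift_at)
    note C [measurable]
    have "{f\<in>A'. f (X f) = k \<and> shift (X f) f \<in> C} = A' \<inter> {f\<in>space path_space. f (X f) = k \<and> shift (X f) f \<in> C}"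
      "{f\<in>A'. f (X f) = k} = A' \<inter> {f\<in>space path_space. f (X f) = k}" using A'S by auto
    moreover have "{f\<in>space path_space. f (X f) = k \<and> shift (X f) f \<in> C} \<in> sets path_space"
      "{f\<in>space path_space. f (X f) = k} \<in> sets path_space" by measurable
    ultimately show "{f\<in>A'. f (X f) = k \<and> shift (X f) f \<in> C} \<in> sets path_space" "{f\<in>A'. f (X f) = k} \<in> sets path_space"
      using A' by auto
  qed
  have grid: "measure (L i) {f\<in>A'. f (Tn n f) = k \<and> shift (Tn n f) f \<in> C} = measure (L i) {f\<in>A'. f (Tn n f) = k} * measure (L k) C"
    if C: "C \<in> sets path_space" for n C
  proof -
    \<comment> \<open>On \<open>Am m\<close> the rounded time \<open>Tn n\<close> equals
      \<open>(m + 1) / 2^n\<close>. The strict inequalities make the event determined up to exactly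
      that time, so that the Markov property applies there.\<close>
    define Am where "Am m = {f\<in>A. T f < ereal (real (Suc m) / 2^n)} - {f\<in>A. T f < ereal (real m / 2^n)}" for m :: nat
    have tr: "{f\<in>A. T f < ereal u} \<in> sets path_space" for u
    proof -
      have "{f\<in>A. T f < ereal u} = A \<inter> {f\<in>space path_space. T f < ereal u}" using sets.sets_into_space[OF A] by auto
      also have "\<dots> \<in> sets path_space" by measurable
      finally show ?thesis .
    qed
    have Am: "Am m \<in> sets path_space" for m unfolding Am_def using tr by auto
    \<comment> \<open>Needed down to \<open>u = 0\<close>, the left end of the first cell, where the
      hypothesis \<open>det\<close> is silent; there the event is empty because \<open>T\<close> is
      nonnegative.\<close>
    have mono: "determined v {f\<in>A. T f < ereal u}" if "0 \<le> u" "u \<le> v" for u v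
    proof (cases "u = 0")
      case True
      then have "{f\<in>A. T f < ereal u} = {}" using T0 by (auto simp: not_less zero_ereal_def)
      then show ?thesis by (simp only: determined_empty)
    next
      case False
      then show ?thesis using det[of u] that by (intro determined_mono[OF det]) auto
    qed
    have detm: "determined (real (Suc m) / 2^n) (Am m)" for m
      unfolding Am_def by (intro determined_Diff mono) (auto simp: divide_right_mono)
    have Am_iff: "f \<in> Am m \<longleftrightarrow> f \<in> A' \<and> \<lfloor>R f * 2^n\<rfloor> = int m" for f m
    proof (cases "T f")
      case (real r)
      then have "\<lfloor>R f * 2^n\<rfloor> = int m \<longleftrightarrow> real m / 2^n \<le> r \<and> r < real (Suc m) / 2^n"
        by (auto simp: R_def floor_eq_iff field_simps)
      then show ?thesis using real by (auto simp: Am_def A'_def)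
    qed (use T0[of f] in \<open>auto simp: Am_def A'_def\<close>)
    have Tnm: "Tn n f = real (Suc m) / 2^n" if "f \<in> Am m" for f m
      using that by (auto simp: Am_iff Tn_def)
    have cover: "A' = (\<Union>m. Am m)"
    proof (intro set_eqI iffI)
      fix f assume "f \<in> A'"
      then have "f \<in> Am (nat \<lfloor>R f * 2^n\<rfloor>)" using R0[of f] by (simp add: Am_iff)
      then show "f \<in> (\<Union>m. Am m)" by auto
    qed (auto simp: Am_iff)
    have disj: "disjoint_family Am" by (auto simp: disjoint_family_on_def Am_iff)
    let ?t = "\<lambda>m. real (Suc m) / 2^n"
    have Et: "{f\<in>Am m. f (?t m) = k \<and> shift (?t m) f \<in> C} \<in> sets (L i)" "{f\<in>Am m. f (?t m) = k} \<in> sets (L i)" for m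
    proof -
      have [measurable]: "(\<lambda>f. f (?t m)) \<in> path_space \<rightarrow>\<^sub>M count_space UNIV" "shift (?t m) \<in> path_space \<rightarrow>\<^sub>M path_space"
        by (auto intro!: measurable_coordinate measurable_shift)
      note C [measurable] Am [measurable]
      have "{f\<in>Am m. f (?t m) = k \<and> shift (?t m) f \<in> C} = Am m \<inter> {f\<in>space path_space. f (?t m) = k \<and> shift (?t m) f \<in> C}"
        "{f\<in>Am m. f (?t m) = k} = Am m \<inter> {f\<in>space path_space. f (?t m) = k}"
        using sets.sets_into_space[OF Am] by auto
      moreover have "Am m \<inter> {f\<in>space path_space. f (?t m) = k \<and> shift (?t m) f \<in> C} \<in> sets path_space"
        "Am m \<inter> {f\<in>space path_space. f (?t m) = k} \<in> sets path_space" by measurable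
      ultimately show "{f\<in>Am m. f (?t m) = k \<and> shift (?t m) f \<in> C} \<in> sets (L i)" "{f\<in>Am m. f (?t m) = k} \<in> sets (L i)"
        by (simp_all add: sets_L)
    qed
    have "(\<lambda>m. measure (L i) {f\<in>Am m. f (?t m) = k \<and> shift (?t m) f \<in> C}) sums
      measure (L i) (\<Union>m. {f\<in>Am m. f (?t m) = k \<and> shift (?t m) f \<in> C})"
      using disj Et by (intro L.finite_measure_UNION) (auto simp: disjoint_family_on_def)
    moreover have "(\<Union>m. {f\<in>Am m. f (?t m) = k \<and> shift (?t m) f \<in> C}) = {f\<in>A'. f (Tn n f) = k \<and> shift (Tn n f) f \<in> C}"
      unfolding cover using Tnm by auto
    moreover have "(\<lambda>m. measure (L i) {f\<in>Am m. f (?t m) = k} * measure (L k) C) sums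
      (measure (L i) (\<Union>m. {f\<in>Am m. f (?t m) = k}) * measure (L k) C)"
      using disj Et by (intro sums_mult2 L.finite_measure_UNION) (auto simp: disjoint_family_on_def)
    moreover have "(\<Union>m. {f\<in>Am m. f (?t m) = k}) = {f\<in>A'. f (Tn n f) = k}"
      unfolding cover using Tnm by auto
    moreover have "measure (L i) {f\<in>Am m. f (?t m) = k \<and> shift (?t m) f \<in> C} = measure (L i) {f\<in>Am m. f (?t m) = k} * measure (L k) C" for m
      by (rule markov) (use Am detm C in auto)
    ultimately show ?thesis by (simp add: sums_iff)
  qed
  have cylinder: "measure (L i) {f\<in>A'. f (R f) = k \<and> shift (R f) f \<in> cyl J x} = measure (L i) {f\<in>A'. f (R f) = k} * measure (L k) (cyl J x)"
    if J: "finite J" "J \<subseteq> {0..}" for J x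
  proof -
    note C = cyl_sets[OF J, of x]
    have conv: "eventually (\<lambda>n. f (Tn n f + u) = f (R f + u)) sequentially" if "step_path f" "0 \<le> u" for f u
    proof -
      have "eventually (\<lambda>n. shift u f ((of_int \<lfloor>R f * 2^n\<rfloor> + 1) / 2^n) = shift u f (R f)) sequentially"
        using that R0 by (intro path_grid_eventually step_path_shift)
      then show ?thesis by (simp add: shift_def Tn_def add.commute)
    qed
    have ev1: "eventually (\<lambda>n. f (Tn n f) = f (R f)) sequentially" if "step_path f" for f
      using conv[OF that, of 0] by simp
    have ev2: "eventually (\<lambda>n. shift (Tn n f) f \<in> cyl J x \<longleftrightarrow> shift (R f) f \<in> cyl J x) sequentially" if f: "step_path f" for f
    proof -
      have "eventually (\<lambda>n. \<forall>u\<in>J. f (Tn n f + u) = f (R f + u)) sequentially"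
        using J by (intro eventually_ball_finite) (auto intro!: conv[OF f])
      then show ?thesis
        by eventually_elim (use f Tn0 R0 in \<open>simp add: cyl_def shift_apply step_path_shift\<close>)
    qed
    have "(\<lambda>n. measure (L i) {f\<in>A'. f (Tn n f) = k \<and> shift (Tn n f) f \<in> cyl J x}) \<longlonglongrightarrow>
      measure (L i) {f\<in>A'. f (R f) = k \<and> shift (R f) f \<in> cyl J x}"
    proof (rule L.measure_tendsto)
      fix f assume "f \<in> space (L i)"
      then have f: "step_path f" by simp
      show "eventually (\<lambda>n. f \<in> {f\<in>A'. f (Tn n f) = k \<and> shift (Tn n f) f \<in> cyl J x} \<longleftrightarrow>
        f \<in> {f\<in>A'. f (R f) = k \<and> shift (R f) f \<in> cyl J x}) sequentially"
        using ev1[OF f] ev2[OF f] by eventually_elim simp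
    qed (use eval[OF Tn Tn0 C] eval[OF R R0 C] in \<open>auto simp: sets_L\<close>)
    moreover have "(\<lambda>n. measure (L i) {f\<in>A'. f (Tn n f) = k} * measure (L k) (cyl J x)) \<longlonglongrightarrow>
      measure (L i) {f\<in>A'. f (R f) = k} * measure (L k) (cyl J x)"
    proof (intro tendsto_mult_right L.measure_tendsto)
      fix f assume "f \<in> space (L i)"
      then have f: "step_path f" by simp
      show "eventually (\<lambda>n. f \<in> {f\<in>A'. f (Tn n f) = k} \<longleftrightarrow> f \<in> {f\<in>A'. f (R f) = k}) sequentially"
        using ev1[OF f] by eventually_elim simp
    qed (use eval[OF Tn Tn0 C] eval[OF R R0 C] in \<open>auto simp: sets_L\<close>)
    ultimately show ?thesis by (simp add: grid[OF C] LIMSEQ_unique)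
  qed
  have "measure (L i) {f\<in>{f\<in>A'. f (R f) = k}. shift (R f) f \<in> B} =
    measure (L i) {f\<in>A'. f (R f) = k} * measure (L k) {f\<in>space (L k). f \<in> B}"
  proof (rule measure_eq_on_generated[OF _ _ _ _ Int_stable_cylinders[where I="{0..}"] cylinders_subset])
    have sets: "sets (sigma ?S (cylinders {0..})) = sets path_space"
      by (simp add: sets_sigma_cylinders sets_path_space_cylinders)
    show "(\<lambda>f. shift (R f) f) \<in> L i \<rightarrow>\<^sub>M sigma ?S (cylinders {0..})" "(\<lambda>f. f) \<in> L k \<rightarrow>\<^sub>M sigma ?S (cylinders {0..})"
      using R R0 by (simp_all add: measurable_cong_sets[OF sets_L sets] measurable_shift_at)
    show "B \<in> sigma_sets ?S (cylinders {0..})" using B by (simp add: sets_path_space_cylinders)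
    show "measure (L i) {f\<in>{f\<in>A'. f (R f) = k}. shift (R f) f \<in> C} =
      measure (L i) {f\<in>A'. f (R f) = k} * measure (L k) {f\<in>space (L k). f \<in> C}" if "C \<in> cylinders {0..}" for C
      using that
    proof (cases rule: cylindersE)
      case (2 J x)
      then have "{f\<in>space (L k). f \<in> C} = C" by (auto simp: cyl_def)
      then show ?thesis using cylinder[of J x] 2 by (simp add: conj_assoc)
    qed simp
    show "{f\<in>A'. f (R f) = k} \<in> sets (L i)" using eval(2)[OF R R0 B] by (simp add: sets_L)
  qed (use L.prob_space in \<open>auto intro: L.finite_measure_axioms\<close>)
  moreover have "{f\<in>space (L k). f \<in> B} = B" using sets.sets_into_space[OF B] by auto
  ultimately show ?thesis by (simp add: conj_assoc A'_def R_def)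
qed

end


section \<open>Small-time behaviour\<close>

lemma matrix_power_entry_bound:
  fixes M :: "real^'n^'n"
  assumes "\<And>i j. \<bar>M $ i $ j\<bar> \<le> q"
  shows "\<bar>((**) M ^^ k) (mat 1) $ i $ j\<bar> \<le> (real CARD('n) * q) ^ k"
proof (induction k arbitrary: i j)
  case 0
  show ?case by (simp add: mat_def)
next
  case (Suc k)
  have q: "0 \<le> q" using assms[of undefined undefined] by (meson abs_ge_zero order_trans)
  have "\<bar>((**) M ^^ Suc k) (mat 1) $ i $ j\<bar> \<le> (\<Sum>l\<in>UNIV. \<bar>M $ i $ l * ((**) M ^^ k) (mat 1) $ l $ j\<bar>)"
    by (simp add: matrix_matrix_mult_def sum_abs)
  also have "\<dots> \<le> (\<Sum>l\<in>(UNIV::'n set). q * (real CARD('n) * q) ^ k)"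
    using Suc assms q by (intro sum_mono) (auto simp: abs_mult intro!: mult_mono)
  finally show ?case by (simp add: mult.assoc)
qed

lemma matrix_exp_entry:
  fixes M :: "real^'n^'n"
  assumes q: "\<And>i j. \<bar>M $ i $ j\<bar> \<le> q"
  shows "summable (\<lambda>k. ((**) M ^^ k) (mat 1) $ i $ j / fact k)"
    and "matrix_exp M $ i $ j = (\<Sum>k. ((**) M ^^ k) (mat 1) $ i $ j / fact k)"
proof -
  have s: "summable (\<lambda>k. ((**) M ^^ k) (mat 1) $ i $ j / fact k)" for i j
  proof (rule summable_comparison_test')
    show "summable (\<lambda>k. inverse (fact k) * (real CARD('n) * q) ^ k)" by (rule summable_exp)
    show "norm (((**) M ^^ k) (mat 1) $ i $ j / fact k) \<le> inverse (fact k) * (real CARD('n) * q) ^ k" for k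
      using matrix_power_entry_bound[OF q, of k i j] by (simp add: field_simps)
  qed
  have "(\<lambda>k. (1 / fact k) *\<^sub>R (((**) M ^^ k) (mat 1))) sums (\<chi> i j. \<Sum>k. ((**) M ^^ k) (mat 1) $ i $ j / fact k)"
    unfolding sums_def
  proof (intro vec_tendstoI)
    fix i j
    have "(\<lambda>n. \<Sum>k<n. ((**) M ^^ k) (mat 1) $ i $ j / fact k) \<longlonglongrightarrow> (\<Sum>k. ((**) M ^^ k) (mat 1) $ i $ j / fact k)"
      using s by (rule summable_LIMSEQ)
    then show "(\<lambda>n. (\<Sum>k<n. (1 / fact k) *\<^sub>R ((**) M ^^ k) (mat 1)) $ i $ j) \<longlonglongrightarrow>
      (\<chi> i j. \<Sum>k. ((**) M ^^ k) (mat 1) $ i $ j / fact k) $ i $ j" by simp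
  qed
  then have "matrix_exp M = (\<chi> i j. \<Sum>k. ((**) M ^^ k) (mat 1) $ i $ j / fact k)"
    unfolding matrix_exp_def by (rule sums_unique[symmetric])
  then show "matrix_exp M $ i $ j = (\<Sum>k. ((**) M ^^ k) (mat 1) $ i $ j / fact k)" by simp
  show "summable (\<lambda>k. ((**) M ^^ k) (mat 1) $ i $ j / fact k)" by (rule s)
qed

text \<open>The remainder is the series from \<open>k = 2\<close> on, where
  \<open>t^k \<le> t^2\<close> for \<open>t \<le> 1\<close>; \<open>C\<close> is that tail for the
  scalar exponential series of \<open>CARD('n) * norm Q\<close>. This is the only analytic property
  of the matrix exponential that is used later.\<close>

lemma matrix_exp_expansion:
  fixes Q :: "real^'n^'n"
  shows "\<exists>C\<ge>0. \<forall>t i j. 0 \<le> t \<longrightarrow> t \<le> 1 \<longrightarrow>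
    \<bar>matrix_exp (t *\<^sub>R Q) $ i $ j - of_bool (i = j) - t * Q $ i $ j\<bar> \<le> C * t\<^sup>2"
proof -
  define r where "r = real CARD('n) * norm Q"
  have r: "0 \<le> r" by (simp add: r_def)
  define a where "a k = inverse (fact k) * r ^ k" for k
  have sa: "summable a" unfolding a_def by (rule summable_exp)
  have sa2: "summable (\<lambda>k. a (k + 2))" using sa by (rule summable_ignore_initial_segment)
  define C where "C = (\<Sum>k. a (k + 2))"
  have "0 \<le> C" unfolding C_def using sa2 r by (intro suminf_nonneg) (auto simp: a_def)
  moreover have "\<bar>matrix_exp (t *\<^sub>R Q) $ i $ j - of_bool (i = j) - t * Q $ i $ j\<bar> \<le> C * t\<^sup>2"
    if t: "0 \<le> t" "t \<le> 1" for t i j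
  proof -
    define b where "b k = ((**) (t *\<^sub>R Q) ^^ k) (mat 1) $ i $ j / fact k" for k
    have q: "\<bar>(t *\<^sub>R Q) $ i $ j\<bar> \<le> t * norm Q" for i j
      using t component_le_norm_cart[of "Q $ i" j] Finite_Cartesian_Product.norm_nth_le[of Q i]
      by (auto simp: abs_mult intro!: mult_left_mono)
    have b_le: "\<bar>b k\<bar> \<le> t ^ k * a k" for k
      using matrix_power_entry_bound[OF q, of k i j]
      by (simp add: b_def a_def r_def power_mult_distrib field_simps)
    have "b 0 = of_bool (i = j)" by (simp add: b_def mat_def)
    moreover have "b 1 = t * Q $ i $ j" by (simp add: b_def)
    moreover have "suminf b = (\<Sum>k. b (k + 2)) + (\<Sum>k<2. b k)"
      using matrix_exp_entry(1)[OF q, of i j] unfolding b_def by (rule suminf_split_initial_segment)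
    moreover have "matrix_exp (t *\<^sub>R Q) $ i $ j = suminf b"
      using matrix_exp_entry(2)[OF q, of i j] unfolding b_def .
    ultimately have eq: "matrix_exp (t *\<^sub>R Q) $ i $ j - of_bool (i = j) - t * Q $ i $ j = (\<Sum>k. b (k + 2))"
      by (simp add: numeral_2_eq_2)
    have "norm (\<Sum>k. b (k + 2)) \<le> (\<Sum>k. a (k + 2) * t\<^sup>2)"
    proof (rule norm_suminf_le)
      show "summable (\<lambda>k. a (k + 2) * t\<^sup>2)" using sa2 by (rule summable_mult2)
      show "norm (b (k + 2)) \<le> a (k + 2) * t\<^sup>2" for k
      proof -
        have "\<bar>b (k + 2)\<bar> \<le> t ^ (k + 2) * a (k + 2)" by (rule b_le)
        also have "\<dots> \<le> t\<^sup>2 * a (k + 2)"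
          using t r by (intro mult_right_mono power_decreasing) (auto simp: a_def)
        finally show ?thesis by (simp add: mult.commute)
      qed
    qed
    also have "\<dots> = C * t\<^sup>2" unfolding C_def using sa2 by (rule suminf_mult2[symmetric])
    finally show ?thesis unfolding eq by simp
  qed
  ultimately show ?thesis by blast
qed

section \<open>Sojourn in the initial phase\<close>

lemma path_setI:
  "Measurable.pred path_space P \<Longrightarrow> {f. step_path f \<and> P f} \<in> sets (path_space :: (real \<Rightarrow> 's::finite) measure)"
  by (simp add: pred_def)

text \<open>The sojourn includes both ends of \<open>[0, u]\<close>. The exponential law of the
  holding time is never computed: a linear bound (\<open>stay_prob\<close>), multiplicativity
  (\<open>stay_add\<close>) and positivity (\<open>stay_pos\<close>) replace it.\<close>

definition stay :: "'s \<Rightarrow> real \<Rightarrow> (real \<Rightarrow> 's) set" where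
  "stay k u = {f. step_path f \<and> (\<forall>s. 0 \<le> s \<and> s \<le> u \<longrightarrow> f s = k)}"

definition grid :: "'s \<Rightarrow> real \<Rightarrow> nat \<Rightarrow> (real \<Rightarrow> 's) set" where
  "grid k u n = cyl ((\<lambda>m. real m * u / 2^n) ` {..2^n}) (\<lambda>_. k)"

lemma grid_iff: "f \<in> grid k u n \<longleftrightarrow> step_path f \<and> (\<forall>m\<le>2^n. f (real m * u / 2^n) = k)"
  by (auto simp: grid_def cyl_def)

lemma grid_sets: "0 \<le> u \<Longrightarrow> grid k u n \<in> sets (path_space :: (real \<Rightarrow> 's::finite) measure)"
  unfolding grid_def by (rule cyl_sets) auto

lemma stay_subset_grid: "0 \<le> u \<Longrightarrow> stay k u \<subseteq> grid k u n"
proof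
  fix f assume u: "0 \<le> u" and f: "f \<in> stay k u"
  have "f (real m * u / 2^n) = k" if m: "m \<le> 2^n" for m
  proof -
    have "real m \<le> 2^n" using of_nat_mono[OF m, where 'a=real] by simp
    then have "real m * u \<le> 2^n * u" using u by (rule mult_right_mono)
    then have "real m * u / 2^n \<le> u" by (simp add: divide_le_eq mult.commute)
    moreover have "0 \<le> real m * u / 2^n" using u by simp
    ultimately show ?thesis using f by (simp add: stay_def)
  qed
  then show "f \<in> grid k u n" using f by (simp add: grid_iff stay_def)
qed

text \<open>A path that is outside \<open>k\<close> at \<open>s\<close> remains so on some
  \<open>[s, s + e)\<close>, and this interval meets every grid of mesh less than \<open>e\<close>
  from some stage on.\<close>

lemma grid_eventually:
  assumes u: "0 \<le> u" and f: "step_path f" and nf: "f \<notin> stay k u"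
  shows "eventually (\<lambda>n. f \<notin> grid k u n) sequentially"
proof -
  obtain s where s: "0 \<le> s" "s \<le> u" "f s \<noteq> k" using f nf by (auto simp: stay_def)
  obtain e l where e: "0 < e" "f s = l" "\<forall>v. s \<le> v \<and> v < s + e \<longrightarrow> f v = l"
    by (rule step_pathE[OF f s(1)])
  show ?thesis
  proof (cases "u = 0")
    case True
    then have "f 0 \<noteq> k" using s by simp
    then have "f \<notin> grid k u n" for n using True unfolding grid_iff by (auto intro!: exI[of _ 0])
    then show ?thesis by simp
  next
    case False
    then have u0: "0 < u" using u by simp
    have "(\<lambda>n. u * (1/2::real)^n) \<longlonglongrightarrow> u * 0" by (intro tendsto_intros LIMSEQ_realpow_zero) auto
    then have "eventually (\<lambda>n. u * (1/2::real)^n < e) sequentially"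
      using e(1) by (auto dest: order_tendstoD)
    then show ?thesis
    proof eventually_elim
      case (elim n)
      \<comment> \<open>The index of the first grid point at or after \<open>s\<close>.\<close>
      define m where "m = nat \<lceil>s * 2^n / u\<rceil>"
      have m: "s * 2^n / u \<le> real m" "real m < s * 2^n / u + 1"
      proof -
        have "0 \<le> s * 2^n / u" using s(1) u0 by simp
        then have "real m = of_int \<lceil>s * 2^n / u\<rceil>" unfolding m_def by simp
        then show "s * 2^n / u \<le> real m" "real m < s * 2^n / u + 1" by linarith+
      qed
      have "s * 2^n / u \<le> 2^n" using s(2) u0 by (simp add: divide_le_eq)
      then have "real m < real (2^n + 1)" using m(2) by simp
      then have m2: "m \<le> 2^n" by (simp only: of_nat_less_iff)
      have "s \<le> real m * u / 2^n" using m(1) u0 by (simp add: field_simps)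
      moreover have "real m * u / 2^n < s + e"
      proof -
        have "real m * u < s * 2^n + u" using m(2) u0 by (simp add: field_simps)
        then have "real m * u / 2^n < s + u / 2^n" by (simp add: field_simps)
        then show ?thesis using elim by (simp add: power_one_over)
      qed
      ultimately have "f (real m * u / 2^n) \<noteq> k" using e s(3) by metis
      then show ?case using m2 by (auto simp: grid_iff)
    qed
  qed
qed

lemma stay_sets:
  assumes "0 \<le> u"
  shows "stay k u \<in> sets (path_space :: (real \<Rightarrow> 's::finite) measure)"
proof -
  have "stay k u = (\<Inter>n. grid k u n)"
  proof (intro set_eqI iffI)
    fix f :: "real \<Rightarrow> 's" assume f: "f \<in> (\<Inter>n. grid k u n)"
    show "f \<in> stay k u"
    proof (rule ccontr)
      assume "f \<notin> stay k u"
      moreover have "step_path f" using f by (auto simp: grid_iff)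
      ultimately have "eventually (\<lambda>n. f \<notin> grid k u n) sequentially" by (intro grid_eventually assms)
      then show False using f by (auto dest: eventually_happens)
    qed
  qed (simp add: subsetD[OF stay_subset_grid[OF assms]])
  moreover have "(\<Inter>n. grid k u n) \<in> sets path_space"
    by (rule sets.countable_INT) (auto intro: grid_sets[OF assms])
  ultimately show ?thesis by simp
qed

lemma determined_stay: "u \<le> v \<Longrightarrow> determined v (stay k u)"
  by (auto simp: determined_def agree_def stay_def)

lemma stay_mono: "u \<le> v \<Longrightarrow> stay k v \<subseteq> stay k u"
  by (auto simp: stay_def)

lemma determined_space: "determined u {f. step_path f}"
  by (auto simp: determined_def agree_def)

section \<open>Sojourn probabilities and positivity of the transition matrix\<close>

context phase_chain
begin

lemma Q_nonneg: "i \<noteq> j \<Longrightarrow> 0 \<le> Q $ i $ j"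
  using irreducible by (simp add: irreducible_generator_def generator_def)

lemma Q_row_sum: "(\<Sum>j\<in>UNIV. Q $ i $ j) = 0"
  using irreducible by (simp add: irreducible_generator_def generator_def)

lemma trans_nonneg: "0 \<le> t \<Longrightarrow> 0 \<le> trans t i j"
  using measure_coordinate[of t i j] by (metis measure_nonneg)

lemma trans_expansion: "\<exists>C\<ge>0. \<forall>t i j. 0 \<le> t \<longrightarrow> t \<le> 1 \<longrightarrow>
    \<bar>trans t i j - of_bool (i = j) - t * Q $ i $ j\<bar> \<le> C * t\<^sup>2"
  unfolding trans_def by (rule matrix_exp_expansion)

lemma measure_shift:
  assumes t: "0 \<le> t" and A: "A \<in> sets path_space" "determined t A" "\<And>f. f \<in> A \<Longrightarrow> f t = k" and B: "B \<in> sets path_space"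
  shows "measure (L i) {f\<in>A. shift t f \<in> B} = measure (L i) A * measure (L k) B"
proof -
  have "{f\<in>A. f t = k \<and> shift t f \<in> B} = {f\<in>A. shift t f \<in> B}" "{f\<in>A. f t = k} = A" using A(3) by auto
  then show ?thesis using markov[OF t A(1,2) B, of i k] by simp
qed

lemma coordinate_sets: "0 \<le> t \<Longrightarrow> {f. step_path f \<and> f t = k} \<in> sets path_space"
proof -
  assume "0 \<le> t"
  moreover have "{f. step_path f \<and> f t = k} = cyl {t} (\<lambda>_. k)" by (auto simp: cyl_def)
  ultimately show ?thesis by (simp add: cyl_sets)
qed

lemma shift_sets: "0 \<le> t \<Longrightarrow> B \<in> sets path_space \<Longrightarrow> {f. step_path f \<and> shift t f \<in> B} \<in> sets (path_space :: (real \<Rightarrow> 's) measure)"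
  using measurable_sets[OF measurable_shift, of t B] by (simp add: vimage_def Int_def conj_commute)

lemma markov_sum:
  assumes t: "0 \<le> t" and B: "B \<in> sets path_space"
  shows "measure (L i) {f. step_path f \<and> shift t f \<in> B} = (\<Sum>k\<in>UNIV. trans t i k * measure (L k) B)"
proof -
  let ?A = "\<lambda>k. {f\<in>{f. step_path f}. f t = k \<and> shift t f \<in> B}"
  have "?A k = {f. step_path f \<and> f t = k} \<inter> {f. step_path f \<and> shift t f \<in> B}" for k by auto
  then have A: "?A k \<in> sets (L i)" for k
    using coordinate_sets[OF t, of k] shift_sets[OF t B] unfolding sets_L by auto
  have "{f. step_path f \<and> shift t f \<in> B} = (\<Union>k\<in>UNIV. ?A k)" by auto
  then have "measure (L i) {f. step_path f \<and> shift t f \<in> B} = (\<Sum>k\<in>UNIV. measure (L i) (?A k))"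
    using A by (auto simp: disjoint_family_on_def intro!: L.finite_measure_finite_Union)
  also have "\<dots> = (\<Sum>k\<in>UNIV. trans t i k * measure (L k) B)"
  proof (rule sum.cong[OF refl])
    fix k
    have "measure (L i) (?A k) = measure (L i) {f\<in>{f. step_path f}. f t = k} * measure (L k) B"
      using sets.top[of path_space] by (intro markov[OF t _ determined_space B]) simp
    then show "measure (L i) (?A k) = trans t i k * measure (L k) B" using measure_coordinate[OF t, of i k] by simp
  qed
  finally show ?thesis .
qed

lemma trans_diag_ge: "\<exists>K\<ge>0. \<forall>t k. 0 \<le> t \<longrightarrow> t \<le> 1 \<longrightarrow> 1 - K * t \<le> trans t k k"
proof -
  obtain C where C: "0 \<le> C" "\<And>t i j. 0 \<le> t \<Longrightarrow> t \<le> 1 \<Longrightarrow> \<bar>trans t i j - of_bool (i = j) - t * Q $ i $ j\<bar> \<le> C * t\<^sup>2"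
    using trans_expansion by blast
  have "1 - (norm Q + C) * t \<le> trans t k k" if t: "0 \<le> t" "t \<le> 1" for t k
  proof -
    have "\<bar>Q $ k $ k\<bar> \<le> norm Q"
      using component_le_norm_cart[of "Q $ k" k] Finite_Cartesian_Product.norm_nth_le[of Q k] by linarith
    then have "t * (- norm Q) \<le> t * Q $ k $ k" using t by (intro mult_left_mono) auto
    moreover have "C * t\<^sup>2 \<le> C * t" using t C by (intro mult_left_mono) (auto simp: power2_eq_square mult_left_le_one_le)
    ultimately show ?thesis using C(2)[OF t, of k k] by (simp add: algebra_simps abs_le_iff)
  qed
  then show ?thesis using C by (intro exI[of _ "norm Q + C"]) auto
qed

text \<open>Each step of length \<open>d\<close> out of \<open>k\<close> loses probability at most
  \<open>K * d\<close>, so the losses add up linearly. For \<open>m * d = u\<close> the bound is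
  independent of the mesh, which is what survives the limit in \<open>stay_prob\<close>.\<close>

lemma grid_prob:
  assumes K: "0 \<le> K" "\<And>t k. 0 \<le> t \<Longrightarrow> t \<le> 1 \<Longrightarrow> 1 - K * t \<le> trans t k k" and d: "0 \<le> d" "d \<le> 1"
  shows "1 - real m * (K * d) \<le> measure (L k) (cyl ((\<lambda>l. real l * d) ` {..m}) (\<lambda>_. k))"
proof (induction m)
  case 0
  show ?case using measure_cyl_start[of k "\<lambda>_. k"] by simp
next
  case (Suc m)
  let ?G = "\<lambda>m. cyl ((\<lambda>l. real l * d) ` {..m}) (\<lambda>_. k)"
  let ?B = "{f. step_path f \<and> f d = k}"
  have t: "0 \<le> real m * d" using d by simp
  have eq: "?G (Suc m) = {f\<in>?G m. shift (real m * d) f \<in> ?B}"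
  proof -
    have "(\<lambda>l. real l * d) ` {..Suc m} = insert (real m * d + d) ((\<lambda>l. real l * d) ` {..m})"
      by (simp add: atMost_Suc algebra_simps)
    then show ?thesis using step_path_shift[OF _ t] by (auto simp: cyl_def shift_apply)
  qed
  have le: "real l * d \<le> real m * d" if "l \<le> m" for l using that d by (intro mult_right_mono) auto
  have "measure (L k) (?G (Suc m)) = measure (L k) (?G m) * measure (L k) ?B"
    unfolding eq
  proof (rule measure_shift[OF t])
    show "?G m \<in> sets path_space" using d by (intro cyl_sets) auto
    show "determined (real m * d) (?G m)" using le d by (auto simp: determined_def agree_def cyl_def)
    show "?B \<in> sets path_space" using d(1) by (rule coordinate_sets)
  qed (auto simp: cyl_def)
  also have "measure (L k) ?B = trans d k k" by (rule measure_coordinate[OF d(1)])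
  finally have "measure (L k) (?G (Suc m)) = measure (L k) (?G m) * trans d k k" .
  moreover have "measure (L k) (?G m) * (1 - K * d) \<le> measure (L k) (?G m) * trans d k k"
    using K(2)[OF d, of k] by (intro mult_left_mono) auto
  moreover have "measure (L k) (?G m) * (K * d) \<le> 1 * (K * d)"
    using K d by (intro mult_right_mono) auto
  ultimately show ?case using Suc by (simp add: algebra_simps)
qed

lemma stay_prob: "\<exists>K\<ge>0. \<forall>u k. 0 \<le> u \<longrightarrow> 1 - K * u \<le> measure (L k) (stay k u)"
proof -
  obtain K where K: "0 \<le> K" "\<And>t k. 0 \<le> t \<Longrightarrow> t \<le> 1 \<Longrightarrow> 1 - K * t \<le> trans t k k"
    using trans_diag_ge by blast
  have "1 - (K + 1) * u \<le> measure (L k) (stay k u)" if u: "0 \<le> u" for u k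
  proof (cases "u \<le> 1")
    case True
    have "(\<lambda>n. measure (L k) (grid k u n)) \<longlonglongrightarrow> measure (L k) (stay k u)"
    proof (rule L.measure_tendsto)
      fix f assume "f \<in> space (L k)"
      then have f: "step_path f" by simp
      show "eventually (\<lambda>n. (f \<in> grid k u n) = (f \<in> stay k u)) sequentially"
      proof (cases "f \<in> stay k u")
        case True
        then have "f \<in> grid k u n" for n by (rule subsetD[OF stay_subset_grid[OF u]])
        then show ?thesis using True by simp
      next
        case False
        then show ?thesis using grid_eventually[OF u f] by simp
      qed
    qed (simp_all add: sets_L grid_sets[OF u] stay_sets[OF u])
    moreover have "1 - K * u \<le> measure (L k) (grid k u n)" for n
    proof -
      have d: "0 \<le> u / 2^n" "u / 2^n \<le> 1" using u True by (simp_all add: divide_le_eq order_trans[OF True])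
      have "1 - real (2^n) * (K * (u / 2^n)) \<le> measure (L k) (cyl ((\<lambda>l. real l * (u / 2^n)) ` {..2^n}) (\<lambda>_. k))"
        by (rule grid_prob[OF K d])
      then show ?thesis by (simp add: grid_def)
    qed
    ultimately have "1 - K * u \<le> measure (L k) (stay k u)"
      by (intro LIMSEQ_le_const) auto
    then show ?thesis using u by (simp add: algebra_simps)
  next
    case False
    have "1 * 1 \<le> (K + 1) * u" using K False by (intro mult_mono) auto
    then show ?thesis using measure_nonneg[of "L k" "stay k u"] by linarith
  qed
  then show ?thesis using K by (intro exI[of _ "K + 1"]) auto
qed

lemma stay_add:
  assumes "0 \<le> s" "0 \<le> t"
  shows "measure (L i) (stay k (s + t)) = measure (L i) (stay k s) * measure (L k) (stay k t)"
proof -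
  have "stay k (s + t) = {f\<in>stay k s. shift s f \<in> stay k t}"
  proof (intro set_eqI iffI)
    fix f assume f: "f \<in> stay k (s + t)"
    then show "f \<in> {f\<in>stay k s. shift s f \<in> stay k t}"
      using assms step_path_shift[OF _ assms(1)] by (auto simp: stay_def shift_apply)
  next
    fix f assume f: "f \<in> {f\<in>stay k s. shift s f \<in> stay k t}"
    have "f u = k" if "0 \<le> u" "u \<le> s + t" for u
    proof (cases "u \<le> s")
      case False
      have "shift s f (u - s) = k" using f that False by (simp add: stay_def)
      then show ?thesis by (simp add: shift_apply)
    qed (use f that in \<open>simp add: stay_def\<close>)
    then show "f \<in> stay k (s + t)" using f by (simp add: stay_def)
  qed
  moreover have "f s = k" if "f \<in> stay k s" for f using that assms by (simp add: stay_def)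
  ultimately show ?thesis
    using measure_shift[OF assms(1) stay_sets[OF assms(1)] determined_stay[OF order_refl] _ stay_sets[OF assms(2)], of k k i k]
    by simp
qed

text \<open>The linear bound is positive only for short times; multiplicativity over pieces of
  length \<open>d\<close> carries positivity to all times.\<close>

lemma stay_pos:
  assumes "0 \<le> u"
  shows "0 < measure (L k) (stay k u)"
proof -
  obtain K where K: "0 \<le> K" "\<And>u k. 0 \<le> u \<Longrightarrow> 1 - K * u \<le> measure (L k) (stay k u)"
    using stay_prob by blast
  define d where "d = 1 / (K + 1)"
  have d: "0 < d" "K * d < 1" using K(1) by (auto simp: d_def field_simps)
  have pos: "0 < measure (L k) (stay k (real n * d))" for n
  proof (induction n)
    case 0
    show ?case using K(2)[of 0 k] by simp
  next
    case (Suc n)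
    have "real (Suc n) * d = real n * d + d" by (simp add: algebra_simps)
    moreover have "0 < measure (L k) (stay k d)" using K(2)[of d k] d by simp
    ultimately show ?case using stay_add[of "real n * d" d k k] Suc d by simp
  qed
  obtain n where "u / d \<le> real n" using real_arch_simple by blast
  then have n: "u \<le> real n * d" using d(1) by (simp add: pos_divide_le_eq)
  have "measure (L k) (stay k (real n * d)) \<le> measure (L k) (stay k u)"
    using stay_mono[OF n] by (intro L.finite_measure_mono) (simp_all add: sets_L stay_sets[OF assms])
  then show ?thesis using pos[of n] by linarith
qed

lemma trans_diag_pos: "0 \<le> t \<Longrightarrow> 0 < trans t k k"
proof -
  assume t: "0 \<le> t"
  have "measure (L k) (stay k t) \<le> measure (L k) {f. step_path f \<and> f t = k}"
    using t coordinate_sets[OF t] by (intro L.finite_measure_mono) (auto simp: sets_L stay_def)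
  then show ?thesis using stay_pos[OF t, of k] measure_coordinate[OF t, of k k] by linarith
qed

lemma trans_add_ge:
  assumes "0 \<le> s" "0 \<le> t"
  shows "trans s i k * trans t k j \<le> trans (s + t) i j"
proof -
  let ?B = "{f. step_path f \<and> f t = j}"
  have B: "?B \<in> sets path_space" by (rule coordinate_sets[OF assms(2)])
  have "{f. step_path f \<and> f (s + t) = j} = {f. step_path f \<and> shift s f \<in> ?B}"
    using step_path_shift[OF _ assms(1)] by (auto simp: shift_apply)
  then have "trans (s + t) i j = (\<Sum>k\<in>UNIV. trans s i k * trans t k j)"
    using markov_sum[OF assms(1) B, of i] measure_coordinate[of "s + t" i j] measure_coordinate[OF assms(2)] assms by simp
  then show ?thesis
    using member_le_sum[of k UNIV "\<lambda>k. trans s i k * trans t k j"] trans_nonneg assms by simp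
qed

text \<open>A single edge is positive at a very short time by the expansion, and waiting in the
  target phase extends this to any time. Along a chain of edges the available time is halved at each
  edge.\<close>

lemma trans_pos:
  assumes t: "0 < t"
  shows "0 < trans t i j"
proof -
  obtain C where C: "0 \<le> C" "\<And>t i j. 0 \<le> t \<Longrightarrow> t \<le> 1 \<Longrightarrow> \<bar>trans t i j - of_bool (i = j) - t * Q $ i $ j\<bar> \<le> C * t\<^sup>2"
    using trans_expansion by blast
  have edge: "0 < trans t k l" if "k \<noteq> l" "0 < Q $ k $ l" "0 < t" for k l t
  proof -
    \<comment> \<open>Small enough for the first-order term \<open>s * Q $ k $ l\<close> to exceed
      the error \<open>C * s^2\<close>.\<close>
    define s where "s = min (min 1 t) (Q $ k $ l / (2 * (C + 1)))"
    have s: "0 < s" "s \<le> 1" "s \<le> t" "s \<le> Q $ k $ l / (2 * (C + 1))"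
      using that C(1) by (auto simp: s_def)
    have "(C + 1) * s < Q $ k $ l" 
    proof -
      have "s * (2 * (C + 1)) \<le> Q $ k $ l" using s(4) C(1) by (simp add: le_divide_eq)
      moreover have "0 < s * (C + 1)" using s C by simp
      ultimately show ?thesis by (simp add: algebra_simps)
    qed
    then have "C * s < Q $ k $ l" using s(1) by (simp add: algebra_simps)
    then have "s * (C * s) < s * Q $ k $ l" using s(1) by (rule mult_strict_left_mono)
    then have "C * s\<^sup>2 < s * Q $ k $ l" by (simp add: power2_eq_square mult.left_commute)
    then have "0 < trans s k l"
      using C(2)[of s k l] s(1,2) that(1) by (simp add: abs_le_iff)
    then have "0 < trans s k l * trans (t - s) l l" using trans_diag_pos[of "t - s" l] s by simp
    also have "\<dots> \<le> trans t k l" using trans_add_ge[of s "t - s" k l l] s by simp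
    finally show ?thesis .
  qed
  have "(i, j) \<in> {(k, l). k \<noteq> l \<and> 0 < Q $ k $ l}\<^sup>*"
    using irreducible by (simp add: irreducible_generator_def)
  then show ?thesis using t
  proof (induction arbitrary: t rule: rtrancl_induct)
    case base
    then show ?case by (simp add: trans_diag_pos)
  next
    case (step k l)
    have "0 < trans (t/2) i k * trans (t/2) k l"
      using step.IH[of "t/2"] step.hyps(2) step.prems edge[of k l "t/2"] by simp
    also have "\<dots> \<le> trans (t/2 + t/2) i l" using step.prems by (intro trans_add_ge) auto
    finally show ?case by simp
  qed
qed

end


section \<open>Decomposition of paths at passage times\<close>

lemma agree_lev: "agree u f g \<Longrightarrow> t \<le> u \<Longrightarrow> lev c f t = lev c g t"
  by (rule lev_agree) (simp add: agree_def)

lemma agree_sym: "agree u f g \<Longrightarrow> agree u g f"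
  by (simp add: agree_def)

lemma agree_path: "agree u f g \<Longrightarrow> step_path f" "agree u f g \<Longrightarrow> step_path g"
  by (simp_all add: agree_def)

lemma determinedI:
  assumes "\<And>f g. agree u f g \<Longrightarrow> f \<in> A \<Longrightarrow> g \<in> A"
  shows "determined u A"
  unfolding determined_def using assms agree_sym by blast

lemma determined_down_time_less:
  "determined u {f\<in>{f. step_path f}. down_time c x f < ereal u}"
proof (rule determinedI)
  fix f g assume fg: "agree u f g" and "f \<in> {f\<in>{f. step_path f}. down_time c x f < ereal u}"
  then obtain t where "0 \<le> t" "t < u" "lev c f t < - x" by (auto simp: down_time_less_iff)
  then show "g \<in> {f\<in>{f. step_path f}. down_time c x f < ereal u}"
    using agree_lev[OF fg, of t c] agree_path[OF fg] by (auto simp: down_time_less_iff)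
qed

text \<open>At a common passage time the phase would have both a negative and a positive
  rate.\<close>

lemma down_times_neq:
  assumes "step_path f" "0 \<le> a" "0 \<le> b" "down_time c a f < \<infinity>"
  shows "down_time c a f \<noteq> down_time (- c) b f"
proof
  assume eq: "down_time c a f = down_time (- c) b f"
  obtain T where T: "down_time c a f = ereal T" using assms(4) by (rule down_time_finiteE)
  show False using at_down_time(2)[OF T assms(2,1)] at_down_time(2)[of "- c" b f T] eq T assms by simp
qed

text \<open>Eliminates the competing passage time, which may lie in the future: a single time
  \<open>t < u\<close> just after the passage is a witness, and it concerns the path up to
  \<open>t\<close> only. This is why the escape event is determined.\<close>

lemma escape_before_iff:
  assumes f: "step_path f" and ab: "0 \<le> a" "0 \<le> b"
  shows "down_time c a f < down_time (- c) b f \<and> down_time c a f < ereal u \<longleftrightarrow>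
    (\<exists>t\<ge>0. t < u \<and> lev c f t < - a \<and> (\<forall>s. 0 \<le> s \<and> s \<le> t \<longrightarrow> - b \<le> lev (- c) f s))"
proof
  assume "down_time c a f < down_time (- c) b f \<and> down_time c a f < ereal u"
  then have "down_time c a f < min (ereal u) (down_time (- c) b f)" by simp
  then obtain y where y: "down_time c a f < y" "y < min (ereal u) (down_time (- c) b f)" using dense by blast
  have "0 \<le> y" using y(1) down_time_nonneg[of c a f] by (meson less_imp_le order_trans)
  then obtain v where v: "y = ereal v" using y(2) by (cases y) auto
  obtain t where t: "0 \<le> t" "t < v" "lev c f t < - a" using y(1) v by (auto simp: down_time_less_iff)
  have "- b \<le> lev (- c) f s" if "0 \<le> s" "s \<le> t" for s
  proof (rule level_before_down_time[OF _ that(1) ab(2) f])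
    have "ereal s \<le> ereal v" using that t by simp
    then show "ereal s \<le> down_time (- c) b f" using y(2) v by (meson min_less_iff_conj less_imp_le order_trans)
  qed
  then show "\<exists>t\<ge>0. t < u \<and> lev c f t < - a \<and> (\<forall>s. 0 \<le> s \<and> s \<le> t \<longrightarrow> - b \<le> lev (- c) f s)"
    using t v y(2) by (intro exI[of _ t]) auto
next
  assume "\<exists>t\<ge>0. t < u \<and> lev c f t < - a \<and> (\<forall>s. 0 \<le> s \<and> s \<le> t \<longrightarrow> - b \<le> lev (- c) f s)"
  then obtain t where t: "0 \<le> t" "t < u" "lev c f t < - a" "\<And>s. 0 \<le> s \<Longrightarrow> s \<le> t \<Longrightarrow> - b \<le> lev (- c) f s" by blast
  have less: "down_time c a f < ereal u" using t by (auto simp: down_time_less_iff)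
  have "\<not> ereal t < down_time c a f"
  proof
    assume "ereal t < down_time c a f"
    then have "- a \<le> lev c f t" using t(1) ab f by (intro level_before_down_time) auto
    then show False using t(3) by simp
  qed
  moreover have "\<not> down_time (- c) b f < ereal t"
  proof
    assume "down_time (- c) b f < ereal t"
    then obtain s where "0 \<le> s" "s < t" "lev (- c) f s < - b" by (auto simp: down_time_less_iff)
    then show False using t(4)[of s] by simp
  qed
  ultimately have "down_time c a f \<le> down_time (- c) b f" by (meson not_less order_trans)
  moreover have "down_time c a f \<noteq> down_time (- c) b f"
    using less by (intro down_times_neq[OF f ab]) auto
  ultimately show "down_time c a f < down_time (- c) b f \<and> down_time c a f < ereal u"
    using less by simp
qed

lemma determined_escape_less:
  assumes ab: "0 \<le> a" "0 \<le> b"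
  shows "determined u {f\<in>{f. step_path f \<and> down_time c a f < down_time (- c) b f}. down_time c a f < ereal u}"
proof (rule determinedI)
  fix f g assume fg: "agree u f g" and "f \<in> {f\<in>{f. step_path f \<and> down_time c a f < down_time (- c) b f}. down_time c a f < ereal u}"
  then obtain t where t: "0 \<le> t" "t < u" "lev c f t < - a" "\<And>s. 0 \<le> s \<Longrightarrow> s \<le> t \<Longrightarrow> - b \<le> lev (- c) f s"
    using escape_before_iff[OF agree_path(1)[OF fg] ab, of c u] by auto
  have "lev c g t < - a" using t agree_lev[OF fg, of t c] by simp
  moreover have "- b \<le> lev (- c) g s" if "0 \<le> s" "s \<le> t" for s
    using t(4)[OF that] agree_lev[OF fg, of s "- c"] t(2) that by simp
  ultimately show "g \<in> {f\<in>{f. step_path f \<and> down_time c a f < down_time (- c) b f}. down_time c a f < ereal u}"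
    using escape_before_iff[OF agree_path(2)[OF fg] ab, of c u] t(1,2) agree_path(2)[OF fg] by auto
qed

section \<open>Passage and escape events\<close>

definition down_event :: "real^'s \<Rightarrow> real \<Rightarrow> 's \<Rightarrow> (real \<Rightarrow> 's) set" where
  "down_event c x j = {f. step_path f \<and> down_time c x f < \<infinity> \<and> f (real_of_ereal (down_time c x f)) = j}"

definition escape_event :: "real^'s \<Rightarrow> real \<Rightarrow> real \<Rightarrow> 's \<Rightarrow> (real \<Rightarrow> 's) set" where
  "escape_event c a b j = {f. step_path f \<and> down_time c a f < down_time (- c) b f \<and>
     f (real_of_ereal (down_time c a f)) = j}"

lemma down_event_sets: "down_event c x j \<in> sets (path_space :: (real \<Rightarrow> 's::finite) measure)"
  unfolding down_event_def by (rule path_setI) measurable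

lemma escape_event_sets: "escape_event c a b j \<in> sets (path_space :: (real \<Rightarrow> 's::finite) measure)"
  unfolding escape_event_def by (rule path_setI) measurable

lemma escape_sets: "{f. step_path f \<and> down_time c a f < down_time d b f} \<in> sets (path_space :: (real \<Rightarrow> 's::finite) measure)"
  by (rule path_setI) measurable

lemma down_event_rate: "f \<in> down_event c x j \<Longrightarrow> 0 \<le> x \<Longrightarrow> c $ j < 0"
proof -
  assume f: "f \<in> down_event c x j" and x: "0 \<le> x"
  then have "down_time c x f < \<infinity>" by (simp add: down_event_def)
  then obtain T where "down_time c x f = ereal T" by (rule down_time_finiteE)
  with at_down_time(2)[OF this x] f show ?thesis by (auto simp: down_event_def)
qed

lemma escape_event_subset: "escape_event c a b j \<subseteq> down_event c a j"
proof
  fix f assume "f \<in> escape_event c a b j"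
  moreover have "down_time c a f < \<infinity>" if "down_time c a f < down_time (- c) b f"
    using less_le_trans[OF that, of \<infinity>] by simp
  ultimately show "f \<in> down_event c a j" by (auto simp: escape_event_def down_event_def)
qed

lemma real_of_ereal_down_time_shift:
  "down_time c z f = ereal T + down_time c' y g \<Longrightarrow> down_time c' y g < \<infinity> \<Longrightarrow>
    real_of_ereal (down_time c z f) = T + real_of_ereal (down_time c' y g)"
  by (erule down_time_finiteE) simp

lemma down_event_shift:
  assumes f: "step_path f" and T: "0 \<le> T" and b: "\<And>t. 0 \<le> t \<Longrightarrow> t \<le> T \<Longrightarrow> - z \<le> lev c f t"
    and y: "y = z + lev c f T"
  shows "f \<in> down_event c z j \<longleftrightarrow> shift T f \<in> down_event c y j"
proof -
  have eq: "down_time c z f = ereal T + down_time c y (shift T f)"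
    unfolding y by (rule down_time_shift[OF f T b])
  have fin: "down_time c z f < \<infinity> \<longleftrightarrow> down_time c y (shift T f) < \<infinity>"
    unfolding eq by (cases "down_time c y (shift T f)") auto
  show ?thesis
    using f step_path_shift[OF f T] fin real_of_ereal_down_time_shift[OF eq]
    by (auto simp: down_event_def shift_apply)
qed

lemma level_le_passage:
  assumes "down_time c x f = ereal T" "0 \<le> x" "step_path f" "0 \<le> t" "t \<le> T"
  shows "- x \<le> lev c f t"
  using assms by (intro level_before_down_time) auto

text \<open>A path that gets below \<open>- (x + y)\<close> has passed \<open>- x\<close> before,
  and by continuity the level at that passage is exactly \<open>- x\<close>, so a further drop of
  exactly \<open>y\<close> remains.\<close>

lemma down_event_add_iff:
  assumes f: "step_path f" and xy: "0 \<le> x" "0 \<le> y"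
  shows "f \<in> down_event c (x + y) j \<longleftrightarrow>
    down_time c x f < \<infinity> \<and> shift (real_of_ereal (down_time c x f)) f \<in> down_event c y j"
proof (cases "down_time c x f < \<infinity>")
  case True
  then obtain T where T: "0 \<le> T" "down_time c x f = ereal T" by (rule down_time_finiteE)
  have "- (x + y) \<le> lev c f t" if "0 \<le> t" "t \<le> T" for t
    using level_le_passage[OF T(2) xy(1) f that] xy by simp
  from down_event_shift[OF f T(1) this, of y j] at_down_time(1)[OF T(2) xy(1) f] show ?thesis
    using T by simp
next
  case False
  have "f \<notin> down_event c (x + y) j"
  proof
    assume "f \<in> down_event c (x + y) j"
    then have "down_time c (x + y) f < \<infinity>" by (simp add: down_event_def)
    then obtain t where "0 \<le> t" "lev c f t < - (x + y)" unfolding down_time_finite_iff by blast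
    then have "0 \<le> t \<and> lev c f t < - x" using xy by simp
    then have "down_time c x f < \<infinity>" unfolding down_time_finite_iff by blast
    then show False using False by simp
  qed
  then show ?thesis using False by simp
qed

text \<open>The pathwise form of one block column of the equation for \<open>E\<close>. Here
  \<open>b\<close> is the distance downwards and \<open>a\<close> the distance upwards: after
  leaving at the top the level is exactly \<open>a\<close>, and a descent by \<open>a + b\<close>
  remains.\<close>

lemma down_event_escape_iff:
  assumes f: "step_path f" and ab: "0 \<le> a" "0 \<le> b"
  shows "f \<in> down_event c b j \<longleftrightarrow> f \<in> escape_event c b a j \<or>
    (down_time (- c) a f < down_time c b f \<and> shift (real_of_ereal (down_time (- c) a f)) f \<in> down_event c (a + b) j)"
    (is "_ \<longleftrightarrow> _ \<or> (?lt \<and> ?sh)")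
proof (cases ?lt)
  case True
  then have "down_time (- c) a f < \<infinity>" using less_le_trans[OF True, of \<infinity>] by simp
  then obtain T where T: "0 \<le> T" "down_time (- c) a f = ereal T" by (rule down_time_finiteE)
  have "- b \<le> lev c f t" if "0 \<le> t" "t \<le> T" for t
  proof (rule level_before_down_time[OF _ that(1) ab(2) f])
    have "ereal t \<le> ereal T" using that by simp
    then show "ereal t \<le> down_time c b f" using True T by (metis less_imp_le order_trans)
  qed
  from down_event_shift[OF f T(1) this, of "a + b" j] at_down_time(1)[OF T(2) ab(1) f]
  have "f \<in> down_event c b j \<longleftrightarrow> ?sh" using T by (simp add: lev_minus)
  moreover have "f \<notin> escape_event c b a j" using True by (auto simp: escape_event_def)
  ultimately show ?thesis using True by simp
next
  case False
  have "f \<in> escape_event c b a j" if *: "f \<in> down_event c b j"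
  proof -
    have "down_time c b f < \<infinity>" using * by (simp add: down_event_def)
    from down_times_neq[OF f ab(2,1) this] False have "down_time c b f < down_time (- c) a f" by auto
    then show ?thesis using * by (simp add: escape_event_def down_event_def)
  qed
  then show ?thesis using False escape_event_subset[of c b a j] by auto
qed

section \<open>Passage and escape probabilities\<close>

context phase_chain
begin

lemma strong_markov_sum:
  assumes T [measurable]: "T \<in> borel_measurable path_space" and T0: "\<And>f. 0 \<le> T f"
    and A: "A \<in> sets path_space"
    and det: "\<And>u. 0 < u \<Longrightarrow> determined u {f\<in>A. T f < ereal u}"
    and B: "B \<in> sets path_space"
  shows "measure (L i) {f\<in>A. T f < \<infinity> \<and> shift (real_of_ereal (T f)) f \<in> B} =
    (\<Sum>k\<in>UNIV. measure (L i) {f\<in>A. T f < \<infinity> \<and> f (real_of_ereal (T f)) = k} * measure (L k) B)"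
proof -
  let ?E = "\<lambda>k. {f\<in>A. T f < \<infinity> \<and> f (real_of_ereal (T f)) = k \<and> shift (real_of_ereal (T f)) f \<in> B}"
  have AS: "A \<subseteq> {f. step_path f}" using sets.sets_into_space[OF A] by simp
  have R: "(\<lambda>f. real_of_ereal (T f)) \<in> borel_measurable path_space" "\<And>f. 0 \<le> real_of_ereal (T f)"
    using T0 by (auto simp: real_of_ereal_pos)
  have [measurable]: "(\<lambda>f. f (real_of_ereal (T f))) \<in> path_space \<rightarrow>\<^sub>M count_space UNIV"
    "(\<lambda>f. shift (real_of_ereal (T f)) f) \<in> path_space \<rightarrow>\<^sub>M path_space"
    using R by (auto intro!: measurable_eval_nonneg measurable_shift_at)
  have "?E k = A \<inter> {f. step_path f \<and> T f < \<infinity> \<and> f (real_of_ereal (T f)) = k \<and> shift (real_of_ereal (T f)) f \<in> B}" for k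
    using AS by auto
  moreover have "{f. step_path f \<and> T f < \<infinity> \<and> f (real_of_ereal (T f)) = k \<and> shift (real_of_ereal (T f)) f \<in> B} \<in> sets path_space" for k
  proof -
    note B [measurable]
    show ?thesis by (intro path_setI) measurable
  qed
  ultimately have E: "?E k \<in> sets (L i)" for k using A by (simp add: sets_L sets.Int)
  have "{f\<in>A. T f < \<infinity> \<and> shift (real_of_ereal (T f)) f \<in> B} = (\<Union>k\<in>UNIV. ?E k)" by auto
  then have "measure (L i) {f\<in>A. T f < \<infinity> \<and> shift (real_of_ereal (T f)) f \<in> B} = (\<Sum>k\<in>UNIV. measure (L i) (?E k))"
    using E by (auto simp: disjoint_family_on_def intro!: L.finite_measure_finite_Union)
  also have "\<dots> = (\<Sum>k\<in>UNIV. measure (L i) {f\<in>A. T f < \<infinity> \<and> f (real_of_ereal (T f)) = k} * measure (L k) B)"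
    using strong_markov[OF T T0 A det B] by (intro sum.cong refl) blast
  finally show ?thesis .
qed

definition down :: "real^'s \<Rightarrow> real \<Rightarrow> 's \<Rightarrow> 's \<Rightarrow> real" where
  "down c x i j = measure (L i) (down_event c x j)"

text \<open>The lower distance comes first. Reflection exchanges the distances as well, so
  \<open>escape (- c) b a\<close> belongs to leaving \<open>(-a, b)\<close> at the top.\<close>

definition escape :: "real^'s \<Rightarrow> real \<Rightarrow> real \<Rightarrow> 's \<Rightarrow> 's \<Rightarrow> real" where
  "escape c a b i j = measure (L i) (escape_event c a b j)"

lemma down_nonneg [simp]: "0 \<le> down c x i j" and escape_nonneg [simp]: "0 \<le> escape c a b i j"
  by (simp_all add: down_def escape_def)

lemma down_eq_0: "0 \<le> x \<Longrightarrow> \<not> c $ j < 0 \<Longrightarrow> down c x i j = 0"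
proof -
  assume "0 \<le> x" "\<not> c $ j < 0"
  then have "down_event c x j = {}" using down_event_rate by blast
  then show ?thesis by (simp add: down_def)
qed

lemma escape_le_down: "escape c a b i j \<le> down c a i j"
  unfolding escape_def down_def
  by (intro L.finite_measure_mono escape_event_subset) (simp add: sets_L down_event_sets)

lemma escape_eq_0: "0 \<le> a \<Longrightarrow> \<not> c $ j < 0 \<Longrightarrow> escape c a b i j = 0"
  using escape_le_down[of c a b i j] down_eq_0[of a c j i] by (simp add: antisym)

text \<open>Strong Markov property at the passage below \<open>x\<close>. For \<open>x = 0\<close>
  it identifies the product of \<Psi> with an exponential of \<open>U\<close> as a passage
  probability from an up phase.\<close>

lemma down_add:
  assumes xy: "0 \<le> x" "0 \<le> y"
  shows "down c (x + y) i j = (\<Sum>k\<in>UNIV. down c x i k * down c y k j)"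
proof -
  let ?S = "{f. step_path f} :: (real \<Rightarrow> 's) set"
  have "?S \<in> sets path_space" using sets.top[of path_space] by simp
  from strong_markov_sum[OF measurable_down_time down_time_nonneg this determined_down_time_less down_event_sets, of i c x c y j]
  have "measure (L i) {f\<in>?S. down_time c x f < \<infinity> \<and> shift (real_of_ereal (down_time c x f)) f \<in> down_event c y j} =
    (\<Sum>k\<in>UNIV. down c x i k * down c y k j)" by (simp add: down_def down_event_def[of c x])
  moreover have "{f\<in>?S. down_time c x f < \<infinity> \<and> shift (real_of_ereal (down_time c x f)) f \<in> down_event c y j} = down_event c (x + y) j"
    using down_event_add_iff[OF _ xy, of _ c j] by (auto simp: down_event_def[of c "x + y"])
  ultimately show ?thesis by (simp add: down_def)
qed

lemma down_escape:
  assumes ab: "0 \<le> a" "0 \<le> b"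
  shows "down c b i j = escape c b a i j + (\<Sum>k\<in>UNIV. escape (- c) a b i k * down c (a + b) k j)"
proof -
  let ?A = "{f. step_path f \<and> down_time (- c) a f < down_time c b f} :: (real \<Rightarrow> 's) set"
  let ?B = "{f\<in>?A. down_time (- c) a f < \<infinity> \<and> shift (real_of_ereal (down_time (- c) a f)) f \<in> down_event c (a + b) j}"
  have A: "?A \<in> sets path_space" by (rule escape_sets)
  have det: "determined u {f\<in>?A. down_time (- c) a f < ereal u}" for u
    using determined_escape_less[OF ab, of u "- c"] by simp
  have fin: "down_time (- c) a f < \<infinity>" if "down_time (- c) a f < down_time c b f" for f
    using less_le_trans[OF that, of \<infinity>] by simp
  have eqk: "{f\<in>?A. down_time (- c) a f < \<infinity> \<and> f (real_of_ereal (down_time (- c) a f)) = k} = escape_event (- c) a b k" for k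
    using fin by (auto simp: escape_event_def)
  have sum: "measure (L i) ?B = (\<Sum>k\<in>UNIV. escape (- c) a b i k * down c (a + b) k j)"
    using strong_markov_sum[OF measurable_down_time down_time_nonneg A det down_event_sets, of i c "a + b" j]
    unfolding eqk by (simp add: down_def escape_def)
  have "(\<lambda>f. shift (real_of_ereal (down_time (- c) a f)) f) \<in> path_space \<rightarrow>\<^sub>M (path_space :: (real \<Rightarrow> 's) measure)"
    by (rule measurable_shift_at) auto
  note [measurable] = this down_event_sets[of c "a + b" j]
  have "?B = ?A \<inter> {f. step_path f \<and> down_time (- c) a f < \<infinity> \<and> shift (real_of_ereal (down_time (- c) a f)) f \<in> down_event c (a + b) j}"
    by auto
  also have "\<dots> \<in> sets path_space" by (intro sets.Int A path_setI) measurable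
  finally have B: "?B \<in> sets (L i)" by (simp add: sets_L)
  have "down_event c b j = escape_event c b a j \<union> ?B"
  proof (intro set_eqI)
    fix f show "f \<in> down_event c b j \<longleftrightarrow> f \<in> escape_event c b a j \<union> ?B"
    proof (cases "step_path f")
      case True
      then show ?thesis using down_event_escape_iff[OF True ab, of c j] fin[of f] by auto
    qed (auto simp: down_event_def escape_event_def)
  qed
  moreover have "escape_event c b a j \<inter> ?B = {}" by (auto simp: escape_event_def)
  ultimately show ?thesis
    using B sum unfolding down_def[of c b] escape_def[of c b]
    by (simp add: L.finite_measure_Union sets_L escape_event_sets)
qed


section \<open>Starting in a phase with rate zero\<close>

text \<open>The level decreases at unit rate outside the set of phases with rate zero; its passage below
  \<open>0\<close> is the first exit from that set.\<close>

definition exit_rate :: "real^'s \<Rightarrow> real^'s" where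
  "exit_rate c = (\<chi> k. if c $ k = 0 then 0 else - 1)"

lemma lev_exit_rate_nonpos: "step_path f \<Longrightarrow> lev (exit_rate c) f t \<le> 0"
proof -
  assume f: "step_path f"
  have "integral {0..t} (\<lambda>s. exit_rate c $ f s) \<le> integral {0..t} (\<lambda>s. 0)"
    by (intro integral_le integrable_on_rate[OF f]) (auto simp: exit_rate_def)
  then show ?thesis by (simp add: lev_def)
qed

text \<open>A phase of nonzero rate at \<open>s\<close> would persist for a moment and push the
  auxiliary level, which is never positive, below 0 before its passage time.\<close>

lemma rate_before_exit:
  assumes f: "step_path f" and s: "0 \<le> s" "ereal s < down_time (exit_rate c) 0 f"
  shows "c $ f s = 0"
proof (rule ccontr)
  assume nz: "c $ f s \<noteq> 0"
  obtain e k where e: "0 < e" "f s = k" "\<forall>v. s \<le> v \<and> v < s + e \<longrightarrow> f v = k"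
    by (rule step_pathE[OF f s(1)])
  obtain y where y: "ereal s < y" "y < min (down_time (exit_rate c) 0 f) (ereal (s + e))"
    using dense[of "ereal s" "min (down_time (exit_rate c) 0 f) (ereal (s + e))"] s e by auto
  then obtain v where v: "y = ereal v" by (cases y) auto
  have "lev (exit_rate c) f (s + (v - s)) = lev (exit_rate c) f s + exit_rate c $ k * (v - s)"
    using y v e s by (intro lev_add_const[OF f]) auto
  moreover have "exit_rate c $ k = - 1" using nz e(2) by (simp add: exit_rate_def)
  moreover have "ereal v \<le> down_time (exit_rate c) 0 f" using y(2) v by (simp add: less_imp_le)
  then have "0 \<le> lev (exit_rate c) f v"
    using level_before_down_time[of v "exit_rate c" 0 f] y v s f by simp
  ultimately show False using lev_exit_rate_nonpos[OF f, of c s] y v by simp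
qed

lemma lev_zero:
  assumes "\<And>s. 0 \<le> s \<Longrightarrow> s < t \<Longrightarrow> c $ f s = 0"
  shows "lev c f t = 0"
proof -
  have "integral {0..t} (\<lambda>s. c $ f s) = integral {0..t} (\<lambda>s. 0)"
    using assms by (intro integral_spike[of "{t}"]) auto
  then show ?thesis by (simp add: lev_def)
qed

text \<open>Until the exit the level rests at 0, so both passage times are merely delayed by the
  exit time; without an exit there is no escape at all. From a phase of nonzero rate the exit is
  immediate.\<close>

lemma escape_event_exit_iff:
  assumes f: "step_path f" and ab: "0 \<le> a" "0 \<le> b"
  shows "f \<in> escape_event c a b j \<longleftrightarrow> down_time (exit_rate c) 0 f < \<infinity> \<and>
    shift (real_of_ereal (down_time (exit_rate c) 0 f)) f \<in> escape_event c a b j"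
proof (cases "down_time (exit_rate c) 0 f < \<infinity>")
  case True
  then obtain T where T: "0 \<le> T" "down_time (exit_rate c) 0 f = ereal T" by (rule down_time_finiteE)
  have z: "lev c f t = 0" if "t \<le> T" for t
    using rate_before_exit[OF f, of _ c] T that by (intro lev_zero) auto
  have 1: "down_time c a f = ereal T + down_time c a (shift T f)"
    using down_time_shift[OF f T(1), of a c] z ab by simp
  have 2: "down_time (- c) b f = ereal T + down_time (- c) b (shift T f)"
    using down_time_shift[OF f T(1), of b "- c"] z ab by (simp add: lev_minus)
  have less: "down_time c a f < down_time (- c) b f \<longleftrightarrow> down_time c a (shift T f) < down_time (- c) b (shift T f)"
    unfolding 1 2 by (cases "down_time c a (shift T f)"; cases "down_time (- c) b (shift T f)") auto
  have "down_time c a (shift T f) < \<infinity>" if "down_time c a (shift T f) < down_time (- c) b (shift T f)"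
    using less_le_trans[OF that, of \<infinity>] by simp
  then have "f (real_of_ereal (down_time c a f)) = shift T f (real_of_ereal (down_time c a (shift T f)))"
    if "down_time c a (shift T f) < down_time (- c) b (shift T f)"
    using real_of_ereal_down_time_shift[OF 1] that by (simp add: shift_apply)
  then show ?thesis using T f less step_path_shift[OF f T(1)] by (auto simp: escape_event_def)
next
  case False
  then have "lev c f t = 0" for t
    using rate_before_exit[OF f, of _ c] by (intro lev_zero) (simp add: less_top[symmetric])
  then have "\<not> down_time c a f < \<infinity>" unfolding down_time_finite_iff using ab by simp
  then have "f \<notin> down_event c a j" by (simp add: down_event_def)
  then show ?thesis using False escape_event_subset[of c a b j] by auto
qed

lemma escape_exit:
  assumes ab: "0 \<le> a" "0 \<le> b"
  shows "escape c a b i j = (\<Sum>k\<in>UNIV. down (exit_rate c) 0 i k * escape c a b k j)"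
proof -
  let ?S = "{f. step_path f} :: (real \<Rightarrow> 's) set"
  let ?T = "down_time (exit_rate c) 0"
  have "?S \<in> sets path_space" using sets.top[of path_space] by simp
  from strong_markov_sum[OF measurable_down_time down_time_nonneg this determined_down_time_less escape_event_sets, of i "exit_rate c" 0 c a b j]
  have "measure (L i) {f\<in>?S. ?T f < \<infinity> \<and> shift (real_of_ereal (?T f)) f \<in> escape_event c a b j} =
    (\<Sum>k\<in>UNIV. down (exit_rate c) 0 i k * escape c a b k j)" by (simp add: down_def escape_def down_event_def)
  moreover have "{f\<in>?S. ?T f < \<infinity> \<and> shift (real_of_ereal (?T f)) f \<in> escape_event c a b j} = escape_event c a b j"
    using escape_event_exit_iff[OF _ ab, of _ c j] by (auto simp: escape_event_def)
  ultimately show ?thesis by (simp add: escape_def)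
qed

lemma down_time_start:
  assumes "step_path f" "c $ f 0 < 0"
  shows "down_time c 0 f = 0"
  using down_time_eqI[of 0 f 0 c] assms by (simp add: zero_ereal_def[symmetric])

text \<open>Conditioning on the phase at a small time \<open>d\<close> changes the exit probabilities by \<open>O(d\<^sup>2)\<close> only: an
  exit before \<open>d\<close> in a different phase requires two jumps within time \<open>2 d\<close>.\<close>

lemma exit_harmonic:
  assumes i: "c $ i = 0"
  shows "(\<Sum>l\<in>UNIV. Q $ i $ l * down (exit_rate c) 0 l k) = 0"
proof -
  let ?e = "exit_rate c"
  let ?T = "down_time ?e 0"
  let ?R = "\<lambda>f. real_of_ereal (?T f)"
  let ?H = "\<lambda>l. down ?e 0 l k"
  let ?E = "down_event ?e 0 k"
  let ?S = "{f. step_path f} :: (real \<Rightarrow> 's) set"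
  have S: "?S \<in> sets path_space" using sets.top[of path_space] by simp
  obtain C where C: "0 \<le> C" "\<And>t i j. 0 \<le> t \<Longrightarrow> t \<le> 1 \<Longrightarrow> \<bar>trans t i j - of_bool (i = j) - t * Q $ i $ j\<bar> \<le> C * t\<^sup>2"
    using trans_expansion by blast
  obtain K where K: "0 \<le> K" "\<And>u k. 0 \<le> u \<Longrightarrow> 1 - K * u \<le> measure (L k) (stay k u)"
    using stay_prob by blast
  have H: "0 \<le> ?H l" "?H l \<le> 1" for l by (simp_all add: down_def)
  have not_stay: "measure (L l) (?S - stay l d) \<le> K * d" if "0 \<le> d" for l d
    using K(2)[OF that, of l] that L.prob_compl[of "stay l d" l] by (simp add: sets_L stay_sets)
  have close: "\<bar>?H i - (\<Sum>l\<in>UNIV. trans d i l * ?H l)\<bar> \<le> K\<^sup>2 * d\<^sup>2" if d: "0 < d" for d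
  proof -
    let ?A = "{f\<in>?S. ?T f < ereal d}"
    let ?F = "{f. step_path f \<and> shift d f \<in> ?E}"
    \<comment> \<open>The exceptional event of two jumps: exit into \<open>l\<close> before
      \<open>d\<close>, and departure from \<open>l\<close> within a further time \<open>d\<close>.
      By the strong Markov property at the exit its probability is a product of two factors of order
      \<open>d\<close>.\<close>
    let ?D = "\<lambda>l. {f\<in>?A. ?T f < \<infinity> \<and> f (?R f) = l \<and> shift (?R f) f \<in> ?S - stay l d}"
    have A: "?A \<in> sets path_space" using path_setI[of "\<lambda>f. ?T f < ereal d"] by simp
    have F: "?F \<in> sets path_space" using d by (intro shift_sets down_event_sets) simp
    have det: "determined u {f\<in>?A. ?T f < ereal u}" for u
    proof -
      have "x < ereal (min d u) \<longleftrightarrow> x < ereal d \<and> x < ereal u" for x by (cases x) auto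
      then have "{f\<in>?A. ?T f < ereal u} = {f\<in>?S. ?T f < ereal (min d u)}" by simp
      then show ?thesis using determined_mono[OF determined_down_time_less, of "min d u" u] by simp
    qed
    have SB: "?S - stay l d \<in> sets path_space" for l using d by (intro sets.Diff S stay_sets) simp
    have Dm: "measure (L i) (?D l) = measure (L i) {f\<in>?A. ?T f < \<infinity> \<and> f (?R f) = l} * measure (L l) (?S - stay l d)" for l
      by (rule strong_markov[OF measurable_down_time down_time_nonneg A det SB])
    have R: "?R \<in> borel_measurable path_space" "\<And>f. 0 \<le> ?R f" by auto
    have [measurable]: "(\<lambda>f. shift (?R f) f) \<in> path_space \<rightarrow>\<^sub>M (path_space :: (real \<Rightarrow> 's) measure)"
      using R by (intro measurable_shift_at) auto
    have Al: "{f\<in>?A. ?T f < \<infinity> \<and> f (?R f) = l} \<in> sets (L i)" for l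
      using path_setI[of "\<lambda>f. ?T f < ereal d \<and> ?T f < \<infinity> \<and> f (?R f) = l"] by (simp add: sets_L conj_assoc)
    have D: "?D l \<in> sets (L i)" for l
    proof -
      note SB [measurable]
      have "{f. step_path f \<and> (?T f < ereal d \<and> ?T f < \<infinity> \<and> f (?R f) = l \<and> shift (?R f) f \<in> ?S - stay l d)} \<in> sets path_space"
        by (rule path_setI) measurable
      then show ?thesis by (simp add: sets_L conj_assoc)
    qed
    have "measure (L i) ?A \<le> measure (L i) (?S - stay i d)"
    proof (rule L.finite_measure_mono)
      show "?A \<subseteq> ?S - stay i d"
      proof
        fix f assume f: "f \<in> ?A"
        then obtain t where t: "0 \<le> t" "t < d" "lev ?e f t < 0" by (auto simp: down_time_less_iff)
        have "f \<notin> stay i d"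
        proof
          assume "f \<in> stay i d"
          then have "?e $ f s = 0" if "0 \<le> s" "s < t" for s using that t i by (simp add: stay_def exit_rate_def)
          then show False using lev_zero[of t ?e f] t(3) by simp
        qed
        then show "f \<in> ?S - stay i d" using f by simp
      qed
    qed (simp add: sets_L SB)
    then have A_le: "measure (L i) ?A \<le> K * d" using not_stay[of d i] d by linarith
    have "measure (L i) (\<Union>l\<in>UNIV. ?D l) \<le> (\<Sum>l\<in>UNIV. measure (L i) (?D l))"
      using D by (intro L.finite_measure_subadditive_finite) auto
    also have "\<dots> \<le> (\<Sum>l\<in>UNIV. measure (L i) {f\<in>?A. ?T f < \<infinity> \<and> f (?R f) = l} * (K * d))"
      unfolding Dm using not_stay[of d] d by (intro sum_mono mult_left_mono) auto
    also have "\<dots> = (\<Sum>l\<in>UNIV. measure (L i) {f\<in>?A. ?T f < \<infinity> \<and> f (?R f) = l}) * (K * d)"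
      by (simp add: sum_distrib_right)
    also have "(\<Sum>l\<in>UNIV. measure (L i) {f\<in>?A. ?T f < \<infinity> \<and> f (?R f) = l}) =
        measure (L i) (\<Union>l\<in>UNIV. {f\<in>?A. ?T f < \<infinity> \<and> f (?R f) = l})"
      using Al by (intro L.finite_measure_finite_Union[symmetric]) (auto simp: disjoint_family_on_def)
    also have "\<dots> \<le> measure (L i) ?A"
      using A by (intro L.finite_measure_mono) (blast, simp only: sets_L)
    also have "\<dots> \<le> K * d" by (rule A_le)
    finally have Dle: "measure (L i) (\<Union>l\<in>UNIV. ?D l) \<le> K\<^sup>2 * d\<^sup>2"
      using K d by (simp add: power2_eq_square mult_right_mono ac_simps)
    \<comment> \<open>Off the exceptional event the path seen from time \<open>d\<close> exits into
      the same phase: after an early exit into \<open>l\<close> it still is in \<open>l\<close> at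
      time \<open>d\<close>, where exit is immediate; otherwise the exit is only shifted by
      \<open>d\<close>.\<close>
    have same: "f \<in> ?E \<longleftrightarrow> f \<in> ?F" if f: "step_path f" and nD: "f \<notin> (\<Union>l\<in>UNIV. ?D l)" for f
    proof (cases "?T f < ereal d")
      case True
      then have "?T f < \<infinity>" using less_trans[of "?T f" "ereal d" \<infinity>] by simp
      then obtain T where T: "0 \<le> T" "?T f = ereal T" by (rule down_time_finiteE)
      have "shift T f \<in> stay (f T) d"
        using nD f True T step_path_shift[OF f T(1)] by auto
      then have fd: "f d = f T" using T True by (auto simp: stay_def shift_apply dest!: spec[of _ "d - T"])
      have neg: "?e $ f T < 0" using at_down_time(2)[OF T(2) order_refl f] .
      have "?T (shift d f) = 0" 
        using neg fd d by (intro down_time_start step_path_shift f) (simp_all add: shift_apply)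
      then have "f \<in> ?F \<longleftrightarrow> f d = k"
        using f step_path_shift[OF f, of d] d by (simp add: down_event_def shift_apply)
      moreover have "f \<in> ?E \<longleftrightarrow> f T = k" using f T by (simp add: down_event_def)
      ultimately show ?thesis using fd by simp
    next
      case False
      have nonneg: "- 0 \<le> lev ?e f t" if "0 \<le> t" "t \<le> d" for t
      proof (rule level_before_down_time[OF _ that(1) order_refl f])
        have "ereal t \<le> ereal d" using that by simp
        then show "ereal t \<le> ?T f" using False by (meson not_less order_trans)
      qed
      have "lev ?e f d = 0" using nonneg[of d] lev_exit_rate_nonpos[OF f, of c d] d by simp
      then show ?thesis using down_event_shift[OF f _ nonneg, of d 0 k] d f by simp
    qed
    have sub1: "?E \<subseteq> ?F \<union> (\<Union>l\<in>UNIV. ?D l)" using same by (auto simp: down_event_def)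
    have sub2: "?F \<subseteq> ?E \<union> (\<Union>l\<in>UNIV. ?D l)" using same by blast
    have U: "(\<Union>l\<in>UNIV. ?D l) \<in> sets (L i)" using D by auto
    have E: "?E \<in> sets (L i)" "?F \<in> sets (L i)" using F by (simp_all add: sets_L down_event_sets)
    have "measure (L i) ?E \<le> measure (L i) (?F \<union> (\<Union>l\<in>UNIV. ?D l))"
      using sub1 E U by (intro L.finite_measure_mono) auto
    also have "\<dots> \<le> measure (L i) ?F + measure (L i) (\<Union>l\<in>UNIV. ?D l)" using E U by (intro measure_Un_le)
    finally have 1: "measure (L i) ?E - measure (L i) ?F \<le> K\<^sup>2 * d\<^sup>2" using Dle by linarith
    have "measure (L i) ?F \<le> measure (L i) (?E \<union> (\<Union>l\<in>UNIV. ?D l))"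
      using sub2 E U by (intro L.finite_measure_mono) auto
    also have "\<dots> \<le> measure (L i) ?E + measure (L i) (\<Union>l\<in>UNIV. ?D l)" using E U by (intro measure_Un_le)
    finally have 2: "measure (L i) ?F - measure (L i) ?E \<le> K\<^sup>2 * d\<^sup>2" using Dle by linarith
    have "measure (L i) ?F = (\<Sum>l\<in>UNIV. trans d i l * ?H l)"
      using markov_sum[of d ?E i] d by (simp add: down_event_sets down_def)
    then show ?thesis using 1 2 by (simp add: down_def abs_le_iff)
  qed
  define s where "s = (\<Sum>l\<in>UNIV. Q $ i $ l * ?H l)"
  define B where "B = K\<^sup>2 + real CARD('s) * C"
  have B: "0 \<le> B" using C by (simp add: B_def)
  have "\<bar>s\<bar> \<le> B * d" if d: "0 < d" "d \<le> 1" for d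
  proof -
    \<comment> \<open>With the expansion of \<open>trans\<close>, the difference just estimated
      becomes \<open>d * s + O(d^2)\<close>. As it is itself \<open>O(d^2)\<close>, division by
      \<open>d\<close> gives \<open>s = O(d)\<close> for all small \<open>d\<close>, hence
      \<open>s = 0\<close>.\<close>
    have "(\<Sum>l\<in>UNIV. trans d i l * ?H l) - ?H i - d * s = (\<Sum>l\<in>UNIV. (trans d i l - of_bool (i = l) - d * Q $ i $ l) * ?H l)"
    proof -
      have "?H i = (\<Sum>l\<in>UNIV. of_bool (i = l) * ?H l)"
        by (simp add: of_bool_def if_distrib[of "\<lambda>x. x * _"] cong: if_cong)
      then show ?thesis
        by (simp add: s_def sum_distrib_left sum_subtractf left_diff_distrib mult.assoc)
    qed
    also have "\<bar>\<dots>\<bar> \<le> (\<Sum>l\<in>(UNIV::'s set). C * d\<^sup>2)"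
    proof (rule order_trans[OF sum_abs sum_mono])
      fix l
      have "\<bar>trans d i l - of_bool (i = l) - d * Q $ i $ l\<bar> * ?H l \<le> (C * d\<^sup>2) * 1"
        using C(2)[of d i l] d H[of l] C(1) by (intro mult_mono) auto
      then show "\<bar>(trans d i l - of_bool (i = l) - d * Q $ i $ l) * ?H l\<bar> \<le> C * d\<^sup>2"
        using H[of l] by (simp add: abs_mult)
    qed
    finally have "d * \<bar>s\<bar> \<le> d * (B * d)"
      using close[OF d(1)] d by (simp add: B_def abs_mult[symmetric] power2_eq_square algebra_simps)
    then show ?thesis using d by simp
  qed
  note bound = this
  have "\<bar>s\<bar> \<le> 0"
  proof (rule field_le_epsilon)
    fix e :: real assume e: "0 < e"
    define d where "d = min 1 (e / (B + 1))"
    have d: "0 < d" "d \<le> 1" "d \<le> e / (B + 1)" using e B by (auto simp: d_def)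
    have "B * d \<le> (B + 1) * d" using d by simp
    also have "\<dots> \<le> e" using d(3) B by (simp add: le_divide_eq mult.commute)
    finally show "\<bar>s\<bar> \<le> 0 + e" using bound[OF d(1,2)] by simp
  qed
  then show ?thesis by (simp add: s_def)
qed

text \<open>As a function of the initial phase, an escape probability is a linear combination of the
  exit probabilities, with coefficients indexed by the phase of exit (\<open>escape_exit\<close>).
  So the small-time argument is carried out for exits only.\<close>

theorem escape_harmonic:
  assumes i: "c $ i = 0" and ab: "0 \<le> a" "0 \<le> b"
  shows "(\<Sum>l\<in>UNIV. Q $ i $ l * escape c a b l j) = 0"
proof -
  have "(\<Sum>l\<in>UNIV. Q $ i $ l * escape c a b l j) =
    (\<Sum>l\<in>UNIV. \<Sum>k\<in>UNIV. Q $ i $ l * down (exit_rate c) 0 l k * escape c a b k j)"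
    by (subst escape_exit[OF ab]) (simp add: sum_distrib_left mult.assoc)
  also have "\<dots> = (\<Sum>k\<in>UNIV. (\<Sum>l\<in>UNIV. Q $ i $ l * down (exit_rate c) 0 l k) * escape c a b k j)"
    by (subst sum.swap) (simp add: sum_distrib_right)
  also have "\<dots> = 0" using exit_harmonic[OF i] by simp
  finally show ?thesis .
qed

end


section \<open>Return to the initial level\<close>

definition return_at :: "real^'s \<Rightarrow> (real \<Rightarrow> 's) \<Rightarrow> ereal" where
  "return_at c f = Inf (ereal ` {t. 0 < t \<and> lev c f t = 0})"

lemma return_time_level: "return_time (level c x0 f) = return_at c f"
  by (simp add: return_time_def return_at_def level_eq)

lemma return_at_uminus: "return_at (- c) f = return_at c f"
  by (simp add: return_at_def lev_minus)

lemma return_at_less_iff: "return_at c f < ereal u \<longleftrightarrow> (\<exists>t>0. t < u \<and> lev c f t = 0)"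
  unfolding return_at_def Inf_less_iff by auto

lemma return_at_nonneg [simp]: "0 \<le> return_at c f"
  unfolding return_at_def by (intro Inf_greatest) auto

lemma level_nonzero_before_return:
  "0 < t \<Longrightarrow> ereal t < return_at c f \<Longrightarrow> lev c f t \<noteq> 0"
proof
  assume t: "0 < t" "ereal t < return_at c f" "lev c f t = 0"
  obtain y where y: "ereal t < y" "y < return_at c f" using dense[OF t(2)] by blast
  then obtain u where u: "y = ereal u" by (cases y) auto
  have "return_at c f < ereal u" unfolding return_at_less_iff using t y u by auto
  then show False using y u by simp
qed

lemma isCont_lev: "step_path f \<Longrightarrow> 0 < t \<Longrightarrow> isCont (lev c f) t"
  using continuous_on_lev[of f c] by (simp add: continuous_on_interior)

lemma level_at_return:
  assumes f: "step_path f" and T: "return_at c f = ereal T" "0 < T"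
  shows "lev c f T = 0"
proof (rule ccontr)
  assume nz: "lev c f T \<noteq> 0"
  have "(lev c f \<longlongrightarrow> lev c f T) (at T)" using isCont_lev[OF f T(2)] by (simp add: isCont_def)
  then have "eventually (\<lambda>t. lev c f t \<noteq> 0) (at T)" using nz by (rule tendsto_imp_eventually_ne)
  then obtain d where d: "0 < d" "\<And>t. t \<noteq> T \<Longrightarrow> dist t T < d \<Longrightarrow> lev c f t \<noteq> 0"
    unfolding eventually_at by auto
  have "return_at c f < ereal (T + d)" using T d by simp
  then obtain t where t: "0 < t" "t < T + d" "lev c f t = 0" by (auto simp: return_at_less_iff)
  have "T \<le> t"
  proof (rule ccontr)
    assume "\<not> T \<le> t"
    then have "return_at c f < ereal T" using t by (auto simp: return_at_less_iff)
    then show False using T by simp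
  qed
  then show False using d(2)[of t] t nz by (cases "t = T") (auto simp: dist_real_def)
qed

text \<open>The level is positive just after time 0; by the intermediate value theorem it cannot
  become nonpositive without a zero, and a zero would be a return.\<close>

lemma level_pos_before_return:
  assumes f: "step_path f" and pos: "0 < c $ f 0" and t: "0 < t" "ereal t < return_at c f"
  shows "0 < lev c f t"
proof (rule ccontr)
  assume "\<not> 0 < lev c f t"
  then have neg: "lev c f t \<le> 0" by simp
  obtain e k where e: "0 < e" "f 0 = k" "\<forall>v. 0 \<le> v \<and> v < 0 + e \<longrightarrow> f v = k"
    by (rule step_pathE[OF f order_refl])
  define s where "s = min (e/2) t"
  have s: "0 < s" "s < e" "s \<le> t" using e t by (auto simp: s_def)
  have "lev c f s = c $ k * s" by (rule lev_const[OF f]) (use s e in auto)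
  then have "0 < lev c f s" using pos e s by simp
  moreover have "continuous_on {s..t} (lev c f)"
    using continuous_on_lev[OF f] by (rule continuous_on_subset) (use s in auto)
  ultimately obtain v where v: "s \<le> v" "v \<le> t" "lev c f v = 0"
    using IVT2'[of "lev c f" t 0 s] neg s by auto
  have "ereal v < return_at c f" using v t(2) by (meson ereal_less_eq(3) le_less_trans)
  then show False using level_nonzero_before_return[of v c f] v s by simp
qed

lemma return_pos:
  assumes f: "step_path f" and pos: "0 < c $ f 0" and T: "return_at c f = ereal T"
  shows "0 < T"
proof (rule ccontr)
  assume "\<not> 0 < T"
  obtain e k where e: "0 < e" "f 0 = k" "\<forall>v. 0 \<le> v \<and> v < 0 + e \<longrightarrow> f v = k"
    by (rule step_pathE[OF f order_refl])
  have "return_at c f < ereal e" using T \<open>\<not> 0 < T\<close> e by simp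
  then obtain t where t: "0 < t" "t < e" "lev c f t = 0" by (auto simp: return_at_less_iff)
  have "lev c f t = c $ k * t" by (rule lev_const[OF f]) (use t e in auto)
  then show False using t pos e by simp
qed

text \<open>Return and passage coincide as soon as the phase at the return has negative rate;
  excluding the other returns is the purpose of \<open>critical_jump\<close>.\<close>

lemma down_time_eq_return:
  assumes f: "step_path f" and pos: "0 < c $ f 0" and T: "return_at c f = ereal T" and neg: "c $ f T < 0"
  shows "down_time c 0 f = ereal T"
proof (rule down_time_eqI)
  have T0: "0 < T" by (rule return_pos[OF f pos T])
  show "lev c f T = - 0" using level_at_return[OF f T T0] by simp
  show "- 0 \<le> lev c f t" if "0 \<le> t" "t \<le> T" for t
    using level_pos_before_return[OF f pos, of t] T level_at_return[OF f T T0] that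
    by (cases "t = 0 \<or> t = T") auto
qed (use f neg return_pos[OF f pos T] in auto)

lemma return_le_down_time:
  assumes f: "step_path f" and pos: "0 < c $ f 0"
  shows "return_at c f \<le> down_time c 0 f"
proof (cases "down_time c 0 f < \<infinity>")
  case True
  then obtain T where T: "0 \<le> T" "down_time c 0 f = ereal T" by (rule down_time_finiteE)
  from at_down_time[OF T(2) order_refl f] have *: "lev c f T = 0" "c $ f T < 0" by simp_all
  have "T \<noteq> 0" using * pos by auto
  then have "ereal T \<in> ereal ` {t. 0 < t \<and> lev c f t = 0}" using T * by auto
  then show ?thesis unfolding T return_at_def by (rule Inf_lower)
qed simp

text \<open>Zeros of the level need not occur at rational times. On a compact interval, however, the
  absence of zeros means a bound \<open>1 / (n + 1)\<close> on the absolute level, which can be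
  tested at rational times (the events \<open>G q v\<close>).\<close>

lemma measurable_return_at [measurable]:
  "return_at c \<in> borel_measurable (path_space :: (real \<Rightarrow> 's::finite) measure)"
proof (rule borel_measurableI_less)
  define G :: "real \<Rightarrow> real \<Rightarrow> (real \<Rightarrow> 's) set" where
    "G q v = {f\<in>space path_space. \<exists>n::nat. \<forall>s\<in>{s\<in>\<rat>. q \<le> s \<and> s \<le> v}. 1 / real (Suc n) \<le> \<bar>lev c f s\<bar>}" for q v
  have G: "G q v \<in> sets path_space" for q v
    unfolding G_def
  proof (rule sets.sets_Collect_countable_Ex)
    fix n :: nat
    show "{f\<in>space path_space. \<forall>s\<in>{s\<in>\<rat>. q \<le> s \<and> s \<le> v}. 1 / real (Suc n) \<le> \<bar>lev c f s\<bar>} \<in> sets (path_space :: (real \<Rightarrow> 's) measure)"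
    proof (rule sets.sets_Collect_countable_All')
      show "countable {s\<in>\<rat>. q \<le> s \<and> s \<le> v}" by (rule countable_subset[OF _ countable_rat]) auto
      show "{f\<in>space path_space. 1 / real (Suc n) \<le> \<bar>lev c f s\<bar>} \<in> sets (path_space :: (real \<Rightarrow> 's) measure)" for s
        by measurable
    qed
  qed
  have G_iff: "f \<in> G q v \<longleftrightarrow> (\<forall>s\<in>{q..v}. lev c f s \<noteq> 0)" if f: "step_path f" and qv: "0 < q" "q < v" for f :: "real \<Rightarrow> 's" and q v
  proof
    assume "f \<in> G q v"
    then obtain n :: nat where n: "\<And>s. s \<in> \<rat> \<Longrightarrow> q \<le> s \<Longrightarrow> s \<le> v \<Longrightarrow> 1 / real (Suc n) \<le> \<bar>lev c f s\<bar>" unfolding G_def by blast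
    show "\<forall>s\<in>{q..v}. lev c f s \<noteq> 0"
    proof
      fix s assume s: "s \<in> {q..v}"
      show "lev c f s \<noteq> 0"
      proof
        assume z: "lev c f s = 0"
        \<comment> \<open>A rational time closer than \<open>d\<close> to the zero \<open>s\<close>
          has absolute level below \<open>1 / (n + 1)\<close> by the Lipschitz bound, against the
          choice of \<open>n\<close>.\<close>
        define d where "d = 1 / (real (Suc n) * (norm c + 1))"
        have d: "0 < d" by (simp add: d_def add_nonneg_pos)
        obtain r where r: "r \<in> \<rat>" "q \<le> r" "r \<le> v" "\<bar>r - s\<bar> < d"
        proof (cases "s < v")
          case True
          then obtain r where "r \<in> \<rat>" "s < r" "r < min v (s + d)"
            using Rats_dense_in_real[of s "min v (s + d)"] d by auto
          then show ?thesis using s that[of r] by auto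
        next
          case False
          then obtain r where "r \<in> \<rat>" "max q (s - d) < r" "r < s"
            using Rats_dense_in_real[of "max q (s - d)" s] d s qv by auto
          then show ?thesis using s that[of r] by auto
        qed
        have "1 / real (Suc n) \<le> \<bar>lev c f r - lev c f s\<bar>" using n[OF r(1-3)] z by simp
        also have "\<dots> \<le> norm c * \<bar>r - s\<bar>" using r s qv by (intro lev_lipschitz[OF f]) auto
        also have "\<dots> \<le> (norm c + 1) * \<bar>r - s\<bar>" by (intro mult_right_mono) auto
        also have "\<dots> < (norm c + 1) * d" using r by (intro mult_strict_left_mono) (auto simp: add_nonneg_pos)
        also have "\<dots> = 1 / real (Suc n)"
        proof -
          have "norm c + 1 \<noteq> 0" using norm_ge_zero[of c] by linarith
          then show ?thesis unfolding d_def by (simp add: divide_simps)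
        qed
        finally show False by simp
      qed
    qed
  next
    assume nz: "\<forall>s\<in>{q..v}. lev c f s \<noteq> 0"
    have "continuous_on {q..v} (\<lambda>s. \<bar>lev c f s\<bar>)"
      using continuous_on_lev[OF f] by (intro continuous_intros continuous_on_subset[OF continuous_on_lev[OF f]]) (use qv in auto)
    moreover have "compact {q..v}" "{q..v} \<noteq> {}" using qv by auto
    ultimately obtain m where m: "m \<in> {q..v}" "\<And>s. s \<in> {q..v} \<Longrightarrow> \<bar>lev c f m\<bar> \<le> \<bar>lev c f s\<bar>"
      using continuous_attains_inf[of "{q..v}" "\<lambda>s. \<bar>lev c f s\<bar>"] by blast
    have "0 < \<bar>lev c f m\<bar>" using nz m by auto
    then obtain n where n: "inverse (real (Suc n)) < \<bar>lev c f m\<bar>" using reals_Archimedean by blast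
    have "1 / real (Suc n) \<le> \<bar>lev c f s\<bar>" if "s \<in> {q..v}" for s
      using m(2)[OF that] n by (simp add: inverse_eq_divide)
    then show "f \<in> G q v" using f by (auto simp: G_def)
  qed
  have finite: "{f\<in>space path_space. return_at c f < ereal u} \<in> sets (path_space :: (real \<Rightarrow> 's) measure)" for u
  proof -
    let ?I = "{(q, v). q \<in> \<rat> \<and> v \<in> \<rat> \<and> 0 < q \<and> q < v \<and> v < u}"
    have "{f\<in>space path_space. return_at c f < ereal u} = (\<Union>(q, v)\<in>?I. space path_space - G q v)"
    proof (intro set_eqI iffI)
      fix f :: "real \<Rightarrow> 's" assume "f \<in> {f\<in>space path_space. return_at c f < ereal u}"
      then obtain t where f: "step_path f" and t: "0 < t" "t < u" "lev c f t = 0" by (auto simp: return_at_less_iff)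
      obtain q where q: "q \<in> \<rat>" "0 < q" "q < t" using Rats_dense_in_real[of 0 t] t by auto
      obtain v where v: "v \<in> \<rat>" "t < v" "v < u" using Rats_dense_in_real[of t u] t by auto
      have "f \<notin> G q v" using G_iff[OF f q(2), of v] q v t by (auto simp del: space_path_space)
      then have "f \<in> space path_space - G q v" using f by simp
      moreover have "(q, v) \<in> ?I" using q v by simp
      ultimately show "f \<in> (\<Union>(q, v)\<in>?I. space path_space - G q v)" by blast
    next
      fix f :: "real \<Rightarrow> 's" assume "f \<in> (\<Union>(q, v)\<in>?I. space path_space - G q v)"
      then obtain q v where f: "step_path f" and qv: "0 < q" "q < v" "v < u" and "f \<notin> G q v" by auto
      then obtain s where "s \<in> {q..v}" "lev c f s = 0" using G_iff[OF f qv(1,2)] by blast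
      then show "f \<in> {f\<in>space path_space. return_at c f < ereal u}"
        using f qv by (auto simp: return_at_less_iff intro!: exI[of _ s])
    qed
    moreover have "countable ?I"
      by (rule countable_subset[of _ "\<rat> \<times> \<rat>"]) (auto simp: countable_rat)
    ultimately show ?thesis using G by (auto intro!: sets.countable_UN' simp del: space_path_space)
  qed
  fix y :: ereal
  show "{f\<in>space path_space. return_at c f < y} \<in> sets (path_space :: (real \<Rightarrow> 's) measure)"
  proof (cases y)
    case PInf
    have "{f\<in>space path_space. return_at c f < y} = (\<Union>n::nat. {f\<in>space path_space. return_at c f < ereal n})"
      unfolding PInf by (auto simp: less_PInf_Ex_of_nat)
    then show ?thesis using finite by auto
  next
    case MInf
    then show ?thesis by (simp add: not_less)
  next
    case (real u)
    then show ?thesis using finite[of u] by simp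
  qed
qed

definition return_event :: "real^'s \<Rightarrow> 's \<Rightarrow> (real \<Rightarrow> 's) set" where
  "return_event c j = {f. step_path f \<and> return_at c f < \<infinity> \<and> f (real_of_ereal (return_at c f)) = j}"

lemma return_event_sets: "return_event c j \<in> sets (path_space :: (real \<Rightarrow> 's::finite) measure)"
proof -
  have [measurable]: "(\<lambda>f. f (real_of_ereal (return_at c f))) \<in> path_space \<rightarrow>\<^sub>M count_space (UNIV :: 's set)"
    by (rule measurable_eval_nonneg) (auto simp: real_of_ereal_pos)
  show ?thesis unfolding return_event_def by (rule path_setI) measurable
qed

text \<open>Starting at time \<open>r\<close> in phase \<open>l\<close> at a positive level, the phase is left exactly when the level
  would reach \<open>0\<close>.\<close>

definition critical_jump :: "real^'s \<Rightarrow> real \<Rightarrow> 's \<Rightarrow> (real \<Rightarrow> 's) set" where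
  "critical_jump c r l = {f. step_path f \<and> (\<exists>v>0. lev c f r = - c $ l * v \<and>
     (\<forall>s. r \<le> s \<and> s < r + v \<longrightarrow> f s = l) \<and> f (r + v) \<noteq> l)}"

text \<open>Just before the return the phase is some constant \<open>l\<close>, in which the
  positive level runs linearly into 0; hence \<open>c $ l < 0\<close> and the phase changes exactly
  at the return. A rational \<open>r\<close> in that stretch leaves countably many events
  \<open>critical_jump c r l\<close> to discard.\<close>

lemma return_outside_down_phases:
  assumes f: "step_path f" and pos: "0 < c $ f 0" and T: "return_at c f = ereal T" and nn: "\<not> c $ f T < 0"
  shows "\<exists>r\<in>{r\<in>\<rat>. 0 < r}. \<exists>l\<in>{l. c $ l < 0}. f \<in> critical_jump c r l"
proof -
  have T0: "0 < T" by (rule return_pos[OF f pos T])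
  obtain e l where e: "0 < e" "e \<le> T" "\<forall>s. T - e \<le> s \<and> s < T \<longrightarrow> f s = l"
    using step_path_leftD[OF f T0] by blast
  obtain r where r: "r \<in> \<rat>" "T - e < r" "r < T" using Rats_dense_in_real[of "T - e" T] e by auto
  have r0: "0 < r" using r e by linarith
  have "lev c f (r + (T - r)) = lev c f r + c $ l * (T - r)"
    by (rule lev_add_const[OF f]) (use r e in auto)
  then have lev: "lev c f r = - c $ l * (T - r)" using level_at_return[OF f T T0] by simp
  have "0 < lev c f r" using level_pos_before_return[OF f pos r0] T r by simp
  then have "c $ l < 0" using lev r by (auto simp: mult_less_0_iff)
  moreover from this have "f T \<noteq> l" using nn by auto
  ultimately show ?thesis
    using r r0 e f lev unfolding critical_jump_def by (intro bexI[of _ r] bexI[of _ l]) (auto intro!: exI[of _ "T - r"])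
qed

context phase_chain
begin

text \<open>Given the past up to \<open>r\<close>, the sojourn in \<open>l\<close> would have to end
  at the one time at which the level would reach 0. Time is cut into windows of length
  \<open>d\<close>; in whichever window that time falls, the sojourn ends there with probability at
  most \<open>K * d\<close>. Only a null superset is claimed, as \<open>critical_jump\<close> is not
  shown to be measurable.\<close>

lemma null_critical_jump:
  assumes l: "c $ l < 0" and r: "0 \<le> r"
  shows "\<exists>N\<in>sets (L i). measure (L i) N = 0 \<and> critical_jump c r l \<subseteq> N"
proof -
  obtain K where K: "0 \<le> K" "\<And>u k. 0 \<le> u \<Longrightarrow> 1 - K * u \<le> measure (L k) (stay k u)"
    using stay_prob by blast
  have small: "\<exists>N\<in>sets (L i). measure (L i) N \<le> K * d \<and> critical_jump c r l \<subseteq> N" if d: "0 < d" for d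
  proof -
    \<comment> \<open>On \<open>?A m\<close> the level at \<open>r\<close>, falling at the rate of
      \<open>l\<close>, reaches 0 in the window from \<open>m * d\<close> to
      \<open>(m + 1) * d\<close>; on \<open>?B m\<close> the sojourn in \<open>l\<close> ends in
      that window. The first event is known at time \<open>r\<close>, the second concerns the future
      only.\<close>
    let ?A = "\<lambda>m::nat. {f. step_path f \<and> (f r = l \<and> real m * d < lev c f r / - c $ l \<and> lev c f r / - c $ l \<le> real (Suc m) * d)}"
    let ?B = "\<lambda>m::nat. stay l (real m * d) - stay l (real (Suc m) * d)"
    let ?N = "\<lambda>m. {f\<in>?A m. shift r f \<in> ?B m}"
    have [measurable]: "(\<lambda>f. f r) \<in> path_space \<rightarrow>\<^sub>M count_space (UNIV :: 's set)" using r by (rule measurable_coordinate)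
    have A: "?A m \<in> sets path_space" for m by (rule path_setI) measurable
    have B: "?B m \<in> sets path_space" for m using d by (intro sets.Diff stay_sets) auto
    have "?N m = ?A m \<inter> {f. step_path f \<and> shift r f \<in> ?B m}" for m by blast
    then have N: "?N m \<in> sets (L i)" for m using A shift_sets[OF r B] by (simp only: sets_L sets.Int)
    have det: "determined r (?A m)" for m
    proof (rule determinedI)
      fix f g assume fg: "agree r f g" and "f \<in> ?A m"
      moreover have "f r = g r" using fg r by (simp add: agree_def)
      ultimately show "g \<in> ?A m" using agree_lev[OF fg order_refl, of c] agree_path(2)[OF fg] by simp
    qed
    have Bm: "measure (L l) (?B m) \<le> K * d" for m
    proof -
      have sub: "stay l (real (Suc m) * d) \<subseteq> stay l (real m * d)" using d by (intro stay_mono) (simp add: mult_right_mono)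
      have split: "real (Suc m) * d = real m * d + d" by (simp add: algebra_simps)
      have md: "0 \<le> real m * d" using d by simp
      have "measure (L l) (?B m) = measure (L l) (stay l (real m * d)) - measure (L l) (stay l (real (Suc m) * d))"
        using sub d by (intro L.finite_measure_Diff) (auto simp: sets_L stay_sets)
      also have "\<dots> = measure (L l) (stay l (real m * d)) * (1 - measure (L l) (stay l d))"
        unfolding split using stay_add[OF md, of d l l] d by (simp add: algebra_simps)
      also have "\<dots> \<le> 1 * (K * d)"
        using K(2)[of d l] d by (intro mult_mono) auto
      finally show ?thesis by simp
    qed
    have Nm: "measure (L i) (?N m) \<le> measure (L i) (?A m) * (K * d)" for m
    proof -
      have "measure (L i) (?N m) = measure (L i) (?A m) * measure (L l) (?B m)"
        by (rule measure_shift[OF r A det _ B]) auto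
      then show ?thesis using Bm[of m] by (simp add: mult_left_mono)
    qed
    \<comment> \<open>The level at \<open>r\<close> is at most \<open>norm c * r\<close>, so
      finitely many windows suffice.\<close>
    define M where "M = nat \<lceil>norm c * r / (- c $ l * d)\<rceil>"
    have disj: "disjoint_family ?A"
    proof -
      have "m = n" if "f \<in> ?A m" "f \<in> ?A n" for f and m n :: nat
      proof -
        have "real m * d < real (Suc n) * d" "real n * d < real (Suc m) * d" using that by auto
        then show ?thesis using d by simp
      qed
      then show ?thesis unfolding disjoint_family_on_def by blast
    qed
    have "measure (L i) (\<Union>m\<in>{..M}. ?N m) \<le> (\<Sum>m\<in>{..M}. measure (L i) (?N m))"
      using N by (intro L.finite_measure_subadditive_finite) auto
    also have "\<dots> \<le> (\<Sum>m\<in>{..M}. measure (L i) (?A m)) * (K * d)"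
      unfolding sum_distrib_right by (intro sum_mono Nm)
    also have "(\<Sum>m\<in>{..M}. measure (L i) (?A m)) = measure (L i) (\<Union>m\<in>{..M}. ?A m)"
    proof (rule L.finite_measure_finite_Union[symmetric])
      show "?A ` {..M} \<subseteq> sets (L i)" using A by (auto simp only: sets_L)
      show "disjoint_family_on ?A {..M}" using disj by (rule disjoint_family_on_mono[rotated]) simp
    qed simp
    also have "\<dots> * (K * d) \<le> 1 * (K * d)" using K d by (intro mult_right_mono) auto
    finally have le: "measure (L i) (\<Union>m\<in>{..M}. ?N m) \<le> K * d" by simp
    have "critical_jump c r l \<subseteq> (\<Union>m\<in>{..M}. ?N m)"
    proof
      fix f assume "f \<in> critical_jump c r l"
      then obtain v where f: "step_path f" and v: "0 < v" "lev c f r = - c $ l * v"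
        "\<forall>s. r \<le> s \<and> s < r + v \<longrightarrow> f s = l" "f (r + v) \<noteq> l" unfolding critical_jump_def by blast
      have lv: "lev c f r / - c $ l = v" using v(2) l by (simp add: field_simps)
      \<comment> \<open>The windows are open on the left and closed on the right, hence the ceiling
        minus one.\<close>
      define m where "m = nat (\<lceil>v / d\<rceil> - 1)"
      have "0 < v / d" using v d by simp
      then have "1 \<le> \<lceil>v / d\<rceil>" by linarith
      then have rm: "real m = of_int \<lceil>v / d\<rceil> - 1" by (simp add: m_def)
      have "real m < v / d" "v / d \<le> real (Suc m)" unfolding of_nat_Suc rm by linarith+
      then have m: "real m * d < v" "v \<le> real (Suc m) * d" using d by (simp_all add: field_simps)
      have "v \<le> norm c * r / - c $ l"
        using lev_bound[OF f r, of c] v(2) l by (simp add: field_simps abs_if split: if_splits)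
      then have "v / d \<le> norm c * r / (- c $ l * d)" using d by (simp add: field_simps)
      then have "\<lceil>v / d\<rceil> \<le> \<lceil>norm c * r / (- c $ l * d)\<rceil>" by (rule ceiling_mono)
      then have mM: "m \<le> M" unfolding m_def M_def by linarith
      have fr: "f r = l" using v by simp
      have sf: "step_path (shift r f)" by (rule step_path_shift[OF f r])
      have 1: "shift r f \<in> stay l (real m * d)" using v(3) m(1) sf by (simp add: stay_def shift_apply)
      have 2: "shift r f \<notin> stay l (real (Suc m) * d)"
      proof
        assume "shift r f \<in> stay l (real (Suc m) * d)"
        then have "shift r f v = l" using v(1) m(2) unfolding stay_def by simp
        then show False using v(4) by (simp add: shift_apply)
      qed
      show "f \<in> (\<Union>m\<in>{..M}. ?N m)"
        using f fr m lv 1 2 mM by (intro UN_I[of m]) (simp_all only: mem_Collect_eq Diff_iff atMost_iff not_False_eq_True)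
    qed
    moreover have "(\<Union>m\<in>{..M}. ?N m) \<in> sets (L i)" using N by auto
    ultimately show ?thesis using le by blast
  qed
  have "\<forall>n::nat. \<exists>N\<in>sets (L i). measure (L i) N \<le> K * (1 / real (Suc n)) \<and> critical_jump c r l \<subseteq> N"
    by (intro allI small) simp
  then obtain N where N: "\<And>n. N n \<in> sets (L i)" "\<And>n. measure (L i) (N n) \<le> K * (1 / real (Suc n))"
    "\<And>n. critical_jump c r l \<subseteq> N n" by metis
  have "measure (L i) (\<Inter>n. N n) \<le> K * (1 / real (Suc n))" for n
    using N(2)[of n] L.finite_measure_mono[of "\<Inter>n. N n" "N n" i] N(1) by (meson INF_lower UNIV_I order_trans)
  moreover have "(\<lambda>n. K * (1 / real (Suc n))) \<longlonglongrightarrow> K * 0"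
    using LIMSEQ_inverse_real_of_nat by (intro tendsto_mult_left) (simp add: inverse_eq_divide)
  ultimately have "measure (L i) (\<Inter>n. N n) \<le> K * 0" by (intro LIMSEQ_le_const) auto
  then have "measure (L i) (\<Inter>n. N n) = 0" by (simp add: measure_le_0_iff)
  moreover have "(\<Inter>n. N n) \<in> sets (L i)" using N by auto
  ultimately show ?thesis using N(3) by (intro bexI[of _ "\<Inter>n. N n"]) auto
qed

text \<open>Outside countably many null sets every finite return ends in a phase of negative rate
  and then is the passage below 0; an infinite return time forces an infinite passage time.\<close>

lemma return_eq_down:
  assumes i: "0 < c $ i" and j: "c $ j < 0"
  shows "measure (L i) (return_event c j) = down c 0 i j"
proof -
  have "\<forall>r l. \<exists>N. 0 < r \<and> c $ l < 0 \<longrightarrow> N \<in> sets (L i) \<and> measure (L i) N = 0 \<and> critical_jump c r l \<subseteq> N"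
    using null_critical_jump[of c _ _ i] by (meson less_imp_le)
  then obtain N where N: "\<And>r l. 0 < r \<Longrightarrow> c $ l < 0 \<Longrightarrow> N r l \<in> sets (L i) \<and> measure (L i) (N r l) = 0 \<and> critical_jump c r l \<subseteq> N r l"
    by metis
  have ae: "AE f in L i. \<forall>r\<in>{r\<in>\<rat>. 0 < r}. \<forall>l\<in>{l. c $ l < 0}. f \<notin> N r l"
  proof (intro AE_ball_countable')
    show "AE f in L i. f \<notin> N r l" if "r \<in> {r\<in>\<rat>. 0 < r}" "l \<in> {l. c $ l < 0}" for r l
      using N[of r l] that by (intro AE_not_in) (auto simp: null_sets_def L.emeasure_eq_measure)
    show "countable {r::real. r \<in> \<rat> \<and> 0 < r}" by (rule countable_subset[OF _ countable_rat]) auto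
  qed auto
  have "AE f in L i. f \<in> return_event c j \<longleftrightarrow> f \<in> down_event c 0 j"
    using ae AE_start[of i] AE_space
  proof eventually_elim
    case (elim f)
    then have f: "step_path f" and pos: "0 < c $ f 0" using i by auto
    have no_jump: "c $ f T < 0" if "return_at c f = ereal T" for T
    proof (rule ccontr)
      assume "\<not> c $ f T < 0"
      from return_outside_down_phases[OF f pos that this] obtain r l where
        "r \<in> {r\<in>\<rat>. 0 < r}" "l \<in> {l. c $ l < 0}" "f \<in> critical_jump c r l" by blast
      moreover from this have "f \<in> N r l" using N[of r l] by auto
      ultimately show False using elim(1) by blast
    qed
    have "return_at c f = down_time c 0 f"
    proof (cases "return_at c f < \<infinity>")
      case True
      then obtain T where T: "return_at c f = ereal T" using return_at_nonneg[of c f] by (cases "return_at c f") auto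
      then show ?thesis using down_time_eq_return[OF f pos T no_jump[OF T]] by simp
    next
      case False
      then show ?thesis using return_le_down_time[OF f pos] by simp
    qed
    then show ?case by (simp add: return_event_def down_event_def)
  qed
  then show ?thesis
    unfolding down_def by (intro L.finite_measure_eq_AE) (simp_all add: sets_L return_event_sets down_event_sets)
qed

end


section \<open>The Markov property for integrals\<close>

lemma determined_down_time_ge:
  "determined u {f. step_path f \<and> ereal u \<le> down_time c a f \<and> ereal u \<le> down_time d b f}"
proof -
  have "{f. step_path f \<and> ereal u \<le> down_time c a f \<and> ereal u \<le> down_time d b f} =
    ({f. step_path f} - {f\<in>{f. step_path f}. down_time c a f < ereal u}) - {f\<in>{f. step_path f}. down_time d b f < ereal u}"
    by (auto simp: not_less)
  then show ?thesis by (simp only: determined_Diff determined_space determined_down_time_less)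
qed

context phase_chain
begin

text \<open>The Markov property as an equality of measures: \<open>L i\<close> restricted to a past
  event ending in phase \<open>k\<close> has, under the shift, a multiple of \<open>L k\<close> as
  image. Both integral versions follow by change of variables.\<close>

lemma markov_measure:
  assumes t: "0 \<le> t" and A: "A \<in> sets path_space" "determined t A"
  shows "distr (density (L i) (\<lambda>f. ennreal (indicator {f\<in>A. f t = k} f))) path_space (shift t) =
    density (L k) (\<lambda>_. ennreal (measure (L i) {f\<in>A. f t = k}))"
proof (rule measure_eqI)
  let ?E = "{f\<in>A. f t = k}"
  have AS: "A \<subseteq> {f. step_path f}" using sets.sets_into_space[OF A(1)] by simp
  have "?E = A \<inter> {f. step_path f \<and> f t = k}" using AS by auto
  then have E [measurable]: "?E \<in> sets (L i)" using A coordinate_sets[OF t, of k] by (simp add: sets_L sets.Int)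
  have [measurable]: "shift t \<in> L i \<rightarrow>\<^sub>M path_space" using measurable_shift[OF t] by (rule measurable_L)
  fix B assume "B \<in> sets (distr (density (L i) (\<lambda>f. ennreal (indicator ?E f))) path_space (shift t))"
  then have B [measurable]: "B \<in> sets path_space" by simp
  have "emeasure (distr (density (L i) (\<lambda>f. ennreal (indicator ?E f))) path_space (shift t)) B =
    emeasure (density (L i) (\<lambda>f. ennreal (indicator ?E f))) (shift t -` B \<inter> space (L i))"
    by (subst emeasure_distr) (simp_all)
  also have "\<dots> = (\<integral>\<^sup>+f. ennreal (indicator ?E f) * indicator (shift t -` B \<inter> space (L i)) f \<partial>L i)"
    by (rule emeasure_density) measurable
  also have "\<dots> = (\<integral>\<^sup>+f. indicator {f\<in>A. f t = k \<and> shift t f \<in> B} f \<partial>L i)"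
    using AS by (intro nn_integral_cong) (auto simp: indicator_def)
  also have "\<dots> = emeasure (L i) {f\<in>A. f t = k \<and> shift t f \<in> B}"
  proof (rule nn_integral_indicator)
    have "{f\<in>A. f t = k \<and> shift t f \<in> B} = ?E \<inter> (shift t -` B \<inter> space (L i))" using AS by auto
    then show "{f\<in>A. f t = k \<and> shift t f \<in> B} \<in> sets (L i)" by (simp only:) measurable
  qed
  also have "\<dots> = ennreal (measure (L i) ?E * measure (L k) B)"
    by (simp add: L.emeasure_eq_measure markov[OF t A B])
  also have "\<dots> = emeasure (density (L k) (\<lambda>_. ennreal (measure (L i) ?E))) B"
    using B by (subst emeasure_density_const) (simp_all add: sets_L L.emeasure_eq_measure ennreal_mult)
  finally show "emeasure (distr (density (L i) (\<lambda>f. ennreal (indicator ?E f))) path_space (shift t)) B =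
    emeasure (density (L k) (\<lambda>_. ennreal (measure (L i) ?E))) B" .
qed (simp add: sets_L)

lemma indicator_coordinate_measurable:
  assumes t: "0 \<le> t" and A: "A \<in> sets path_space"
  shows "{f\<in>A. f t = k} \<in> sets (L i)"
proof -
  have "{f\<in>A. f t = k} = A \<inter> {f. step_path f \<and> f t = k}" using sets.sets_into_space[OF A] by auto
  then show ?thesis using A coordinate_sets[OF t, of k] by (simp add: sets_L sets.Int)
qed

lemma markov_nn_integral:
  assumes t: "0 \<le> t" and A: "A \<in> sets path_space" "determined t A" and G: "G \<in> borel_measurable path_space"
  shows "(\<integral>\<^sup>+f. indicator {f\<in>A. f t = k} f * G (shift t f) \<partial>L i) =
    ennreal (measure (L i) {f\<in>A. f t = k}) * (\<integral>\<^sup>+f. G f \<partial>L k)"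
proof -
  let ?E = "{f\<in>A. f t = k}"
  note G [measurable] and indicator_coordinate_measurable[OF t A(1), of k i, measurable]
  have G' [measurable]: "G \<in> borel_measurable (L k)" for k using G by (rule measurable_L)
  have [measurable]: "shift t \<in> L i \<rightarrow>\<^sub>M path_space" using measurable_shift[OF t] by (rule measurable_L)
  have "(\<integral>\<^sup>+f. G f \<partial>distr (density (L i) (\<lambda>f. ennreal (indicator ?E f))) path_space (shift t)) =
    (\<integral>\<^sup>+f. G (shift t f) \<partial>density (L i) (\<lambda>f. ennreal (indicator ?E f)))"
    by (rule nn_integral_distr) measurable
  also have "\<dots> = (\<integral>\<^sup>+f. ennreal (indicator ?E f) * G (shift t f) \<partial>L i)"
    by (rule nn_integral_density) measurable
  also have "\<dots> = (\<integral>\<^sup>+f. indicator ?E f * G (shift t f) \<partial>L i)"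
    by (intro nn_integral_cong) (simp add: indicator_def)
  finally have "(\<integral>\<^sup>+f. indicator ?E f * G (shift t f) \<partial>L i) =
    (\<integral>\<^sup>+f. G f \<partial>density (L k) (\<lambda>_. ennreal (measure (L i) ?E)))"
    unfolding markov_measure[OF t A] by simp
  also have "\<dots> = (\<integral>\<^sup>+f. ennreal (measure (L i) ?E) * G f \<partial>L k)"
    by (rule nn_integral_density) measurable
  also have "\<dots> = ennreal (measure (L i) ?E) * (\<integral>\<^sup>+f. G f \<partial>L k)"
    by (rule nn_integral_cmult) measurable
  finally show ?thesis .
qed

lemma markov_integral:
  fixes G :: "(real \<Rightarrow> 's) \<Rightarrow> real"
  assumes t: "0 \<le> t" and A: "A \<in> sets path_space" "determined t A" and G: "G \<in> borel_measurable path_space"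
  shows "(\<integral>f. indicator {f\<in>A. f t = k} f * G (shift t f) \<partial>L i) =
    measure (L i) {f\<in>A. f t = k} * (\<integral>f. G f \<partial>L k)"
proof -
  define E where "E = {f\<in>A. f t = k}"
  have E [measurable]: "E \<in> sets (L i)" unfolding E_def by (rule indicator_coordinate_measurable[OF t A(1)])
  note G [measurable]
  have G' [measurable]: "G \<in> borel_measurable (L k)" for k using G by (rule measurable_L)
  have sh [measurable]: "shift t \<in> L i \<rightarrow>\<^sub>M path_space" using measurable_shift[OF t] by (rule measurable_L)
  have "(\<integral>f. G f \<partial>distr (density (L i) (\<lambda>f. ennreal (indicator E f))) path_space (shift t)) =
    (\<integral>f. G (shift t f) \<partial>density (L i) (\<lambda>f. ennreal (indicator E f)))"
    by (rule integral_distr) measurable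
  also have "\<dots> = (\<integral>f. indicator E f *\<^sub>R G (shift t f) \<partial>L i)"
    by (rule integral_density) simp_all
  finally have "(\<integral>f. indicator E f * G (shift t f) \<partial>L i) =
    (\<integral>f. G f \<partial>density (L k) (\<lambda>_. ennreal (measure (L i) E)))"
    unfolding E_def markov_measure[OF t A] by simp
  also have "\<dots> = (\<integral>f. measure (L i) E *\<^sub>R G f \<partial>L k)"
    by (rule integral_density) simp_all
  finally show ?thesis by (simp add: E_def)
qed

text \<open>Allows a weight \<open>F\<close> of the past that is not an indicator. The condition on
  \<open>F\<close> says that it depends on the stopped path only, so it suffices to compare the
  images under \<open>stop t\<close> of two measures, with and without the factor
  \<open>G\<close>.\<close>

lemma markov_product:
  assumes t: "0 \<le> t" and F: "F \<in> borel_measurable path_space" and F_stop: "\<And>f. step_path f \<Longrightarrow> F (stop t f) = F f"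
    and G: "G \<in> borel_measurable path_space"
  shows "(\<integral>\<^sup>+f. F f * (indicator {f. step_path f \<and> f t = k} f * G (shift t f)) \<partial>L i) =
    (\<integral>\<^sup>+f. F f * indicator {f. step_path f \<and> f t = k} f \<partial>L i) * (\<integral>\<^sup>+f. G f \<partial>L k)"
proof -
  let ?E = "{f. step_path f \<and> f t = k}"
  let ?g = "\<integral>\<^sup>+f. G f \<partial>L k"
  note F [measurable] G [measurable]
  have E [measurable]: "?E \<in> sets (L i)" using coordinate_sets[OF t] by (simp add: sets_L)
  have [measurable]: "F \<in> borel_measurable (L i)" using F by (rule measurable_L)
  have [measurable]: "shift t \<in> L i \<rightarrow>\<^sub>M path_space" "stop t \<in> L i \<rightarrow>\<^sub>M path_space"
    using measurable_shift[OF t] measurable_stop[OF t] by (auto intro: measurable_L)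
  let ?M = "density (L i) (\<lambda>f. indicator ?E f * G (shift t f))"
  let ?N = "density (L i) (indicator ?E)"
  have st: "stop t \<in> ?M \<rightarrow>\<^sub>M path_space" "stop t \<in> ?N \<rightarrow>\<^sub>M path_space" by measurable
  have eq: "distr ?M path_space (stop t) = density (distr ?N path_space (stop t)) (\<lambda>_. ?g)"
  proof (rule measure_eqI)
    fix C assume "C \<in> sets (distr ?M path_space (stop t))"
    then have C [measurable]: "C \<in> sets path_space" by simp
    let ?A = "{f. step_path f \<and> stop t f \<in> C}"
    have A_eq: "?A = stop t -` C \<inter> space (L i)" by auto
    have A: "?A \<in> sets path_space"
      using measurable_sets[OF measurable_stop[OF t] C] by (simp add: vimage_def Int_def conj_commute)
    have A' [measurable]: "?A \<in> sets (L i)" using A by (simp add: sets_L)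
    have det: "determined t ?A"
    proof (rule determinedI)
      fix f g assume fg: "agree t f g" and "f \<in> ?A"
      moreover have "stop t f = stop t g" using fg t by (auto simp: agree_def stop_def)
      ultimately show "g \<in> ?A" using agree_path(2)[OF fg] by simp
    qed
    have "emeasure (distr ?M path_space (stop t)) C = emeasure ?M ?A"
      unfolding A_eq using st(1) by (subst emeasure_distr) (simp_all)
    also have "\<dots> = (\<integral>\<^sup>+f. (indicator ?E f * G (shift t f)) * indicator ?A f \<partial>L i)"
      by (rule emeasure_density) measurable
    also have "\<dots> = (\<integral>\<^sup>+f. indicator {f\<in>?A. f t = k} f * G (shift t f) \<partial>L i)"
      by (intro nn_integral_cong) (auto simp: indicator_def)
    also have "\<dots> = ennreal (measure (L i) {f\<in>?A. f t = k}) * ?g"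
      by (rule markov_nn_integral[OF t A det G])
    also have "ennreal (measure (L i) {f\<in>?A. f t = k}) = emeasure (L i) (?E \<inter> ?A)"
      unfolding L.emeasure_eq_measure by (intro arg_cong[where f="\<lambda>A. ennreal (measure (L i) A)"]) auto
    also have "\<dots> = (\<integral>\<^sup>+f. indicator (?E \<inter> ?A) f \<partial>L i)"
      by (rule nn_integral_indicator[symmetric]) (rule sets.Int[OF E A'])
    also have "\<dots> = (\<integral>\<^sup>+f. indicator ?E f * indicator ?A f \<partial>L i)"
      by (simp only: indicator_inter_arith)
    also have "\<dots> = emeasure ?N ?A" by (rule emeasure_density[symmetric]) measurable
    also have "\<dots> = emeasure (distr ?N path_space (stop t)) C"
      unfolding A_eq using st(2) by (subst emeasure_distr) (simp_all)
    also have "\<dots> * ?g = emeasure (density (distr ?N path_space (stop t)) (\<lambda>_. ?g)) C"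
      by (subst emeasure_density_const) (simp_all add: mult.commute)
    finally show "emeasure (distr ?M path_space (stop t)) C = emeasure (density (distr ?N path_space (stop t)) (\<lambda>_. ?g)) C" .
  qed simp
  have "(\<integral>\<^sup>+f. F f \<partial>distr ?M path_space (stop t)) = (\<integral>\<^sup>+f. F (stop t f) \<partial>?M)"
    by (rule nn_integral_distr[OF st(1)]) measurable
  also have "\<dots> = (\<integral>\<^sup>+f. (indicator ?E f * G (shift t f)) * F (stop t f) \<partial>L i)"
    by (rule nn_integral_density) measurable
  also have "\<dots> = (\<integral>\<^sup>+f. F f * (indicator ?E f * G (shift t f)) \<partial>L i)"
    by (intro nn_integral_cong) (simp add: F_stop mult.commute)
  finally have 1: "(\<integral>\<^sup>+f. F f \<partial>distr ?M path_space (stop t)) = (\<integral>\<^sup>+f. F f * (indicator ?E f * G (shift t f)) \<partial>L i)" .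
  have "(\<integral>\<^sup>+f. F f \<partial>density (distr ?N path_space (stop t)) (\<lambda>_. ?g)) = (\<integral>\<^sup>+f. ?g * F f \<partial>distr ?N path_space (stop t))"
    by (rule nn_integral_density) measurable
  also have "\<dots> = ?g * (\<integral>\<^sup>+f. F f \<partial>distr ?N path_space (stop t))"
    by (rule nn_integral_cmult) measurable
  also have "(\<integral>\<^sup>+f. F f \<partial>distr ?N path_space (stop t)) = (\<integral>\<^sup>+f. F (stop t f) \<partial>?N)"
    by (rule nn_integral_distr[OF st(2)]) measurable
  also have "\<dots> = (\<integral>\<^sup>+f. indicator ?E f * F (stop t f) \<partial>L i)"
    by (rule nn_integral_density) measurable
  also have "\<dots> = (\<integral>\<^sup>+f. F f * indicator ?E f \<partial>L i)"
    by (intro nn_integral_cong) (simp add: F_stop mult.commute)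
  finally show ?thesis using 1 eq by (simp add: mult.commute)
qed

lemma lev_measurable_L [measurable]: "(\<lambda>f. lev c f t) \<in> borel_measurable (L i)"
  by (rule measurable_L) measurable

lemma vec_coordinate_measurable: "0 \<le> t \<Longrightarrow> (\<lambda>f. (h :: real^'s) $ f t) \<in> borel_measurable path_space"
  by (rule measurable_compose[OF measurable_coordinate]) simp_all

lemma vec_coordinate_measurable_L: "0 \<le> t \<Longrightarrow> (\<lambda>f. (h :: real^'s) $ f t) \<in> borel_measurable (L i)"
  by (rule measurable_L, rule vec_coordinate_measurable)

lemma integrable_vec_coordinate: "0 \<le> t \<Longrightarrow> integrable (L i) (\<lambda>f. (h :: real^'s) $ f t)"
  by (rule L.integrable_const_bound[where B="norm h"]) (auto simp: component_le_norm_cart vec_coordinate_measurable_L)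

lemma integrable_lev: "0 \<le> t \<Longrightarrow> integrable (L i) (\<lambda>f. lev c f t)"
  by (rule L.integrable_const_bound[where B="norm c * t"]) (auto simp: lev_bound)

lemma integral_vec_coordinate:
  assumes t: "0 \<le> t"
  shows "(\<integral>f. (h :: real^'s) $ f t \<partial>L k) = (\<Sum>l\<in>UNIV. trans t k l * h $ l)"
proof -
  let ?E = "\<lambda>l. {f. step_path f \<and> f t = l}"
  have E [measurable]: "?E l \<in> sets (L k)" for l using coordinate_sets[OF t] by (simp add: sets_L)
  have "(\<integral>f. h $ f t \<partial>L k) = (\<integral>f. (\<Sum>l\<in>UNIV. indicator (?E l) f * h $ l) \<partial>L k)"
  proof (intro Bochner_Integration.integral_cong refl)
    fix f assume f: "f \<in> space (L k)"
    have "(\<Sum>l\<in>UNIV. indicator (?E l) f * h $ l) = (\<Sum>l\<in>UNIV. if l = f t then h $ l else 0)"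
      using f by (intro sum.cong) (auto simp: indicator_def)
    then show "h $ f t = (\<Sum>l\<in>UNIV. indicator (?E l) f * h $ l)" by simp
  qed
  also have "\<dots> = (\<Sum>l\<in>UNIV. measure (L k) (?E l) * h $ l)"
  proof -
    have "integrable (L k) (\<lambda>f. indicator (?E l) f * h $ l)" for l
      by (intro integrable_mult_left integrable_real_indicator E) (simp add: L.emeasure_eq_measure)
    then have "(\<integral>f. (\<Sum>l\<in>UNIV. indicator (?E l) f * h $ l) \<partial>L k) = (\<Sum>l\<in>UNIV. \<integral>f. indicator (?E l) f * h $ l \<partial>L k)"
      by (rule Bochner_Integration.integral_sum)
    moreover have "(\<integral>f. indicator (?E l) f * h $ l \<partial>L k) = measure (L k) (?E l) * h $ l" for l
      by (simp only: integral_mult_left_zero Bochner_Integration.integral_indicator) (simp add: Int_def conj_commute)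
    ultimately show ?thesis by (simp only:)
  qed
  finally show ?thesis by (simp add: measure_coordinate[OF t])
qed

text \<open>The level equals \<open>c $ k * t\<close> unless phase \<open>k\<close> is left before
  \<open>t\<close>; this has probability at most \<open>K * t\<close>, and the error is then at most
  \<open>2 * norm c * t\<close>.\<close>

lemma integral_lev: "\<exists>C\<ge>0. \<forall>t k. 0 \<le> t \<longrightarrow> \<bar>(\<integral>f. lev c f t \<partial>L k) - c $ k * t\<bar> \<le> C * t\<^sup>2"
proof -
  obtain K where K: "0 \<le> K" "\<And>u k. 0 \<le> u \<Longrightarrow> 1 - K * u \<le> measure (L k) (stay k u)"
    using stay_prob by blast
  have "\<bar>(\<integral>f. lev c f t \<partial>L k) - c $ k * t\<bar> \<le> (2 * norm c * K) * t\<^sup>2" if t: "0 \<le> t" for t k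
  proof -
    let ?N = "space (L k) - stay k t"
    have N [measurable]: "?N \<in> sets (L k)" by (intro sets.Diff sets.top) (simp add: sets_L stay_sets[OF t])
    have mN: "measure (L k) ?N \<le> K * t"
      using K(2)[OF t, of k] L.prob_compl[of "stay k t" k] stay_sets[OF t, of k] by (simp add: sets_L)
    have "(\<integral>f. lev c f t \<partial>L k) - c $ k * t = (\<integral>f. lev c f t - c $ k * t \<partial>L k)"
      using integrable_lev[OF t] L.prob_space[of k] by (simp add: Bochner_Integration.integral_diff)
    also have "\<bar>\<dots>\<bar> \<le> (\<integral>f. \<bar>lev c f t - c $ k * t\<bar> \<partial>L k)" by (rule integral_abs_bound)
    also have "\<dots> \<le> (\<integral>f. (2 * norm c * t) * indicator ?N f \<partial>L k)"
    proof (rule integral_mono)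
      show "integrable (L k) (\<lambda>f. \<bar>lev c f t - c $ k * t\<bar>)" using integrable_lev[OF t] by simp
      show "integrable (L k) (\<lambda>f. (2 * norm c * t) * indicator ?N f)"
        by (intro integrable_mult_right integrable_real_indicator N) (simp add: L.emeasure_eq_measure)
      fix f assume "f \<in> space (L k)"
      then have f: "step_path f" by simp
      show "\<bar>lev c f t - c $ k * t\<bar> \<le> (2 * norm c * t) * indicator ?N f"
      proof (cases "f \<in> stay k t")
        case True
        then have "lev c f t = c $ k * t" by (intro lev_const[OF f t]) (simp add: stay_def)
        then show ?thesis using True by simp
      next
        case False
        have "\<bar>c $ k * t\<bar> \<le> norm c * t" using t component_le_norm_cart[of c k] by (simp add: abs_mult mult_right_mono)
        then show ?thesis using lev_bound[OF f t, of c] False f by (simp add: abs_le_iff)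
      qed
    qed
    also have "\<dots> = (2 * norm c * t) * measure (L k) ?N" by (simp del: space_L)
    also have "\<dots> \<le> (2 * norm c * t) * (K * t)" using mN t by (intro mult_left_mono) auto
    finally show ?thesis by (simp add: power2_eq_square ac_simps)
  qed
  then show ?thesis using K by (intro exI[of _ "2 * norm c * K"]) auto
qed

text \<open>First-order action of the generator of the pair (level, phase) on the function
  \<open>X + h(\<phi>)\<close>, with an error that is quadratic uniformly in the phase.\<close>

lemma drift_estimate:
  fixes h :: "real^'s"
  shows "\<exists>C\<ge>0. \<forall>t k. 0 \<le> t \<longrightarrow> t \<le> 1 \<longrightarrow>
    \<bar>(\<integral>f. lev c f t + h $ f t \<partial>L k) - h $ k - t * (c $ k + (Q *v h) $ k)\<bar> \<le> C * t\<^sup>2"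
proof -
  obtain C1 where C1: "0 \<le> C1" "\<And>t k. 0 \<le> t \<Longrightarrow> \<bar>(\<integral>f. lev c f t \<partial>L k) - c $ k * t\<bar> \<le> C1 * t\<^sup>2"
    using integral_lev[of c] by blast
  obtain C2 where C2: "0 \<le> C2" "\<And>t i j. 0 \<le> t \<Longrightarrow> t \<le> 1 \<Longrightarrow> \<bar>trans t i j - of_bool (i = j) - t * Q $ i $ j\<bar> \<le> C2 * t\<^sup>2"
    using trans_expansion by blast
  let ?C = "C1 + real CARD('s) * (C2 * norm h)"
  have "\<bar>(\<integral>f. lev c f t + h $ f t \<partial>L k) - h $ k - t * (c $ k + (Q *v h) $ k)\<bar> \<le> ?C * t\<^sup>2"
    if t: "0 \<le> t" "t \<le> 1" for t k
  proof -
    have "(\<integral>f. lev c f t + h $ f t \<partial>L k) = (\<integral>f. lev c f t \<partial>L k) + (\<Sum>l\<in>UNIV. trans t k l * h $ l)"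
      using integrable_lev[OF t(1)] integrable_vec_coordinate[OF t(1)] by (simp add: integral_vec_coordinate[OF t(1)])
    moreover have "\<bar>(\<Sum>l\<in>UNIV. trans t k l * h $ l) - h $ k - t * (Q *v h) $ k\<bar> \<le> real CARD('s) * (C2 * norm h) * t\<^sup>2"
    proof -
      have "h $ k = (\<Sum>l\<in>UNIV. of_bool (k = l) * h $ l)"
        by (simp add: of_bool_def if_distrib[of "\<lambda>x. x * _"] cong: if_cong)
      then have "(\<Sum>l\<in>UNIV. trans t k l * h $ l) - h $ k - t * (Q *v h) $ k =
        (\<Sum>l\<in>UNIV. (trans t k l - of_bool (k = l) - t * Q $ k $ l) * h $ l)"
        by (simp add: matrix_vector_mult_def sum_distrib_left sum_subtractf left_diff_distrib mult.assoc)
      also have "\<bar>\<dots>\<bar> \<le> (\<Sum>l\<in>(UNIV::'s set). C2 * t\<^sup>2 * norm h)"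
      proof (rule order_trans[OF sum_abs sum_mono])
        fix l
        have "\<bar>trans t k l - of_bool (k = l) - t * Q $ k $ l\<bar> * \<bar>h $ l\<bar> \<le> (C2 * t\<^sup>2) * norm h"
          using C2(1) by (intro mult_mono C2(2)[OF t] component_le_norm_cart) auto
        then show "\<bar>(trans t k l - of_bool (k = l) - t * Q $ k $ l) * h $ l\<bar> \<le> C2 * t\<^sup>2 * norm h"
          by (simp only: abs_mult)
      qed
      finally show ?thesis by (simp add: ac_simps)
    qed
    moreover have "c $ k * t = t * c $ k" by simp
    ultimately show ?thesis using C1(2)[OF t(1), of k] by (simp add: algebra_simps abs_le_iff)
  qed
  then show ?thesis using C1 C2 by (intro exI[of _ ?C]) auto
qed

end


section \<open>Escape from an interval\<close>

context phase_chain
begin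

section \<open>Almost sure escape and optional stopping\<close>

definition no_exit :: "real^'s \<Rightarrow> real \<Rightarrow> real \<Rightarrow> real \<Rightarrow> (real \<Rightarrow> 's) set" where
  "no_exit c a b u = {f. step_path f \<and> ereal u \<le> down_time c a f \<and> ereal u \<le> down_time (- c) b f}"

lemma no_exit_sets: "no_exit c a b u \<in> sets path_space"
  unfolding no_exit_def by (rule path_setI) measurable

lemma determined_no_exit: "determined u (no_exit c a b u)"
  unfolding no_exit_def by (rule determined_down_time_ge)

lemma no_exit_level:
  assumes "f \<in> no_exit c a b u" "0 \<le> a" "0 \<le> b" "0 \<le> t" "t \<le> u"
  shows "- a \<le> lev c f t" "lev c f t \<le> b"
proof -
  have f: "step_path f" and u: "ereal u \<le> down_time c a f" "ereal u \<le> down_time (- c) b f"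
    using assms(1) by (auto simp: no_exit_def)
  have "ereal t \<le> ereal u" using assms by simp
  then have "ereal t \<le> down_time c a f" "ereal t \<le> down_time (- c) b f" using u by (meson order_trans)+
  then show "- a \<le> lev c f t" "lev c f t \<le> b"
    using level_before_down_time[of t c a f] level_before_down_time[of t "- c" b f] f assms by (simp_all add: lev_minus)
qed

text \<open>From any phase the chain is in \<open>p\<close> at time 1 and then stays there for time
  \<open>r\<close>, with a probability bounded away from 0 because there are finitely many
  phases.\<close>

lemma level_exceeds:
  assumes p: "0 < c $ p" and M: "0 \<le> M"
  shows "\<exists>u>0. \<exists>e>0. \<forall>k. e \<le> measure (L k) {f. step_path f \<and> M < lev c f u}"
proof -
  \<comment> \<open>The climb has to compensate a loss of up to \<open>norm c\<close> during the
    first unit of time; the last summand makes the inequality strict.\<close>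
  define r where "r = (M + norm c + 1) / c $ p"
  have r: "0 < r" "c $ p * r = M + norm c + 1" using p M by (auto simp: r_def add_nonneg_pos)
  define e where "e = Min (range (\<lambda>k. trans 1 k p * measure (L p) (stay p r)))"
  have "0 < e" unfolding e_def using r by (subst Min_gr_iff) (auto simp: trans_pos stay_pos)
  moreover have "e \<le> measure (L k) {f. step_path f \<and> M < lev c f (1 + r)}" for k
  proof -
    let ?A = "{f. step_path f \<and> f 1 = p}"
    have A: "?A \<in> sets path_space" by (rule coordinate_sets) simp
    have det: "determined 1 ?A" by (rule determinedI) (simp add: agree_def)
    have "e \<le> trans 1 k p * measure (L p) (stay p r)" unfolding e_def by (rule Min_le) auto
    also have "\<dots> = measure (L k) {f\<in>?A. shift 1 f \<in> stay p r}"
    proof -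
      have "measure (L k) {f\<in>?A. shift 1 f \<in> stay p r} = measure (L k) ?A * measure (L p) (stay p r)"
        by (rule measure_shift[OF _ A det _ stay_sets]) (use r in auto)
      then show ?thesis using measure_coordinate[of 1 k p] by simp
    qed
    also have "\<dots> \<le> measure (L k) {f. step_path f \<and> M < lev c f (1 + r)}"
    proof (rule L.finite_measure_mono)
      show "{f\<in>?A. shift 1 f \<in> stay p r} \<subseteq> {f. step_path f \<and> M < lev c f (1 + r)}"
      proof
        fix f assume f: "f \<in> {f\<in>?A. shift 1 f \<in> stay p r}"
        then have sp: "step_path f" by simp
        have "lev c (shift 1 f) r = c $ p * r"
          using f r step_path_shift[OF sp] by (intro lev_const) (auto simp: stay_def)
        moreover have "- norm c \<le> lev c f 1" using lev_bound[OF sp, of 1 c] by simp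
        ultimately show "f \<in> {f. step_path f \<and> M < lev c f (1 + r)}"
          using lev_shift[OF sp, of 1 r c] r sp by simp
      qed
      show "{f. step_path f \<and> M < lev c f (1 + r)} \<in> sets (L k)"
        unfolding sets_L by (rule path_setI) measurable
    qed
    finally show ?thesis .
  qed
  moreover have "0 < 1 + r" using r by simp
  ultimately show ?thesis by blast
qed

lemma measure_phases:
  assumes t: "0 \<le> t" and A: "A \<in> sets path_space"
  shows "(\<Sum>k\<in>UNIV. measure (L i) {f\<in>A. f t = k}) = measure (L i) A"
proof -
  have "A = (\<Union>k\<in>UNIV. {f\<in>A. f t = k})" by auto
  moreover have "measure (L i) (\<Union>k\<in>UNIV. {f\<in>A. f t = k}) = (\<Sum>k\<in>UNIV. measure (L i) {f\<in>A. f t = k})"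
    by (intro L.finite_measure_finite_Union)
      (auto simp: indicator_coordinate_measurable[OF t A] disjoint_family_on_def)
  ultimately show ?thesis by simp
qed

text \<open>In each period of length \<open>u\<close> the level gains more than \<open>a + b\<close>
  with probability at least \<open>e\<close>, whatever the phase, and no path inside the interval
  survives such a gain. The probability of remaining for \<open>n\<close> periods is at most
  \<open>(1 - e)^n\<close>.\<close>

lemma exit_finite:
  assumes p: "0 < c $ p" and ab: "0 \<le> a" "0 \<le> b"
  shows "AE f in L i. min (down_time c a f) (down_time (- c) b f) < \<infinity>"
proof -
  obtain u e where u: "0 < u" "0 < e" "\<And>k. e \<le> measure (L k) {f. step_path f \<and> a + b < lev c f u}"
    using level_exceeds[OF p, of "a + b"] ab by auto
  let ?V = "\<lambda>n::nat. no_exit c a b (real n * u)"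
  let ?B = "{f. step_path f \<and> \<not> a + b < lev c f u}"
  have B: "?B \<in> sets path_space" by (rule path_setI) measurable
  have mB: "measure (L k) ?B \<le> 1 - e" for k
  proof -
    have "{f. step_path f \<and> a + b < lev c f u} \<in> sets (L k)" unfolding sets_L by (rule path_setI) measurable
    from L.prob_compl[OF this] u(3)[of k] show ?thesis by (simp add: set_diff_eq Collect_conj_eq[symmetric] conj_comms cong: conj_cong)
  qed
  have e1: "e \<le> 1" using u(3)[of i] L.prob_le_1 order_trans by blast
  have V: "measure (L i) (?V n) \<le> (1 - e) ^ n" for n
  proof (induction n)
    case (Suc n)
    let ?t = "real n * u"
    have t: "0 \<le> ?t" using u by simp
    let ?W = "\<lambda>k. {f\<in>?V n. f ?t = k \<and> shift ?t f \<in> ?B}"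
    have "?W k = {f\<in>?V n. f ?t = k} \<inter> {f. step_path f \<and> shift ?t f \<in> ?B}" for k by (auto simp: no_exit_def)
    then have W: "?W k \<in> sets (L i)" for k
      using indicator_coordinate_measurable[OF t no_exit_sets, of c a b ?t k i] shift_sets[OF t B] by (simp only: sets_L sets.Int)
    have "?V (Suc n) \<subseteq> (\<Union>k\<in>UNIV. ?W k)"
    proof
      fix f assume f: "f \<in> ?V (Suc n)"
      then have sp: "step_path f" by (simp add: no_exit_def)
      have split: "real (Suc n) * u = ?t + u" by (simp add: algebra_simps)
      have le: "ereal ?t \<le> ereal (real (Suc n) * u)" using u by (simp add: algebra_simps)
      have "f \<in> ?V n"
        unfolding no_exit_def mem_Collect_eq
        using f[unfolded no_exit_def mem_Collect_eq] order_trans[OF le] by blast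
      moreover have "- a \<le> lev c f ?t" "lev c f (?t + u) \<le> b"
        using no_exit_level[OF f ab, of ?t] no_exit_level[OF f ab, of "?t + u"] u t by (simp_all add: algebra_simps)
      then have "\<not> a + b < lev c (shift ?t f) u" using lev_shift[OF sp t, of u c] u by simp
      ultimately show "f \<in> (\<Union>k\<in>UNIV. ?W k)" using step_path_shift[OF sp t] by simp
    qed
    then have "measure (L i) (?V (Suc n)) \<le> measure (L i) (\<Union>k\<in>UNIV. ?W k)"
      using W by (intro L.finite_measure_mono) auto
    also have "\<dots> \<le> (\<Sum>k\<in>UNIV. measure (L i) (?W k))"
      using W by (intro L.finite_measure_subadditive_finite) auto
    also have "\<dots> = (\<Sum>k\<in>UNIV. measure (L i) {f\<in>?V n. f ?t = k} * measure (L k) ?B)"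
      by (intro sum.cong refl markov[OF t no_exit_sets determined_no_exit B])
    also have "\<dots> \<le> (\<Sum>k\<in>UNIV. measure (L i) {f\<in>?V n. f ?t = k} * (1 - e))"
      using mB by (intro sum_mono mult_left_mono) auto
    also have "\<dots> = measure (L i) (?V n) * (1 - e)"
      unfolding sum_distrib_right[symmetric] measure_phases[OF t no_exit_sets] by simp
    also have "\<dots> \<le> (1 - e) ^ n * (1 - e)" using Suc e1 by (intro mult_right_mono) auto
    finally show ?case by (simp add: mult.commute)
  qed simp
  let ?I = "{f. step_path f \<and> min (down_time c a f) (down_time (- c) b f) = \<infinity>}"
  have I: "?I \<in> sets (L i)" unfolding sets_L by (rule path_setI) measurable
  have "measure (L i) ?I \<le> (1 - e) ^ n" for n
  proof -
    have "?I \<subseteq> ?V n" by (auto simp: no_exit_def min_def split: if_splits)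
    then have "measure (L i) ?I \<le> measure (L i) (?V n)"
      by (intro L.finite_measure_mono) (simp_all add: sets_L no_exit_sets)
    then show ?thesis using V[of n] by linarith
  qed
  moreover have "(\<lambda>n. (1 - e) ^ n) \<longlonglongrightarrow> 0" using u e1 by (intro LIMSEQ_realpow_zero) auto
  ultimately have "measure (L i) ?I \<le> 0" by (intro LIMSEQ_le_const) auto
  then have "measure (L i) ?I = 0" by (simp add: measure_le_0_iff)
  then have "AE f in L i. f \<notin> ?I" using I by (intro AE_not_in) (auto simp: null_sets_def L.emeasure_eq_measure)
  then show ?thesis using AE_space by eventually_elim (auto simp: less_top[symmetric] top_ereal_def)
qed

text \<open>A sum of increments taken only before a stopping index is the value at that index, or at
  the horizon if this comes sooner.\<close>

lemma telescope_min:
  fixes g :: "nat \<Rightarrow> real"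
  shows "(\<Sum>m<N. of_bool (m < k) * (g (Suc m) - g m)) = g (min N k) - g 0"
proof (induction N)
  case (Suc N)
  then show ?case by (cases "N < k") (simp_all only: sum.lessThan_Suc, simp_all add: min_def)
qed simp

text \<open>Conditionally on the phase at \<open>t\<close>, the increment over
  \<open>[t, t + d]\<close> is distributed as the one from time 0, and the weight
  \<open>indicator A\<close> is already known at \<open>t\<close>.\<close>

lemma stopped_increment:
  fixes h :: "real^'s"
  assumes C: "\<And>k. \<bar>(\<integral>f. lev c f d + h $ f d \<partial>L k) - h $ k\<bar> \<le> D" and d: "0 \<le> d" and t: "0 \<le> t"
    and A: "A \<in> sets path_space" "determined t A"
  shows "\<bar>\<integral>f. indicator A f * ((lev c f (t + d) + h $ f (t + d)) - (lev c f t + h $ f t)) \<partial>L i\<bar> \<le> D"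
proof -
  define G where "G f = lev c f d + h $ f d - h $ f 0" for f
  have G: "G \<in> borel_measurable path_space"
    unfolding G_def by (intro borel_measurable_diff borel_measurable_add borel_measurable_lev vec_coordinate_measurable) (use d in auto)
  have [measurable]: "G \<in> borel_measurable (L i)" using G by (rule measurable_L)
  have sh [measurable]: "shift t \<in> L i \<rightarrow>\<^sub>M path_space" using measurable_shift[OF t] by (rule measurable_L)
  have G_bound: "\<bar>G f\<bar> \<le> norm c * d + 2 * norm h" if "step_path f" for f
    using lev_bound[OF that d, of c] component_le_norm_cart[of h "f d"] component_le_norm_cart[of h "f 0"]
    unfolding G_def by linarith
  define E where "E k = {f\<in>A. f t = k}" for k
  have E [measurable]: "E k \<in> sets (L i)" for k unfolding E_def by (rule indicator_coordinate_measurable[OF t A(1)])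
  have AS: "A \<subseteq> {f. step_path f}" using sets.sets_into_space[OF A(1)] by simp
  have mG [measurable]: "(\<lambda>f. G (shift t f)) \<in> borel_measurable (L i)" using measurable_comp[OF sh G] by (simp add: comp_def)
  have int: "integrable (L i) (\<lambda>f. indicator (E k) f * G (shift t f))" for k
  proof (rule L.integrable_const_bound[where B="norm c * d + 2 * norm h"])
    show "AE f in L i. norm (indicator (E k) f * G (shift t f)) \<le> norm c * d + 2 * norm h"
    proof (rule AE_I2)
      fix f assume "f \<in> space (L i)"
      then have "\<bar>G (shift t f)\<bar> \<le> norm c * d + 2 * norm h" by (intro G_bound step_path_shift t) simp
      moreover have "0 \<le> norm c * d + 2 * norm h" using d by simp
      ultimately show "norm (indicator (E k) f * G (shift t f)) \<le> norm c * d + 2 * norm h"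
        by (simp add: indicator_def)
    qed
  qed measurable
  have "(\<integral>f. indicator A f * ((lev c f (t + d) + h $ f (t + d)) - (lev c f t + h $ f t)) \<partial>L i) =
    (\<integral>f. (\<Sum>k\<in>UNIV. indicator (E k) f * G (shift t f)) \<partial>L i)"
  proof (intro Bochner_Integration.integral_cong refl)
    fix f assume "f \<in> space (L i)"
    then have f: "step_path f" by simp
    have "(\<Sum>k\<in>UNIV. indicator (E k) f) = (\<Sum>k\<in>UNIV. if k = f t then indicator A f else 0 :: real)"
      by (intro sum.cong) (auto simp: E_def indicator_def)
    then have "(\<Sum>k\<in>UNIV. indicator (E k) f) = (indicator A f :: real)" by simp
    moreover have "G (shift t f) = (lev c f (t + d) + h $ f (t + d)) - (lev c f t + h $ f t)"
      using lev_shift[OF f t d, of c] by (simp add: G_def shift_apply)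
    ultimately show "indicator A f * ((lev c f (t + d) + h $ f (t + d)) - (lev c f t + h $ f t)) =
      (\<Sum>k\<in>UNIV. indicator (E k) f * G (shift t f))"
      by (simp only: sum_distrib_right[symmetric])
  qed
  also have "\<dots> = (\<Sum>k\<in>UNIV. measure (L i) (E k) * (\<integral>f. G f \<partial>L k))"
  proof -
    have "(\<integral>f. indicator (E k) f * G (shift t f) \<partial>L i) = measure (L i) (E k) * (\<integral>f. G f \<partial>L k)" for k
      unfolding E_def by (rule markov_integral[OF t A G])
    moreover have "(\<integral>f. (\<Sum>k\<in>UNIV. indicator (E k) f * G (shift t f)) \<partial>L i) = (\<Sum>k\<in>UNIV. \<integral>f. indicator (E k) f * G (shift t f) \<partial>L i)"
      using int by (rule Bochner_Integration.integral_sum)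
    ultimately show ?thesis by (simp only:)
  qed
  also have "\<bar>\<dots>\<bar> \<le> (\<Sum>k\<in>UNIV. measure (L i) (E k) * D)"
  proof (rule order_trans[OF sum_abs sum_mono])
    fix k
    have "(\<integral>f. G f \<partial>L k) = (\<integral>f. lev c f d + h $ f d - h $ k \<partial>L k)"
    proof (rule integral_cong_AE)
      show "G \<in> borel_measurable (L k)" using G by (rule measurable_L)
      show "(\<lambda>f. lev c f d + h $ f d - h $ k) \<in> borel_measurable (L k)"
        using vec_coordinate_measurable_L[OF d, of h k] by measurable
      show "AE f in L k. G f = lev c f d + h $ f d - h $ k"
        using AE_start[of k] by eventually_elim (simp add: G_def)
    qed
    also have "\<dots> = (\<integral>f. lev c f d + h $ f d \<partial>L k) - h $ k"
      using integrable_lev[OF d] integrable_vec_coordinate[OF d] L.prob_space[of k] by (simp add: Bochner_Integration.integral_diff)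
    finally have "\<bar>\<integral>f. G f \<partial>L k\<bar> \<le> D" using C[of k] by simp
    then show "\<bar>measure (L i) (E k) * (\<integral>f. G f \<partial>L k)\<bar> \<le> measure (L i) (E k) * D"
      by (simp add: abs_mult mult_left_mono)
  qed
  also have "\<dots> = measure (L i) A * D"
    unfolding sum_distrib_right[symmetric] E_def measure_phases[OF t A(1)] by simp
  also have "\<dots> \<le> 1 * D" using C[of i] by (intro mult_right_mono) auto
  finally show ?thesis by simp
qed

text \<open>The process \<open>X(t) + h(\<phi>(t))\<close> is a martingale; the escape time is approximated from the right by
  dyadic times, and each step of length \<open>2\<^sup>-\<^sup>n\<close> changes the stopped expectation by \<open>O(4\<^sup>-\<^sup>n)\<close>.\<close>

theorem optional_stopping:
  fixes h :: "real^'s"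
  assumes h: "\<And>k. (Q *v h) $ k = - c $ k" and p: "0 < c $ p" and ab: "0 \<le> a" "0 \<le> b"
  shows "(\<Sum>j\<in>UNIV. escape c a b i j * (h $ j - a)) + (\<Sum>j\<in>UNIV. escape (- c) b a i j * (h $ j + b)) = h $ i"
    and "(\<Sum>j\<in>UNIV. escape c a b i j) + (\<Sum>j\<in>UNIV. escape (- c) b a i j) = 1"
proof -
  define T where "T f = min (down_time c a f) (down_time (- c) b f)" for f
  define M where "M f t = lev c f t + h $ f t" for f t
  \<comment> \<open>The value of \<open>M\<close> at the escape time, where the level is exactly
    \<open>- a\<close> or \<open>b\<close>, written through the escape events.\<close>
  define W where "W f = (\<Sum>j\<in>UNIV. indicator (escape_event c a b j) f * (h $ j - a)) +
    (\<Sum>j\<in>UNIV. indicator (escape_event (- c) b a j) f * (h $ j + b))" for f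
  \<comment> \<open>The increments of \<open>M\<close> over grid steps that begin no later than the
    escape, up to the horizon \<open>n\<close>; the sum telescopes to \<open>M\<close> at the
    rounded escape time minus its initial value.\<close>
  define S where "S n f = (\<Sum>m<n * 2^n. indicator (no_exit c a b (real m / 2^n)) f * (M f (real (Suc m) / 2^n) - M f (real m / 2^n)))" for n f
  have esc [measurable]: "escape_event c a b j \<in> sets (L i)" "escape_event (- c) b a j \<in> sets (L i)" for j
    by (simp_all add: sets_L escape_event_sets)
  have M_meas: "(\<lambda>f. M f t) \<in> borel_measurable (L i)" if "0 \<le> t" for t
    unfolding M_def using vec_coordinate_measurable_L[OF that, of h i] by measurable
  have M_bound: "\<bar>M f t\<bar> \<le> norm c * t + norm h" if "step_path f" "0 \<le> t" for f t
    using lev_bound[OF that, of c] component_le_norm_cart[of h "f t"] unfolding M_def by linarith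
  have exit_path: "\<exists>r\<ge>0. T f = ereal r \<and> W f = M f r \<and>
      (\<Sum>j\<in>UNIV. indicator (escape_event c a b j) f) + (\<Sum>j\<in>UNIV. indicator (escape_event (- c) b a j) f) = (1 :: real)"
    if f: "step_path f" and fin: "T f < \<infinity>" for f
  proof (cases "down_time c a f < down_time (- c) b f")
    case True
    then have "down_time c a f < \<infinity>" using less_le_trans[OF True, of \<infinity>] by simp
    then obtain r where r: "0 \<le> r" "down_time c a f = ereal r" by (rule down_time_finiteE)
    have "f \<in> escape_event c a b j \<longleftrightarrow> j = f r" for j using True r f by (auto simp: escape_event_def)
    moreover have "f \<notin> escape_event (- c) b a j" for j using True by (auto simp: escape_event_def)
    moreover have "T f = ereal r" using True r by (simp add: T_def min_absorb1 less_imp_le)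
    moreover have "lev c f r = - a" by (rule at_down_time(1)[OF r(2) ab(1) f])
    ultimately show ?thesis using r by (intro exI[of _ r]) (simp add: W_def M_def indicator_def of_bool_def if_distrib[of "\<lambda>x. x * _"] cong: if_cong)
  next
    case False
    then have le: "down_time (- c) b f \<le> down_time c a f" by simp
    then have fin2: "down_time (- c) b f < \<infinity>" using fin by (simp add: T_def min_def split: if_splits)
    then obtain r where r: "0 \<le> r" "down_time (- c) b f = ereal r" by (rule down_time_finiteE)
    have less: "down_time (- c) b f < down_time c a f"
      using le down_times_neq[OF f ab(2,1) fin2] by simp
    have "f \<in> escape_event (- c) b a j \<longleftrightarrow> j = f r" for j using less r f by (auto simp: escape_event_def)
    moreover have "f \<notin> escape_event c a b j" for j using less by (auto simp: escape_event_def)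
    moreover have "T f = ereal r" using less r by (simp add: T_def min_absorb2 less_imp_le)
    moreover have "lev c f r = b" using at_down_time(1)[OF r(2) ab(2) f] by (simp add: lev_minus)
    ultimately show ?thesis using r by (intro exI[of _ r]) (simp add: W_def M_def indicator_def of_bool_def if_distrib[of "\<lambda>x. x * _"] cong: if_cong)
  qed
  have ae: "AE f in L i. T f < \<infinity>" unfolding T_def by (rule exit_finite[OF p ab])
  have int_ind: "integrable (L i) (\<lambda>f. indicator (escape_event c a b j) f * (x::real))"
    "integrable (L i) (\<lambda>f. indicator (escape_event (- c) b a j) f * (x::real))" for j x
    by (intro integrable_mult_left integrable_real_indicator esc; simp add: L.emeasure_eq_measure)+
  have ind: "(\<integral>f. indicator E f * x \<partial>L i) = measure (L i) E * x" if "E \<in> sets (L i)" for E and x :: real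
    using sets.sets_into_space[OF that] by (simp only: integral_mult_left_zero Bochner_Integration.integral_indicator Int_absorb2)
  show "(\<Sum>j\<in>UNIV. escape c a b i j) + (\<Sum>j\<in>UNIV. escape (- c) b a i j) = 1"
  proof -
    have "(\<integral>f. (\<Sum>j\<in>UNIV. indicator (escape_event c a b j) f * 1) + (\<Sum>j\<in>UNIV. indicator (escape_event (- c) b a j) f * 1) \<partial>L i) = (\<integral>f. (1::real) \<partial>L i)"
    proof (rule integral_cong_AE)
      show "AE f in L i. (\<Sum>j\<in>UNIV. indicator (escape_event c a b j) f * 1) + (\<Sum>j\<in>UNIV. indicator (escape_event (- c) b a j) f * 1) = (1::real)"
        using ae AE_space by eventually_elim (use exit_path in auto)
    qed measurable
    also have "\<dots> = 1" using L.prob_space[of i] by simp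
    also have "(\<integral>f. (\<Sum>j\<in>UNIV. indicator (escape_event c a b j) f * 1) + (\<Sum>j\<in>UNIV. indicator (escape_event (- c) b a j) f * 1) \<partial>L i) =
      (\<Sum>j\<in>UNIV. (\<integral>f. indicator (escape_event c a b j) f * 1 \<partial>L i)) + (\<Sum>j\<in>UNIV. (\<integral>f. indicator (escape_event (- c) b a j) f * (1::real) \<partial>L i))"
      using int_ind[of _ 1] by (simp only: Bochner_Integration.integral_add Bochner_Integration.integrable_sum Bochner_Integration.integral_sum)
    finally show ?thesis unfolding ind[OF esc(1)] ind[OF esc(2)] unfolding mult_1_right escape_def .
  qed
  have W_int: "(\<integral>f. W f \<partial>L i) = (\<Sum>j\<in>UNIV. escape c a b i j * (h $ j - a)) + (\<Sum>j\<in>UNIV. escape (- c) b a i j * (h $ j + b))"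
    unfolding W_def using int_ind
    by (simp only: Bochner_Integration.integral_add Bochner_Integration.integrable_sum Bochner_Integration.integral_sum ind[OF esc(1)] ind[OF esc(2)] escape_def)
  have W_meas [measurable]: "W \<in> borel_measurable (L i)" unfolding W_def by measurable
  have W_integrable: "integrable (L i) W"
    unfolding W_def using int_ind by (intro Bochner_Integration.integrable_add Bochner_Integration.integrable_sum)
  obtain C where C: "0 \<le> C" "\<And>t k. 0 \<le> t \<Longrightarrow> t \<le> 1 \<Longrightarrow>
      \<bar>(\<integral>f. lev c f t + h $ f t \<partial>L k) - h $ k - t * (c $ k + (Q *v h) $ k)\<bar> \<le> C * t\<^sup>2"
    using drift_estimate[of c h] by blast
  have step: "\<bar>(\<integral>f. lev c f d + h $ f d \<partial>L k) - h $ k\<bar> \<le> C * d\<^sup>2" if "0 \<le> d" "d \<le> 1" for d k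
    using C(2)[OF that, of k] h[of k] by simp
  have term_int: "integrable (L i) (\<lambda>f. indicator (no_exit c a b t) f * (M f s - M f t))" if st: "0 \<le> t" "0 \<le> s" for s t
  proof (rule L.integrable_const_bound[where B="norm c * s + norm c * t + 2 * norm h"])
    show "AE f in L i. norm (indicator (no_exit c a b t) f * (M f s - M f t)) \<le> norm c * s + norm c * t + 2 * norm h"
    proof (rule AE_I2)
      fix f assume "f \<in> space (L i)"
      then have f: "step_path f" by simp
      have "0 \<le> norm c * s + norm c * t + 2 * norm h" using st by simp
      moreover have "\<bar>M f s - M f t\<bar> \<le> norm c * s + norm c * t + 2 * norm h"
        using M_bound[OF f st(1)] M_bound[OF f st(2)] by linarith
      ultimately show "norm (indicator (no_exit c a b t) f * (M f s - M f t)) \<le> norm c * s + norm c * t + 2 * norm h"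
        by (simp add: indicator_def)
    qed
    have "no_exit c a b t \<in> sets (L i)" by (simp add: sets_L no_exit_sets)
    then show "(\<lambda>f. indicator (no_exit c a b t) f * (M f s - M f t)) \<in> borel_measurable (L i)"
      using M_meas[OF st(1)] M_meas[OF st(2)] by measurable
  qed
  have S_int: "\<bar>\<integral>f. S n f \<partial>L i\<bar> \<le> C * (real n * (1/2)^n)" for n
  proof -
    let ?d = "1 / 2^n :: real"
    have d: "0 \<le> ?d" "?d \<le> 1" by (simp_all add: divide_le_eq)
    have "(\<integral>f. S n f \<partial>L i) = (\<Sum>m<n * 2^n. \<integral>f. indicator (no_exit c a b (real m / 2^n)) f * (M f (real (Suc m) / 2^n) - M f (real m / 2^n)) \<partial>L i)"
      unfolding S_def using term_int by (intro Bochner_Integration.integral_sum) simp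
    also have "\<bar>\<dots>\<bar> \<le> (\<Sum>m<n * 2^n. C * ?d\<^sup>2)"
    proof (rule order_trans[OF sum_abs sum_mono])
      fix m
      let ?t = "real m / 2^n"
      have eq: "real (Suc m) / 2^n = ?t + ?d" by (simp add: add_divide_distrib)
      have "\<bar>\<integral>f. indicator (no_exit c a b ?t) f * ((lev c f (?t + ?d) + h $ f (?t + ?d)) - (lev c f ?t + h $ f ?t)) \<partial>L i\<bar> \<le> C * ?d\<^sup>2"
        by (rule stopped_increment[OF step[OF d] d(1) _ no_exit_sets determined_no_exit]) simp
      then show "\<bar>\<integral>f. indicator (no_exit c a b (real m / 2^n)) f * (M f (real (Suc m) / 2^n) - M f (real m / 2^n)) \<partial>L i\<bar> \<le> C * ?d\<^sup>2"
        unfolding M_def eq .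
    qed
    \<comment> \<open>There are \<open>n * 2^n\<close> steps with an error of \<open>C / 4^n\<close>
      each, so the total still tends to 0 although the horizon grows.\<close>
    also have "\<dots> = C * (real n * (1/2)^n)"
      by (simp add: power2_eq_square power_one_over field_simps)
    finally show ?thesis .
  qed
  have S_path: "(\<forall>n. \<bar>S n f\<bar> \<le> a + b + norm c + 2 * norm h) \<and> (\<lambda>n. S n f) \<longlonglongrightarrow> W f - h $ f 0"
    if f: "step_path f" and fin: "T f < \<infinity>" for f
  proof -
    obtain r where r: "0 \<le> r" "T f = ereal r" "W f = M f r" using exit_path[OF f fin] by blast
    \<comment> \<open>Since \<open>no_exit\<close> requires the weak inequality
      \<open>u \<le> T\<close>, the step that begins at \<open>m / 2^n\<close> counts for
      \<open>m \<le> \<lfloor>r * 2^n\<rfloor>\<close>; hence the increment by one.\<close>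
    define k where "k n = nat \<lfloor>r * 2^n\<rfloor> + 1" for n :: nat
    have fl: "0 \<le> \<lfloor>r * 2^n\<rfloor>" for n :: nat using r by simp
    then have rk: "real (k n) = of_int \<lfloor>r * 2^n\<rfloor> + 1" for n by (simp add: k_def)
    have exit_iff: "indicator (no_exit c a b (real m / 2^n)) f = (of_bool (m < k n) :: real)" for m n :: nat
    proof -
      have "f \<in> no_exit c a b (real m / 2^n) \<longleftrightarrow> ereal (real m / 2^n) \<le> T f"
        using f by (simp add: no_exit_def T_def)
      also have "\<dots> \<longleftrightarrow> real m \<le> r * 2^n" using r by (simp add: divide_le_eq)
      also have "\<dots> \<longleftrightarrow> int m \<le> \<lfloor>r * 2^n\<rfloor>" by (simp add: le_floor_iff)
      also have "\<dots> \<longleftrightarrow> m < k n" using fl[of n] unfolding k_def by linarith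
      finally show ?thesis by (simp add: indicator_def)
    qed
    have S_eq: "S n f = M f (real (min (n * 2^n) (k n)) / 2^n) - h $ f 0" for n
      unfolding S_def exit_iff using telescope_min[where g="\<lambda>m. M f (real m / 2^n)"] by (simp add: M_def)
    have kr: "real (k n) / 2^n \<le> r + 1 / 2^n" "r < real (k n) / 2^n" for n :: nat
    proof -
      have "of_int \<lfloor>r * 2^n\<rfloor> \<le> r * 2^n" "r * 2^n < of_int \<lfloor>r * 2^n\<rfloor> + 1" by linarith+
      then show "real (k n) / 2^n \<le> r + 1 / 2^n" "r < real (k n) / 2^n" unfolding rk by (simp_all add: field_simps)
    qed
    have f_ne: "f \<in> no_exit c a b r"
      using f min.cobounded1[of "down_time c a f" "down_time (- c) b f"] min.cobounded2[of "down_time c a f" "down_time (- c) b f"]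
      unfolding r(2)[unfolded T_def] by (simp add: no_exit_def)
    \<comment> \<open>The rounded time exceeds the escape time by at most 1, so the level may leave
      the interval by at most \<open>norm c\<close>; this provides the dominating constant.\<close>
    have lev_b: "\<bar>lev c f t\<bar> \<le> a + b + norm c" if t: "0 \<le> t" "t \<le> r + 1" for t
    proof (cases "t \<le> r")
      case True
      then show ?thesis using no_exit_level[OF f_ne ab t(1)] ab norm_ge_zero[of c] unfolding abs_le_iff by linarith
    next
      case False
      have "norm c * \<bar>t - r\<bar> \<le> norm c * 1" using False t by (intro mult_left_mono) auto
      then have "\<bar>lev c f t - lev c f r\<bar> \<le> norm c" using lev_lipschitz[OF f r(1) t(1), of c] by linarith
      then show ?thesis using no_exit_level[OF f_ne ab r(1)] ab by (simp add: abs_le_iff)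
    qed
    have "\<bar>S n f\<bar> \<le> a + b + norm c + 2 * norm h" for n
    proof -
      let ?t = "real (min (n * 2^n) (k n)) / 2^n"
      have "?t \<le> real (k n) / 2^n" by (intro divide_right_mono) auto
      also have "\<dots> \<le> r + 1" using kr(1)[of n] by (rule order_trans) (simp add: divide_le_eq)
      finally have "\<bar>lev c f ?t\<bar> \<le> a + b + norm c" by (intro lev_b) auto
      then show ?thesis unfolding S_eq M_def
        using component_le_norm_cart[of h "f ?t"] component_le_norm_cart[of h "f 0"] by linarith
    qed
    moreover have "(\<lambda>n. S n f) \<longlonglongrightarrow> W f - h $ f 0"
    proof -
      have ev: "eventually (\<lambda>n. S n f = lev c f (real (k n) / 2^n) + h $ f r - h $ f 0) sequentially"
        using path_grid_eventually[OF f r(1)] eventually_ge_at_top[of "nat \<lceil>r + 1\<rceil>"]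
      proof eventually_elim
        case (elim n)
        have "r + 1 \<le> real n" using elim(2) by linarith
        then have le1: "(r + 1) * 2^n \<le> real n * 2^n" by (intro mult_right_mono) auto
        have le2: "real (k n) \<le> (r + 1) * 2^n"
        proof -
          have "of_int \<lfloor>r * 2^n\<rfloor> \<le> r * 2^n" by simp
          moreover have "(1::real) \<le> 2^n" by simp
          ultimately show ?thesis unfolding rk distrib_right mult_1 by linarith
        qed
        have "real (k n) \<le> real (n * 2^n)" using order_trans[OF le2 le1] by simp
        then have "min (n * 2^n) (k n) = k n" by (simp only: of_nat_le_iff min_def) simp
        moreover have "f (real (k n) / 2^n) = f r" using elim(1) unfolding rk .
        ultimately show ?case by (simp add: S_eq M_def)
      qed
      have "(\<lambda>n. lev c f (real (k n) / 2^n)) \<longlonglongrightarrow> lev c f r"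
      proof (rule Lim_null_comparison[THEN LIM_zero_cancel])
        show "eventually (\<lambda>n. norm (lev c f (real (k n) / 2^n) - lev c f r) \<le> norm c * (1/2)^n) sequentially"
        proof (rule always_eventually, rule allI)
          fix n :: nat
          have "\<bar>lev c f (real (k n) / 2^n) - lev c f r\<bar> \<le> norm c * \<bar>real (k n) / 2^n - r\<bar>"
            using r by (intro lev_lipschitz[OF f]) auto
          also have "\<dots> \<le> norm c * (1/2)^n"
            using kr[of n] by (intro mult_left_mono) (auto simp: power_one_over)
          finally show "norm (lev c f (real (k n) / 2^n) - lev c f r) \<le> norm c * (1/2)^n" by simp
        qed
        have "(\<lambda>n. norm c * (1/2::real)^n) \<longlonglongrightarrow> norm c * 0" by (intro tendsto_mult_left LIMSEQ_realpow_zero) auto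
        then show "(\<lambda>n. norm c * (1/2::real)^n) \<longlonglongrightarrow> 0" by simp
      qed
      then have "(\<lambda>n. lev c f (real (k n) / 2^n) + h $ f r - h $ f 0) \<longlonglongrightarrow> lev c f r + h $ f r - h $ f 0"
        by (intro tendsto_intros)
      then have "(\<lambda>n. S n f) \<longlonglongrightarrow> lev c f r + h $ f r - h $ f 0"
        by (rule Lim_transform_eventually) (use ev in \<open>auto elim: eventually_mono\<close>)
      then show ?thesis by (simp add: r(3) M_def)
    qed
    ultimately show ?thesis by blast
  qed
  have "(\<lambda>n. \<integral>f. S n f \<partial>L i) \<longlonglongrightarrow> (\<integral>f. W f - h $ f 0 \<partial>L i)"
  proof (rule integral_dominated_convergence[where w="\<lambda>_. a + b + norm c + 2 * norm h"])
    show "(\<lambda>f. W f - h $ f 0) \<in> borel_measurable (L i)"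
      using vec_coordinate_measurable_L[of 0 h i] by measurable
    show "S n \<in> borel_measurable (L i)" for n
      unfolding S_def using term_int by (intro borel_measurable_sum borel_measurable_integrable) simp
    show "AE f in L i. (\<lambda>n. S n f) \<longlonglongrightarrow> W f - h $ f 0"
      using ae AE_space by eventually_elim (use S_path in auto)
    show "AE f in L i. norm (S n f) \<le> a + b + norm c + 2 * norm h" for n
      using ae AE_space by eventually_elim (use S_path in auto)
  qed simp
  moreover have "(\<lambda>n. \<integral>f. S n f \<partial>L i) \<longlonglongrightarrow> 0"
  proof (rule Lim_null_comparison)
    show "eventually (\<lambda>n. norm (\<integral>f. S n f \<partial>L i) \<le> C * (real n * (1/2)^n)) sequentially"
      using S_int by simp
    have "(\<lambda>n. real n * (1/2::real)^n) \<longlonglongrightarrow> 0" using powser_times_n_limit_0[of "1/2::real"] by simp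
    then have "(\<lambda>n. C * (real n * (1/2::real)^n)) \<longlonglongrightarrow> C * 0" by (rule tendsto_mult_left)
    then show "(\<lambda>n. C * (real n * (1/2::real)^n)) \<longlonglongrightarrow> 0" by simp
  qed
  ultimately have "(\<integral>f. W f - h $ f 0 \<partial>L i) = 0" by (rule LIMSEQ_unique)
  moreover have "(\<integral>f. W f - h $ f 0 \<partial>L i) = (\<integral>f. W f \<partial>L i) - (\<integral>f. h $ f 0 \<partial>L i)"
    using W_integrable integrable_vec_coordinate[of 0 i h] by (intro Bochner_Integration.integral_diff) auto
  moreover have "(\<integral>f. h $ f 0 \<partial>L i) = (\<integral>f. h $ i \<partial>L i)"
  proof (rule integral_cong_AE)
    show "AE f in L i. h $ f 0 = h $ i" using AE_start[of i] by eventually_elim simp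
  qed (simp_all add: vec_coordinate_measurable_L)
  moreover have "(\<integral>f. h $ i \<partial>L i) = h $ i" using L.prob_space[of i] by simp
  ultimately show "(\<Sum>j\<in>UNIV. escape c a b i j * (h $ j - a)) + (\<Sum>j\<in>UNIV. escape (- c) b a i j * (h $ j + b)) = h $ i"
    using W_int by simp
qed

end


section \<open>Recurrence and transience\<close>

text \<open>For \<open>x = - y\<close> with \<open>y > 0\<close> the claim reads
  \<open>1 \<le> (1 - y + y^2) * exp y\<close>; replacing \<open>exp y\<close> by its quadratic
  Taylor polynomial leaves \<open>1 + y^2/2 + y^3/2 + y^4/2\<close>.\<close>

lemma exp_le_quadratic:
  fixes x :: real
  assumes "\<bar>x\<bar> \<le> 1"
  shows "exp x \<le> 1 + x + x\<^sup>2"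
proof (cases "0 \<le> x")
  case True
  then show ?thesis using exp_bound[of x] assms by simp
next
  case False
  define y where "y = - x"
  have y: "0 \<le> y" "y \<le> 1" using False assms by (auto simp: y_def)
  have pos: "0 < 1 + y + y\<^sup>2 / 2" using y by (simp add: add_pos_nonneg)
  have "1 + 0 \<le> 1 + (y\<^sup>2 / 2 + y ^ 3 / 2 + y ^ 4 / 2)" using y by (intro add_left_mono) simp
  also have "\<dots> = (1 - y + y\<^sup>2) * (1 + y + y\<^sup>2 / 2)"
    by (simp add: field_simps power2_eq_square power3_eq_cube power4_eq_xxxx)
  finally have "1 \<le> (1 - y + y\<^sup>2) * (1 + y + y\<^sup>2 / 2)" by simp
  also have "\<dots> \<le> (1 - y + y\<^sup>2) * exp y"
  proof (rule mult_left_mono[OF exp_lower_Taylor_quadratic[OF y(1)]])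
    have "0 \<le> (1 - y)" using y by simp
    then show "0 \<le> 1 - y + y\<^sup>2" by simp
  qed
  finally have "exp (- y) \<le> 1 - y + y\<^sup>2" by (simp add: exp_minus field_simps)
  then show ?thesis by (simp add: y_def)
qed

lemma sum_weighted_le:
  fixes w h :: "'k::finite \<Rightarrow> real"
  assumes "\<And>j. 0 \<le> w j" "\<And>j. \<bar>h j\<bar> \<le> H"
  shows "\<bar>\<Sum>j\<in>UNIV. w j * h j\<bar> \<le> (\<Sum>j\<in>UNIV. w j) * H"
proof -
  have "\<bar>\<Sum>j\<in>UNIV. w j * h j\<bar> \<le> (\<Sum>j\<in>UNIV. \<bar>w j * h j\<bar>)" by (rule sum_abs)
  also have "\<dots> \<le> (\<Sum>j\<in>UNIV. w j * H)" using assms by (intro sum_mono) (auto simp: abs_mult intro!: mult_left_mono)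
  finally show ?thesis by (simp add: sum_distrib_right)
qed

context phase_chain
begin

lemma down_sum_le_1: "(\<Sum>j\<in>UNIV. down c x i j) \<le> 1"
proof -
  have "(\<Sum>j\<in>UNIV. down c x i j) = measure (L i) (\<Union>j\<in>UNIV. down_event c x j)"
    unfolding down_def
  proof (rule L.finite_measure_finite_Union[symmetric])
    show "down_event c x ` UNIV \<subseteq> sets (L i)" by (auto simp: sets_L down_event_sets)
    show "disjoint_family_on (down_event c x) UNIV" by (auto simp: disjoint_family_on_def down_event_def)
  qed simp
  then show ?thesis by simp
qed

text \<open>An explicit scenario of positive probability: climb in \<open>i\<close> for one unit of
  time, be in \<open>j\<close> at a time \<open>d\<close> later, then stay in \<open>j\<close> until
  the level is below \<open>- x\<close>. The initial climb keeps the level nonnegative in between,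
  so the passage happens in phase \<open>j\<close>.\<close>

lemma down_pos:
  assumes ij: "0 < c $ i" "c $ j < 0" and x: "0 \<le> x"
  shows "0 < down c x i j"
proof -
  \<comment> \<open>So short that the unknown phases between time 1 and \<open>1 + d\<close> cannot
    undo the initial climb.\<close>
  define d where "d = c $ i / (norm c + 1)"
  have d: "0 < d" "norm c * d < c $ i"
  proof -
    show d: "0 < d" using ij by (simp add: d_def add_nonneg_pos)
    have "norm c + 1 \<noteq> 0" using norm_ge_zero[of c] by linarith
    then have "(norm c + 1) * d = c $ i" unfolding d_def by simp
    then show "norm c * d < c $ i" using d by (simp add: distrib_right)
  qed
  \<comment> \<open>Long enough for a descent to \<open>- x\<close> from the greatest possible level
    at time \<open>1 + d\<close>, with one unit to spare, so that the passage falls strictly inside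
    the sojourn.\<close>
  define v where "v = (norm c * (1 + d) + x + 1) / - c $ j"
  have v: "0 < v" "- c $ j * v = norm c * (1 + d) + x + 1"
  proof -
    have "0 \<le> norm c * (1 + d)" using d by simp
    then have "0 < norm c * (1 + d) + x + 1" using x by linarith
    then show "0 < v" unfolding v_def using ij by (intro divide_pos_pos) auto
    show "- c $ j * v = norm c * (1 + d) + x + 1" unfolding v_def using ij by simp
  qed
  let ?B = "{f\<in>{f. step_path f \<and> f d = j}. shift d f \<in> stay j v}"
  have Bd: "{f. step_path f \<and> f d = j} \<in> sets path_space" using d by (intro coordinate_sets) simp
  have "?B = {f. step_path f \<and> f d = j} \<inter> {f. step_path f \<and> shift d f \<in> stay j v}" by auto
  then have B: "?B \<in> sets path_space" using Bd shift_sets[of d "stay j v"] d v by (simp add: stay_sets sets.Int)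
  have "measure (L i) ?B = measure (L i) {f. step_path f \<and> f d = j} * measure (L j) (stay j v)"
    by (rule measure_shift[OF _ Bd]) (use d v in \<open>auto simp: stay_sets determined_def agree_def\<close>)
  then have Bpos: "0 < measure (L i) ?B"
    using measure_coordinate[of d i j] trans_pos[OF d(1), of i j] stay_pos[of v j] d v by simp
  have "measure (L i) {f\<in>stay i 1. shift 1 f \<in> ?B} = measure (L i) (stay i 1) * measure (L i) ?B"
    by (rule measure_shift[OF _ _ _ _ B]) (auto simp: stay_sets determined_stay, simp add: stay_def)
  then have "0 < measure (L i) {f\<in>stay i 1. shift 1 f \<in> ?B}" using Bpos stay_pos[of 1 i] by simp
  also have "\<dots> \<le> down c x i j"
    unfolding down_def
  proof (rule L.finite_measure_mono)
    show "{f\<in>stay i 1. shift 1 f \<in> ?B} \<subseteq> down_event c x j"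
    proof
      fix f assume f: "f \<in> {f\<in>stay i 1. shift 1 f \<in> ?B}"
      then have sp: "step_path f" by (simp add: stay_def)
      have s1: "shift d (shift 1 f) = shift (1 + d) f" by (simp add: shift_def add.assoc)
      have st: "shift (1 + d) f \<in> stay j v" using f unfolding s1[symmetric] by simp
      have lev1: "lev c f t = c $ i * t" if "0 \<le> t" "t \<le> 1" for t
        using f that by (intro lev_const[OF sp]) (auto simp: stay_def)
      have nonneg: "0 \<le> lev c f t" if "0 \<le> t" "t \<le> 1 + d" for t
      proof (cases "t \<le> 1")
        case True
        then show ?thesis using lev1[OF that(1)] that ij by simp
      next
        case False
        have "\<bar>lev c f t - lev c f 1\<bar> \<le> norm c * \<bar>t - 1\<bar>" using that by (intro lev_lipschitz[OF sp]) auto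
        also have "\<dots> \<le> norm c * d" using False that by (intro mult_left_mono) auto
        finally show ?thesis using lev1[of 1] d(2) by simp
      qed
      define y where "y = x + lev c f (1 + d)"
      have y: "0 \<le> y" "y < - c $ j * v"
        using nonneg[of "1 + d"] lev_bound[OF sp, of "1 + d" c] d x v(2) by (auto simp: y_def)
      define r where "r = y / - c $ j"
      have r: "0 \<le> r" "r < v" "c $ j * r = - y" using y ij by (auto simp: r_def field_simps)
      let ?g = "shift (1 + d) f"
      have g: "step_path ?g" using step_path_shift[OF sp] d by simp
      have levg: "lev c ?g t = c $ j * t" if "0 \<le> t" "t \<le> v" for t
        using st that by (intro lev_const[OF g]) (auto simp: stay_def)
      have gr: "?g r = j" using st r by (simp add: stay_def)
      have "down_time c y ?g = ereal r"
      proof (rule down_time_eqI[OF r(1) g])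
        show "- y \<le> lev c ?g t" if "0 \<le> t" "t \<le> r" for t
        proof -
          have "- c $ j * t \<le> - c $ j * r" using that ij by (intro mult_left_mono) auto
          then show ?thesis using levg[of t] that r by simp
        qed
        show "lev c ?g r = - y" using levg[of r] r by simp
        show "c $ ?g r < 0" using gr ij by simp
      qed
      then have "?g \<in> down_event c y j" using g gr by (simp add: down_event_def)
      moreover have "- x \<le> lev c f t" if "0 \<le> t" "t \<le> 1 + d" for t using nonneg[OF that] x by simp
      ultimately show "f \<in> down_event c x j" using down_event_shift[OF sp _ _ y_def, of j] d by simp
    qed
  qed (simp add: sets_L down_event_sets)
  finally show ?thesis .
qed

section \<open>Zero drift: recurrence and the strict sign of the overshoot\<close>

text \<open>The two identities of optional stopping are solved for the total probability of leaving
  at the top.\<close>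

lemma escape_up_identity:
  fixes h :: "real^'s"
  assumes h: "\<And>k. (Q *v h) $ k = - c $ k" and p: "0 < c $ p" and ab: "0 \<le> a" "0 \<le> b"
  shows "(a + b) * (\<Sum>j\<in>UNIV. escape (- c) b a i j) =
    h $ i + a - (\<Sum>j\<in>UNIV. escape c a b i j * h $ j) - (\<Sum>j\<in>UNIV. escape (- c) b a i j * h $ j)"
proof -
  have 1: "(\<Sum>j\<in>UNIV. escape c a b i j) = 1 - (\<Sum>j\<in>UNIV. escape (- c) b a i j)"
    using optional_stopping(2)[OF h p ab, of i] by simp
  have "(\<Sum>j\<in>UNIV. escape c a b i j * h $ j) - a * (\<Sum>j\<in>UNIV. escape c a b i j) +
    ((\<Sum>j\<in>UNIV. escape (- c) b a i j * h $ j) + b * (\<Sum>j\<in>UNIV. escape (- c) b a i j)) = h $ i"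
    using optional_stopping(1)[OF h p ab, of i]
    by (simp add: algebra_simps sum.distrib sum_subtractf sum_distrib_left)
  then show ?thesis unfolding 1 by (simp add: algebra_simps)
qed

text \<open>The gambler's ruin probability \<open>a / (a + b)\<close>, up to the bounded correction
  that \<open>h\<close> contributes at the start and at the end.\<close>

lemma escape_up_bounds:
  fixes h :: "real^'s"
  assumes h: "\<And>k. (Q *v h) $ k = - c $ k" and p: "0 < c $ p" and ab: "0 \<le> a" "0 \<le> b"
  shows "\<bar>(a + b) * (\<Sum>j\<in>UNIV. escape (- c) b a i j) - a\<bar> \<le> 2 * norm h"
proof -
  have "\<bar>\<Sum>j\<in>UNIV. escape c a b i j * h $ j\<bar> \<le> (\<Sum>j\<in>UNIV. escape c a b i j) * norm h"
    "\<bar>\<Sum>j\<in>UNIV. escape (- c) b a i j * h $ j\<bar> \<le> (\<Sum>j\<in>UNIV. escape (- c) b a i j) * norm h"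
    by (auto intro!: sum_weighted_le component_le_norm_cart)
  moreover have "(\<Sum>j\<in>UNIV. escape c a b i j) * norm h + (\<Sum>j\<in>UNIV. escape (- c) b a i j) * norm h = norm h"
    using optional_stopping(2)[OF h p ab, of i] by (simp add: distrib_right[symmetric])
  moreover have "\<bar>h $ i\<bar> \<le> norm h" by (rule component_le_norm_cart)
  ultimately show ?thesis unfolding escape_up_identity[OF h p ab] by linarith
qed

text \<open>The probability of leaving at a distant top \<open>b\<close> first is
  \<open>O(1 / b)\<close>, and leaving at the bottom first implies passage below
  \<open>- a\<close>.\<close>

lemma recurrent:
  fixes h :: "real^'s"
  assumes h: "\<And>k. (Q *v h) $ k = - c $ k" and p: "0 < c $ p" and a: "0 \<le> a"
  shows "(\<Sum>j\<in>UNIV. down c a i j) = 1"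
proof (rule antisym[OF down_sum_le_1])
  have "1 - (2 * norm h + a) * (1 / real (Suc n)) \<le> (\<Sum>j\<in>UNIV. down c a i j)" for n
  proof -
    let ?b = "real (Suc n)" and ?p = "\<Sum>j\<in>UNIV. escape (- c) (real (Suc n)) a i j"
    have p0: "0 \<le> ?p" by (intro sum_nonneg) simp
    have "(a + ?b) * ?p \<le> 2 * norm h + a" using escape_up_bounds[OF h p a, of ?b i] by (simp add: abs_le_iff)
    moreover have "?b * ?p \<le> (a + ?b) * ?p" using a p0 by (intro mult_right_mono) auto
    ultimately have "?p \<le> (2 * norm h + a) * (1 / ?b)" by (simp add: field_simps)
    moreover have "(\<Sum>j\<in>UNIV. escape c a ?b i j) \<le> (\<Sum>j\<in>UNIV. down c a i j)"
      by (intro sum_mono escape_le_down)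
    ultimately show ?thesis using optional_stopping(2)[OF h p a, of ?b i] by linarith
  qed
  moreover have "(\<lambda>n. 1 - (2 * norm h + a) * (1 / real (Suc n))) \<longlonglongrightarrow> 1 - (2 * norm h + a) * 0"
    using LIMSEQ_inverse_real_of_nat by (intro tendsto_intros) (simp add: inverse_eq_divide)
  ultimately show "1 \<le> (\<Sum>j\<in>UNIV. down c a i j)"
    by (intro LIMSEQ_le_const2[of "\<lambda>n. 1 - (2 * norm h + a) * (1 / real (Suc n))" 1]) auto
qed

text \<open>A path that passes \<open>- a\<close> at time \<open>T\<close> cannot have risen above
  \<open>n\<close> by time \<open>T + 1\<close> once \<open>n \<ge> norm c * (T + 1)\<close>. So
  membership in the events is eventually constant along each path.\<close>

lemma escape_tendsto_down:
  assumes a: "0 \<le> a"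
  shows "(\<lambda>n. escape c a (real n) i j) \<longlonglongrightarrow> down c a i j"
  unfolding escape_def down_def
proof (rule L.measure_tendsto)
  fix f assume "f \<in> space (L i)"
  then have f: "step_path f" by simp
  show "eventually (\<lambda>n. (f \<in> escape_event c a (real n) j) = (f \<in> down_event c a j)) sequentially"
  proof (cases "f \<in> down_event c a j")
    case True
    then have "down_time c a f < \<infinity>" by (simp add: down_event_def)
    then obtain T where T: "0 \<le> T" "down_time c a f = ereal T" by (rule down_time_finiteE)
    have "f \<in> escape_event c a (real n) j" if n: "norm c * (T + 1) \<le> real n" for n
    proof -
      have "\<not> down_time (- c) (real n) f < ereal (T + 1)"
      proof
        assume "down_time (- c) (real n) f < ereal (T + 1)"
        then obtain t where t: "0 \<le> t" "t < T + 1" "lev (- c) f t < - real n" by (auto simp: down_time_less_iff)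
        have "norm c * t \<le> norm c * (T + 1)" using t by (intro mult_left_mono) auto
        then show False using lev_bound[OF f t(1), of c] t(3) n by (simp add: lev_minus)
      qed
      then have "ereal (T + 1) \<le> down_time (- c) (real n) f" by simp
      then have "down_time c a f < down_time (- c) (real n) f" unfolding T(2)
        by (rule less_le_trans[rotated]) simp
      then show ?thesis using True by (simp add: escape_event_def down_event_def)
    qed
    moreover have "eventually (\<lambda>n. norm c * (T + 1) \<le> real n) sequentially"
      using eventually_ge_at_top[of "nat \<lceil>norm c * (T + 1)\<rceil>"] by eventually_elim linarith
    ultimately show ?thesis using True by (auto elim: eventually_mono)
  next
    case False
    then have "f \<notin> escape_event c a (real n) j" for n using subsetD[OF escape_event_subset] by blast
    then show ?thesis using False by simp
  qed
qed (simp_all add: sets_L escape_event_sets down_event_sets)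

text \<open>A sojourn of length \<open>r\<close> in an up phase moves the level monotonically to
  \<open>c $ i * r\<close> inside the interval; from there on the escape is from the interval seen
  from the new level.\<close>

lemma escape_up_after_climb:
  assumes a: "0 \<le> a" and r: "0 \<le> r" and b: "c $ i * r \<le> b" and i: "0 < c $ i"
  shows "measure (L i) (stay i r) * (\<Sum>j\<in>UNIV. escape (- c) (b - c $ i * r) (a + c $ i * r) i j) \<le>
    (\<Sum>j\<in>UNIV. escape (- c) b a i j)"
proof -
  let ?x = "c $ i * r"
  have "measure (L i) (stay i r) * escape (- c) (b - ?x) (a + ?x) i j \<le> escape (- c) b a i j" for j
  proof -
    let ?E = "escape_event (- c) (b - ?x) (a + ?x) j"
    have x: "0 \<le> ?x" using i r by simp
    have "measure (L i) (stay i r) * escape (- c) (b - ?x) (a + ?x) i j = measure (L i) {f\<in>stay i r. shift r f \<in> ?E}"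
      unfolding escape_def using r
      by (intro measure_shift[symmetric] stay_sets determined_stay escape_event_sets) (auto simp: stay_def)
    also have "\<dots> \<le> escape (- c) b a i j"
      unfolding escape_def
    proof (rule L.finite_measure_mono)
      show "{f\<in>stay i r. shift r f \<in> ?E} \<subseteq> escape_event (- c) b a j"
      proof
        fix f assume f: "f \<in> {f\<in>stay i r. shift r f \<in> ?E}"
        then have sp: "step_path f" by (simp add: stay_def)
        have lev: "lev c f t = c $ i * t" if "0 \<le> t" "t \<le> r" for t
          using f that by (intro lev_const[OF sp]) (auto simp: stay_def)
        have up: "down_time (- c) b f = ereal r + down_time (- c) (b - ?x) (shift r f)"
        proof -
          have "- b \<le> lev (- c) f t" if "0 \<le> t" "t \<le> r" for t
          proof -
            have "c $ i * t \<le> ?x" using that i by (intro mult_left_mono) auto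
            then show ?thesis using lev[OF that] b by (simp add: lev_minus)
          qed
          from down_time_shift[OF sp r this] show ?thesis using lev[of r] r by (simp add: lev_minus)
        qed
        have dn: "down_time c a f = ereal r + down_time c (a + ?x) (shift r f)"
        proof -
          have "- a \<le> lev c f t" if "0 \<le> t" "t \<le> r" for t
          proof -
            have "0 \<le> c $ i * t" using that i by simp
            then show ?thesis using lev[OF that] a by simp
          qed
          from down_time_shift[OF sp r this] show ?thesis using lev[of r] r by simp
        qed
        have E: "down_time (- c) (b - ?x) (shift r f) < down_time c (a + ?x) (shift r f)"
          "shift r f (real_of_ereal (down_time (- c) (b - ?x) (shift r f))) = j"
          using f by (auto simp: escape_event_def)
        then have fin: "down_time (- c) (b - ?x) (shift r f) < \<infinity>"
          using less_le_trans[OF E(1), of \<infinity>] by simp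
        have "down_time (- c) b f < down_time c a f"
          using E(1) fin unfolding up dn
          by (cases "down_time (- c) (b - ?x) (shift r f)"; cases "down_time c (a + ?x) (shift r f)") auto
        then show "f \<in> escape_event (- c) b a j"
          using sp E(2) real_of_ereal_down_time_shift[OF up fin] by (simp add: escape_event_def shift_apply)
      qed
    qed (simp add: sets_L escape_event_sets)
    finally show ?thesis .
  qed
  then show ?thesis unfolding sum_distrib_left by (rule sum_mono)
qed

text \<open>The quantity is the limit of \<open>b\<close> times the probability of an upward escape at distance \<open>b\<close>, which
  is bounded below because the flow may first climb to a high level.\<close>

lemma overshoot_pos:
  fixes h :: "real^'s"
  assumes h: "\<And>k. (Q *v h) $ k = - c $ k" and i: "0 < c $ i" and a: "0 \<le> a"
  shows "0 < h $ i + a - (\<Sum>j\<in>UNIV. down c a i j * h $ j)"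
proof -
  \<comment> \<open>The climb exceeds the error \<open>2 * norm h\<close> of the ruin estimate by 1,
    so from the top of the climb the escape probability times \<open>a + n\<close> is at least
    1.\<close>
  define r where "r = (2 * norm h + 1) / c $ i"
  have r: "0 \<le> r" "c $ i * r = 2 * norm h + 1" using i by (auto simp: r_def)
  let ?x = "c $ i * r"
  let ?e = "measure (L i) (stay i r)"
  have e: "0 < ?e" by (rule stay_pos[OF r(1)])
  let ?p = "\<lambda>n. \<Sum>j\<in>UNIV. escape (- c) (real n) a i j"
  have lower: "?e \<le> (a + real n) * ?p n" if n: "?x \<le> real n" for n
  proof -
    let ?q = "\<Sum>j\<in>UNIV. escape (- c) (real n - ?x) (a + ?x) i j"
    have "\<bar>((a + ?x) + (real n - ?x)) * ?q - (a + ?x)\<bar> \<le> 2 * norm h"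
      by (rule escape_up_bounds[OF h i]) (use a r n in auto)
    moreover have "(a + ?x) + (real n - ?x) = a + real n" by simp
    ultimately have "a + ?x - 2 * norm h \<le> (a + real n) * ?q" by (simp only:)
    then have "1 \<le> (a + real n) * ?q" using r a by simp
    then have "?e * 1 \<le> ?e * ((a + real n) * ?q)" using e by (intro mult_left_mono) auto
    also have "\<dots> = (a + real n) * (?e * ?q)" by simp
    also have "\<dots> \<le> (a + real n) * ?p n"
      using escape_up_after_climb[OF a r(1) n i] a by (intro mult_left_mono) auto
    finally show ?thesis by simp
  qed
  have lim1: "(\<lambda>n. \<Sum>j\<in>UNIV. escape c a (real n) i j * h $ j) \<longlonglongrightarrow> (\<Sum>j\<in>UNIV. down c a i j * h $ j)"
    by (intro tendsto_intros escape_tendsto_down a)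
  have lim2: "(\<lambda>n. \<Sum>j\<in>UNIV. escape (- c) (real n) a i j * h $ j) \<longlonglongrightarrow> 0"
  proof (rule Lim_null_comparison)
    have "\<bar>\<Sum>j\<in>UNIV. escape (- c) (real n) a i j * h $ j\<bar> \<le> (1 - (\<Sum>j\<in>UNIV. escape c a (real n) i j)) * norm h" for n
    proof -
      have "\<bar>\<Sum>j\<in>UNIV. escape (- c) (real n) a i j * h $ j\<bar> \<le> (\<Sum>j\<in>UNIV. escape (- c) (real n) a i j) * norm h"
        by (intro sum_weighted_le component_le_norm_cart) simp
      also have "(\<Sum>j\<in>UNIV. escape (- c) (real n) a i j) = 1 - (\<Sum>j\<in>UNIV. escape c a (real n) i j)"
        using optional_stopping(2)[OF h i a, of "real n" i] by simp
      finally show ?thesis .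
    qed
    then show "eventually (\<lambda>n. norm (\<Sum>j\<in>UNIV. escape (- c) (real n) a i j * h $ j) \<le> (1 - (\<Sum>j\<in>UNIV. escape c a (real n) i j)) * norm h) sequentially"
      by simp
    have "(\<lambda>n. (1 - (\<Sum>j\<in>UNIV. escape c a (real n) i j)) * norm h) \<longlonglongrightarrow> (1 - (\<Sum>j\<in>UNIV. down c a i j)) * norm h"
      by (intro tendsto_intros escape_tendsto_down a)
    then show "(\<lambda>n. (1 - (\<Sum>j\<in>UNIV. escape c a (real n) i j)) * norm h) \<longlonglongrightarrow> 0"
      using recurrent[OF h i a, of i] by simp
  qed
  have "(\<lambda>n. h $ i + a - (\<Sum>j\<in>UNIV. escape c a (real n) i j * h $ j) - (\<Sum>j\<in>UNIV. escape (- c) (real n) a i j * h $ j))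
    \<longlonglongrightarrow> h $ i + a - (\<Sum>j\<in>UNIV. down c a i j * h $ j) - 0"
    by (intro tendsto_diff tendsto_const lim1 lim2)
  moreover have "eventually (\<lambda>n. ?e \<le> h $ i + a - (\<Sum>j\<in>UNIV. escape c a (real n) i j * h $ j) - (\<Sum>j\<in>UNIV. escape (- c) (real n) a i j * h $ j)) sequentially"
    using eventually_ge_at_top[of "nat \<lceil>?x\<rceil>"]
  proof eventually_elim
    case (elim n)
    then have "?x \<le> real n" by linarith
    from lower[OF this] show ?case using escape_up_identity[OF h i a, of "real n" i] by simp
  qed
  ultimately have "?e \<le> h $ i + a - (\<Sum>j\<in>UNIV. down c a i j * h $ j) - 0"
    by (intro tendsto_lowerbound) auto
  then show ?thesis using e by simp
qed

text \<open>To first order in \<open>r\<close> the mean changes by \<open>r \<mu> d + O(r d\<^sup>2)\<close>; the other terms are \<open>O(r\<^sup>2)\<close>. So \<open>d\<close> is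
  chosen first and then \<open>r\<close>.\<close>

lemma exponential_decay:
  fixes h :: "real^'s"
  assumes h: "\<And>k. (Q *v h) $ k = \<mu> - c $ k" and \<mu>: "\<mu> < 0"
  shows "\<exists>d r \<rho>. 0 < d \<and> 0 < r \<and> 0 \<le> \<rho> \<and> \<rho> < 1 \<and> r * norm h \<le> 1 / 2 \<and>
    (\<forall>k. (\<integral>f. exp (r * lev c f d) * (1 + r * h $ f d) \<partial>L k) \<le> \<rho> * (1 + r * h $ k))"
proof -
  obtain C where C: "0 \<le> C" "\<And>t k. 0 \<le> t \<Longrightarrow> t \<le> 1 \<Longrightarrow>
      \<bar>(\<integral>f. lev c f t + h $ f t \<partial>L k) - h $ k - t * (c $ k + (Q *v h) $ k)\<bar> \<le> C * t\<^sup>2"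
    using drift_estimate[of c h] by blast
  \<comment> \<open>With this choice the error \<open>C * d^2\<close> consumes at most half of the
    mean decrease, and \<open>m\<close> below is the other half.\<close>
  define d where "d = min 1 (- \<mu> / (2 * (C + 1)))"
  have d: "0 < d" "d \<le> 1" "d \<le> - \<mu> / (2 * (C + 1))" 
  proof -
    have "0 < - \<mu> / (2 * (C + 1))" using \<mu> C(1) by (intro divide_pos_pos) auto
    then show "0 < d" "d \<le> 1" "d \<le> - \<mu> / (2 * (C + 1))" unfolding d_def by simp_all
  qed
  define m where "m = - \<mu> * d / 2"
  have m: "0 < m" using mult_neg_pos[OF \<mu> d(1)] by (simp add: m_def)
  have drift: "(\<integral>f. lev c f d + h $ f d \<partial>L k) \<le> h $ k - m" for k
  proof -
    have "0 < 2 * (C + 1)" using C(1) by simp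
    then have "d * (2 * (C + 1)) \<le> - \<mu>" using d(3) by (simp only: pos_le_divide_eq)
    then have "C * d \<le> - \<mu> / 2" using d(1) by (simp add: algebra_simps)
    then have "C * d * d \<le> - \<mu> / 2 * d" using d(1) by (intro mult_right_mono) auto
    then show ?thesis using C(2)[of d k] d h[of k] by (simp add: m_def power2_eq_square algebra_simps abs_le_iff)
  qed
  define B where "B = norm c * d"
  define H where "H = norm h"
  \<comment> \<open>The coefficient of \<open>r^2\<close>: \<open>B * H\<close> from the mixed
    product, \<open>2 * B^2\<close> from the quadratic term of the exponential, whose factor
    \<open>1 + r * h\<close> is at most 2, and 1 to keep \<open>D\<close> positive.\<close>
  define D where "D = B * H + 2 * B\<^sup>2 + 1"
  have BH: "0 \<le> B" "0 \<le> H" using d by (auto simp: B_def H_def)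
  have D: "0 < D" using BH by (simp add: D_def add_nonneg_pos)
  \<comment> \<open>The four bounds in turn: the exponent stays in the range of
    \<open>exp_le_quadratic\<close>; the weights \<open>1 + r * h\<close> stay above 1/2; the
    second-order term takes at most half of the gain \<open>r * m\<close>; and \<rho> is
    nonnegative.\<close>
  define r where "r = min (min (1 / (B + 1)) (1 / (2 * (H + 1)))) (min (m / (2 * D)) (1 / m))"
  have r0: "0 < r" using BH m D by (simp add: r_def)
  have rB: "r * B \<le> 1"
  proof -
    have "r \<le> 1 / (B + 1)" by (simp add: r_def)
    then have "r * (B + 1) \<le> 1" using BH by (simp add: pos_le_divide_eq)
    then show ?thesis using r0 by (simp add: distrib_left)
  qed
  have rH: "r * H \<le> 1 / 2"
  proof -
    have "r \<le> 1 / (2 * (H + 1))" by (simp add: r_def)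
    then have "r * (2 * (H + 1)) \<le> 1" using BH by (simp add: pos_le_divide_eq)
    then show ?thesis using r0 by (simp add: algebra_simps)
  qed
  have rD: "r * D \<le> m / 2"
  proof -
    have "r \<le> m / (2 * D)" by (simp add: r_def)
    then show ?thesis using D by (simp add: pos_le_divide_eq)
  qed
  have rm: "r * m \<le> 1"
  proof -
    have "r \<le> 1 / m" by (simp add: r_def)
    then show ?thesis using m by (simp add: pos_le_divide_eq)
  qed
  \<comment> \<open>A net gain of \<open>r * m / 2\<close> remains; since the weight
    \<open>1 + r * h\<close> is at most 2, this is at least the fraction \<open>r * m / 4\<close> of
    the weight.\<close>
  define \<rho> where "\<rho> = 1 - r * m / 4"
  have \<rho>: "0 \<le> \<rho>" "\<rho> < 1" using rm r0 m by (auto simp: \<rho>_def)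
  have bound: "(\<integral>f. exp (r * lev c f d) * (1 + r * h $ f d) \<partial>L k) \<le> \<rho> * (1 + r * h $ k)" for k
  proof -
    have d0: "0 \<le> d" using d by simp
    have hH: "\<bar>h $ j\<bar> \<le> H" for j unfolding H_def by (rule component_le_norm_cart)
    have rh: "\<bar>r * h $ j\<bar> \<le> 1 / 2" for j
    proof -
      have "r * \<bar>h $ j\<bar> \<le> r * H" using hH[of j] r0 by (intro mult_left_mono) auto
      then have "r * \<bar>h $ j\<bar> \<le> 1 / 2" using rH by linarith
      then show ?thesis using r0 by (simp add: abs_mult)
    qed
    have pt: "exp (r * lev c f d) * (1 + r * h $ f d) \<le> 1 + r * (lev c f d + h $ f d) + r\<^sup>2 * D" if f: "step_path f" for f
    proof -
      let ?x = "lev c f d" and ?y = "h $ f d"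
      have x: "\<bar>?x\<bar> \<le> B" unfolding B_def by (rule lev_bound[OF f d0])
      have "\<bar>r * ?x\<bar> \<le> 1"
      proof -
        have "r * \<bar>?x\<bar> \<le> r * B" using x r0 by (intro mult_left_mono) auto
        then have "r * \<bar>?x\<bar> \<le> 1" using rB by linarith
        then show ?thesis using r0 by (simp add: abs_mult)
      qed
      then have "exp (r * ?x) \<le> 1 + r * ?x + (r * ?x)\<^sup>2" by (rule exp_le_quadratic)
      also have "(r * ?x)\<^sup>2 \<le> r\<^sup>2 * B\<^sup>2"
        using x unfolding power_mult_distrib by (intro mult_left_mono) (auto simp: abs_le_square_iff[symmetric] BH)
      finally have e: "exp (r * ?x) \<le> 1 + r * ?x + r\<^sup>2 * B\<^sup>2" by simp
      have "0 \<le> 1 + r * ?y" "1 + r * ?y \<le> 2" using rh[of "f d"] by (auto simp: abs_le_iff)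
      note y = this
      have "exp (r * ?x) * (1 + r * ?y) \<le> (1 + r * ?x + r\<^sup>2 * B\<^sup>2) * (1 + r * ?y)"
        using e y by (intro mult_right_mono) auto
      also have "\<dots> = 1 + r * (?x + ?y) + r\<^sup>2 * (?x * ?y) + r\<^sup>2 * B\<^sup>2 * (1 + r * ?y)"
        by (simp add: algebra_simps power2_eq_square)
      also have "\<dots> \<le> 1 + r * (?x + ?y) + r\<^sup>2 * (B * H) + r\<^sup>2 * B\<^sup>2 * 2"
      proof -
        have "?x * ?y \<le> \<bar>?x\<bar> * \<bar>?y\<bar>" by (metis abs_ge_self abs_mult)
        also have "\<dots> \<le> B * H" using x hH[of "f d"] BH by (intro mult_mono) auto
        finally have "r\<^sup>2 * (?x * ?y) \<le> r\<^sup>2 * (B * H)" by (intro mult_left_mono) auto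
        moreover have "r\<^sup>2 * B\<^sup>2 * (1 + r * ?y) \<le> r\<^sup>2 * B\<^sup>2 * 2" using y by (intro mult_left_mono) auto
        ultimately show ?thesis by linarith
      qed
      also have "\<dots> \<le> 1 + r * (?x + ?y) + r\<^sup>2 * D" by (simp add: D_def algebra_simps)
      finally show ?thesis .
    qed
    have int: "integrable (L k) (\<lambda>f. 1 + r * (lev c f d + h $ f d) + r\<^sup>2 * D)"
      using integrable_lev[OF d0] integrable_vec_coordinate[OF d0]
      by (intro Bochner_Integration.integrable_add integrable_mult_right integrable_const) auto
    have "(\<integral>f. exp (r * lev c f d) * (1 + r * h $ f d) \<partial>L k) \<le> (\<integral>f. 1 + r * (lev c f d + h $ f d) + r\<^sup>2 * D \<partial>L k)"
    proof (rule integral_mono'[OF int])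
      fix f assume "f \<in> space (L k)"
      then have f: "step_path f" by simp
      show "exp (r * lev c f d) * (1 + r * h $ f d) \<le> 1 + r * (lev c f d + h $ f d) + r\<^sup>2 * D" by (rule pt[OF f])
      have "0 \<le> 1 + r * h $ f d" using rh[of "f d"] by (auto simp: abs_le_iff)
      then have "0 \<le> exp (r * lev c f d) * (1 + r * h $ f d)" by simp
      then show "0 \<le> 1 + r * (lev c f d + h $ f d) + r\<^sup>2 * D" using pt[OF f] by linarith
    qed
    also have "\<dots> = 1 + r * (\<integral>f. lev c f d + h $ f d \<partial>L k) + r\<^sup>2 * D"
      using integrable_lev[OF d0] integrable_vec_coordinate[OF d0] L.prob_space[of k] by simp
    also have "\<dots> \<le> 1 + r * (h $ k - m) + r * (m / 2)"
    proof -
      have "r * (\<integral>f. lev c f d + h $ f d \<partial>L k) \<le> r * (h $ k - m)" using drift[of k] r0 by (intro mult_left_mono) auto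
      moreover have "r\<^sup>2 * D \<le> r * (m / 2)" using rD r0 by (simp add: power2_eq_square mult.assoc mult_left_mono)
      ultimately show ?thesis by linarith
    qed
    also have "\<dots> = (1 + r * h $ k) - r * m / 4 * 2" by (simp add: algebra_simps)
    also have "\<dots> \<le> (1 + r * h $ k) - r * m / 4 * (1 + r * h $ k)"
    proof -
      have "1 + r * h $ k \<le> 2" using rh[of k] by (auto simp: abs_le_iff)
      then have "r * m / 4 * (1 + r * h $ k) \<le> r * m / 4 * 2" using r0 m by (intro mult_left_mono) auto
      then show ?thesis by linarith
    qed
    also have "\<dots> = \<rho> * (1 + r * h $ k)" by (simp add: \<rho>_def algebra_simps)
    finally show ?thesis .
  qed
  have "r * norm h \<le> 1 / 2" using rH by (simp add: H_def)
  then show ?thesis using d(1) r0 \<rho> bound by blast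
qed

text \<open>Splitting at time \<open>n * d\<close> by the Markov property reduces one more step to
  the one-step inequality. The weight \<open>exp (r * lev)\<close> of the past factors out by
  \<open>markov_product\<close>.\<close>

lemma exponential_moment_bound:
  fixes h :: "real^'s"
  assumes d: "0 \<le> d" and r: "0 < r" and \<rho>: "0 \<le> \<rho>" and rh: "r * norm h \<le> 1 / 2"
    and step: "\<And>k. (\<integral>f. exp (r * lev c f d) * (1 + r * h $ f d) \<partial>L k) \<le> \<rho> * (1 + r * h $ k)"
  shows "(\<integral>\<^sup>+f. ennreal (exp (r * lev c f (real n * d)) * (1 + r * h $ f (real n * d))) \<partial>L i) \<le>
    ennreal (\<rho> ^ n * (1 + r * h $ i))"
proof (induction n)
  case 0
  have "(\<integral>\<^sup>+f. ennreal (exp (r * lev c f (real 0 * d)) * (1 + r * h $ f (real 0 * d))) \<partial>L i) =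
    (\<integral>\<^sup>+f. ennreal (1 + r * h $ i) \<partial>L i)"
    by (rule nn_integral_cong_AE) (use AE_start[of i] in \<open>eventually_elim, simp\<close>)
  then show ?case using L.emeasure_space_1[of i] by simp
next
  case (Suc n)
  define t where "t = real n * d"
  have t: "0 \<le> t" "real (Suc n) * d = t + d" using d by (simp_all add: t_def algebra_simps)
  have pos: "0 \<le> 1 + r * h $ k" for k
  proof -
    have "r * \<bar>h $ k\<bar> \<le> r * norm h" using r component_le_norm_cart[of h k] by (intro mult_left_mono) auto
    then have "r * \<bar>h $ k\<bar> \<le> 1 / 2" using rh by linarith
    then have "\<bar>r * h $ k\<bar> \<le> 1 / 2" using r by (simp add: abs_mult)
    then show ?thesis by (auto simp: abs_le_iff)
  qed
  define F where "F f = ennreal (exp (r * lev c f t))" for f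
  define G where "G f = ennreal (exp (r * lev c f d) * (1 + r * h $ f d))" for f
  define E :: "'s \<Rightarrow> (real \<Rightarrow> 's) set" where "E k = {f. step_path f \<and> f t = k}" for k
  have hd [measurable]: "(\<lambda>f. h $ f d) \<in> borel_measurable path_space" by (rule vec_coordinate_measurable[OF d])
  have F: "F \<in> borel_measurable path_space" unfolding F_def by measurable
  have G: "G \<in> borel_measurable path_space" unfolding G_def by measurable
  have G' [measurable]: "(\<lambda>f. G (shift t f)) \<in> borel_measurable (L i)"
    using measurable_comp[OF measurable_shift[OF t(1)] G] by (auto simp: comp_def intro: measurable_L)
  have F' [measurable]: "F \<in> borel_measurable (L i)" using F by (rule measurable_L)
  have E [measurable]: "E k \<in> sets (L i)" for k unfolding E_def sets_L by (rule coordinate_sets[OF t(1)])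
  have F_stop: "F (stop t f) = F f" if "step_path f" for f
  proof -
    have "lev c (stop t f) t = lev c f t" by (rule lev_agree) (simp add: stop_def)
    then show ?thesis by (simp add: F_def)
  qed
  have one: "(\<Sum>k\<in>UNIV. F f * (indicator (E k) f * z k)) = F f * z (f t)" if "step_path f" for f and z :: "'s \<Rightarrow> ennreal"
  proof -
    have "(\<Sum>k\<in>UNIV. F f * (indicator (E k) f * z k)) = (\<Sum>k\<in>UNIV. if k = f t then F f * z k else 0)"
      using that by (intro sum.cong) (auto simp: E_def indicator_def)
    then show ?thesis by simp
  qed
  have G_int: "(\<integral>\<^sup>+f. G f \<partial>L k) \<le> ennreal (\<rho> * (1 + r * h $ k))" for k
  proof -
    have "integrable (L k) (\<lambda>f. exp (r * lev c f d) * (1 + r * h $ f d))"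
    proof (rule L.integrable_const_bound[where B="exp (r * (norm c * d)) * (1 + r * norm h)"])
      show "AE f in L k. norm (exp (r * lev c f d) * (1 + r * h $ f d)) \<le> exp (r * (norm c * d)) * (1 + r * norm h)"
      proof (rule AE_I2)
        fix f assume "f \<in> space (L k)"
        then have f: "step_path f" by simp
        have "lev c f d \<le> norm c * d" using lev_bound[OF f d, of c] by (simp add: abs_le_iff)
        then have "exp (r * lev c f d) \<le> exp (r * (norm c * d))" using r by simp
        moreover have "h $ f d \<le> norm h" using component_le_norm_cart[of h "f d"] by (simp add: abs_le_iff)
        then have "1 + r * h $ f d \<le> 1 + r * norm h" using r by simp
        ultimately have "exp (r * lev c f d) * (1 + r * h $ f d) \<le> exp (r * (norm c * d)) * (1 + r * norm h)"
          using pos[of "f d"] by (intro mult_mono) auto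
        then show "norm (exp (r * lev c f d) * (1 + r * h $ f d)) \<le> exp (r * (norm c * d)) * (1 + r * norm h)"
          using pos[of "f d"] by (simp add: abs_mult)
      qed
      show "(\<lambda>f. exp (r * lev c f d) * (1 + r * h $ f d)) \<in> borel_measurable (L k)"
        using vec_coordinate_measurable_L[OF d, of h k] by measurable
    qed
    then have "(\<integral>\<^sup>+f. G f \<partial>L k) = ennreal (\<integral>f. exp (r * lev c f d) * (1 + r * h $ f d) \<partial>L k)"
      unfolding G_def using pos by (intro nn_integral_eq_integral) auto
    then show ?thesis using step[of k] by (simp add: ennreal_leI)
  qed
  have "(\<integral>\<^sup>+f. ennreal (exp (r * lev c f (real (Suc n) * d)) * (1 + r * h $ f (real (Suc n) * d))) \<partial>L i) =
    (\<integral>\<^sup>+f. (\<Sum>k\<in>UNIV. F f * (indicator (E k) f * G (shift t f))) \<partial>L i)"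
  proof (rule nn_integral_cong)
    fix f assume "f \<in> space (L i)"
    then have f: "step_path f" by simp
    have "exp (r * lev c f (t + d)) = exp (r * lev c f t) * exp (r * lev c (shift t f) d)"
      unfolding lev_shift[OF f t(1) d] by (simp add: distrib_left exp_add)
    then have "ennreal (exp (r * lev c f (t + d)) * (1 + r * h $ f (t + d))) = F f * G (shift t f)"
      unfolding F_def G_def by (simp add: shift_apply ennreal_mult'[symmetric] mult.assoc)
    then show "ennreal (exp (r * lev c f (real (Suc n) * d)) * (1 + r * h $ f (real (Suc n) * d))) =
      (\<Sum>k\<in>UNIV. F f * (indicator (E k) f * G (shift t f)))"
      unfolding one[OF f, of "\<lambda>k. G (shift t f)"] t(2) .
  qed
  also have "\<dots> = (\<Sum>k\<in>UNIV. \<integral>\<^sup>+f. F f * (indicator (E k) f * G (shift t f)) \<partial>L i)"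
    by (rule nn_integral_sum) measurable
  also have "\<dots> = (\<Sum>k\<in>UNIV. (\<integral>\<^sup>+f. F f * indicator (E k) f \<partial>L i) * (\<integral>\<^sup>+f. G f \<partial>L k))"
    unfolding E_def by (intro sum.cong refl markov_product[OF t(1) F F_stop G])
  also have "\<dots> \<le> (\<Sum>k\<in>UNIV. (\<integral>\<^sup>+f. F f * indicator (E k) f \<partial>L i) * ennreal (\<rho> * (1 + r * h $ k)))"
    by (intro sum_mono mult_left_mono G_int) simp
  also have "\<dots> = (\<Sum>k\<in>UNIV. \<integral>\<^sup>+f. F f * (indicator (E k) f * ennreal (\<rho> * (1 + r * h $ k))) \<partial>L i)"
    by (intro sum.cong refl) (simp add: nn_integral_multc[symmetric] mult.assoc)
  also have "\<dots> = (\<integral>\<^sup>+f. (\<Sum>k\<in>UNIV. F f * (indicator (E k) f * ennreal (\<rho> * (1 + r * h $ k)))) \<partial>L i)"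
    by (rule nn_integral_sum[symmetric]) measurable
  also have "\<dots> = (\<integral>\<^sup>+f. ennreal \<rho> * ennreal (exp (r * lev c f t) * (1 + r * h $ f t)) \<partial>L i)"
  proof (rule nn_integral_cong)
    fix f assume "f \<in> space (L i)"
    then have f: "step_path f" by simp
    show "(\<Sum>k\<in>UNIV. F f * (indicator (E k) f * ennreal (\<rho> * (1 + r * h $ k)))) =
      ennreal \<rho> * ennreal (exp (r * lev c f t) * (1 + r * h $ f t))"
      unfolding one[OF f] unfolding F_def using \<rho> pos[of "f t"] by (simp add: ennreal_mult[symmetric] mult.left_commute)
  qed
  also have "\<dots> = ennreal \<rho> * (\<integral>\<^sup>+f. ennreal (exp (r * lev c f t) * (1 + r * h $ f t)) \<partial>L i)"
  proof (rule nn_integral_cmult)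
    show "(\<lambda>f. ennreal (exp (r * lev c f t) * (1 + r * h $ f t))) \<in> borel_measurable (L i)"
      using vec_coordinate_measurable_L[OF t(1), of h i] by measurable
  qed
  also have "\<dots> \<le> ennreal \<rho> * ennreal (\<rho> ^ n * (1 + r * h $ i))"
    using Suc unfolding t_def by (intro mult_left_mono) auto
  also have "\<dots> = ennreal (\<rho> ^ Suc n * (1 + r * h $ i))"
    using \<rho> pos[of i] by (simp add: ennreal_mult[symmetric] mult.assoc)
  finally show ?case .
qed

text \<open>Markov's inequality for the exponential weight. The threshold is
  \<open>- norm c * d\<close> rather than 0 because the level moves by at most that much between two
  grid times: below it at a grid time, the level is negative until the next.\<close>

lemma level_tail_bound:
  fixes h :: "real^'s"
  assumes h: "\<And>k. (Q *v h) $ k = \<mu> - c $ k" and \<mu>: "\<mu> < 0"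
  shows "\<exists>d B \<rho>. 0 < d \<and> 0 \<le> \<rho> \<and> \<rho> < 1 \<and> 0 \<le> B \<and>
    (\<forall>k n. measure (L k) {f. step_path f \<and> - (norm c * d) \<le> lev c f (real n * d)} \<le> B * \<rho> ^ n)"
proof -
  obtain d r \<rho> where dr: "0 < d" "0 < r" "0 \<le> \<rho>" "\<rho> < 1" "r * norm h \<le> 1 / 2"
    and step: "\<And>k. (\<integral>f. exp (r * lev c f d) * (1 + r * h $ f d) \<partial>L k) \<le> \<rho> * (1 + r * h $ k)"
    using exponential_decay[OF h \<mu>] by blast
  define M where "M = norm c * d"
  have rh: "\<bar>r * h $ k\<bar> \<le> 1 / 2" for k
  proof -
    have "r * \<bar>h $ k\<bar> \<le> r * norm h" using dr component_le_norm_cart[of h k] by (intro mult_left_mono) auto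
    then have "r * \<bar>h $ k\<bar> \<le> 1 / 2" using dr(5) by linarith
    then show ?thesis using dr by (simp add: abs_mult)
  qed
  have "measure (L k) {f. step_path f \<and> - M \<le> lev c f (real n * d)} \<le> (4 * exp (r * M)) * \<rho> ^ n" for k n
  proof -
    let ?t = "real n * d"
    let ?A = "{f. step_path f \<and> - M \<le> lev c f ?t}"
    have A: "?A \<in> sets (L k)" unfolding sets_L by (rule path_setI) measurable
    have t: "0 \<le> ?t" using dr by simp
    have "ennreal (exp (- r * M) / 2 * measure (L k) ?A) = (\<integral>\<^sup>+f. ennreal (exp (- r * M) / 2) * indicator ?A f \<partial>L k)"
    proof -
      have "ennreal (exp (- r * M) / 2 * measure (L k) ?A) = ennreal (exp (- r * M) / 2) * ennreal (measure (L k) ?A)"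
        by (rule ennreal_mult) simp_all
      then show ?thesis unfolding nn_integral_cmult_indicator[OF A] L.emeasure_eq_measure .
    qed
    also have "\<dots> \<le> (\<integral>\<^sup>+f. ennreal (exp (r * lev c f ?t) * (1 + r * h $ f ?t)) \<partial>L k)"
    proof (rule nn_integral_mono)
      fix f
      show "ennreal (exp (- r * M) / 2) * indicator ?A f \<le> ennreal (exp (r * lev c f ?t) * (1 + r * h $ f ?t))"
      proof (cases "f \<in> ?A")
        case True
        have "- r * M \<le> r * lev c f ?t"
        proof -
          have "r * (- M) \<le> r * lev c f ?t" using True dr by (intro mult_left_mono) auto
          then show ?thesis by simp
        qed
        moreover have "1 / 2 \<le> 1 + r * h $ f ?t" using rh[of "f ?t"] by (auto simp: abs_le_iff)
        ultimately have "exp (- r * M) * (1 / 2) \<le> exp (r * lev c f ?t) * (1 + r * h $ f ?t)"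
          by (intro mult_mono) auto
        then show ?thesis using True by (simp add: ennreal_leI)
      qed simp
    qed
    also have "\<dots> \<le> ennreal (\<rho> ^ n * (1 + r * h $ k))"
      by (rule exponential_moment_bound[OF less_imp_le[OF dr(1)] dr(2,3,5) step])
    finally have le: "exp (- r * M) / 2 * measure (L k) ?A \<le> \<rho> ^ n * (1 + r * h $ k)"
      using dr rh[of k] by (subst (asm) ennreal_le_iff) (auto simp: abs_le_iff)
    also have "\<dots> \<le> \<rho> ^ n * 2" using dr rh[of k] by (intro mult_left_mono) (auto simp: abs_le_iff)
    finally have le2: "exp (r * M) * (exp (- r * M) / 2 * measure (L k) ?A) \<le> exp (r * M) * (\<rho> ^ n * 2)"
      by (intro mult_left_mono) auto
    have "exp (r * M) * (exp (- r * M) / 2 * measure (L k) ?A) = measure (L k) ?A / 2"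
      by (simp add: exp_minus)
    then have "measure (L k) ?A / 2 \<le> exp (r * M) * (\<rho> ^ n * 2)" using le2 by (simp only:)
    then show ?thesis by (simp add: mult.assoc)
  qed
  then show ?thesis using dr unfolding M_def
    by (intro exI[of _ d] exI[of _ "4 * exp (r * (norm c * d))"] exI[of _ \<rho>]) auto
qed

text \<open>From a down phase there is a positive chance of never exceeding the initial level. The
  flow first descends so far that it cannot return within time \<open>m * d\<close>; from then on it
  stays low at all grid times, since the tail of the summable bounds is less than 1.\<close>

lemma transient:
  fixes h :: "real^'s"
  assumes h: "\<And>k. (Q *v h) $ k = \<mu> - c $ k" and \<mu>: "\<mu> < 0" and i: "c $ i < 0"
  shows "(\<Sum>j\<in>UNIV. down (- c) 0 i j) < 1"
proof -
  obtain d B \<rho> where dB: "0 < d" "0 \<le> \<rho>" "\<rho> < 1" "0 \<le> B"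
    and tail: "\<And>k n. measure (L k) {f. step_path f \<and> - (norm c * d) \<le> lev c f (real n * d)} \<le> B * \<rho> ^ n"
    using level_tail_bound[OF h \<mu>] by blast
  let ?A = "\<lambda>n. {f. step_path f \<and> - (norm c * d) \<le> lev c f (real n * d)}"
  have A: "?A n \<in> sets path_space" for n by (rule path_setI) measurable
  \<comment> \<open>\<open>m\<close> is chosen so that the probabilities of a high level at the grid
    times from \<open>m\<close> on add up to less than 1.\<close>
  have "(\<lambda>m. B * (\<rho> ^ m / (1 - \<rho>))) \<longlonglongrightarrow> B * (0 / (1 - \<rho>))"
    using dB by (intro tendsto_intros LIMSEQ_realpow_zero) auto
  then have "eventually (\<lambda>m. B * (\<rho> ^ m / (1 - \<rho>)) < 1) sequentially"
    by (rule order_tendstoD) simp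
  then obtain m where m: "B * (\<rho> ^ m / (1 - \<rho>)) < 1" by (auto simp: eventually_sequentially)
  let ?U = "\<Union>n. ?A (n + m)"
  have U: "?U \<in> sets path_space" by (rule sets.countable_nat_UN) (blast intro: A)
  have geo: "(\<lambda>n. B * \<rho> ^ (n + m)) sums (B * (\<rho> ^ m / (1 - \<rho>)))"
  proof -
    have "(\<lambda>n. \<rho> ^ n) sums (1 / (1 - \<rho>))" using dB by (intro geometric_sums) auto
    then have "(\<lambda>n. (B * \<rho> ^ m) * \<rho> ^ n) sums ((B * \<rho> ^ m) * (1 / (1 - \<rho>)))" by (rule sums_mult)
    then show ?thesis by (simp add: power_add mult.commute mult.left_commute)
  qed
  have U_less: "measure (L i) ?U < 1"
  proof -
    have sm: "summable (\<lambda>n. measure (L i) (?A (n + m)))"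
    proof (rule summable_comparison_test'[OF sums_summable[OF geo], of 0])
      show "norm (measure (L i) (?A (n + m))) \<le> B * \<rho> ^ (n + m)" for n
        using tail[of i "n + m"] by (simp only: real_norm_def abs_of_nonneg[OF measure_nonneg])
    qed
    have "measure (L i) ?U \<le> (\<Sum>n. measure (L i) (?A (n + m)))"
    proof (rule L.finite_measure_subadditive_countably[OF _ sm])
      show "range (\<lambda>n. ?A (n + m)) \<subseteq> sets (L i)" unfolding sets_L by (blast intro: A)
    qed
    also have "\<dots> \<le> (\<Sum>n. B * \<rho> ^ (n + m))"
      using sm sums_summable[OF geo] by (intro suminf_le tail)
    also have "\<dots> = B * (\<rho> ^ m / (1 - \<rho>))" using geo by (simp add: sums_iff)
    finally show ?thesis using m by linarith
  qed
  \<comment> \<open>The sojourn in \<open>i\<close> that lowers the level by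
    \<open>norm c * (m * d)\<close>, the greatest possible rise during the first \<open>m\<close>
    grid steps.\<close>
  define u where "u = norm c * (real m * d) / - c $ i"
  have u: "0 \<le> u" "c $ i * u = - (norm c * (real m * d))"
    using i dB by (auto simp: u_def divide_nonneg_pos field_simps)
  let ?S = "{f. step_path f} - ?U"
  have S: "?S \<in> sets path_space" using U sets.top[of path_space] by (intro sets.Diff) simp_all
  have pos: "0 < measure (L i) {f\<in>stay i u. shift u f \<in> ?S}"
  proof -
    have "measure (L i) {f\<in>stay i u. shift u f \<in> ?S} = measure (L i) (stay i u) * measure (L i) ?S"
      using u S by (intro measure_shift stay_sets determined_stay) (auto simp: stay_def)
    moreover have "measure (L i) ?S = 1 - measure (L i) ?U"
      using L.prob_compl[of ?U i] U by (simp add: sets_L)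
    ultimately show ?thesis using U_less stay_pos[OF u(1), of i] by simp
  qed
  have disj: "f \<notin> down_event (- c) 0 j" if f: "f \<in> {f\<in>stay i u. shift u f \<in> ?S}" for f j
  proof
    assume "f \<in> down_event (- c) 0 j"
    then have "down_time (- c) 0 f < \<infinity>" by (simp add: down_event_def)
    then obtain t where t: "0 \<le> t" "0 < lev c f t" unfolding down_time_finite_iff by (auto simp: lev_minus)
    have sp: "step_path f" using f by (simp add: stay_def)
    have lev: "lev c f s = c $ i * s" if "0 \<le> s" "s \<le> u" for s
      using f that by (intro lev_const[OF sp]) (auto simp: stay_def)
    show False
    proof (cases "t \<le> u")
      case True
      then have "lev c f t = c $ i * t" using lev t by simp
      then show False using t i by (simp add: zero_less_mult_iff)
    next
      case False
      define s where "s = t - u"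
      have s: "0 \<le> s" "t = u + s" using False by (auto simp: s_def)
      let ?g = "shift u f"
      have g: "step_path ?g" by (rule step_path_shift[OF sp u(1)])
      have lt: "lev c f t = - (norm c * (real m * d)) + lev c ?g s"
        unfolding s(2) lev_shift[OF sp u(1) s(1)] using lev[of u] u by simp
      show False
      proof (cases "s \<le> real m * d")
        case True
        have "lev c ?g s \<le> norm c * s" using lev_bound[OF g s(1), of c] by (simp add: abs_le_iff)
        also have "\<dots> \<le> norm c * (real m * d)" using True by (intro mult_left_mono) auto
        finally show False using lt t by simp
      next
        case False
        define n where "n = nat \<lfloor>s / d\<rfloor>"
        have fl: "0 \<le> \<lfloor>s / d\<rfloor>" using s dB by simp
        then have rn: "real n = of_int \<lfloor>s / d\<rfloor>" by (simp add: n_def)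
        have "real n \<le> s / d" "s / d < real n + 1" unfolding rn by linarith+
        then have n: "real n * d \<le> s" "s < (real n + 1) * d" using dB by (simp_all add: field_simps)
        have "real m * d < (real n + 1) * d" using False n by linarith
        then have mn: "m \<le> n" using dB by simp
        have "?g \<notin> ?A (n - m + m)" using f by blast
        then have less: "lev c ?g (real n * d) < - (norm c * d)" using g mn by simp
        have "lev c ?g s - lev c ?g (real n * d) \<le> norm c * \<bar>s - real n * d\<bar>"
          using lev_lipschitz[OF g, of "real n * d" s c] s dB by (simp add: abs_le_iff)
        also have "\<dots> \<le> norm c * d" using n by (intro mult_left_mono) (auto simp: algebra_simps)
        finally have "lev c ?g s < 0" using less by simp
        moreover have "0 \<le> norm c * (real m * d)" using dB by simp
        ultimately show False using lt t by simp
      qed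
    qed
  qed
  have "(\<Sum>j\<in>UNIV. down (- c) 0 i j) = measure (L i) (\<Union>j\<in>UNIV. down_event (- c) 0 j)"
    unfolding down_def
  proof (rule L.finite_measure_finite_Union[symmetric])
    show "down_event (- c) 0 ` UNIV \<subseteq> sets (L i)" by (auto simp: sets_L down_event_sets)
    show "disjoint_family_on (down_event (- c) 0) UNIV" by (auto simp: disjoint_family_on_def down_event_def)
  qed simp
  moreover have "measure (L i) (\<Union>j\<in>UNIV. down_event (- c) 0 j) + measure (L i) {f\<in>stay i u. shift u f \<in> ?S} \<le> 1"
  proof -
    have "{f\<in>stay i u. shift u f \<in> ?S} = stay i u \<inter> {f. step_path f \<and> shift u f \<in> ?S}" by (auto simp: stay_def)
    then have "{f\<in>stay i u. shift u f \<in> ?S} \<in> sets (L i)"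
      using stay_sets[OF u(1), of i] shift_sets[OF u(1) S] by (simp only: sets_L sets.Int)
    moreover have "(\<Union>j\<in>UNIV. down_event (- c) 0 j) \<in> sets (L i)" by (auto simp: sets_L down_event_sets)
    moreover have "(\<Union>j\<in>UNIV. down_event (- c) 0 j) \<inter> {f\<in>stay i u. shift u f \<in> ?S} = {}" using disj by blast
    ultimately have "measure (L i) (\<Union>j\<in>UNIV. down_event (- c) 0 j) + measure (L i) {f\<in>stay i u. shift u f \<in> ?S} =
      measure (L i) ((\<Union>j\<in>UNIV. down_event (- c) 0 j) \<union> {f\<in>stay i u. shift u f \<in> ?S})"
      by (intro L.finite_measure_Union[symmetric])
    then show ?thesis by simp
  qed
  ultimately show ?thesis using pos by linarith
qed

end


section \<open>Group inverses and simple eigenvalues\<close>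

lemma invertible_iff_kernel:
  fixes M :: "real^'n^'n"
  shows "invertible M \<longleftrightarrow> (\<forall>x. M *v x = 0 \<longrightarrow> x = 0)"
  unfolding invertible_left_inverse matrix_left_invertible_ker ..

lemma matrix_inv_mult:
  fixes M :: "real^'n^'n"
  assumes "invertible M"
  shows "M ** matrix_inv M = mat 1" "matrix_inv M ** M = mat 1"
  using someI_ex[OF assms[unfolded invertible_def]] unfolding matrix_inv_def by blast+

lemma matrix_mult_diff_left: "(A - B) ** C = A ** C - B ** (C :: real^'k^'n)"
  by (vector matrix_matrix_mult_def sum_subtractf left_diff_distrib)

lemma matrix_mult_diff_right: "A ** (B - C) = A ** B - A ** (C :: real^'k^'n)"
  by (vector matrix_matrix_mult_def sum_subtractf right_diff_distrib)

lemma outer_product_mult_vec: "outer_product v u *v x = (u \<bullet> x) *\<^sub>R v"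
  by (simp add: vec_eq_iff outer_product_def matrix_vector_mult_def inner_vec_def sum_distrib_left ac_simps)

lemma vec_mult_outer_product: "x v* outer_product v u = (x \<bullet> v) *\<^sub>R u"
  by (simp add: vec_eq_iff outer_product_def vector_matrix_mult_def inner_vec_def sum_distrib_left ac_simps)

lemma mult_outer_product: "A ** outer_product v u = outer_product (A *v v) u"
  by (simp add: vec_eq_iff outer_product_def matrix_matrix_mult_def matrix_vector_mult_def sum_distrib_left ac_simps)

lemma outer_product_mult: "outer_product v u ** A = outer_product v (u v* A)"
  by (simp add: vec_eq_iff outer_product_def matrix_matrix_mult_def vector_matrix_mult_def sum_distrib_left ac_simps)

lemma outer_product_scaleR: "outer_product (r *\<^sub>R v) (s *\<^sub>R u) = (r * s) *\<^sub>R outer_product v u"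
  by (simp add: vec_eq_iff outer_product_def ac_simps)

lemma outer_product_zero [simp]: "outer_product 0 u = 0" "outer_product v 0 = 0"
  by (simp_all add: vec_eq_iff outer_product_def)

locale simple_kernel =
  fixes M :: "real^'n^'n" and v u :: "real^'n"
  assumes right: "M *v v = 0" and left: "u v* M = 0" and normalized: "u \<bullet> v = 1"
    and kernel: "\<And>x. M *v x = 0 \<Longrightarrow> \<exists>r. x = r *\<^sub>R v"
begin

text \<open>The rank-one shift that moves the eigenvalue 0 on \<open>v\<close> to 1 and changes
  nothing on the complement annihilated by \<open>u\<close>; subtracting the same projection from
  its inverse yields the group inverse.\<close>

definition N :: "real^'n^'n" where "N = M + outer_product v u"

lemma N_v: "N *v v = v"
  by (simp add: N_def matrix_vector_mult_add_rdistrib right outer_product_mult_vec normalized)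

lemma u_N: "u v* N = u"
  by (simp add: N_def vector_matrix_mult_add_rdistrib left vec_mult_outer_product normalized)

lemma invertible_N: "invertible N"
  unfolding invertible_iff_kernel
proof (intro allI impI)
  fix x assume x: "N *v x = 0"
  have "u \<bullet> x = u \<bullet> (N *v x)" using u_N by (simp add: dot_lmul_matrix[symmetric])
  then have ux: "u \<bullet> x = 0" using x by simp
  then have "M *v x = 0" using x by (simp add: N_def matrix_vector_mult_add_rdistrib outer_product_mult_vec)
  then obtain r where "x = r *\<^sub>R v" using kernel by blast
  then show "x = 0" using ux normalized by simp
qed

lemma inv_N_v: "matrix_inv N *v v = v"
  using N_v matrix_inv_mult(2)[OF invertible_N] by (metis matrix_vector_mul_assoc matrix_vector_mul_lid)

lemma u_inv_N: "u v* matrix_inv N = u"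
  using u_N matrix_inv_mult(1)[OF invertible_N] by (metis vector_matrix_mul_assoc vector_matrix_mul_rid)

text \<open>The locale assumes a one-dimensional right kernel only; the left kernel is obtained by
  inverting \<open>N\<close>, which maps \<open>u\<close> to itself from the left.\<close>

lemma left_kernel:
  assumes "x v* M = 0"
  shows "x = (x \<bullet> v) *\<^sub>R u"
proof -
  have "x v* N = (x \<bullet> v) *\<^sub>R u"
    using assms by (simp add: N_def vector_matrix_mult_add_rdistrib vec_mult_outer_product)
  then have "(x v* N) v* matrix_inv N = (x \<bullet> v) *\<^sub>R u"
    by (simp add: scaleR_vector_matrix_assoc u_inv_N)
  then show ?thesis
    by (simp add: vector_matrix_mul_assoc matrix_inv_mult[OF invertible_N])
qed

lemma inv_N_M: "matrix_inv N ** M = mat 1 - outer_product v u"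
proof -
  have "M = N - outer_product v u" by (simp add: N_def)
  then have "matrix_inv N ** M = matrix_inv N ** (N - outer_product v u)" by simp
  then show ?thesis
    by (simp add: matrix_mult_diff_right mult_outer_product inv_N_v matrix_inv_mult[OF invertible_N])
qed

lemma M_inv_N: "M ** matrix_inv N = mat 1 - outer_product v u"
proof -
  have "M = N - outer_product v u" by (simp add: N_def)
  then have "M ** matrix_inv N = (N - outer_product v u) ** matrix_inv N" by simp
  then show ?thesis
    by (simp add: matrix_mult_diff_left outer_product_mult u_inv_N matrix_inv_mult[OF invertible_N])
qed

text \<open>Uniqueness for the definite description: any other admissible pair is
  \<open>(r v, s u)\<close> with \<open>r s = 1\<close>, so the projection is the same, and
  inverting \<open>N\<close> then determines the matrix.\<close>

lemma group_inverse_eq: "group_inverse M = matrix_inv N - outer_product v u"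
  unfolding group_inverse_def
proof (rule the_equality)
  let ?G = "matrix_inv N - outer_product v u"
  have "?G ** M = mat 1 - outer_product v u"
    by (simp add: matrix_mult_diff_left outer_product_mult left inv_N_M)
  moreover have "?G *v v = 0"
    by (simp add: matrix_vector_mult_diff_rdistrib inv_N_v outer_product_mult_vec normalized)
  ultimately show "\<exists>v u. M *v v = 0 \<and> u v* M = 0 \<and> u \<bullet> v = 1 \<and> ?G ** M = mat 1 - outer_product v u \<and> ?G *v v = 0"
    using right left normalized by blast
next
  fix G assume "\<exists>v u. M *v v = 0 \<and> u v* M = 0 \<and> u \<bullet> v = 1 \<and> G ** M = mat 1 - outer_product v u \<and> G *v v = 0"
  then obtain v' u' where G: "M *v v' = 0" "u' v* M = 0" "u' \<bullet> v' = 1"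
    "G ** M = mat 1 - outer_product v' u'" "G *v v' = 0" by blast
  obtain r where v': "v' = r *\<^sub>R v" using kernel[OF G(1)] by blast
  define s where "s = u' \<bullet> v"
  have u': "u' = s *\<^sub>R u" unfolding s_def by (rule left_kernel[OF G(2)])
  have rs: "r * s = 1" using G(3) v' u' normalized by (simp add: mult.commute)
  have outer: "outer_product v' u' = outer_product v u" using rs by (simp add: v' u' outer_product_scaleR)
  have "r *\<^sub>R (G *v v) = 0" using G(5) v' by (simp add: matrix_vector_mult_scaleR)
  then have Gv: "G *v v = 0" using rs by auto
  have "G ** N = mat 1 - outer_product v u"
    using G(4) by (simp add: N_def matrix_add_ldistrib mult_outer_product Gv outer)
  then have "(G ** N) ** matrix_inv N = matrix_inv N - outer_product v u"
    by (simp add: matrix_mult_diff_left outer_product_mult u_inv_N)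
  then show "G = matrix_inv N - outer_product v u"
    by (simp add: matrix_mul_assoc[symmetric] matrix_inv_mult[OF invertible_N])
qed

text \<open>The definition prescribes the product in the other order. This order is what is needed
  to multiply \<open>E M\<close> by the group inverse and to solve the Poisson equation.\<close>

lemma mult_group_inverse: "M ** group_inverse M = mat 1 - outer_product v u"
  by (simp add: group_inverse_eq matrix_mult_diff_right mult_outer_product right M_inv_N)

end

section \<open>The characteristic polynomial of a matrix with simple kernel\<close>

lemma poly_det:
  fixes A :: "real poly^'n^'n"
  shows "poly (det A) x = det (\<chi> i j. poly (A $ i $ j) x)"
proof -
  have "poly (of_int k) x = of_int k" for k :: int
    by (cases k rule: int_cases2) (simp_all add: of_nat_poly)
  then show ?thesis by (simp add: det_def poly_sum poly_prod)
qed

text \<open>Adding to row \<open>k\<close> of \<open>x I - M\<close> the other rows with weights \<open>u\<close> turns it into \<open>x u\<close>, which splits off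
  the factor \<open>x\<close> of the characteristic polynomial.\<close>

lemma (in simple_kernel) simple_eigenvalue_0: "simple_eigenvalue M 0"
proof -
  have "u \<noteq> 0" using normalized by auto
  then obtain k where k: "u $ k \<noteq> 0" by (auto simp: vec_eq_iff)
  define R where "R = (\<chi> i. if i = k then \<chi> j. [:u $ j:] else \<chi> j. (if i = j then [:0, 1:] else 0) - [:M $ i $ j:])"
  have poly_R: "poly (det R) x = det (\<chi> i. if i = k then u else row i (mat x - M))" for x
    unfolding poly_det
    by (rule arg_cong[where f=det]) (auto simp: R_def vec_eq_iff row_def mat_def)
  have poly_char: "poly (char_polynomial M) x = det (mat x - M)" for x
    unfolding char_polynomial_def poly_det
    by (rule arg_cong[where f=det]) (auto simp: vec_eq_iff mat_def)
  have "poly (smult (u $ k) (char_polynomial M)) x = poly ([:0, 1:] * det R) x" for x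
  proof -
    have rows: "(\<Sum>i\<in>UNIV. u $ i *s row i (mat x - M)) = x *s u"
    proof -
      have "(\<Sum>i\<in>UNIV. u $ i *s row i (mat x - M)) = u v* (mat x - M)"
        by (simp add: vec_eq_iff row_def vector_matrix_mult_def mult.commute)
      also have "\<dots> = u v* mat x" by (simp add: vector_matrix_mult_diff_rdistrib left)
      also have "\<dots> = x *s u"
        by (simp add: vec_eq_iff vector_matrix_mult_def mat_def if_distrib[of "\<lambda>y. _ * y"] if_distrib[of "\<lambda>y. y * _"] cong: if_cong)
      finally show ?thesis .
    qed
    have "u $ k * det (mat x - M) = det (\<chi> i. if i = k then x *s u else row i (mat x - M))"
      using cramer_lemma_transpose[of k u "mat x - M"] unfolding rows by simp
    also have "\<dots> = x * det (\<chi> i. if i = k then u else row i (mat x - M))"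
      by (rule det_row_mul)
    finally show ?thesis by (simp add: poly_R poly_char)
  qed
  then have eq: "smult (u $ k) (char_polynomial M) = [:0, 1:] * det R"
    by (intro poly_eq_poly_eq_iff[THEN iffD1]) auto
  \<comment> \<open>At \<open>x = 0\<close> the matrix consists of \<open>u\<close> in row
    \<open>k\<close> and of the other rows of \<open>- M\<close>. A null vector \<open>y\<close> of
    it satisfies \<open>u \<bullet> y = 0\<close> and \<open>M y = 0\<close> off row
    \<open>k\<close>; as \<open>u\<close> annihilates \<open>M\<close> and
    \<open>u $ k \<noteq> 0\<close>, also in row \<open>k\<close>. So \<open>y\<close> is a multiple
    of \<open>v\<close>, hence 0.\<close>
  have "poly (det R) 0 \<noteq> 0"
  proof -
    let ?A = "\<chi> i. if i = k then u else row i (mat 0 - M)"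
    have "invertible ?A"
      unfolding invertible_iff_kernel
    proof (intro allI impI)
      fix y assume y: "?A *v y = 0"
      have uy: "u \<bullet> y = 0"
      proof -
        have "(?A *v y) $ k = u \<bullet> y" by (simp add: matrix_vector_mult_def inner_vec_def)
        then show ?thesis using y by simp
      qed
      have My: "(M *v y) $ i = 0" if "i \<noteq> k" for i
      proof -
        have "(?A *v y) $ i = - (M *v y) $ i"
          using that by (simp add: matrix_vector_mult_def row_def sum_negf)
        then show ?thesis using y by simp
      qed
      have "0 = u \<bullet> (M *v y)" using left by (simp add: dot_lmul_matrix[symmetric])
      also have "\<dots> = (\<Sum>i\<in>UNIV. if i = k then u $ k * (M *v y) $ k else 0)"
        unfolding inner_vec_def using My by (intro sum.cong) auto
      also have "\<dots> = u $ k * (M *v y) $ k" by simp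
      finally have "(M *v y) $ k = 0" using k by simp
      then have "M *v y = 0" using My by (metis vec_eq_iff zero_index)
      then obtain r where "y = r *\<^sub>R v" using kernel by blast
      then show "y = 0" using uy normalized by simp
    qed
    then show ?thesis by (simp add: poly_R invertible_det_nz)
  qed
  then have "det R \<noteq> 0" "order 0 (det R) = 0" by (auto intro: order_0I)
  then have "order 0 ([:0, 1:] * det R) = order 0 [:0, 1::real:]"
    by (subst order_mult) auto
  also have "\<dots> = 1" using order_power_n_n[of "0::real" 1] by simp
  finally have "order 0 (smult (u $ k) (char_polynomial M)) = 1" by (simp only: eq)
  then show ?thesis using k by (simp add: simple_eigenvalue_def order_smult)
qed


section \<open>Irreducibility\<close>

lemma finite_max_exists: "\<exists>k. \<forall>l. f l \<le> f k" for f :: "'a::finite \<Rightarrow> real"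
proof -
  have "Max (range f) \<in> range f" by (rule Max_in) auto
  then obtain k where "Max (range f) = f k" by blast
  moreover have "f l \<le> Max (range f)" for l by (rule Max_ge) auto
  ultimately show ?thesis by (intro exI[of _ k]) auto
qed

context phase_chain
begin

lemma closed_phases:
  assumes k: "k \<in> A" and closed: "\<And>i j. i \<in> A \<Longrightarrow> i \<noteq> j \<Longrightarrow> 0 < Q $ i $ j \<Longrightarrow> j \<in> A"
  shows "l \<in> A"
proof -
  have "(k, l) \<in> {(k, l). k \<noteq> l \<and> 0 < Q $ k $ l}\<^sup>*"
    using irreducible by (simp add: irreducible_generator_def)
  then show ?thesis by (induction rule: rtrancl_induct) (use k closed in auto)
qed

lemma Q_row_sum_weighted:
  fixes x :: "'s \<Rightarrow> real"
  shows "(\<Sum>l\<in>UNIV. Q $ i $ l * x l) = (\<Sum>l\<in>UNIV - {i}. Q $ i $ l * (x l - x i))"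
proof -
  have "(\<Sum>l\<in>UNIV. Q $ i $ l * x l) = (\<Sum>l\<in>UNIV. Q $ i $ l * (x l - x i))"
    using Q_row_sum[of i] by (simp add: right_diff_distrib sum_subtractf sum_distrib_right[symmetric])
  also have "\<dots> = (\<Sum>l\<in>UNIV - {i}. Q $ i $ l * (x l - x i))"
    by (subst sum.remove[of UNIV i]) auto
  finally show ?thesis .
qed

text \<open>The sum of the nonnegative terms \<open>Q $ i $ l * (x i - x l)\<close> is at most 0, so
  each of them vanishes.\<close>

lemma maximum_principle:
  fixes x :: "'s \<Rightarrow> real"
  assumes max: "\<And>l. x l \<le> x i" and harm: "0 \<le> (\<Sum>l\<in>UNIV. Q $ i $ l * x l)" and j: "i \<noteq> j" "0 < Q $ i $ j"
  shows "x j = x i"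
proof -
  have "(\<Sum>l\<in>UNIV - {i}. Q $ i $ l * (x i - x l)) \<le> 0"
    using harm unfolding Q_row_sum_weighted by (simp add: right_diff_distrib sum_subtractf)
  moreover have nn: "0 \<le> Q $ i $ l * (x i - x l)" if "l \<in> UNIV - {i}" for l
    using Q_nonneg[of i l] max[of l] that by auto
  ultimately have "(\<Sum>l\<in>UNIV - {i}. Q $ i $ l * (x i - x l)) = 0"
    by (intro antisym sum_nonneg) blast+
  then have "\<forall>l\<in>UNIV - {i}. Q $ i $ l * (x i - x l) = 0"
    using nn by (subst (asm) sum_nonneg_eq_0_iff) auto
  then have "Q $ i $ j * (x i - x j) = 0" by (rule bspec) (use j in simp)
  then show ?thesis using j(2) by simp
qed

lemma Q_kernel:
  assumes "Q *v x = 0"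
  shows "\<exists>r. x = r *\<^sub>R 1"
proof -
  obtain k where k: "\<And>l. x $ l \<le> x $ k" using finite_max_exists[of "\<lambda>l. x $ l"] by blast
  have "l \<in> {l. x $ l = x $ k}" for l
  proof (rule closed_phases[of k])
    fix i j assume ij: "i \<in> {l. x $ l = x $ k}" "i \<noteq> j" "0 < Q $ i $ j"
    have "(\<Sum>l\<in>UNIV. Q $ i $ l * x $ l) = 0"
      using assms by (simp add: vec_eq_iff matrix_vector_mult_def)
    then have "x $ j = x $ i" using k ij by (intro maximum_principle[of "\<lambda>l. x $ l"]) auto
    then show "j \<in> {l. x $ l = x $ k}" using ij by simp
  qed simp
  then show ?thesis by (intro exI[of _ "x $ k"]) (simp add: vec_eq_iff)
qed

lemma simple_kernel_Q:
  assumes "stationary_vector Q \<alpha>"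
  shows "simple_kernel Q 1 \<alpha>"
proof
  show "Q *v 1 = 0" by (simp add: vec_eq_iff matrix_vector_mult_def Q_row_sum)
qed (use assms Q_kernel in \<open>auto simp: stationary_vector_def\<close>)

text \<open>The role of \<open>h\<close>: it solves \<open>Q h = \<mu> 1 - c\<close>. For zero drift
  this makes \<open>X + h(\<phi>)\<close> a martingale; in general it equalises the mean drift over
  the phases.\<close>

lemma Poisson_equation:
  assumes \<alpha>: "stationary_vector Q \<alpha>"
  shows "(Q *v (- (group_inverse Q *v c))) $ k = \<alpha> \<bullet> c - c $ k"
proof -
  interpret K: simple_kernel Q 1 \<alpha> by (rule simple_kernel_Q[OF \<alpha>])
  have "Q *v (group_inverse Q *v c) = c - (\<alpha> \<bullet> c) *\<^sub>R 1"
    by (simp add: matrix_vector_mul_assoc K.mult_group_inverse matrix_vector_mult_diff_rdistrib outer_product_mult_vec)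
  moreover have "Q *v (- (group_inverse Q *v c)) = - (Q *v (group_inverse Q *v c))"
    using matrix_vector_mult_diff_distrib[of Q 0 "group_inverse Q *v c"] by simp
  ultimately show ?thesis by simp
qed

text \<open>A null vector of the block, extended by 0, is harmonic at the phases of the block. A
  positive maximum would spread by irreducibility to all phases, also to \<open>p\<close>, where the
  extension is 0.\<close>

lemma invertible_subgenerator:
  fixes e0 :: "'z::finite \<Rightarrow> 's"
  assumes e0: "inj e0" and p: "p \<notin> range e0"
  shows "invertible (- submat e0 e0 Q)"
  unfolding invertible_iff_kernel
proof (intro allI impI)
  fix y assume "(- submat e0 e0 Q) *v y = 0"
  then have y: "(\<Sum>z\<in>UNIV. Q $ e0 r $ e0 z * y $ z) = 0" for r
    by (simp add: vec_eq_iff matrix_vector_mult_def submat_def sum_negf)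
  define x where "x l = (if l \<in> range e0 then y $ (inv e0 l) else 0)" for l
  have x_e0: "x (e0 z) = y $ z" for z using e0 by (simp add: x_def inv_f_f)
  have Qx: "(\<Sum>l\<in>UNIV. Q $ e0 r $ l * x l) = 0" for r
  proof -
    have "(\<Sum>l\<in>UNIV. Q $ e0 r $ l * x l) = (\<Sum>l\<in>range e0. Q $ e0 r $ l * x l)"
      by (rule sum.mono_neutral_right) (auto simp: x_def)
    also have "\<dots> = (\<Sum>z\<in>UNIV. Q $ e0 r $ e0 z * y $ z)"
      using e0 by (subst sum.reindex) (auto simp: x_e0)
    finally show ?thesis using y by simp
  qed
  \<comment> \<open>Both signs are treated at once, so that the argument for the maximum also covers
    the minimum.\<close>
  have nonpos: "s * x l \<le> 0" if s: "s = 1 \<or> s = - 1" for s l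
  proof (rule ccontr)
    assume "\<not> s * x l \<le> 0"
    obtain k where k: "\<And>l. s * x l \<le> s * x k" using finite_max_exists[of "\<lambda>l. s * x l"] by blast
    have pos: "0 < s * x k" using k[of l] \<open>\<not> s * x l \<le> 0\<close> by simp
    have "p \<in> {l. s * x l = s * x k}"
    proof (rule closed_phases[of k])
      fix i j assume ij: "i \<in> {l. s * x l = s * x k}" "i \<noteq> j" "0 < Q $ i $ j"
      then have "x i \<noteq> 0" using pos by auto
      then obtain r where r: "i = e0 r" by (auto simp: x_def split: if_splits)
      have "(\<Sum>l\<in>UNIV. Q $ i $ l * (s * x l)) = s * (\<Sum>l\<in>UNIV. Q $ i $ l * x l)"
        by (simp add: sum_distrib_left mult.left_commute)
      then have "(\<Sum>l\<in>UNIV. Q $ i $ l * (s * x l)) = 0" using Qx[of r] r by simp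
      then have "s * x j = s * x i" using k ij by (intro maximum_principle[of "\<lambda>l. s * x l"]) auto
      then show "j \<in> {l. s * x l = s * x k}" using ij(1) by (simp only: mem_Collect_eq)
    qed simp
    moreover have "x p = 0" using p by (simp add: x_def)
    ultimately show False using pos by auto
  qed
  have "x l = 0" for l using nonpos[of 1 l] nonpos[of "-1" l] by simp
  then show "y = 0" using x_e0 by (simp add: vec_eq_iff)
qed

end


section \<open>Block matrices with off-diagonal blocks\<close>

lemma sum_UNIV_Plus: "(\<Sum>x\<in>UNIV. f x) = (\<Sum>x\<in>UNIV. f (Inl x)) + (\<Sum>x\<in>UNIV. f (Inr x))"
  for f :: "'p::finite + 'm::finite \<Rightarrow> real"
  by (simp add: UNIV_Plus_UNIV[symmetric] sum.Plus del: UNIV_Plus_UNIV)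

locale off_diagonal =
  fixes A :: "real^'m^'p" and B :: "real^'p^'m"
  assumes A_nonneg: "\<And>p m. 0 \<le> A $ p $ m" and B_nonneg: "\<And>m p. 0 \<le> B $ m $ p"
begin

definition offdiag :: "real^('p + 'm)^('p + 'm)" where "offdiag = block_mat 0 A B 0"

lemma P_mult:
  "((mat 1 + offdiag) *v x) $ Inl p = x $ Inl p + (\<Sum>m\<in>UNIV. A $ p $ m * x $ Inr m)"
  "((mat 1 + offdiag) *v x) $ Inr m = x $ Inr m + (\<Sum>p\<in>UNIV. B $ m $ p * x $ Inl p)"
proof -
  have "(offdiag *v x) $ Inl p = (\<Sum>m\<in>UNIV. A $ p $ m * x $ Inr m)" "(offdiag *v x) $ Inr m = (\<Sum>p\<in>UNIV. B $ m $ p * x $ Inl p)"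
    by (simp_all add: matrix_vector_mult_def sum_UNIV_Plus offdiag_def block_mat_def block_vec_def)
  then show "((mat 1 + offdiag) *v x) $ Inl p = x $ Inl p + (\<Sum>m\<in>UNIV. A $ p $ m * x $ Inr m)"
    "((mat 1 + offdiag) *v x) $ Inr m = x $ Inr m + (\<Sum>p\<in>UNIV. B $ m $ p * x $ Inl p)"
    by (simp_all add: matrix_vector_mult_add_rdistrib)
qed

lemma mult_P:
  "(x v* (mat 1 + offdiag)) $ Inl p = x $ Inl p + (\<Sum>m\<in>UNIV. x $ Inr m * B $ m $ p)"
  "(x v* (mat 1 + offdiag)) $ Inr m = x $ Inr m + (\<Sum>p\<in>UNIV. x $ Inl p * A $ p $ m)"
proof -
  have "(x v* offdiag) $ Inl p = (\<Sum>m\<in>UNIV. x $ Inr m * B $ m $ p)" "(x v* offdiag) $ Inr m = (\<Sum>p\<in>UNIV. x $ Inl p * A $ p $ m)"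
    by (simp_all add: vector_matrix_mult_def sum_UNIV_Plus offdiag_def block_mat_def block_vec_def mult.commute)
  then show "(x v* (mat 1 + offdiag)) $ Inl p = x $ Inl p + (\<Sum>m\<in>UNIV. x $ Inr m * B $ m $ p)"
    "(x v* (mat 1 + offdiag)) $ Inr m = x $ Inr m + (\<Sum>p\<in>UNIV. x $ Inl p * A $ p $ m)"
    by (simp_all add: vector_matrix_mult_add_rdistrib)
qed

text \<open>For a null vector, the largest modulus on either half is bounded by the largest one on
  the other half. Strict row sums in one of the two blocks are enough to force both to 0.\<close>

lemma invertible_substochastic:
  assumes A1: "\<And>p. (\<Sum>m\<in>UNIV. A $ p $ m) \<le> 1" and B1: "\<And>m. (\<Sum>p\<in>UNIV. B $ m $ p) \<le> 1"
    and strict: "(\<forall>p. (\<Sum>m\<in>UNIV. A $ p $ m) < 1) \<or> (\<forall>m. (\<Sum>p\<in>UNIV. B $ m $ p) < 1)"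
  shows "invertible (mat 1 + offdiag)"
  unfolding invertible_iff_kernel
proof (intro allI impI)
  fix x assume x: "(mat 1 + offdiag) *v x = 0"
  have xl: "x $ Inl p = - (\<Sum>m\<in>UNIV. A $ p $ m * x $ Inr m)" for p using P_mult(1)[of x p] x by simp
  have xr: "x $ Inr m = - (\<Sum>p\<in>UNIV. B $ m $ p * x $ Inl p)" for m using P_mult(2)[of x m] x by simp
  obtain p where p: "\<And>q. \<bar>x $ Inl q\<bar> \<le> \<bar>x $ Inl p\<bar>" using finite_max_exists[of "\<lambda>l. \<bar>x $ Inl l\<bar>"] by blast
  obtain m where m: "\<And>q. \<bar>x $ Inr q\<bar> \<le> \<bar>x $ Inr m\<bar>" using finite_max_exists[of "\<lambda>l. \<bar>x $ Inr l\<bar>"] by blast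
  let ?a = "\<Sum>m\<in>UNIV. A $ p $ m" and ?b = "\<Sum>p\<in>UNIV. B $ m $ p"
  let ?Y = "\<bar>x $ Inl p\<bar>" and ?Z = "\<bar>x $ Inr m\<bar>"
  have YZ: "?Y \<le> ?a * ?Z" unfolding xl[of p] abs_minus_cancel by (intro sum_weighted_le A_nonneg m)
  have ZY: "?Z \<le> ?b * ?Y" unfolding xr[of m] abs_minus_cancel by (intro sum_weighted_le B_nonneg p)
  have Y1: "?a * ?Z \<le> 1 * ?Z" using A1 by (intro mult_right_mono) auto
  have Z1: "?b * ?Y \<le> 1 * ?Y" using B1 by (intro mult_right_mono) auto
  have eq: "?Y = ?Z" using YZ ZY Y1 Z1 by simp
  have "?Y = 0"
  proof (rule ccontr)
    assume "?Y \<noteq> 0"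
    then have pos: "0 < ?Y" "0 < ?Z" using eq by auto
    from strict show False
    proof
      assume "\<forall>p. (\<Sum>m\<in>UNIV. A $ p $ m) < 1"
      then have "?a * ?Z < 1 * ?Z" using pos by (intro mult_strict_right_mono) auto
      then show False using YZ eq by simp
    next
      assume "\<forall>m. (\<Sum>p\<in>UNIV. B $ m $ p) < 1"
      then have "?b * ?Y < 1 * ?Y" using pos by (intro mult_strict_right_mono) auto
      then show False using ZY eq by simp
    qed
  qed
  then have "x $ Inl q = 0" "x $ Inr q' = 0" for q q' using p[of q] m[of q'] eq by simp_all
  then have "x $ i = 0" for i by (cases i) auto
  then show "x = 0" by (simp add: vec_eq_iff)
qed

end

locale positive_stochastic = off_diagonal A B
  for A :: "real^'m^'p" and B :: "real^'p^'m" +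
  assumes A_pos: "\<And>p m. 0 < A $ p $ m" and B_pos: "\<And>m p. 0 < B $ m $ p"
    and A_sum: "\<And>p. (\<Sum>m\<in>UNIV. A $ p $ m) = 1" and B_sum: "\<And>m. (\<Sum>p\<in>UNIV. B $ m $ p) = 1"
begin

text \<open>The two-step kernel on the up phases; squaring the off-diagonal matrix decouples the two
  halves, and \<open>K\<close> is the upper block of the square.\<close>

definition K :: "'p \<Rightarrow> 'p \<Rightarrow> real" where "K p q = (\<Sum>m\<in>UNIV. A $ p $ m * B $ m $ q)"

lemma K_pos: "0 < K p q"
  unfolding K_def by (intro sum_pos) (auto simp: A_pos B_pos)

lemma K_sum: "(\<Sum>q\<in>UNIV. K p q) = 1"
  unfolding K_def by (subst sum.swap) (simp add: sum_distrib_left[symmetric] B_sum A_sum)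

definition v :: "real^('p + 'm)" where "v = block_vec 1 (- 1)"

lemma P_v: "(mat 1 + offdiag) *v v = 0"
proof -
  have "((mat 1 + offdiag) *v v) $ i = 0" for i
    by (cases i) (simp_all add: P_mult v_def block_vec_def sum_negf A_sum B_sum)
  then show ?thesis by (simp add: vec_eq_iff)
qed

text \<open>The upper half of a null vector is harmonic for the positive stochastic kernel
  \<open>K\<close>, hence constant; the lower half is then the negative of this constant.\<close>

lemma kernel_P:
  assumes x: "(mat 1 + offdiag) *v x = 0"
  shows "\<exists>r. x = r *\<^sub>R v"
proof -
  have xl: "x $ Inl p = - (\<Sum>m\<in>UNIV. A $ p $ m * x $ Inr m)" for p using P_mult(1)[of x p] x by simp
  have xr: "x $ Inr m = - (\<Sum>p\<in>UNIV. B $ m $ p * x $ Inl p)" for m using P_mult(2)[of x m] x by simp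
  have xK: "x $ Inl p = (\<Sum>q\<in>UNIV. K p q * x $ Inl q)" for p
  proof -
    have "x $ Inl p = (\<Sum>m\<in>UNIV. A $ p $ m * (\<Sum>q\<in>UNIV. B $ m $ q * x $ Inl q))"
      unfolding xl[of p] by (subst xr) (simp add: sum_negf)
    also have "\<dots> = (\<Sum>m\<in>UNIV. \<Sum>q\<in>UNIV. A $ p $ m * B $ m $ q * x $ Inl q)"
      by (simp add: sum_distrib_left mult.assoc)
    also have "\<dots> = (\<Sum>q\<in>UNIV. K p q * x $ Inl q)"
      unfolding K_def by (subst sum.swap) (simp add: sum_distrib_right)
    finally show ?thesis .
  qed
  obtain p where p: "\<And>q. x $ Inl q \<le> x $ Inl p" using finite_max_exists[of "\<lambda>l. x $ Inl l"] by blast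
  have "(\<Sum>q\<in>UNIV. K p q * (x $ Inl p - x $ Inl q)) = 0"
    using xK[of p] K_sum[of p] by (simp add: right_diff_distrib sum_subtractf sum_distrib_right[symmetric])
  moreover have "0 \<le> K p q * (x $ Inl p - x $ Inl q)" for q using K_pos[of p q] p[of q] by simp
  ultimately have "\<forall>q\<in>UNIV. K p q * (x $ Inl p - x $ Inl q) = 0"
    by (subst (asm) sum_nonneg_eq_0_iff) auto
  then have "K p q * (x $ Inl p - x $ Inl q) = 0" for q by (rule bspec) simp
  moreover define y where "y = x $ Inl p"
  ultimately have l: "x $ Inl q = y" for q using K_pos[of p q] by (metis mult_eq_0_iff less_irrefl eq_iff_diff_eq_0)
  have r: "x $ Inr m = - y" for m
    unfolding xr[of m] by (simp add: l sum_distrib_right[symmetric] B_sum)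
  have "x $ i = (y *\<^sub>R v) $ i" for i
    by (cases i) (simp_all add: l r v_def block_vec_def)
  then show ?thesis by (auto simp: vec_eq_iff)
qed

lemma left_kernel_P:
  assumes \<eta>: "\<eta> v* (mat 1 + offdiag) = 0"
  shows "\<eta> $ Inr m = - (\<Sum>p\<in>UNIV. \<eta> $ Inl p * A $ p $ m)"
    and "\<eta> $ Inl q = (\<Sum>p\<in>UNIV. \<eta> $ Inl p * K p q)"
proof -
  have r: "\<eta> $ Inr m = - (\<Sum>p\<in>UNIV. \<eta> $ Inl p * A $ p $ m)" for m using mult_P(2)[of \<eta> m] \<eta> by simp
  then show "\<eta> $ Inr m = - (\<Sum>p\<in>UNIV. \<eta> $ Inl p * A $ p $ m)" .
  have "\<eta> $ Inl q = - (\<Sum>m\<in>UNIV. \<eta> $ Inr m * B $ m $ q)" using mult_P(1)[of \<eta> q] \<eta> by simp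
  also have "\<dots> = (\<Sum>m\<in>UNIV. \<Sum>p\<in>UNIV. \<eta> $ Inl p * A $ p $ m * B $ m $ q)"
    by (simp add: r sum_negf sum_distrib_right)
  also have "\<dots> = (\<Sum>p\<in>UNIV. \<eta> $ Inl p * K p q)"
    unfolding K_def by (subst sum.swap) (simp add: sum_distrib_left mult.assoc)
  finally show "\<eta> $ Inl q = (\<Sum>p\<in>UNIV. \<eta> $ Inl p * K p q)" .
qed

text \<open>The upper part of a left null vector is invariant under the positive stochastic kernel \<open>K\<close>, and
  so is the vector of its absolute values.\<close>

lemma left_kernel_sign:
  assumes \<eta>: "\<eta> v* (mat 1 + offdiag) = 0" and nz: "\<eta> \<noteq> 0"
  shows "(\<forall>p. 0 < \<eta> $ Inl p) \<or> (\<forall>p. \<eta> $ Inl p < 0)"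
proof -
  let ?y = "\<lambda>p. \<eta> $ Inl p"
  have y: "?y q = (\<Sum>p\<in>UNIV. ?y p * K p q)" for q by (rule left_kernel_P(2)[OF \<eta>])
  have le: "\<bar>?y q\<bar> \<le> (\<Sum>p\<in>UNIV. \<bar>?y p\<bar> * K p q)" for q
  proof -
    have "\<bar>?y q\<bar> \<le> (\<Sum>p\<in>UNIV. \<bar>?y p * K p q\<bar>)" by (subst y) (rule sum_abs)
    also have "\<dots> = (\<Sum>p\<in>UNIV. \<bar>?y p\<bar> * K p q)"
      by (intro sum.cong refl) (simp add: abs_mult abs_of_pos[OF K_pos])
    finally show ?thesis .
  qed
  have "(\<Sum>q\<in>UNIV. (\<Sum>p\<in>UNIV. \<bar>?y p\<bar> * K p q) - \<bar>?y q\<bar>) = 0"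
  proof -
    have "(\<Sum>q\<in>UNIV. \<Sum>p\<in>UNIV. \<bar>?y p\<bar> * K p q) = (\<Sum>p\<in>UNIV. \<bar>?y p\<bar>)"
      by (subst sum.swap) (simp add: sum_distrib_left[symmetric] K_sum)
    then show ?thesis by (simp add: sum_subtractf)
  qed
  then have "(\<Sum>p\<in>UNIV. \<bar>?y p\<bar> * K p q) - \<bar>?y q\<bar> = 0" for q
    using le by (subst (asm) sum_nonneg_eq_0_iff) auto
  then have abs: "\<bar>?y q\<bar> = (\<Sum>p\<in>UNIV. \<bar>?y p\<bar> * K p q)" for q by (simp add: algebra_simps)
  have pos: "0 < (\<Sum>p\<in>UNIV. w p * K p q)" if w: "\<And>p. 0 \<le> w p" "w p0 \<noteq> 0" for w p0 q
  proof -
    have "0 < w p0 * K p0 q" using w(1)[of p0] w(2) K_pos[of p0 q] by simp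
    also have "\<dots> \<le> (\<Sum>p\<in>UNIV. w p * K p q)"
      using w K_pos by (intro member_le_sum) (auto intro!: mult_nonneg_nonneg simp: less_imp_le)
    finally show ?thesis .
  qed
  have ex: "\<exists>p. ?y p \<noteq> 0"
  proof (rule ccontr)
    assume "\<not> (\<exists>p. ?y p \<noteq> 0)"
    then have z: "?y p = 0" for p by simp
    have "\<eta> $ i = 0" for i by (cases i) (simp_all add: z left_kernel_P(1)[OF \<eta>])
    then show False using nz by (simp add: vec_eq_iff)
  qed
  show ?thesis
  \<comment> \<open>The negative part \<open>\<bar>y\<bar> - y\<close> is invariant as well; a
    nonzero nonnegative invariant vector of a positive kernel is positive everywhere.\<close>
  proof (cases "\<exists>p. \<bar>?y p\<bar> - ?y p \<noteq> 0")
    case True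
    then obtain p0 where p0: "\<bar>?y p0\<bar> - ?y p0 \<noteq> 0" by blast
    have "?y q < 0" for q
    proof -
      have "0 < (\<Sum>p\<in>UNIV. (\<bar>?y p\<bar> - ?y p) * K p q)" by (rule pos[of _ p0]) (use p0 in auto)
      also have "\<dots> = \<bar>?y q\<bar> - ?y q"
        by (simp add: left_diff_distrib sum_subtractf abs[of q, symmetric] y[of q, symmetric])
      finally show ?thesis by simp
    qed
    then show ?thesis by blast
  next
    case False
    obtain p0 where p0: "?y p0 \<noteq> 0" using ex by blast
    have nn: "0 \<le> ?y p" for p using False by (metis abs_ge_zero eq_iff_diff_eq_0)
    have "0 < ?y q" for q by (subst y) (rule pos[of _ p0], use p0 nn in auto)
    then show ?thesis by blast
  qed
qed

text \<open>The lower half of \<eta> is expressed by the upper one. Inner products with \<eta> thus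
  become sums over the up phases, where \<eta> has one strict sign.\<close>

lemma left_kernel_inner:
  assumes \<eta>: "\<eta> v* (mat 1 + offdiag) = 0"
  shows "\<eta> \<bullet> block_vec x y = (\<Sum>p\<in>UNIV. \<eta> $ Inl p * (x $ p - (\<Sum>m\<in>UNIV. A $ p $ m * y $ m)))"
proof -
  have "(\<Sum>m\<in>UNIV. \<eta> $ Inr m * y $ m) = - (\<Sum>m\<in>UNIV. \<Sum>p\<in>UNIV. \<eta> $ Inl p * A $ p $ m * y $ m)"
    by (simp add: left_kernel_P(1)[OF \<eta>] sum_negf sum_distrib_right)
  also have "\<dots> = - (\<Sum>p\<in>UNIV. \<eta> $ Inl p * (\<Sum>m\<in>UNIV. A $ p $ m * y $ m))"
    by (subst sum.swap) (simp add: sum_distrib_left mult.assoc)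
  finally show ?thesis
    by (simp add: inner_vec_def sum_UNIV_Plus block_vec_def right_diff_distrib sum_subtractf)
qed

lemma signed_sum_nonzero:
  fixes \<eta> :: "real^('p + 'm)" and z :: "'p \<Rightarrow> real"
  assumes "(\<forall>p. 0 < \<eta> $ Inl p) \<or> (\<forall>p. \<eta> $ Inl p < 0)" and "\<And>p. 0 < z p"
  shows "(\<Sum>p\<in>(UNIV :: 'p set). \<eta> $ Inl p * z p) \<noteq> 0"
  using assms(1)
proof
  assume "\<forall>p. 0 < \<eta> $ Inl p"
  then have "0 < \<eta> $ Inl p * z p" for p using assms(2)[of p] by simp
  then have "0 < (\<Sum>p\<in>(UNIV :: 'p set). \<eta> $ Inl p * z p)" by (intro sum_pos) auto
  then show ?thesis by simp
next
  assume "\<forall>p. \<eta> $ Inl p < 0"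
  then have "0 < - (\<eta> $ Inl p * z p)" for p using assms(2)[of p] by (simp add: mult_neg_pos)
  then have "0 < (\<Sum>p\<in>(UNIV :: 'p set). - (\<eta> $ Inl p * z p))" by (intro sum_pos) auto
  then show ?thesis by (simp add: sum_negf)
qed

lemma left_kernel_v:
  assumes "\<eta> v* (mat 1 + offdiag) = 0" "\<eta> \<noteq> 0"
  shows "\<eta> \<bullet> v \<noteq> 0"
proof -
  have "\<eta> \<bullet> v = (\<Sum>p\<in>UNIV. \<eta> $ Inl p * 2)"
    unfolding v_def left_kernel_inner[OF assms(1)] by (simp add: sum_negf A_sum)
  then show ?thesis using signed_sum_nonzero[OF left_kernel_sign[OF assms], of "\<lambda>_. 2"] by simp
qed

lemma simple_kernel_P:
  assumes "\<eta> v* (mat 1 + offdiag) = 0" "\<eta> \<noteq> 0"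
  shows "simple_kernel (mat 1 + offdiag) v ((1 / (\<eta> \<bullet> v)) *\<^sub>R \<eta>)"
  by standard (use P_v kernel_P left_kernel_v[OF assms] assms in \<open>auto simp: scaleR_vector_matrix_assoc\<close>)

lemma left_kernel_exists: "\<exists>\<eta>. \<eta> \<noteq> 0 \<and> \<eta> v* (mat 1 + offdiag) = 0"
proof -
  have "v \<noteq> 0" by (auto simp: vec_eq_iff v_def block_vec_def split: sum.split)
  then have "\<not> invertible (mat 1 + offdiag)" using P_v unfolding invertible_iff_kernel by blast
  then have "\<not> invertible (transpose (mat 1 + offdiag))" by (metis det_transpose invertible_det_nz)
  then show ?thesis unfolding invertible_iff_kernel by auto
qed

end


section \<open>The escape formula\<close>

text \<open>All matrices of the theorem are probabilities of events in the path of \<phi>, so they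
  can be computed under the image law, which is again a chain with generator
  \<open>Q\<close>.\<close>

lemma markov_chain_distr:
  fixes \<phi> :: "real \<Rightarrow> 'w \<Rightarrow> 's::finite"
  assumes M: "markov_chain_from Q M \<phi> i"
  shows "(\<lambda>\<omega> t. \<phi> t \<omega>) \<in> M \<rightarrow>\<^sub>M path_space"
    and "markov_chain_from Q (distr M path_space (\<lambda>\<omega> t. \<phi> t \<omega>)) (\<lambda>t f. f t) i"
proof -
  let ?f = "\<lambda>\<omega> t. \<phi> t \<omega>"
  interpret M: prob_space M using M by (simp add: markov_chain_from_def)
  show f: "?f \<in> M \<rightarrow>\<^sub>M path_space"
    using M by (intro measurable_path_spaceI) (auto simp: markov_chain_from_def)
  have prob: "measure (distr M path_space ?f) {f\<in>space path_space. \<forall>m\<le>n. f (t m) = k m} =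
    measure M {\<omega>\<in>space M. \<forall>m\<le>n. \<phi> (t m) \<omega> = k m}" if t: "\<And>m. m \<le> n \<Longrightarrow> 0 \<le> t m" for t :: "nat \<Rightarrow> real" and k :: "nat \<Rightarrow> 's" and n
  proof -
    have "{f\<in>space path_space. f (t m) = k m} \<in> sets path_space" if "m \<le> n" for m
      using measurable_sets[OF measurable_coordinate[OF t[OF that]], of "{k m}"] by (simp add: vimage_def Int_def conj_commute)
    then have "{f\<in>space path_space. \<forall>m\<in>{..n}. f (t m) = k m} \<in> sets path_space"
      by (intro sets.sets_Collect_finite_All) auto
    then have "measure (distr M path_space ?f) {f\<in>space path_space. \<forall>m\<in>{..n}. f (t m) = k m} =
      measure M (?f -` {f\<in>space path_space. \<forall>m\<in>{..n}. f (t m) = k m} \<inter> space M)"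
      by (rule measure_distr[OF f])
    also have "?f -` {f\<in>space path_space. \<forall>m\<in>{..n}. f (t m) = k m} \<inter> space M = {\<omega>\<in>space M. \<forall>m\<le>n. \<phi> (t m) \<omega> = k m}"
      using measurable_space[OF f] by auto
    finally show ?thesis by (simp only: Ball_def atMost_iff)
  qed
  have mono: "0 \<le> t m" if "0 \<le> t 0" "\<forall>m\<le>n. t m \<le> t (Suc m)" "m \<le> Suc n" for t :: "nat \<Rightarrow> real" and m n
    using that(3)
  proof (induction m)
    case (Suc m)
    then have "0 \<le> t m" "t m \<le> t (Suc m)" using that(2) by auto
    then show ?case by linarith
  qed (use that(1) in simp)
  show "markov_chain_from Q (distr M path_space ?f) (\<lambda>t f. f t) i"
    unfolding markov_chain_from_def
  proof (intro conjI allI impI ballI)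
    show "prob_space (distr M path_space ?f)" by (rule M.prob_space_distr[OF f])
    show "(\<lambda>f. f t) \<in> distr M path_space ?f \<rightarrow>\<^sub>M count_space UNIV" if "0 \<le> t" for t
      using measurable_coordinate[OF that] by simp
    show "step_path (\<lambda>t. g t)" if "g \<in> space (distr M path_space ?f)" for g using that by simp
    show "AE g in distr M path_space ?f. g 0 = i"
    proof (subst AE_distr_iff[OF f])
      show "{g\<in>space path_space. g 0 = i} \<in> sets path_space"
        using measurable_sets[OF measurable_coordinate[of 0], of "{i}"] by (simp add: vimage_def Int_def conj_commute)
      show "AE \<omega> in M. \<phi> 0 \<omega> = i" using M by (simp add: markov_chain_from_def)
    qed
    fix n and t :: "nat \<Rightarrow> real" and k :: "nat \<Rightarrow> 's"
    assume t: "0 \<le> t 0" "\<forall>m\<le>n. t m \<le> t (Suc m)"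
    have "measure (distr M path_space ?f) {f\<in>space path_space. \<forall>m\<le>Suc n. f (t m) = k m} = measure M {\<omega>\<in>space M. \<forall>m\<le>Suc n. \<phi> (t m) \<omega> = k m}"
      by (rule prob) (use mono[OF t] in auto)
    moreover have "measure (distr M path_space ?f) {f\<in>space path_space. \<forall>m\<le>n. f (t m) = k m} = measure M {\<omega>\<in>space M. \<forall>m\<le>n. \<phi> (t m) \<omega> = k m}"
      by (rule prob) (use mono[OF t] in auto)
    moreover have "measure M {\<omega>\<in>space M. \<forall>m\<le>Suc n. \<phi> (t m) \<omega> = k m} =
      measure M {\<omega>\<in>space M. \<forall>m\<le>n. \<phi> (t m) \<omega> = k m} * matrix_exp ((t (Suc n) - t n) *\<^sub>R Q) $ k n $ k (Suc n)"
      using M t unfolding markov_chain_from_def by blast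
    ultimately show "measure (distr M path_space ?f) {f\<in>space (distr M path_space ?f). \<forall>m\<le>Suc n. f (t m) = k m} =
      measure (distr M path_space ?f) {f\<in>space (distr M path_space ?f). \<forall>m\<le>n. f (t m) = k m} *
        matrix_exp ((t (Suc n) - t n) *\<^sub>R Q) $ k n $ k (Suc n)"
      unfolding space_distr by (simp only:)
  qed
qed

locale phase_process =
  fixes Q :: "real^'s^'s" and P :: "'s \<Rightarrow> 'w measure" and \<phi> :: "real \<Rightarrow> 'w \<Rightarrow> 's"
  assumes irreducible_Q: "irreducible_generator Q" and chain: "\<And>i. markov_chain_from Q (P i) \<phi> i"
begin

sublocale phase_chain Q "\<lambda>i. distr (P i) path_space (\<lambda>\<omega> t. \<phi> t \<omega>)"
  by standard (use irreducible_Q markov_chain_distr(2)[OF chain] in auto)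

lemma measure_path_event:
  assumes A: "A \<in> sets path_space"
  shows "measure (distr (P i) path_space (\<lambda>\<omega> t. \<phi> t \<omega>)) A = measure (P i) {\<omega>\<in>space (P i). (\<lambda>t. \<phi> t \<omega>) \<in> A}"
  using measure_distr[OF markov_chain_distr(1)[OF chain] A, of i] by (simp add: vimage_def Int_def conj_commute)

lemma path: "\<omega> \<in> space (P i) \<Longrightarrow> step_path (\<lambda>t. \<phi> t \<omega>)"
  using chain[of i] by (simp add: markov_chain_from_def)

lemma down_matrix_eq: "down_matrix c P \<phi> x0 x $ i $ j = down c x i j"
  unfolding down_def measure_path_event[OF down_event_sets] down_matrix_def
  by (simp add: Let_def tau_minus_level down_event_def path cong: conj_cong)

lemma up_matrix_eq: "up_matrix c P \<phi> x0 x $ i $ j = down (- c) x i j"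
  unfolding down_def measure_path_event[OF down_event_sets] up_matrix_def
  by (simp add: Let_def tau_plus_level down_event_def path cong: conj_cong)

lemma escape_down_eq: "escape_down c P \<phi> a b $ i $ j = escape c a b i j"
  unfolding escape_def measure_path_event[OF escape_event_sets] escape_down_def
  by (simp add: Let_def tau_minus_level tau_plus_level escape_event_def path cong: conj_cong)

lemma escape_up_eq: "escape_up c P \<phi> a b $ i $ j = escape (- c) b a i j"
  unfolding escape_def measure_path_event[OF escape_event_sets] escape_up_def
  by (simp add: Let_def tau_minus_level tau_plus_level escape_event_def path cong: conj_cong)

lemma return_matrix_event:
  "return_matrix c P \<phi> x0 $ i $ j = measure (distr (P i) path_space (\<lambda>\<omega> t. \<phi> t \<omega>)) (return_event c j)"
  unfolding measure_path_event[OF return_event_sets] return_matrix_def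
  by (simp add: Let_def return_time_level return_event_def path cong: conj_cong)

lemma return_matrix_down: "0 < c $ i \<Longrightarrow> c $ j < 0 \<Longrightarrow> return_matrix c P \<phi> x0 $ i $ j = down c 0 i j"
  by (simp add: return_matrix_event return_eq_down)

lemma return_matrix_up: "c $ i < 0 \<Longrightarrow> 0 < c $ j \<Longrightarrow> return_matrix c P \<phi> x0 $ i $ j = down (- c) 0 i j"
  using return_eq_down[of "- c" i j] by (simp add: return_matrix_event return_event_def return_at_uminus)

end

text \<open>Types are nonempty, so the bijections \<open>ep\<close> and \<open>em\<close> also
  express that there are up phases and down phases.\<close>

locale fluid_flow = phase_process Q P \<phi>
  for Q :: "real^'s^'s" and P :: "'s \<Rightarrow> 'w measure" and \<phi> :: "real \<Rightarrow> 'w \<Rightarrow> 's" +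
  fixes c :: "real^'s" and ep :: "'p::finite \<Rightarrow> 's" and em :: "'m::finite \<Rightarrow> 's" and a b :: real
  assumes ep: "bij_betw ep UNIV {i. c $ i > 0}" and em: "bij_betw em UNIV {i. c $ i < 0}"
    and ab: "0 \<le> a" "0 \<le> b"
begin

lemma ep_pos: "0 < c $ ep p" and em_neg: "c $ em m < 0"
  using ep em by (auto simp: bij_betw_def)

lemma sum_up: "(\<And>k. \<not> 0 < c $ k \<Longrightarrow> f k = 0) \<Longrightarrow> (\<Sum>k\<in>UNIV. f k) = (\<Sum>p\<in>UNIV. f (ep p))"
  for f :: "'s \<Rightarrow> real"
  using sum.reindex_bij_betw[OF ep, of f] sum.mono_neutral_right[of UNIV "{i. c $ i > 0}" f] by auto

lemma sum_down: "(\<And>k. \<not> c $ k < 0 \<Longrightarrow> f k = 0) \<Longrightarrow> (\<Sum>k\<in>UNIV. f k) = (\<Sum>m\<in>UNIV. f (em m))"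
  for f :: "'s \<Rightarrow> real"
  using sum.reindex_bij_betw[OF em, of f] sum.mono_neutral_right[of UNIV "{i. c $ i < 0}" f] by auto

lemma sum_phases:
  fixes f :: "'s \<Rightarrow> real" and e0 :: "'z::finite \<Rightarrow> 's"
  assumes e0: "bij_betw e0 UNIV {i. c $ i = 0}"
  shows "(\<Sum>k\<in>UNIV. f k) = (\<Sum>p\<in>UNIV. f (ep p)) + (\<Sum>m\<in>UNIV. f (em m)) + (\<Sum>z\<in>UNIV. f (e0 z))"
proof -
  have U: "(UNIV :: 's set) = ({i. c $ i > 0} \<union> {i. c $ i < 0}) \<union> {i. c $ i = 0}" by auto
  have "(\<Sum>k\<in>UNIV. f k) = (\<Sum>k\<in>{i. c $ i > 0}. f k) + (\<Sum>k\<in>{i. c $ i < 0}. f k) + (\<Sum>k\<in>{i. c $ i = 0}. f k)"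
    by (subst U, subst sum.union_disjoint, auto, subst sum.union_disjoint, auto)
  then show ?thesis
    using sum.reindex_bij_betw[OF ep, of f] sum.reindex_bij_betw[OF em, of f] sum.reindex_bij_betw[OF e0, of f] by simp
qed

text \<open>Only down phases can occur at a downward passage, so the sum over all phases in
  \<open>down_add\<close> is a matrix product over the enumerated ones.\<close>

lemma down_zero_sum:
  assumes "0 \<le> x"
  shows "(\<Sum>m\<in>UNIV. down c 0 i (em m) * down c x (em m) j) = down c x i j"
    and "(\<Sum>p\<in>UNIV. down (- c) 0 i (ep p) * down (- c) x (ep p) j) = down (- c) x i j"
proof -
  have "(\<Sum>k\<in>UNIV. down c 0 i k * down c x k j) = (\<Sum>m\<in>UNIV. down c 0 i (em m) * down c x (em m) j)"
    by (rule sum_down) (simp add: down_eq_0)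
  then show "(\<Sum>m\<in>UNIV. down c 0 i (em m) * down c x (em m) j) = down c x i j"
    using down_add[OF order_refl assms, of c i j] by simp
  have "(\<Sum>k\<in>UNIV. down (- c) 0 i k * down (- c) x k j) = (\<Sum>p\<in>UNIV. down (- c) 0 i (ep p) * down (- c) x (ep p) j)"
    by (rule sum_up) (simp add: down_eq_0)
  then show "(\<Sum>p\<in>UNIV. down (- c) 0 i (ep p) * down (- c) x (ep p) j) = down (- c) x i j"
    using down_add[OF order_refl assms, of "- c" i j] by simp
qed

lemma down_row_mono:
  assumes "0 \<le> x"
  shows "(\<Sum>j\<in>UNIV. down d x i j) \<le> (\<Sum>j\<in>UNIV. down d 0 i j)"
proof -
  have "(\<Sum>j\<in>UNIV. down d x i j) = (\<Sum>k\<in>UNIV. down d 0 i k * (\<Sum>j\<in>UNIV. down d x k j))"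
    using down_add[OF order_refl assms, of d i]
    by (simp add: sum_distrib_left) (rule sum.swap)
  also have "\<dots> \<le> (\<Sum>k\<in>UNIV. down d 0 i k * 1)"
    by (intro sum_mono mult_left_mono down_sum_le_1) simp
  finally show ?thesis by simp
qed

definition phase :: "'p + 'm \<Rightarrow> 's" where
  "phase = case_sum ep em"

text \<open>The upper right block of the matrix P, read as a passage probability; the identification
  with the product of \<Psi> and the exponential takes place in the final proof.\<close>

definition down_block :: "real^'m^'p" where
  "down_block = (\<chi> p m. down c (a + b) (ep p) (em m))"

definition up_block :: "real^'p^'m" where
  "up_block = (\<chi> m p. down (- c) (a + b) (em m) (ep p))"

definition escape_matrix :: "real^('p + 'm)^('p + 'm)" where
  "escape_matrix = block_mat
     (submat ep ep (escape_up c P \<phi> a b)) (submat ep em (escape_down c P \<phi> a b))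
     (submat em ep (escape_up c P \<phi> a b)) (submat em em (escape_down c P \<phi> a b))"

lemma escape_matrix_entry:
  "escape_matrix $ i $ Inl p = escape (- c) b a (phase i) (ep p)"
  "escape_matrix $ i $ Inr m = escape c a b (phase i) (em m)"
  by (cases i; simp add: escape_matrix_def block_mat_def block_vec_def submat_def escape_up_eq escape_down_eq phase_def)+

sublocale off_diagonal down_block up_block
  by standard (simp_all add: down_block_def up_block_def)

lemma sum_down_block: "(\<Sum>m\<in>UNIV. down_block $ p $ m * x (em m)) = (\<Sum>k\<in>UNIV. down c (a + b) (ep p) k * x k)"
  using ab by (subst sum_down) (simp_all add: down_block_def down_eq_0)

lemma sum_up_block: "(\<Sum>p\<in>UNIV. up_block $ m $ p * x (ep p)) = (\<Sum>k\<in>UNIV. down (- c) (a + b) (em m) k * x k)"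
  using ab by (subst sum_up) (simp_all add: up_block_def down_eq_0)

lemma row_sums:
  "(\<Sum>m\<in>UNIV. down_block $ p $ m) = (\<Sum>k\<in>UNIV. down c (a + b) (ep p) k)"
  "(\<Sum>p\<in>UNIV. up_block $ m $ p) = (\<Sum>k\<in>UNIV. down (- c) (a + b) (em m) k)"
  using sum_down_block[of p "\<lambda>_. 1"] sum_up_block[of m "\<lambda>_. 1"] by simp_all

lemma escape_row:
  "(\<Sum>i\<in>UNIV. escape_matrix $ r $ i * block_vec x y $ i) =
    (\<Sum>p\<in>UNIV. escape (- c) b a (phase r) (ep p) * x $ p) + (\<Sum>m\<in>UNIV. escape c a b (phase r) (em m) * y $ m)"
  by (simp add: sum_UNIV_Plus escape_matrix_entry block_vec_def)

lemma escape_sums: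
  fixes f :: "'s \<Rightarrow> real"
  shows "(\<Sum>p\<in>UNIV. escape (- c) b a i (ep p) * f (ep p)) = (\<Sum>k\<in>UNIV. escape (- c) b a i k * f k)"
    and "(\<Sum>m\<in>UNIV. escape c a b i (em m) * f (em m)) = (\<Sum>k\<in>UNIV. escape c a b i k * f k)"
  using ab by (simp_all add: sum_up[of "\<lambda>k. escape (- c) b a i k * f k"] sum_down[of "\<lambda>k. escape c a b i k * f k"] escape_eq_0)

text \<open>The two columns of blocks are the two orientations of \<open>down_escape\<close>:
  passage above \<open>b\<close>, and passage below \<open>- a\<close> with the roles of
  \<open>a\<close> and \<open>b\<close> exchanged.\<close>

lemma escape_equation:
  "(escape_matrix ** (mat 1 + offdiag)) $ i $ Inl p = down (- c) b (phase i) (ep p)"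
  "(escape_matrix ** (mat 1 + offdiag)) $ i $ Inr m = down c a (phase i) (em m)"
proof -
  have P: "offdiag $ Inr m $ Inl p = up_block $ m $ p" "offdiag $ Inl p $ Inl q = 0" "offdiag $ Inl p $ Inr m = down_block $ p $ m" "offdiag $ Inr m $ Inr n = 0" for p q m n
    by (simp_all add: offdiag_def block_mat_def block_vec_def)
  have "(escape_matrix ** offdiag) $ i $ Inl p = (\<Sum>m\<in>UNIV. escape c a b (phase i) (em m) * down (- c) (a + b) (em m) (ep p))"
    by (simp add: matrix_matrix_mult_def sum_UNIV_Plus escape_matrix_entry P) (simp add: up_block_def)
  then show "(escape_matrix ** (mat 1 + offdiag)) $ i $ Inl p = down (- c) b (phase i) (ep p)"
    using down_escape[OF ab, of "- c" "phase i" "ep p"] escape_sums(2)[of "phase i" "\<lambda>k. down (- c) (a + b) k (ep p)"]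
    by (simp add: matrix_add_ldistrib escape_matrix_entry)
  have "(escape_matrix ** offdiag) $ i $ Inr m = (\<Sum>p\<in>UNIV. escape (- c) b a (phase i) (ep p) * down c (a + b) (ep p) (em m))"
    by (simp add: matrix_matrix_mult_def sum_UNIV_Plus escape_matrix_entry P) (simp add: down_block_def)
  then show "(escape_matrix ** (mat 1 + offdiag)) $ i $ Inr m = down c a (phase i) (em m)"
    using down_escape[OF ab(2,1), of c "phase i" "em m"] escape_sums(1)[of "phase i" "\<lambda>k. down c (a + b) k (em m)"]
    by (simp add: matrix_add_ldistrib escape_matrix_entry add.commute)
qed

text \<open>The harmonic equations at the phases of rate 0, with the sum split by the sign of the
  rate; the invertible block over those phases is moved to the other side.\<close>

lemma zero_rate_formula:
  fixes e0 :: "'z::finite \<Rightarrow> 's"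
  assumes e0: "bij_betw e0 UNIV {i. c $ i = 0}"
  shows "invertible (- submat e0 e0 Q)"
    and "block_row (submat e0 ep (escape_up c P \<phi> a b)) (submat e0 em (escape_down c P \<phi> a b)) =
      matrix_inv (- submat e0 e0 Q) ** block_row (submat e0 ep Q) (submat e0 em Q) ** escape_matrix"
proof -
  have zero: "c $ e0 z = 0" for z using e0 by (auto simp: bij_betw_def)
  have "ep undefined \<notin> range e0" using zero ep_pos[of undefined] by auto
  then show inv: "invertible (- submat e0 e0 Q)"
    using e0 by (intro invertible_subgenerator) (auto simp: bij_betw_def)
  let ?B = "block_row (submat e0 ep (escape_up c P \<phi> a b)) (submat e0 em (escape_down c P \<phi> a b))"
  let ?R = "block_row (submat e0 ep Q) (submat e0 em Q)"
  have "((- submat e0 e0 Q) ** ?B) $ r $ j = (?R ** escape_matrix) $ r $ j" for r j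
  proof (cases j)
    case (Inl p)
    have "(\<Sum>l\<in>UNIV. Q $ e0 r $ l * escape (- c) b a l (ep p)) = 0"
      using escape_harmonic[of "- c" "e0 r" b a "ep p"] zero ab by simp
    then show ?thesis unfolding sum_phases[OF e0] Inl
      by (simp add: matrix_matrix_mult_def sum_UNIV_Plus block_row_def block_vec_def submat_def escape_up_eq escape_matrix_entry phase_def sum_negf)
  next
    case (Inr m)
    have "(\<Sum>l\<in>UNIV. Q $ e0 r $ l * escape c a b l (em m)) = 0"
      using escape_harmonic[of c "e0 r" a b "em m"] zero ab by simp
    then show ?thesis unfolding sum_phases[OF e0] Inr
      by (simp add: matrix_matrix_mult_def sum_UNIV_Plus block_row_def block_vec_def submat_def escape_down_eq escape_matrix_entry phase_def sum_negf)
  qed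
  then have "(- submat e0 e0 Q) ** ?B = ?R ** escape_matrix" by (simp add: vec_eq_iff)
  then have "matrix_inv (- submat e0 e0 Q) ** ((- submat e0 e0 Q) ** ?B) = matrix_inv (- submat e0 e0 Q) ** (?R ** escape_matrix)"
    by simp
  then show "?B = matrix_inv (- submat e0 e0 Q) ** ?R ** escape_matrix"
    by (simp add: matrix_mul_assoc matrix_inv_mult[OF inv])
qed

text \<open>Negative drift makes upward passage from the down phases uncertain, positive drift
  downward passage from the up phases. The distance \<open>a + b\<close> can only lower the row sums
  further.\<close>

lemma invertible_drift:
  assumes \<alpha>: "stationary_vector Q \<alpha>" and drift: "\<alpha> \<bullet> c \<noteq> 0"
  shows "invertible (mat 1 + offdiag)"
proof (rule invertible_substochastic)
  show "(\<Sum>m\<in>UNIV. down_block $ p $ m) \<le> 1" "(\<Sum>p\<in>UNIV. up_block $ m $ p) \<le> 1" for p m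
    unfolding row_sums by (rule down_sum_le_1)+
  have x: "0 \<le> a + b" using ab by simp
  show "(\<forall>p. (\<Sum>m\<in>UNIV. down_block $ p $ m) < 1) \<or> (\<forall>m. (\<Sum>p\<in>UNIV. up_block $ m $ p) < 1)"
  proof (cases "\<alpha> \<bullet> c < 0")
    case True
    have "(\<Sum>k\<in>UNIV. down (- c) 0 (em m) k) < 1" for m
      by (rule transient[OF Poisson_equation[OF \<alpha>] True em_neg])
    then show ?thesis unfolding row_sums using down_row_mono[OF x] by (meson order_le_less_trans)
  next
    case False
    then have neg: "\<alpha> \<bullet> (- c) < 0" using drift by simp
    have "(\<Sum>k\<in>UNIV. down (- (- c)) 0 (ep p) k) < 1" for p
      by (rule transient[OF Poisson_equation[OF \<alpha>] neg]) (simp add: ep_pos)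
    then show ?thesis unfolding row_sums using down_row_mono[OF x] by (simp, meson order_le_less_trans)
  qed
qed

lemma recurrent_blocks:
  assumes \<alpha>: "stationary_vector Q \<alpha>" and drift: "\<alpha> \<bullet> c = 0"
  shows "positive_stochastic down_block up_block"
proof
  have x: "0 \<le> a + b" using ab by simp
  show "0 < down_block $ p $ m" for p m
    unfolding down_block_def using down_pos[OF ep_pos em_neg x] by simp
  show "0 < up_block $ m $ p" for p m
    unfolding up_block_def using down_pos[of "- c" "em m" "ep p", OF _ _ x] ep_pos em_neg by simp
  have h: "(Q *v (- (group_inverse Q *v d))) $ k = - d $ k" if "\<alpha> \<bullet> d = 0" for d k
    using Poisson_equation[OF \<alpha>, of d k] that by simp
  show "(\<Sum>m\<in>UNIV. down_block $ p $ m) = 1" for p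
    unfolding row_sums by (rule recurrent[OF h[OF drift] ep_pos[of p] x])
  show "(\<Sum>p\<in>UNIV. up_block $ m $ p) = 1" for m
    unfolding row_sums using drift em_neg[of m] by (intro recurrent[OF h _ x, of _ "em m"]) simp_all
qed

text \<open>The entries of \<beta> are the values of \<open>X + h(\<phi>)\<close> at the two ends of
  the interval, so this is optional stopping in matrix form.\<close>

lemma escape_boundary_vector:
  fixes h :: "real^'s"
  assumes h: "\<And>k. (Q *v h) $ k = - c $ k"
  shows "escape_matrix *v block_vec (b *\<^sub>R 1 + subvec ep h) (- a *\<^sub>R 1 + subvec em h) =
    block_vec (subvec ep h) (subvec em h)"
proof -
  have "(\<Sum>i\<in>UNIV. escape_matrix $ r $ i * block_vec (b *\<^sub>R 1 + subvec ep h) (- a *\<^sub>R 1 + subvec em h) $ i) = h $ phase r" for r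
    unfolding escape_row
    using optional_stopping(1)[OF h ep_pos[of undefined] ab, of "phase r"]
      escape_sums(1)[of "phase r" "\<lambda>k. h $ k + b"] escape_sums(2)[of "phase r" "\<lambda>k. h $ k - a"]
    by (simp add: subvec_def add.commute)
  moreover have "block_vec (subvec ep h) (subvec em h) $ r = h $ phase r" for r
    by (cases r) (simp_all add: block_vec_def subvec_def phase_def)
  ultimately show ?thesis by (simp add: vec_eq_iff matrix_vector_mult_def)
qed

text \<open>Eliminating the down phases leaves, for each up phase, the quantity shown positive in
  \<open>overshoot_pos\<close> for the distance \<open>a + b\<close>; the weights from \<eta> all
  have the same strict sign.\<close>

lemma overshoot_nonzero:
  assumes \<alpha>: "stationary_vector Q \<alpha>" and drift: "\<alpha> \<bullet> c = 0"
    and h: "\<And>k. (Q *v h) $ k = - c $ k"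
    and \<eta>: "\<eta> v* (mat 1 + offdiag) = 0" "\<eta> \<noteq> 0"
  shows "\<eta> \<bullet> block_vec (b *\<^sub>R 1 + subvec ep h) (- a *\<^sub>R 1 + subvec em h) \<noteq> 0"
proof -
  interpret S: positive_stochastic down_block up_block by (rule recurrent_blocks[OF \<alpha> drift])
  have x: "0 \<le> a + b" using ab by simp
  have eq: "(b *\<^sub>R 1 + subvec ep h) $ p - (\<Sum>m\<in>UNIV. down_block $ p $ m * (- a *\<^sub>R 1 + subvec em h) $ m) =
    h $ ep p + (a + b) - (\<Sum>j\<in>UNIV. down c (a + b) (ep p) j * h $ j)" for p
  proof -
    have "(\<Sum>m\<in>UNIV. down_block $ p $ m * (- a *\<^sub>R 1 + subvec em h) $ m) =
      (\<Sum>m\<in>UNIV. down_block $ p $ m * h $ em m) - a"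
      using S.A_sum[of p] by (simp add: subvec_def right_diff_distrib sum_subtractf sum_distrib_right[symmetric])
    then show ?thesis using sum_down_block[of p "\<lambda>k. h $ k"] by (simp add: subvec_def)
  qed
  show ?thesis
    unfolding S.left_kernel_inner[OF \<eta>(1)] eq
    by (rule S.signed_sum_nonzero[OF S.left_kernel_sign[OF \<eta>]]) (rule overshoot_pos[OF h ep_pos x])
qed

end

text \<open>The rank-one correction in the third case comes from \<open>E M G = E - E v u\<^sup>T\<close> for the group inverse \<open>G\<close> of
  \<open>M = I + P\<close>; the unknown vector \<open>E v\<close> is read off by applying this to \<open>\<beta>\<close>.\<close>

lemma rank_one_correction:
  fixes M E W :: "real^'n^'n"
  assumes K: "simple_kernel M v ((1 / (\<eta> \<bullet> v)) *\<^sub>R \<eta>)" and EM: "E ** M = W" and E\<beta>: "E *v \<beta> = H"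
    and \<beta>: "\<eta> \<bullet> \<beta> \<noteq> 0"
  shows "E = W ** group_inverse M + outer_product (inverse (\<eta> \<bullet> \<beta>) *\<^sub>R (H - (W ** group_inverse M) *v \<beta>)) \<eta>"
proof -
  interpret K: simple_kernel M v "(1 / (\<eta> \<bullet> v)) *\<^sub>R \<eta>" by fact
  let ?s = "1 / (\<eta> \<bullet> v)"
  have WG: "W ** group_inverse M = E - outer_product (E *v v) (?s *\<^sub>R \<eta>)"
    unfolding EM[symmetric] matrix_mul_assoc[symmetric] K.mult_group_inverse
    by (simp add: matrix_mult_diff_right mult_outer_product)
  have "(W ** group_inverse M) *v \<beta> = H - (?s * (\<eta> \<bullet> \<beta>)) *\<^sub>R (E *v v)"
    by (simp add: WG matrix_vector_mult_diff_rdistrib outer_product_mult_vec E\<beta>)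
  then have "inverse (\<eta> \<bullet> \<beta>) *\<^sub>R (H - (W ** group_inverse M) *v \<beta>) = ?s *\<^sub>R (E *v v)"
    using \<beta> by simp
  moreover have "outer_product (?s *\<^sub>R (E *v v)) \<eta> = outer_product (E *v v) (?s *\<^sub>R \<eta>)"
    using outer_product_scaleR[of ?s "E *v v" 1 \<eta>] outer_product_scaleR[of 1 "E *v v" ?s \<eta>] by simp
  ultimately show ?thesis using WG by simp
qed

theorem theorem8p5:
  fixes Q :: "real^'s^'s" and c \<alpha> :: "real^'s"
    and P :: "'s \<Rightarrow> 'w measure" and \<phi> :: "real \<Rightarrow> 'w \<Rightarrow> 's"
    and ep :: "'p::finite \<Rightarrow> 's" and em :: "'m::finite \<Rightarrow> 's"
    and x0 a b :: real
    and \<Psi> :: "real^'m^'p" and \<Psi>' :: "real^'p^'m"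
    and U :: "real^'m^'m" and U' :: "real^'p^'p"
    and h :: "real^'s" and \<beta> :: "real^('p + 'm)"
    and PP UU E :: "real^('p + 'm)^('p + 'm)"
  assumes "irreducible_generator Q"
    and "stationary_vector Q \<alpha>"
    and "\<And>i. markov_chain_from Q (P i) \<phi> i"
    and "bij_betw ep UNIV {i. c $ i > 0}"
    and "bij_betw em UNIV {i. c $ i < 0}"
    and "a \<ge> 0" and "b \<ge> 0"
    and "\<Psi> = submat ep em (return_matrix c P \<phi> x0)"
    and "\<Psi>' = submat em ep (return_matrix c P \<phi> x0)"
    and "\<And>x. x \<ge> 0 \<Longrightarrow> matrix_exp (x *\<^sub>R U) = submat em em (down_matrix c P \<phi> x0 x)"
    and "\<And>x. x \<ge> 0 \<Longrightarrow> matrix_exp (x *\<^sub>R U') = submat ep ep (up_matrix c P \<phi> x0 x)"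
    and "PP = calP \<Psi> \<Psi>' U U' a b"
    and "UU = calU \<Psi> \<Psi>' U U' a b"
    and "h = - (group_inverse Q *v c)"
    and "\<beta> = block_vec (b *\<^sub>R 1 + subvec ep h) (- a *\<^sub>R 1 + subvec em h)"
    and "E = block_mat
           (submat ep ep (escape_up c P \<phi> a b)) (submat ep em (escape_down c P \<phi> a b))
           (submat em ep (escape_up c P \<phi> a b)) (submat em em (escape_down c P \<phi> a b))"
  shows "(\<forall>e0 :: 'z::finite \<Rightarrow> 's. bij_betw e0 UNIV {i. c $ i = 0} \<longrightarrow>
            invertible (- submat e0 e0 Q) \<and>
            block_row (submat e0 ep (escape_up c P \<phi> a b)) (submat e0 em (escape_down c P \<phi> a b)) =
              matrix_inv (- submat e0 e0 Q) ** block_row (submat e0 ep Q) (submat e0 em Q) ** E)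
       \<and> (\<alpha> \<bullet> c \<noteq> 0 \<longrightarrow>
            invertible (mat 1 + PP) \<and> E = UU ** matrix_inv (mat 1 + PP))
       \<and> (\<alpha> \<bullet> c = 0 \<longrightarrow>
            simple_eigenvalue (mat 1 + PP) 0 \<and>
            (\<forall>\<eta>. \<eta> \<noteq> 0 \<and> \<eta> v* (mat 1 + PP) = 0 \<longrightarrow>
               \<eta> \<bullet> \<beta> \<noteq> 0 \<and>
               E = UU ** group_inverse (mat 1 + PP)
                   + outer_product
                       (inverse (\<eta> \<bullet> \<beta>) *\<^sub>R
                          (block_vec (subvec ep h) (subvec em h)
                             - (UU ** group_inverse (mat 1 + PP)) *v \<beta>))
                       \<eta>))"
proof -
  interpret F: fluid_flow Q P \<phi> c ep em a b
    by unfold_locales (use assms(1,3-7) in auto)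
  have ab: "0 \<le> a + b" using assms(6,7) by simp
  have E: "E = F.escape_matrix" unfolding assms(16) F.escape_matrix_def ..
  have \<Psi>: "\<Psi> $ p $ m = F.down c 0 (ep p) (em m)" and \<Psi>': "\<Psi>' $ m $ p = F.down (- c) 0 (em m) (ep p)" for p m
    by (simp_all add: assms(8,9) submat_def F.return_matrix_down F.return_matrix_up F.ep_pos F.em_neg)
  have U: "matrix_exp (x *\<^sub>R U) $ m $ n = F.down c x (em m) (em n)" if "0 \<le> x" for x m n
    using assms(10)[OF that] by (simp add: submat_def F.down_matrix_eq)
  have U': "matrix_exp (x *\<^sub>R U') $ p $ q = F.down (- c) x (ep p) (ep q)" if "0 \<le> x" for x p q
    using assms(11)[OF that] by (simp add: submat_def F.up_matrix_eq)
  have \<Psi>U: "(\<Psi> ** matrix_exp (x *\<^sub>R U)) $ p $ m = F.down c x (ep p) (em m)" if "0 \<le> x" for x p m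
    using F.down_zero_sum(1)[OF that, of "ep p" "em m"] by (simp add: matrix_matrix_mult_def \<Psi> U[OF that])
  have \<Psi>U': "(\<Psi>' ** matrix_exp (x *\<^sub>R U')) $ m $ p = F.down (- c) x (em m) (ep p)" if "0 \<le> x" for x p m
    using F.down_zero_sum(2)[OF that, of "em m" "ep p"] by (simp add: matrix_matrix_mult_def \<Psi>' U'[OF that])
  have PP: "PP = F.offdiag"
  proof -
    have "\<Psi> ** matrix_exp ((a + b) *\<^sub>R U) = F.down_block" "\<Psi>' ** matrix_exp ((a + b) *\<^sub>R U') = F.up_block"
      by (simp_all add: vec_eq_iff \<Psi>U[OF ab] \<Psi>U'[OF ab] F.down_block_def F.up_block_def)
    then show ?thesis by (simp add: assms(12) calP_def F.offdiag_def)
  qed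
  have EM: "E ** (mat 1 + PP) = UU"
  proof -
    have "(E ** (mat 1 + PP)) $ i $ j = UU $ i $ j" for i j
      by (cases i; cases j)
        (simp_all add: E PP F.escape_equation assms(13) calU_def block_mat_def block_vec_def F.phase_def
          \<Psi>U[OF assms(6)] \<Psi>U'[OF assms(7)] U[OF assms(6)] U'[OF assms(7)])
    then show ?thesis by (simp add: vec_eq_iff)
  qed
  show ?thesis
  proof (intro conjI allI impI)
    \<comment> \<open>If no phase has rate 0, there is no such bijection from a nonempty type, and
      the block is omitted.\<close>
    fix e0 :: "'z \<Rightarrow> 's" assume e0: "bij_betw e0 UNIV {i. c $ i = 0}"
    show "invertible (- submat e0 e0 Q)" by (rule F.zero_rate_formula(1)[OF e0])
    show "block_row (submat e0 ep (escape_up c P \<phi> a b)) (submat e0 em (escape_down c P \<phi> a b)) =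
      matrix_inv (- submat e0 e0 Q) ** block_row (submat e0 ep Q) (submat e0 em Q) ** E"
      unfolding E by (rule F.zero_rate_formula(2)[OF e0])
  next
    assume drift: "\<alpha> \<bullet> c \<noteq> 0"
    show inv: "invertible (mat 1 + PP)" unfolding PP by (rule F.invertible_drift[OF assms(2) drift])
    show "E = UU ** matrix_inv (mat 1 + PP)"
      unfolding EM[symmetric] matrix_mul_assoc[symmetric] matrix_inv_mult(1)[OF inv] by simp
  next
    assume drift: "\<alpha> \<bullet> c = 0"
    interpret S: positive_stochastic F.down_block F.up_block by (rule F.recurrent_blocks[OF assms(2) drift])
    have h: "(Q *v h) $ k = - c $ k" for k
      using F.Poisson_equation[OF assms(2), of c k] drift by (simp add: assms(14))
    obtain \<eta> where "\<eta> \<noteq> 0" "\<eta> v* (mat 1 + F.offdiag) = 0" using S.left_kernel_exists by blast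
    then show "simple_eigenvalue (mat 1 + PP) 0"
      unfolding PP by (intro simple_kernel.simple_eigenvalue_0[OF S.simple_kernel_P])
    fix \<eta> assume "\<eta> \<noteq> 0 \<and> \<eta> v* (mat 1 + PP) = 0"
    then have \<eta>: "\<eta> v* (mat 1 + F.offdiag) = 0" "\<eta> \<noteq> 0" unfolding PP by auto
    show nz: "\<eta> \<bullet> \<beta> \<noteq> 0"
      unfolding assms(15) by (rule F.overshoot_nonzero[OF assms(2) drift h \<eta>])
    have "E *v \<beta> = block_vec (subvec ep h) (subvec em h)"
      unfolding E assms(15) by (rule F.escape_boundary_vector[OF h])
    from rank_one_correction[OF S.simple_kernel_P[OF \<eta>, folded PP] EM this nz]
    show "E = UU ** group_inverse (mat 1 + PP) + outer_product (inverse (\<eta> \<bullet> \<beta>) *\<^sub>R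
      (block_vec (subvec ep h) (subvec em h) - (UU ** group_inverse (mat 1 + PP)) *v \<beta>)) \<eta>" .
  qed
qed

end
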